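(* Let $\tilde m_1=\Gamma_{s_1}m_1$ and $\tilde m_2=\Gamma_{s_2}m_2$ be sequences of generalized moments of orders $s_1$ and $s_2$ respectively ($m_1,m_2$ preserving summability), where $0\le s_1<s_2$. Let $a,\lambda\in\mathbb{C}$, $z_0\in\mathbb{C}\setminus\{0\}$ and $k=\frac{1}{s_2-s_1}$. Then the Cauchy problem $$\big(\partial_{\tilde m_1,t}-\lambda\partial_{\tilde m_2,z}\big)u=0,\qquad u(0,z)=\varphi(z):=\frac{a}{z-z_0}\in\mathcal{O}(D)$$ has a unique formal power series solution $\hat u\in\mathcal{O}[[t]]$, and this solution is $k$-summable with only one singular direction $d=\arg z_0-\arg\lambda$ (modulo $2\pi$). Moreover, the jump for $\hat u$ across this singular direction $d$ is given by $$J_{L_d,k}\hat u(t,0)=u^{d^+}(t,0)-u^{d^-}(t,0)=\left[\frac{a}{z_0}e_m\Big(\frac{\lambda s}{z_0}\Big)\right]_d\left[\frac{k(s/t)^ke^{-(s/t)^k}}{s}\right],$$ where $e_m(z)$ denotes the kernel function associated with the sequence preserving summability $$m=\frac{\Gamma_{s_2}}{\Gamma_{s_1}\Gamma_{s_2-s_1}}\frac{m_2}{m_1}.$$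
   Context: All sequences are sequences of positive real numbers with zeroth term $1$; products and quotients are termwise; $\Gamma_s=(\Gamma(1+sn))_{n\ge0}$, $s\ge0$. Spaces. $D_r=\{|z|<r\}$; $D$ is such a disc with unspecified radius, and $\mathcal{O}(D)$ is the set of holomorphic functions on $D$. $\mathcal{O}_r$ is the Banach space of functions holomorphic on $D_r$ and continuous on $\overline D_r$, with sup norm; $\mathcal{O}$ means $\mathcal{O}_r$ with unspecified $r>0$. $S_d(\alpha)=\{re^{i\phi}:r>0,|\phi-d|<\alpha/2\}$ in the universal covering $\widetilde{\mathbb{C}}$ of $\mathbb{C}\setminus\{0\}$; $S_d$ is such a sector with unspecified opening; $\hat S_d=S_d\cup D$ is called a disc-sector. $\mathcal{O}^k(\hat S_d,\mathbb{E})$ ($\mathbb{E}$ a complex Banach space, omitted if $\mathbb{E}=\mathbb{C}$): $\mathbb{E}$-valued holomorphic functions $f$ on $\hat S_d=S_d(\alpha)\cup D_r$ such that for all $\tilde\alpha\in(0,\alpha)$, $\tilde r\in(0,r)$ there are $A,B>0$ with $\|f(t)\|<Ae^{B|t|^k}$ on $S_d(\tilde\alpha)\cup D_{\tilde r}$. Operators. $\hat{\mathcal{B}}_{m,t}(\sum a_nt^n)=\sum\frac{a_n}{m(n)}t^n$; $\partial_{m,t}(\sum a_nt^n)=\sum\frac{m(n+1)}{m(n)}a_{n+1}t^n$; similarly in $z$. Summability. $\hat u\in\mathbb{E}[[t]]$ is $k$-summable in direction $d$ ($\hat u\in\mathbb{E}\{t\}_{k,d}$) if $\hat{\mathcal{B}}_{\Gamma_{1/k},t}\hat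 u\in\mathcal{O}^k(\hat S_d,\mathbb{E})$ for some disc-sector $\hat S_d$. Its $k$-sum is $u^d(t)=\int_{e^{i\theta}\mathbb{R}_+}(\hat{\mathcal{B}}_{\Gamma_{1/k},t}\hat u)(s)\,e^{-(s/t)^k}k(s/t)^k\frac{ds}{s}$ for $\theta$ close to $d$. $\hat u$ is $k$-summable if it is $k$-summable in all directions except finitely many (modulo $2\pi$), which are called its singular directions. A sequence $m$ preserves summability if for every $k>0$, $d\in\mathbb{R}$ and every $\hat u\in\mathbb{E}[[t]]$ ($\mathbb{E}$ a complex Banach space): $\hat u\in\mathbb{E}\{t\}_{k,d}$ if and only if $\hat{\mathcal{B}}_{m,t}\hat u\in\mathbb{E}\{t\}_{k,d}$. A sequence of generalized moments of order $s\ge0$ is a sequence $m\Gamma_s$ with $m$ preserving summability. Kernel. For $m$ preserving summability, $e_m(z)=\sum_{n\ge0}m(n)z^n$; it is holomorphic near $0$ and extends holomorphically to $D\cup(\mathbb{C}\setminus\mathbb{R}_+)$, with less than exponential growth (of any positive order) in $\mathbb{C}\setminus\mathbb{R}_+$. Jumps and hyperfunctions. $L_d=\{t\in\widetilde{\mathbb{C}}:\arg t=d\}$. $d^+$ (resp. $d^-$) is a direction close to $d$ and greater (resp. less) than $d$; $J_{L_d,k}\hat u=u^{d^+}-u^{d^-}$ is the jump for $\hat u$ across the singular direction $d$. For $g\in\mathcal{O}^k(D\cup(S_d\setminus L_d))$ (holomorphic on $D\cup(S_d\setminus L_d)$ and of exponential growth of order at most $k$ there), the hyperfunction $[g(s)]_d$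 is the class of $g$ modulo $\mathcal{O}^k(\hat S_d)$, acting as the analytic functional $[g(s)]_d[\varphi(s)]=\int_{\gamma_d}g(s)\varphi(s)\,ds$, where $\gamma_d$ runs along the half-line from $e^{id^-}\infty$ to $0$ and then from $0$ to $e^{id^+}\infty$.
   Formalization: The jump formula has -a/z0 in place of a/z0 (the printed sign fails, e.g. a=λ=z0=1, s1=0, s2=1, m1=m2=1); for a=0 or λ=0 there is no singular direction; Banach spaces in "preserves summability" have carriers of at most continuum size, which suffices by passing to closed spans. *)

theory Defs
  imports "HOL-Complex_Analysis.Complex_Analysis" "HOL-Algebra.Module"
begin

section \<open>Complex Banach spaces with explicit carrier\<close>

text \<open>
  The notion ``preserving summability'' quantifies over all complex Banach spaces, and the spaces
  of holomorphic functions below depend on a radius, so Banach spaces are modelled by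
  HOL-Algebra modules over the complex numbers with a norm on the carrier. (The ring
  multiplication and the unit that the module record inherits are irrelevant.)
\<close>

definition complex_ring :: "complex ring" where
  "complex_ring = \<lparr>carrier = UNIV, mult = (*), one = 1, zero = 0, add = (+)\<rparr>"

record 'v nmodule = "(complex, 'v) module" +
  nrm :: "'v \<Rightarrow> real"

definition complex_banach :: "'v nmodule \<Rightarrow> bool" where
  "complex_banach E \<longleftrightarrow>
     module complex_ring E \<and>
     (\<forall>x\<in>carrier E. 0 \<le> nrm E x \<and> (nrm E x = 0 \<longleftrightarrow> x = \<zero>\<^bsub>E\<^esub>)) \<and>
     (\<forall>x\<in>carrier E. \<forall>y\<in>carrier E. nrm E (x \<oplus>\<^bsub>E\<^esub> y) \<le> nrm E x + nrm E y) \<and>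
     (\<forall>c. \<forall>x\<in>carrier E. nrm E (c \<odot>\<^bsub>E\<^esub> x) = cmod c * nrm E x) \<and>
     (\<forall>\<sigma>. (\<forall>n. \<sigma> n \<in> carrier E) \<and>
          (\<forall>\<epsilon>>0. \<exists>N::nat. \<forall>i\<ge>N. \<forall>j\<ge>N. nrm E (\<sigma> i \<ominus>\<^bsub>E\<^esub> \<sigma> j) < \<epsilon>) \<longrightarrow>
          (\<exists>x\<in>carrier E. (\<lambda>n. nrm E (\<sigma> n \<ominus>\<^bsub>E\<^esub> x)) \<longlonglongrightarrow> 0))"

definition complex_space :: "complex nmodule" where
  "complex_space = \<lparr>carrier = UNIV, mult = (*), one = 1, zero = 0, add = (+),
                    smult = (*), nrm = cmod\<rparr>"

text \<open>
  The space of functions continuous on the closed disc of radius \<open>r\<close> and holomorphic in its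
  interior. The functions are extended by 0, so that equality of elements is equality on the disc.
\<close>

definition hol_space :: "real \<Rightarrow> (complex \<Rightarrow> complex) nmodule" where
  "hol_space r =
     \<lparr>carrier = {f. continuous_on (cball 0 r) f \<and> f holomorphic_on ball 0 r \<and>
                    (\<forall>z. z \<notin> cball 0 r \<longrightarrow> f z = 0)},
      mult = (\<lambda>f g z. f z * g z), one = (\<lambda>z. if z \<in> cball 0 r then 1 else 0),
      zero = (\<lambda>z. 0), add = (\<lambda>f g z. f z + g z),
      smult = (\<lambda>c f z. c * f z), nrm = (\<lambda>f. SUP z\<in>cball 0 r. cmod (f z))\<rparr>"

definition holomorphic_into :: "'v nmodule \<Rightarrow> (complex \<Rightarrow> 'v) \<Rightarrow> complex set \<Rightarrow> bool" where
  "holomorphic_into E f S \<longleftrightarrow>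
     (\<forall>z\<in>S. f z \<in> carrier E) \<and>
     (\<forall>z\<in>S. \<exists>D\<in>carrier E.
        ((\<lambda>w. nrm E (inverse (w - z) \<odot>\<^bsub>E\<^esub> (f w \<ominus>\<^bsub>E\<^esub> f z) \<ominus>\<^bsub>E\<^esub> D)) \<longlongrightarrow> 0) (at z within S))"


section \<open>Disc-sectors and functions of exponential growth\<close>

text \<open>
  Sectors are projected to the complex plane. All openings below are at most \<open>2 * pi\<close>, for which
  the projection is injective; every use is existential in the opening, so this loses nothing.
\<close>

definition sector :: "real \<Rightarrow> real \<Rightarrow> complex set" where
  "sector d \<alpha> = {rcis \<rho> \<phi> | \<rho> \<phi>. \<rho> > 0 \<and> \<bar>\<phi> - d\<bar> < \<alpha> / 2}"

definition disc_sector :: "real \<Rightarrow> real \<Rightarrow> real \<Rightarrow> complex set" where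
  "disc_sector d \<alpha> r = sector d \<alpha> \<union> ball 0 r"

definition exp_growth ::
  "'v nmodule \<Rightarrow> real \<Rightarrow> real \<Rightarrow> real \<Rightarrow> real \<Rightarrow> (complex \<Rightarrow> 'v) set" where
  "exp_growth E k d \<alpha> r =
     {f. holomorphic_into E f (disc_sector d \<alpha> r) \<and>
         (\<forall>\<alpha>'\<in>{0<..<\<alpha>}. \<forall>r'\<in>{0<..<r}. \<exists>A>0. \<exists>B>0.
            \<forall>t\<in>disc_sector d \<alpha>' r'. nrm E (f t) < A * exp (B * cmod t powr k))}"


section \<open>Summability\<close>

text \<open>A formal power series in \<open>t\<close> over \<open>E\<close> is the sequence of its coefficients.\<close>

definition Gamma_seq :: "real \<Rightarrow> nat \<Rightarrow> real" where
  "Gamma_seq s n = Gamma (1 + s * real n)"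

definition borel_transform :: "'v nmodule \<Rightarrow> (nat \<Rightarrow> real) \<Rightarrow> (nat \<Rightarrow> 'v) \<Rightarrow> nat \<Rightarrow> 'v" where
  "borel_transform E m u n = complex_of_real (1 / m n) \<odot>\<^bsub>E\<^esub> u n"

definition borel_continuation ::
  "'v nmodule \<Rightarrow> real \<Rightarrow> real \<Rightarrow> (nat \<Rightarrow> 'v) \<Rightarrow> (complex \<Rightarrow> 'v) \<Rightarrow> bool" where
  "borel_continuation E k d u f \<longleftrightarrow>
     (\<forall>n. u n \<in> carrier E) \<and>
     (\<exists>\<alpha> r. 0 < \<alpha> \<and> \<alpha> \<le> 2 * pi \<and> 0 < r \<and> f \<in> exp_growth E k d \<alpha> r) \<and>
     (\<exists>\<epsilon>>0. \<forall>t\<in>ball 0 \<epsilon>.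
        (\<lambda>N. nrm E ((\<Oplus>\<^bsub>E\<^esub>n\<in>{..<N}. t ^ n \<odot>\<^bsub>E\<^esub> borel_transform E (Gamma_seq (1 / k)) u n) \<ominus>\<^bsub>E\<^esub> f t))
          \<longlonglongrightarrow> 0)"

definition summable_in :: "'v nmodule \<Rightarrow> real \<Rightarrow> real \<Rightarrow> (nat \<Rightarrow> 'v) \<Rightarrow> bool" where
  "summable_in E k d u \<longleftrightarrow> (\<exists>f. borel_continuation E k d u f)"

text \<open>
  HOL cannot quantify over all types here, so \<open>E\<close> ranges over all complex Banach spaces whose
  carrier is a set of complex sequences. This is no restriction: summability of a series only
  involves the closed linear span of its coefficients, which is separable and hence has at most
  the cardinality of the continuum.
\<close>

definition preserves_summability :: "(nat \<Rightarrow> real) \<Rightarrow> bool" where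
  "preserves_summability m \<longleftrightarrow>
     m 0 = 1 \<and> (\<forall>n. 0 < m n) \<and>
     (\<forall>k>0. \<forall>d. \<forall>E :: (nat \<Rightarrow> complex) nmodule. complex_banach E \<longrightarrow>
        (\<forall>u. (\<forall>n. u n \<in> carrier E) \<longrightarrow>
           (summable_in E k d u \<longleftrightarrow> summable_in E k d (borel_transform E m u))))"


section \<open>Formal series with holomorphic coefficients\<close>

text \<open>
  A germ at 0 is represented by its Taylor series, so \<open>u n\<close> is the Taylor series in \<open>z\<close> of the
  coefficient of \<open>t ^ n\<close>.  \<open>represents r v u\<close>: the coefficients of \<open>u\<close> are those of the series \<open>v\<close>
  over \<open>hol_space r\<close>. The radius is unspecified, so it may depend on the direction of summation.
\<close>

definition represents ::
  "real \<Rightarrow> (nat \<Rightarrow> complex \<Rightarrow> complex) \<Rightarrow> (nat \<Rightarrow> complex fps) \<Rightarrow> bool" where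
  "represents r v u \<longleftrightarrow> (\<forall>n. v n \<in> carrier (hol_space r) \<and> fps_expansion (v n) 0 = u n)"

definition hol_series :: "(nat \<Rightarrow> complex fps) set" where
  "hol_series = {u. \<exists>r>0. \<exists>v. represents r v u}"

definition moment_deriv_t :: "(nat \<Rightarrow> real) \<Rightarrow> (nat \<Rightarrow> complex fps) \<Rightarrow> nat \<Rightarrow> complex fps" where
  "moment_deriv_t m u n = fps_const (complex_of_real (m (Suc n) / m n)) * u (Suc n)"

definition moment_deriv_z :: "(nat \<Rightarrow> real) \<Rightarrow> complex fps \<Rightarrow> complex fps" where
  "moment_deriv_z m F = Abs_fps (\<lambda>j. complex_of_real (m (Suc j) / m j) * fps_nth F (Suc j))"

definition formal_solution ::
  "(nat \<Rightarrow> real) \<Rightarrow> (nat \<Rightarrow> real) \<Rightarrow> complex \<Rightarrow> (complex \<Rightarrow> complex) \<Rightarrow>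
   (nat \<Rightarrow> complex fps) \<Rightarrow> bool" where
  "formal_solution m1 m2 lam \<phi> u \<longleftrightarrow>
     u \<in> hol_series \<and>
     (\<forall>n. moment_deriv_t m1 u n - fps_const lam * moment_deriv_z m2 (u n) = 0) \<and>
     u 0 = fps_expansion \<phi> 0"

definition hol_summable_in :: "real \<Rightarrow> real \<Rightarrow> (nat \<Rightarrow> complex fps) \<Rightarrow> bool" where
  "hol_summable_in k d u \<longleftrightarrow> (\<exists>r>0. \<exists>v. represents r v u \<and> summable_in (hol_space r) k d v)"

definition singular_directions :: "real \<Rightarrow> (nat \<Rightarrow> complex fps) \<Rightarrow> real set" where
  "singular_directions k u = {d. \<not> hol_summable_in k d u}"

definition hol_summable :: "real \<Rightarrow> (nat \<Rightarrow> complex fps) \<Rightarrow> bool" where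
  "hol_summable k u \<longleftrightarrow> finite (cis ` singular_directions k u)"


section \<open>Sums and jumps\<close>

text \<open>Points of the universal covering of the punctured plane, as (modulus, argument).\<close>

type_synonym cov = "real \<times> real"

definition cov_proj :: "cov \<Rightarrow> complex" where
  "cov_proj s = rcis (fst s) (snd s)"

definition cov_quot_powr :: "cov \<Rightarrow> cov \<Rightarrow> real \<Rightarrow> complex" where
  "cov_quot_powr s t k = rcis ((fst s / fst t) powr k) (k * (snd s - snd t))"

definition laplace_kernel :: "real \<Rightarrow> cov \<Rightarrow> cov \<Rightarrow> complex" where
  "laplace_kernel k t s =
     complex_of_real k * cov_quot_powr s t k * exp (- cov_quot_powr s t k) / cov_proj s"

definition has_ray_integral :: "(cov \<Rightarrow> complex) \<Rightarrow> complex \<Rightarrow> real \<Rightarrow> bool" where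
  "has_ray_integral F w \<theta> \<longleftrightarrow> ((\<lambda>\<sigma>. F (\<sigma>, \<theta>) * cis \<theta>) has_integral w) {0<..}"

text \<open>
  \<open>has_sum_at k d u t z w\<close>: the \<open>k\<close>-sum of \<open>u\<close> in direction \<open>d\<close> has the value \<open>w\<close> at \<open>(t, z)\<close>.
  The integral of a \<open>hol_space r\<close>-valued function is evaluated pointwise in \<open>z\<close>.
\<close>

definition has_sum_at ::
  "real \<Rightarrow> real \<Rightarrow> (nat \<Rightarrow> complex fps) \<Rightarrow> cov \<Rightarrow> complex \<Rightarrow> complex \<Rightarrow> bool" where
  "has_sum_at k d u t z w \<longleftrightarrow>
     (\<exists>r>0. \<exists>v f. z \<in> cball 0 r \<and> represents r v u \<and> borel_continuation (hol_space r) k d v f \<and>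
        (\<forall>\<^sub>F \<theta> in nhds d. has_ray_integral (\<lambda>s. f (cov_proj s) z * laplace_kernel k t s) w \<theta>))"

definition has_jump ::
  "real \<Rightarrow> real \<Rightarrow> real \<Rightarrow> (nat \<Rightarrow> complex fps) \<Rightarrow> cov \<Rightarrow> complex \<Rightarrow> complex \<Rightarrow> bool" where
  "has_jump k dm dp u t z w \<longleftrightarrow>
     (\<exists>wp wm. has_sum_at k dp u t z wp \<and> has_sum_at k dm u t z wm \<and> w = wp - wm)"


section \<open>Hyperfunctions and the kernel function\<close>

text \<open>
  The disc-sector \<open>disc_sector d \<alpha> r\<close> with the part of the ray \<open>arg s = d\<close> outside the disc removed
  is the union of the disc-sectors in the directions \<open>d + \<alpha>/4\<close> and \<open>d - \<alpha>/4\<close> of opening \<open>\<alpha>/2\<close>.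
\<close>

definition cut_exp_growth :: "real \<Rightarrow> real \<Rightarrow> real \<Rightarrow> real \<Rightarrow> (complex \<Rightarrow> complex) set" where
  "cut_exp_growth k d \<alpha> r =
     exp_growth complex_space k (d + \<alpha> / 4) (\<alpha> / 2) r \<inter>
     exp_growth complex_space k (d - \<alpha> / 4) (\<alpha> / 2) r"

definition hyperfunction ::
  "real \<Rightarrow> real \<Rightarrow> real \<Rightarrow> real \<Rightarrow> (complex \<Rightarrow> complex) \<Rightarrow> (complex \<Rightarrow> complex) set" where
  "hyperfunction k d \<alpha> r g =
     {h. g \<in> cut_exp_growth k d \<alpha> r \<and> h \<in> cut_exp_growth k d \<alpha> r \<and>
         (\<exists>q\<in>exp_growth complex_space k d \<alpha> r.
            \<forall>s\<in>disc_sector (d + \<alpha> / 4) (\<alpha> / 2) r \<union> disc_sector (d - \<alpha> / 4) (\<alpha> / 2) r.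
              h s - g s = q s)}"

text \<open>
  The action on a test function, along the path coming in from infinity in the direction \<open>dm\<close>
  and going out in the direction \<open>dp\<close>; the value does not depend on the representative \<open>h\<close>.
\<close>

definition hyperfunction_acts ::
  "real \<Rightarrow> real \<Rightarrow> (complex \<Rightarrow> complex) set \<Rightarrow> (cov \<Rightarrow> complex) \<Rightarrow> complex \<Rightarrow> bool" where
  "hyperfunction_acts dm dp H \<phi> w \<longleftrightarrow>
     (\<exists>h\<in>H. \<exists>wp wm. has_ray_integral (\<lambda>s. h (cov_proj s) * \<phi> s) wp dp \<and>
                    has_ray_integral (\<lambda>s. h (cov_proj s) * \<phi> s) wm dm \<and> w = wp - wm)"

text \<open>
  The continuation of the power series is unique on the domain below; the values on the rest of
  the positive half-line are arbitrary.

  Since \<open>a / (z - z0)\<close> is \<open>- a / z0\<close> times the geometric series in \<open>z / z0\<close>, the Borel transform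
  at \<open>z = 0\<close> of the series solution with this initial value is \<open>- (a / z0) * kernel_fun m (lam * t / z0)\<close>.
\<close>

definition kernel_fun :: "(nat \<Rightarrow> real) \<Rightarrow> complex \<Rightarrow> complex" where
  "kernel_fun m = (SOME e. \<exists>\<epsilon>>0. e holomorphic_on (ball 0 \<epsilon> \<union> - \<real>\<^sub>\<ge>\<^sub>0) \<and>
     (\<forall>z\<in>ball 0 \<epsilon>. (\<lambda>n. complex_of_real (m n) * z ^ n) sums e z))"

end

theory Submission
  imports Defs "HOL-Real_Asymp.Real_Asymp"
begin

text \<open>
  The series solution is explicit. With \<open>c = \<lambda> / z\<^sub>0\<close>, the coefficient of \<open>t\<^sup>n z\<^sup>j\<close> is
  \<open>- (a / z\<^sub>0) c\<^sup>n z\<^sub>0\<^bsup>-j\<^esup> m\<^sub>2'(n + j) / (m\<^sub>1'(n) m\<^sub>2'(j))\<close>, where \<open>m\<^sub>1' = \<Gamma>\<^bsub>s\<^sub>1\<^esub> m\<^sub>1\<close> and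
  \<open>m\<^sub>2' = \<Gamma>\<^bsub>s\<^sub>2\<^esub> m\<^sub>2\<close>. At \<open>z = 0\<close> its Borel transform of order \<open>k\<close> is \<open>- (a / z\<^sub>0) \<Sum> m(n) (c t)\<^sup>n\<close>, a kernel
  series, which continues to the plane without the ray \<open>c t > 0\<close>; the jump of the Laplace integral
  across that ray is the asserted one. Three things have to be shown: that \<open>m\<close> preserves summability, that
  all coefficients in \<open>z\<close> are summable simultaneously in every direction off the ray, and that the ray
  is singular unless \<open>a c = 0\<close>.

  Preservation of summability passes to products and quotients, so for \<open>m\<close> only
  \<open>b(n) = \<Gamma>(1 + (s\<^sub>1 + s) n) / (\<Gamma>(1 + s\<^sub>1 n) \<Gamma>(1 + s n))\<close> matters, where \<open>s = s\<^sub>2 - s\<^sub>1\<close>. If \<open>b(n) = \<integral> \<kappa> \<psi>\<^sup>n\<close> with nodes \<open>\<psi>\<close> close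
  to the positive half-line, and \<open>f\<close> continues the Borel transform of a series, then \<open>\<integral> \<kappa> f(\<psi> t)\<close>
  continues that of its product with \<open>b\<close>, with values in the same Banach space
  (\<open>narrow_moment_summable\<close>). The factor \<open>1 / b\<close> is a Beta integral times a linear sequence. For \<open>b\<close>
  itself the extraction of a binomial coefficient from \<open>(1 + w)\<^bsup>p + q\<^esup>\<close> is carried out for real exponents,
  on the contour on which \<open>arg (1 + w)\<close> is a fixed multiple \<open>\<alpha>\<close> of \<open>arg w\<close> (\<open>contour_integral_binomial\<close>); for
  \<open>\<alpha> = s / (s\<^sub>1 + s)\<close> the nodes are positive. Values in a Banach space are handled by testing with
  functionals, which the Hahn--Banach theorem supplies.

  For simultaneous summability, the coefficients in \<open>z\<close> are collected in a weighted sequence space. There the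
  Gamma factor \<open>\<Gamma>(1 + s\<^sub>2 (n + j)) / (\<Gamma>(1 + s\<^sub>2 n) \<Gamma>(1 + s\<^sub>2 j))\<close> has again a contour integral, now
  with \<open>\<alpha>\<close> small, and it acts on the shifted kernels \<open>\<Sum> m\<^sub>2(n + j) (c t)\<^sup>n\<close>, whose continuations grow only
  geometrically in \<open>j\<close> (\<open>shifted_kernels\<close>, \<open>summable_binomial_series\<close>). The remaining factors \<open>b\<close> and
  \<open>m\<^sub>1\<close> preserve summability, and a bounded linear map takes sequences to holomorphic functions.

  If the solution were summable along the ray, then evaluating at \<open>z = 0\<close>
  and dividing by \<open>m\<close> would continue the geometric series \<open>\<Sum> (c t)\<^sup>n\<close> to its pole.

  As for the jump, the continuations of the kernel series in the various directions live on domains that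
  are star-shaped about 0, so they fit together, and the continuation of the solution at \<open>z = 0\<close>
  agrees with the kernel on every ray next to the singular one. The Laplace integrals do not change
  when the ray is rotated (\<open>laplace_ray_integral\<close>), so they are the two sums whose difference is
  the jump, and also the two halves of the integral that defines the hyperfunction.
\<close>

section \<open>Functionals on normed spaces with explicit carrier\<close>

lemma complex_ring_simps [simp]:
  "carrier complex_ring = UNIV" "x \<otimes>\<^bsub>complex_ring\<^esub> y = x * y" "\<one>\<^bsub>complex_ring\<^esub> = 1"
  "\<zero>\<^bsub>complex_ring\<^esub> = 0" "x \<oplus>\<^bsub>complex_ring\<^esub> y = x + y"
  by (simp_all add: complex_ring_def)

lemma cring_complex_ring: "cring complex_ring"
proof (rule cringI)
  show "abelian_group complex_ring"
  proof (rule abelian_groupI)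
    fix x assume "x \<in> carrier complex_ring"
    show "\<exists>y\<in>carrier complex_ring. y \<oplus>\<^bsub>complex_ring\<^esub> x = \<zero>\<^bsub>complex_ring\<^esub>"
      by (rule bexI[of _ "- x"]) auto
  qed (auto simp: algebra_simps)
  show "comm_monoid complex_ring"
    by (rule comm_monoidI) (auto simp: algebra_simps)
qed (auto simp: algebra_simps)

lemma complex_ring_minus [simp]: "\<ominus>\<^bsub>complex_ring\<^esub> x = - x"
proof -
  interpret cring complex_ring by (rule cring_complex_ring)
  show ?thesis
    by (rule minus_equality) auto
qed

locale normed_mod =
  fixes E :: "'v nmodule" (structure)
  assumes mod: "module complex_ring E"
    and nrm_nonneg: "x \<in> carrier E \<Longrightarrow> 0 \<le> nrm E x"
    and nrm_eq_0: "x \<in> carrier E \<Longrightarrow> nrm E x = 0 \<longleftrightarrow> x = \<zero>"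
    and nrm_triangle: "x \<in> carrier E \<Longrightarrow> y \<in> carrier E \<Longrightarrow> nrm E (x \<oplus> y) \<le> nrm E x + nrm E y"
    and nrm_smult: "x \<in> carrier E \<Longrightarrow> nrm E (c \<odot> x) = cmod c * nrm E x"

sublocale normed_mod \<subseteq> module complex_ring E
  by (rule mod)

lemma complex_banach_normed_mod: "complex_banach E \<Longrightarrow> normed_mod E"
  unfolding complex_banach_def normed_mod_def by blast

context normed_mod
begin

lemma smult_closed' [simp, intro]: "x \<in> carrier E \<Longrightarrow> c \<odot> x \<in> carrier E"
  by (rule smult_closed) auto

lemma smult_add: "x \<in> carrier E \<Longrightarrow> (a + b) \<odot> x = a \<odot> x \<oplus> b \<odot> x"
  using smult_l_distr[of a b x] by simp

lemma smult_smult: "x \<in> carrier E \<Longrightarrow> a \<odot> (b \<odot> x) = (a * b) \<odot> x"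
  using smult_assoc1[of a b x] by simp

lemma smult_0 [simp]: "x \<in> carrier E \<Longrightarrow> 0 \<odot> x = \<zero>"
  using smult_l_null[of x] by simp

lemma smult_1 [simp]: "x \<in> carrier E \<Longrightarrow> 1 \<odot> x = x"
  using smult_one[of x] by simp

lemma smult_zero [simp]: "c \<odot> \<zero> = \<zero>"
  using smult_r_null[of c] by simp

lemma smult_distr: "x \<in> carrier E \<Longrightarrow> y \<in> carrier E \<Longrightarrow> c \<odot> (x \<oplus> y) = c \<odot> x \<oplus> c \<odot> y"
  using smult_r_distr[of c x y] by simp

lemma minus_smult: "x \<in> carrier E \<Longrightarrow> \<ominus> x = (-1) \<odot> x"
  using smult_l_minus[of 1 x] by simp

lemma nrm_zero [simp]: "nrm E \<zero> = 0"
  using nrm_eq_0[of \<zero>] by simp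

lemma nrm_minus: "x \<in> carrier E \<Longrightarrow> nrm E (\<ominus> x) = nrm E x"
  by (simp add: minus_smult nrm_smult)

end

text \<open>
  Functionals are required to be contractive, so that a norming family recovers the norm exactly.
\<close>

definition functional :: "'v nmodule \<Rightarrow> ('v \<Rightarrow> complex) \<Rightarrow> bool" where
  "functional E l \<longleftrightarrow>
     (\<forall>x\<in>carrier E. \<forall>y\<in>carrier E. l (x \<oplus>\<^bsub>E\<^esub> y) = l x + l y) \<and>
     (\<forall>c. \<forall>x\<in>carrier E. l (c \<odot>\<^bsub>E\<^esub> x) = c * l x) \<and>
     (\<forall>x\<in>carrier E. cmod (l x) \<le> nrm E x)"

definition norming :: "'v nmodule \<Rightarrow> ('v \<Rightarrow> complex) set \<Rightarrow> bool" where
  "norming E L \<longleftrightarrow> (\<forall>l\<in>L. functional E l) \<and>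
     (\<forall>x\<in>carrier E. \<forall>B. (\<forall>l\<in>L. cmod (l x) \<le> B) \<longrightarrow> nrm E x \<le> B)"

context normed_mod
begin

lemma functional_add: "functional E l \<Longrightarrow> x \<in> carrier E \<Longrightarrow> y \<in> carrier E \<Longrightarrow> l (x \<oplus> y) = l x + l y"
  and functional_smult: "functional E l \<Longrightarrow> x \<in> carrier E \<Longrightarrow> l (c \<odot> x) = c * l x"
  and functional_bound: "functional E l \<Longrightarrow> x \<in> carrier E \<Longrightarrow> cmod (l x) \<le> nrm E x"
  by (auto simp: functional_def)

lemma functional_zero: "functional E l \<Longrightarrow> l \<zero> = 0"
  using functional_bound[of l \<zero>] by simp

lemma functional_uminus: "functional E l \<Longrightarrow> x \<in> carrier E \<Longrightarrow> l (\<ominus> x) = - l x"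
  by (simp add: minus_smult functional_smult)

lemma functional_minus:
  "functional E l \<Longrightarrow> x \<in> carrier E \<Longrightarrow> y \<in> carrier E \<Longrightarrow> l (x \<ominus> y) = l x - l y"
  by (simp add: a_minus_def functional_add functional_uminus)

lemma finsum_lessThan_Suc:
  assumes "\<And>n. x n \<in> carrier E"
  shows "(\<Oplus>n\<in>{..<Suc N}. x n) = x N \<oplus> (\<Oplus>n\<in>{..<N}. x n)"
  using assms by (simp add: lessThan_Suc finsum_insert Pi_def)

lemma functional_finsum:
  fixes N :: nat
  assumes "functional E l" "\<And>n. x n \<in> carrier E"
  shows "l (\<Oplus>n\<in>{..<N}. x n) = (\<Sum>n<N. l (x n))"
proof (induction N)
  case 0 then show ?case by (simp add: functional_zero assms)
next
  case (Suc N)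
  have "(\<Oplus>n\<in>{..<N}. x n) \<in> carrier E" using assms by (intro finsum_closed) auto
  then show ?case using Suc assms
    by (simp only: finsum_lessThan_Suc functional_add sum.lessThan_Suc) (simp add: add.commute)
qed

lemma normingD: "norming E L \<Longrightarrow> x \<in> carrier E \<Longrightarrow> (\<And>l. l \<in> L \<Longrightarrow> cmod (l x) \<le> B) \<Longrightarrow> nrm E x \<le> B"
  and norming_functional: "norming E L \<Longrightarrow> l \<in> L \<Longrightarrow> functional E l"
  by (auto simp: norming_def)

lemma norming_eqI:
  assumes "norming E L" "x \<in> carrier E" "y \<in> carrier E" "\<And>l. l \<in> L \<Longrightarrow> l x = l y"
  shows "x = y"
proof -
  have "nrm E (x \<ominus> y) \<le> 0"
    by (rule normingD[OF assms(1)])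
       (use assms in \<open>auto simp: functional_minus norming_functional[OF assms(1)]\<close>)
  then have "x \<ominus> y = \<zero>" using nrm_nonneg[of "x \<ominus> y"] nrm_eq_0[of "x \<ominus> y"] assms by auto
  moreover have "x = (x \<ominus> y) \<oplus> y" using assms by (simp add: a_minus_def a_assoc l_neg)
  ultimately show ?thesis using assms by simp
qed

subsection \<open>The Hahn--Banach theorem\<close>

definition sublinear :: "('v \<Rightarrow> real) \<Rightarrow> bool" where
  "sublinear q \<longleftrightarrow>
     (\<forall>x\<in>carrier E. \<forall>y\<in>carrier E. q (x \<oplus> y) \<le> q x + q y) \<and>
     (\<forall>x\<in>carrier E. \<forall>r\<ge>0. q (complex_of_real r \<odot> x) = r * q x) \<and>
     (\<forall>x. x \<notin> carrier E \<longrightarrow> q x = 0)"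

lemma sublinear_zero: "sublinear q \<Longrightarrow> q \<zero> = 0"
  unfolding sublinear_def
  by (metis mult_zero_left of_real_0 order_refl smult_zero zero_closed)

lemma sublinear_neg:
  assumes "sublinear q" "x \<in> carrier E" shows "- q (\<ominus> x) \<le> q x"
proof -
  have "q (x \<oplus> \<ominus> x) \<le> q x + q (\<ominus> x)" using assms unfolding sublinear_def by blast
  moreover have "x \<oplus> \<ominus> x = \<zero>" using assms by (simp add: r_neg)
  ultimately show ?thesis using sublinear_zero[OF assms(1)] by simp
qed

text \<open>
  Lowering a sublinear function along the ray spanned by \<open>y\<close>. A minimal sublinear function is not
  changed by this, which makes it additive.
\<close>

definition lower :: "('v \<Rightarrow> real) \<Rightarrow> 'v \<Rightarrow> 'v \<Rightarrow> real" where
  "lower q y x = (if x \<in> carrier E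
     then (INF t\<in>{0..}. q (x \<oplus> complex_of_real t \<odot> y) - t * q y) else 0)"

lemma lower_bounded:
  assumes "sublinear q" "x \<in> carrier E" "y \<in> carrier E" "t \<ge> 0"
  shows "- q (\<ominus> x) \<le> q (x \<oplus> complex_of_real t \<odot> y) - t * q y"
proof -
  let ?ty = "complex_of_real t \<odot> y"
  have "q ((x \<oplus> ?ty) \<oplus> \<ominus> x) \<le> q (x \<oplus> ?ty) + q (\<ominus> x)"
    using assms unfolding sublinear_def by auto
  moreover have "(x \<oplus> ?ty) \<oplus> \<ominus> x = ?ty" using assms
    by (smt (verit) a_comm a_assoc l_neg r_zero smult_closed' add.inv_closed)
  moreover have "q ?ty = t * q y" using assms unfolding sublinear_def by auto
  ultimately show ?thesis by simp
qed

lemma lower_le: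
  assumes "sublinear q" "x \<in> carrier E" "y \<in> carrier E" "t \<ge> 0"
  shows "lower q y x \<le> q (x \<oplus> complex_of_real t \<odot> y) - t * q y"
proof -
  have "bdd_below ((\<lambda>t. q (x \<oplus> complex_of_real t \<odot> y) - t * q y) ` {0..})"
    using lower_bounded[OF assms(1-3)] by (intro bdd_belowI2[of _ "- q (\<ominus> x)"]) auto
  then show ?thesis using assms by (auto simp: lower_def intro!: cINF_lower)
qed

lemma lower_ge:
  assumes "x \<in> carrier E" "\<And>t. t \<ge> 0 \<Longrightarrow> c \<le> q (x \<oplus> complex_of_real t \<odot> y) - t * q y"
  shows "c \<le> lower q y x"
  using assms by (auto simp: lower_def intro!: cINF_greatest)

lemma lower_le_self:
  assumes "sublinear q" "x \<in> carrier E" "y \<in> carrier E"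
  shows "lower q y x \<le> q x"
  using lower_le[OF assms, of 0] assms by simp

lemma sublinear_lower:
  assumes q: "sublinear q" and y: "y \<in> carrier E"
  shows "sublinear (lower q y)"
  unfolding sublinear_def
proof (intro conjI ballI allI impI)
  fix x z assume xz: "x \<in> carrier E" "z \<in> carrier E"
  have "lower q y (x \<oplus> z) - (q (z \<oplus> complex_of_real t \<odot> y) - t * q y) \<le> lower q y x"
    if t: "t \<ge> 0" for t
  proof (rule lower_ge[OF xz(1)])
    fix s :: real assume s: "s \<ge> 0"
    let ?s = "complex_of_real s \<odot> y" and ?t = "complex_of_real t \<odot> y"
    have "lower q y (x \<oplus> z) \<le> q ((x \<oplus> z) \<oplus> complex_of_real (s + t) \<odot> y) - (s + t) * q y"
      using lower_le[OF q _ y, of "x \<oplus> z" "s + t"] xz s t by simp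
    also have "(x \<oplus> z) \<oplus> complex_of_real (s + t) \<odot> y = (x \<oplus> ?s) \<oplus> (z \<oplus> ?t)"
      using xz y by (simp add: smult_add a_ac)
    also have "q ((x \<oplus> ?s) \<oplus> (z \<oplus> ?t)) \<le> q (x \<oplus> ?s) + q (z \<oplus> ?t)"
      using q xz y unfolding sublinear_def by auto
    finally show "lower q y (x \<oplus> z) - (q (z \<oplus> ?t) - t * q y) \<le> q (x \<oplus> ?s) - s * q y"
      by (simp add: algebra_simps)
  qed
  then have "lower q y (x \<oplus> z) - lower q y x \<le> lower q y z"
    by (intro lower_ge[OF xz(2)]) (simp add: algebra_simps)
  then show "lower q y (x \<oplus> z) \<le> lower q y x + lower q y z" by simp
next
  fix x and r :: real assume x: "x \<in> carrier E" and r: "r \<ge> 0"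
  have ge: "r * lower q y x \<le> lower q y (complex_of_real r \<odot> x)"
    if x: "x \<in> carrier E" and r: "r > 0" for x and r :: real
  proof (rule lower_ge)
    fix t :: real assume t: "t \<ge> 0"
    have "complex_of_real r \<odot> (x \<oplus> complex_of_real (t / r) \<odot> y)
        = complex_of_real r \<odot> x \<oplus> complex_of_real t \<odot> y"
      using x y r by (simp add: smult_distr smult_smult)
    moreover have "q (complex_of_real r \<odot> (x \<oplus> complex_of_real (t / r) \<odot> y))
        = r * q (x \<oplus> complex_of_real (t / r) \<odot> y)"
      using q x y r unfolding sublinear_def by (meson a_closed less_imp_le smult_closed')
    ultimately have "q (complex_of_real r \<odot> x \<oplus> complex_of_real t \<odot> y) - t * q y
        = r * (q (x \<oplus> complex_of_real (t / r) \<odot> y) - (t / r) * q y)"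
      using r by (simp add: right_diff_distrib)
    moreover have "lower q y x \<le> q (x \<oplus> complex_of_real (t / r) \<odot> y) - (t / r) * q y"
      using lower_le[OF q x y, of "t / r"] r t by simp
    ultimately show "r * lower q y x \<le> q (complex_of_real r \<odot> x \<oplus> complex_of_real t \<odot> y) - t * q y"
      using r by (simp add: mult_left_mono)
  qed (use x in auto)
  show "lower q y (complex_of_real r \<odot> x) = r * lower q y x"
  proof (cases "r = 0")
    case True
    have "lower q y \<zero> \<ge> 0"
      using q y by (intro lower_ge) (auto simp: sublinear_def)
    moreover have "lower q y \<zero> \<le> 0"
      using lower_le_self[OF q _ y, of \<zero>] sublinear_zero[OF q] by simp
    ultimately show ?thesis using True x by simp
  next
    case False
    then have r: "r > 0" using \<open>r \<ge> 0\<close> by simp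
    have "(1 / r) * lower q y (complex_of_real r \<odot> x)
        \<le> lower q y (complex_of_real (1 / r) \<odot> (complex_of_real r \<odot> x))"
      using r x by (intro ge) auto
    also have "complex_of_real (1 / r) \<odot> (complex_of_real r \<odot> x) = x"
      using x r by (simp add: smult_smult)
    finally show ?thesis using ge[OF x r] r by (simp add: field_simps)
  qed
qed (auto simp: lower_def)

text \<open>
  Zorn's lemma applies to the sublinear functions below \<open>p\<close>: each of them is at least \<open>- p (- x)\<close> at \<open>x\<close>,
  so the pointwise infimum of a chain is finite, and it is again sublinear.
\<close>

lemma minimal_sublinear:
  assumes p: "sublinear p"
  obtains q where "sublinear q" "\<And>x. q x \<le> p x"
    "\<And>q' x. sublinear q' \<Longrightarrow> (\<And>x. q' x \<le> q x) \<Longrightarrow> q' = q"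
proof -
  define A where "A = {q. sublinear q \<and> (\<forall>x. q x \<le> p x)}"
  define P :: "('v \<Rightarrow> real) \<Rightarrow> ('v \<Rightarrow> real) \<Rightarrow> bool" where "P = (\<lambda>a u. \<forall>x. u x \<le> a x)"
  have bound: "- p (\<ominus> x) \<le> q x" if "q \<in> A" "x \<in> carrier E" for q x
  proof -
    have "q (\<ominus> x) \<le> p (\<ominus> x)" and q: "sublinear q" using that(1) by (auto simp: A_def)
    then show ?thesis using sublinear_neg[OF q that(2)] by linarith
  qed
  have "\<exists>m\<in>A. \<forall>a\<in>A. P m a \<longrightarrow> a = m"
  proof (rule predicate_Zorn)
    show "partial_order_on A (relation_of P A)"
    proof (rule partial_order_on_relation_ofI)
      fix a b c assume "P a b" "P b c"
      then show "P a c" unfolding P_def using order_trans by blast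
    next
      fix a b assume "P a b" "P b a"
      then show "a = b" unfolding P_def by (intro ext antisym) auto
    qed (auto simp: P_def)
  next
    fix C assume C: "C \<in> Chains (relation_of P A)"
    have CA: "C \<subseteq> A" using C by (auto simp: Chains_def relation_of_def)
    have tot: "P a b \<or> P b a" if "a \<in> C" "b \<in> C" for a b
      using C that by (auto simp: Chains_def relation_of_def)
    show "\<exists>u\<in>A. \<forall>a\<in>C. P a u"
    proof (cases "C = {}")
      case True then show ?thesis using p by (auto simp: A_def)
    next
      case False
      define u where "u = (\<lambda>x. if x \<in> carrier E then INF q\<in>C. q x else 0)"
      have bdd: "bdd_below ((\<lambda>q. q x) ` C)" if "x \<in> carrier E" for x
        using bound[OF _ that] CA by (intro bdd_belowI2[of _ "- p (\<ominus> x)"]) auto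
      have le: "u x \<le> q x" if "q \<in> C" for q x
      proof (cases "x \<in> carrier E")
        case True then show ?thesis using that bdd by (auto simp: u_def intro: cINF_lower)
      next
        case F: False then show ?thesis using that CA by (auto simp: u_def A_def sublinear_def)
      qed
      have sub: "sublinear q" if "q \<in> C" for q using CA that by (auto simp: A_def)
      have ge: "c \<le> u z" if "z \<in> carrier E" "\<And>q. q \<in> C \<Longrightarrow> c \<le> q z" for c z
        using that \<open>C \<noteq> {}\<close> by (auto simp: u_def intro!: cINF_greatest)
      have "sublinear u"
        unfolding sublinear_def
      proof (intro conjI ballI allI impI)
        fix x y assume xy: "x \<in> carrier E" "y \<in> carrier E"
        have "u (x \<oplus> y) \<le> q x + q' y" if qq: "q \<in> C" "q' \<in> C" for q q'
        proof -
          obtain r where r: "r \<in> C" "r x \<le> q x" "r y \<le> q' y"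
            using tot[OF qq] qq unfolding P_def by fastforce
          have "u (x \<oplus> y) \<le> r (x \<oplus> y)" by (rule le[OF r(1)])
          also have "\<dots> \<le> r x + r y" using sub[OF r(1)] xy unfolding sublinear_def by blast
          finally show ?thesis using r by simp
        qed
        then have "u (x \<oplus> y) - q' y \<le> u x" if "q' \<in> C" for q'
          using that by (intro ge[OF xy(1)]) (simp add: algebra_simps)
        then have "u (x \<oplus> y) - u x \<le> u y"
          by (intro ge[OF xy(2)]) (simp add: algebra_simps)
        then show "u (x \<oplus> y) \<le> u x + u y" by simp
      next
        fix x and r :: real assume x: "x \<in> carrier E" and r: "r \<ge> 0"
        have sc: "q (complex_of_real r \<odot> x) = r * q x" if "q \<in> C" for q
          using sub[OF that] x r unfolding sublinear_def by blast
        show "u (complex_of_real r \<odot> x) = r * u x"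
        proof (cases "r = 0")
          case True
          have "u \<zero> = (INF q\<in>C. 0)"
            using sub sublinear_zero by (auto simp: u_def intro!: INF_cong)
          then show ?thesis using True x \<open>C \<noteq> {}\<close> by simp
        next
          case False
          then have r: "r > 0" using r by simp
          show ?thesis
          proof (rule antisym)
            have "u (complex_of_real r \<odot> x) / r \<le> u x"
            proof (rule ge[OF x])
              fix q assume q: "q \<in> C"
              have "u (complex_of_real r \<odot> x) \<le> r * q x" using le[OF q] sc[OF q] by metis
              then show "u (complex_of_real r \<odot> x) / r \<le> q x" using r by (simp add: field_simps)
            qed
            then show "u (complex_of_real r \<odot> x) \<le> r * u x" using r by (simp add: field_simps)
            show "r * u x \<le> u (complex_of_real r \<odot> x)"
            proof (rule ge)
              fix q assume q: "q \<in> C"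
              show "r * u x \<le> q (complex_of_real r \<odot> x)"
                unfolding sc[OF q] using r le[OF q] by (intro mult_left_mono) auto
            qed (use x in auto)
          qed
        qed
      qed (auto simp: u_def)
      moreover have "u x \<le> p x" for x
        using le CA \<open>C \<noteq> {}\<close> unfolding A_def by (smt (verit) ex_in_conv mem_Collect_eq subsetD)
      ultimately show ?thesis using le by (intro bexI[of _ u]) (auto simp: A_def P_def)
    qed
  qed
  then obtain m where m: "m \<in> A" "\<And>a. a \<in> A \<Longrightarrow> P m a \<Longrightarrow> a = m" by blast
  show thesis
  proof (rule that[of m])
    fix q' x assume q': "sublinear q'" "\<And>x. q' x \<le> m x"
    then have "q' \<in> A" using m(1) by (auto simp: A_def intro: order_trans)
    then show "q' = m" using m(2) q' by (auto simp: P_def)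
  qed (use m in \<open>auto simp: A_def\<close>)
qed

text \<open>
  Lowering the norm along \<open>x0\<close> before minimising forces the value at \<open>- x0\<close> down to \<open>- \<parallel>x0\<parallel>\<close>.
\<close>

lemma Hahn_Banach_real:
  assumes x0: "x0 \<in> carrier E"
  obtains f where "\<And>x y. x \<in> carrier E \<Longrightarrow> y \<in> carrier E \<Longrightarrow> f (x \<oplus> y) = f x + f y"
    "\<And>x r. x \<in> carrier E \<Longrightarrow> f (complex_of_real r \<odot> x) = r * f x"
    "\<And>x. x \<in> carrier E \<Longrightarrow> f x \<le> nrm E x" "f x0 = nrm E x0"
proof -
  define p where "p = (\<lambda>x. if x \<in> carrier E then nrm E x else 0)"
  have p: "sublinear p"
    by (auto simp: sublinear_def p_def nrm_triangle nrm_smult)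
  obtain q where q: "sublinear q" "\<And>x. q x \<le> lower p x0 x"
    and min: "\<And>q' x. sublinear q' \<Longrightarrow> (\<And>x. q' x \<le> q x) \<Longrightarrow> q' = q"
    using minimal_sublinear[OF sublinear_lower[OF p x0]] by metis
  have qlow: "lower q y = q" if y: "y \<in> carrier E" for y
  proof (rule min[OF sublinear_lower[OF q(1) y]])
    show "lower q y x \<le> q x" for x
      using lower_le_self[OF q(1) _ y] q(1) by (cases "x \<in> carrier E") (auto simp: lower_def sublinear_def)
  qed
  have add: "q (x \<oplus> y) = q x + q y" if "x \<in> carrier E" "y \<in> carrier E" for x y
  proof (rule antisym)
    show "q (x \<oplus> y) \<le> q x + q y" using q(1) that unfolding sublinear_def by blast
    show "q x + q y \<le> q (x \<oplus> y)"
      using lower_le[OF q(1) that, of 1] qlow[OF that(2)] that by simp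
  qed
  have neg: "q (\<ominus> x) = - q x" if "x \<in> carrier E" for x
    using add[of x "\<ominus> x"] that sublinear_zero[OF q(1)] by (simp add: r_neg)
  have le: "q x \<le> nrm E x" if "x \<in> carrier E" for x
    using q(2)[of x] lower_le_self[OF p that x0] that by (simp add: p_def)
  show thesis
  proof (rule that[of q])
    fix x and r :: real assume x: "x \<in> carrier E"
    show "q (complex_of_real r \<odot> x) = r * q x"
    proof (cases "r \<ge> 0")
      case True then show ?thesis using q(1) x unfolding sublinear_def by blast
    next
      case False
      have "complex_of_real r \<odot> x = \<ominus> (complex_of_real (- r) \<odot> x)"
        using x by (simp add: minus_smult smult_smult)
      moreover have "q (complex_of_real (- r) \<odot> x) = - r * q x"
        using q(1) x False unfolding sublinear_def by (metis le_cases neg_0_le_iff_le)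
      ultimately show ?thesis using x neg by simp
    qed
  next
    have "q (\<ominus> x0) \<le> lower p x0 (\<ominus> x0)" by (rule q(2))
    also have "\<dots> \<le> p (\<ominus> x0 \<oplus> complex_of_real 1 \<odot> x0) - 1 * p x0"
      using x0 by (intro lower_le[OF p]) auto
    also have "\<dots> = - nrm E x0" using x0 by (simp add: p_def l_neg)
    finally have "nrm E x0 \<le> q x0" using neg[OF x0] by simp
    then show "q x0 = nrm E x0" using le[OF x0] by simp
  qed (use add le in auto)
qed

text \<open>
  The complexification \<open>f x - \<i> f (\<i> x)\<close> of a real functional has the same norm: at a given point,
  rotate the argument so that its value becomes real.
\<close>

theorem norming_functionals: "norming E {l. functional E l}"
  unfolding norming_def
proof (intro conjI ballI allI impI)
  fix x B assume x: "x \<in> carrier E" and B: "\<forall>l\<in>{l. functional E l}. cmod (l x) \<le> B"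
  obtain f where f: "\<And>x y. x \<in> carrier E \<Longrightarrow> y \<in> carrier E \<Longrightarrow> f (x \<oplus> y) = f x + f y"
    "\<And>x r. x \<in> carrier E \<Longrightarrow> f (complex_of_real r \<odot> x) = r * f x"
    "\<And>x. x \<in> carrier E \<Longrightarrow> f x \<le> nrm E x" "f x = nrm E x"
    using Hahn_Banach_real[OF x] by metis
  define l where "l = (\<lambda>x. Complex (f x) (- f (\<i> \<odot> x)))"
  have l_add: "l (y \<oplus> z) = l y + l z" if "y \<in> carrier E" "z \<in> carrier E" for y z
    using that f(1) by (simp add: l_def smult_distr complex_eq_iff)
  have l_smult: "l (c \<odot> y) = c * l y" if y: "y \<in> carrier E" for c y
  proof -
    have c: "c = complex_of_real (Re c) + complex_of_real (Im c) * \<i>"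
      by (simp add: complex_eq_iff)
    have 1: "f (c \<odot> y) = Re c * f y + Im c * f (\<i> \<odot> y)"
      by (subst c, subst smult_add) (use y f(1,2) in \<open>simp_all flip: smult_smult\<close>)
    have c2: "\<i> * c = complex_of_real (- Im c) + complex_of_real (Re c) * \<i>"
      by (simp add: complex_eq_iff)
    have 2: "f ((\<i> * c) \<odot> y) = - Im c * f y + Re c * f (\<i> \<odot> y)"
      by (subst c2, subst smult_add) (use y f(1) f(2)[of _ "- Im c"] f(2) in \<open>simp_all flip: smult_smult\<close>)
    show ?thesis using 1 2 y by (simp add: l_def smult_smult complex_eq_iff)
  qed
  have l_bound: "cmod (l y) \<le> nrm E y" if y: "y \<in> carrier E" for y
  proof -
    define u where "u = cis (- Arg (l y))"
    have "u * l y = complex_of_real (cmod (l y))"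
      using rcis_cmod_Arg[of "l y"] unfolding u_def rcis_def
      by (metis cis_mult cis_zero add.left_inverse mult.left_commute mult.right_neutral)
    then have "f (u \<odot> y) = cmod (l y)"
      using l_smult[OF y, of u] by (simp add: l_def complex_eq_iff)
    then have "cmod (l y) \<le> nrm E (u \<odot> y)" using f(3)[of "u \<odot> y"] y by simp
    also have "\<dots> = nrm E y" using y by (simp add: nrm_smult u_def)
    finally show ?thesis .
  qed
  have "functional E l" using l_add l_smult l_bound by (auto simp: functional_def)
  then have "cmod (l x) \<le> B" using B by auto
  moreover have "f x \<le> cmod (l x)" using complex_Re_le_cmod[of "l x"] by (simp add: l_def)
  ultimately show "nrm E x \<le> B" using f(4) by simp
qed auto

end

section \<open>Disc-sectors\<close>

text \<open>
  After a rotation the sector is described by the principal argument, which is continuous off the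
  negative half-line; openness follows.
\<close>

lemma sector_eq:
  assumes "0 < \<alpha>" "\<alpha> \<le> 2 * pi"
  shows "sector d \<alpha> = (\<lambda>z. cis d * z) ` {z. z \<notin> \<real>\<^sub>\<le>\<^sub>0 \<and> \<bar>Arg z\<bar> < \<alpha> / 2}"
proof (intro equalityI subsetI)
  fix z assume "z \<in> sector d \<alpha>"
  then obtain \<rho> \<phi> where z: "z = rcis \<rho> \<phi>" "\<rho> > 0" "\<bar>\<phi> - d\<bar> < \<alpha> / 2"
    by (auto simp: sector_def)
  have A: "Arg (rcis \<rho> (\<phi> - d)) = \<phi> - d"
    using z assms by (subst Arg_rcis) (auto simp: abs_if split: if_splits)
  have "rcis \<rho> (\<phi> - d) \<notin> \<real>\<^sub>\<le>\<^sub>0"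
  proof
    assume "rcis \<rho> (\<phi> - d) \<in> \<real>\<^sub>\<le>\<^sub>0"
    moreover have "rcis \<rho> (\<phi> - d) \<noteq> 0" using z by simp
    ultimately have "Arg (rcis \<rho> (\<phi> - d)) = pi"
      by (auto simp: complex_nonpos_Reals_iff Arg_eq_pi complex_eq_iff less_le)
    then show False using A z(3) assms by auto
  qed
  moreover have "z = cis d * rcis \<rho> (\<phi> - d)" by (simp add: z cis_rcis_eq rcis_mult)
  ultimately show "z \<in> (\<lambda>z. cis d * z) ` {z. z \<notin> \<real>\<^sub>\<le>\<^sub>0 \<and> \<bar>Arg z\<bar> < \<alpha> / 2}"
    using A z(3) by auto
next
  fix z assume "z \<in> (\<lambda>z. cis d * z) ` {z. z \<notin> \<real>\<^sub>\<le>\<^sub>0 \<and> \<bar>Arg z\<bar> < \<alpha> / 2}"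
  then obtain w where w: "z = cis d * w" "w \<notin> \<real>\<^sub>\<le>\<^sub>0" "\<bar>Arg w\<bar> < \<alpha> / 2" by auto
  then have "w \<noteq> 0" by auto
  moreover have "z = rcis (cmod w) (Arg w + d)"
    by (subst w(1), subst (1) rcis_cmod_Arg[symmetric]) (simp add: cis_rcis_eq rcis_mult add.commute)
  ultimately show "z \<in> sector d \<alpha>" using w(3)
    unfolding sector_def by (intro CollectI exI[of _ "cmod w"] exI[of _ "Arg w + d"]) auto
qed

lemma open_scale_complex:
  fixes c :: complex
  assumes "open S" "c \<noteq> 0"
  shows "open ((\<lambda>z. c * z) ` S)"
proof -
  have "(\<lambda>z. c * z) ` S = (\<lambda>z. z / c) -` S"
    using assms(2) by (auto simp: image_iff intro!: rev_bexI)
  then show ?thesis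
    using assms by (auto intro!: open_vimage continuous_intros)
qed

lemma open_sector: "0 < \<alpha> \<Longrightarrow> \<alpha> \<le> 2 * pi \<Longrightarrow> open (sector d \<alpha>)"
proof -
  assume a: "0 < \<alpha>" "\<alpha> \<le> 2 * pi"
  have "continuous_on (- \<real>\<^sub>\<le>\<^sub>0) Arg"
    by (intro continuous_at_imp_continuous_on ballI continuous_at_Arg) auto
  then have "open ((- \<real>\<^sub>\<le>\<^sub>0) \<inter> Arg -` {- \<alpha> / 2<..<\<alpha> / 2})"
    by (intro continuous_open_preimage) (auto simp: closed_nonpos_Reals_complex)
  also have "(- \<real>\<^sub>\<le>\<^sub>0) \<inter> Arg -` {- \<alpha> / 2<..<\<alpha> / 2} = {z. z \<notin> \<real>\<^sub>\<le>\<^sub>0 \<and> \<bar>Arg z\<bar> < \<alpha> / 2}"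
    by (auto simp: abs_if split: if_splits)
  finally show ?thesis
    unfolding sector_eq[OF a] by (intro open_scale_complex) auto
qed

lemma open_disc_sector: "0 < \<alpha> \<Longrightarrow> \<alpha> \<le> 2 * pi \<Longrightarrow> open (disc_sector d \<alpha> r)"
  by (simp add: disc_sector_def open_sector open_Un)

lemma rcis_in_sector: "\<rho> > 0 \<Longrightarrow> \<bar>\<phi> - d\<bar> < \<alpha> / 2 \<Longrightarrow> rcis \<rho> \<phi> \<in> sector d \<alpha>"
  by (auto simp: sector_def)

lemma ball_subset_disc_sector: "ball 0 r \<subseteq> disc_sector d \<alpha> r"
  by (auto simp: disc_sector_def)

lemma sector_mono: "\<alpha> \<le> \<beta> \<Longrightarrow> sector d \<alpha> \<subseteq> sector d \<beta>"
  by (fastforce simp: sector_def)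

lemma disc_sector_mono: "\<alpha> \<le> \<beta> \<Longrightarrow> r \<le> s \<Longrightarrow> disc_sector d \<alpha> r \<subseteq> disc_sector d \<beta> s"
  using sector_mono unfolding disc_sector_def by fastforce

text \<open>
  The opening lost under multiplication by numbers of modulus at most \<open>M\<close> depends only on their
  arguments, and the radius lost depends only on \<open>M\<close>.
\<close>

lemma disc_sector_rcis_mult:
  assumes t: "t \<in> disc_sector d \<alpha> r" and r: "0 < r" "0 < M" and R: "0 \<le> R" "R \<le> M" and \<theta>: "\<bar>\<theta>\<bar> \<le> \<eta>"
  shows "rcis R \<theta> * t \<in> disc_sector d (\<alpha> + 2 * \<eta>) (M * r)"
proof (cases "t \<in> ball 0 r \<or> R = 0")
  case True
  have "R * cmod t < M * r"
  proof (cases "R = 0")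
    case False
    then have "cmod t < r" using True by simp
    then have "R * cmod t < R * r" using False R by simp
    also have "\<dots> \<le> M * r" using R r by (simp add: mult_right_mono)
    finally show ?thesis .
  qed (use r in auto)
  then show ?thesis using R by (auto simp: disc_sector_def norm_mult)
next
  case False
  then have "t \<in> sector d \<alpha>" using t by (auto simp: disc_sector_def)
  then obtain \<rho> \<phi> where z: "t = rcis \<rho> \<phi>" "\<rho> > 0" "\<bar>\<phi> - d\<bar> < \<alpha> / 2" by (auto simp: sector_def)
  have "rcis R \<theta> * t = rcis (R * \<rho>) (\<theta> + \<phi>)" by (simp add: z rcis_mult)
  also have "\<dots> \<in> sector d (\<alpha> + 2 * \<eta>)"
    using False R z \<theta> by (intro rcis_in_sector) (auto simp: abs_if split: if_splits)
  finally show ?thesis by (simp add: disc_sector_def)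
qed

lemma disc_sector_scale:
  assumes "t \<in> disc_sector d \<alpha> r" "0 < r" "0 \<le> x" "x \<le> 1"
  shows "complex_of_real x * t \<in> disc_sector d \<alpha> r"
  using disc_sector_rcis_mult[OF assms(1,2), of 1 x 0 0] assms by (simp add: rcis_def)

lemma disc_sector_exhaust:
  assumes "t \<in> disc_sector d \<alpha> r" "0 < \<alpha>" "0 < r"
  obtains \<alpha>' r' where "0 < \<alpha>'" "\<alpha>' < \<alpha>" "0 < r'" "r' < r" "t \<in> disc_sector d \<alpha>' r'"
proof (cases "t \<in> ball 0 r")
  case True
  then show thesis
    using assms by (intro that[of "\<alpha> / 2" "(cmod t + r) / 2"]) (auto simp: disc_sector_def intro: add_nonneg_pos)
next
  case False
  then obtain \<rho> \<phi> where z: "t = rcis \<rho> \<phi>" "\<rho> > 0" "\<bar>\<phi> - d\<bar> < \<alpha> / 2"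
    using assms by (auto simp: disc_sector_def sector_def)
  obtain \<beta> where "2 * \<bar>\<phi> - d\<bar> < \<beta>" "\<beta> < \<alpha>" using z(3) dense[of "2 * \<bar>\<phi> - d\<bar>" \<alpha>] by auto
  moreover then have "t \<in> sector d \<beta>" using z by (auto intro: rcis_in_sector)
  moreover have "0 < \<beta>" using calculation(1) by (rule le_less_trans[rotated]) simp
  ultimately show thesis
    using assms by (intro that[of \<beta> "r / 2"]) (auto simp: disc_sector_def)
qed

section \<open>Weak description of Borel continuations\<close>

locale banach_mod = normed_mod +
  assumes complete: "(\<And>n::nat. \<sigma> n \<in> carrier E) \<Longrightarrow>
      (\<And>\<epsilon>. \<epsilon> > 0 \<Longrightarrow> \<exists>N. \<forall>i\<ge>N. \<forall>j\<ge>N. nrm E (\<sigma> i \<ominus> \<sigma> j) < \<epsilon>) \<Longrightarrow>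
      \<exists>x\<in>carrier E. (\<lambda>n. nrm E (\<sigma> n \<ominus> x)) \<longlonglongrightarrow> 0"

lemma complex_banach_iff: "complex_banach E \<longleftrightarrow> banach_mod E"
proof
  assume "complex_banach E"
  then show "banach_mod E"
    using complex_banach_normed_mod[of E]
    by (auto simp: banach_mod_def banach_mod_axioms_def complex_banach_def)
next
  assume "banach_mod E"
  then interpret banach_mod E .
  show "complex_banach E"
    unfolding complex_banach_def
  proof (intro conjI ballI allI impI)
    fix \<sigma> :: "nat \<Rightarrow> 'a"
    assume "(\<forall>n. \<sigma> n \<in> carrier E) \<and>
        (\<forall>\<epsilon>>0. \<exists>N. \<forall>i\<ge>N. \<forall>j\<ge>N. nrm E (\<sigma> i \<ominus>\<^bsub>E\<^esub> \<sigma> j) < \<epsilon>)"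
    then show "\<exists>x\<in>carrier E. (\<lambda>n. nrm E (\<sigma> n \<ominus>\<^bsub>E\<^esub> x)) \<longlonglongrightarrow> 0"
      using complete[of \<sigma>] by simp
  qed (simp_all add: mod nrm_nonneg nrm_eq_0 nrm_triangle nrm_smult)
qed

text \<open>
  Taylor's formula of second order; the constant comes from Cauchy's estimate \<open>2 * (B + 1) / (R / 4) ^ 2\<close> for the
  second derivative. It depends only on the bound \<open>B\<close>, so it is uniform over functionals.
\<close>

lemma difference_quotient_estimate:
  fixes g :: "complex \<Rightarrow> complex"
  assumes g: "g holomorphic_on ball z R" and B: "\<And>w. w \<in> ball z R \<Longrightarrow> cmod (g w) \<le> B"
    and R: "R > 0" and w: "w \<in> ball z (R / 2)" "w \<noteq> z"
  shows "cmod (inverse (w - z) * (g w - g z) - deriv g z) \<le> 32 * (B + 1) / R ^ 2 * cmod (w - z)"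
proof -
  let ?S = "ball z (R / 2)" and ?C = "32 * (B + 1) / R ^ 2"
  have sub: "?S \<subseteq> ball z R" using R by auto
  have hol: "(deriv ^^ i) g holomorphic_on ball z R" for i
    by (intro holomorphic_higher_deriv g) auto
  have "cmod ((deriv ^^ 0) g w - (\<Sum>i\<le>1. (deriv ^^ i) g z * (w - z) ^ i / fact i))
      \<le> ?C * cmod (w - z) ^ Suc 1 / fact 1"
  proof (rule complex_Taylor[of ?S 1 "\<lambda>i. (deriv ^^ i) g"])
    fix i x assume x: "x \<in> ?S" "i \<le> (1::nat)"
    have "((deriv ^^ i) g has_field_derivative deriv ((deriv ^^ i) g) x) (at x)"
      using hol x sub by (intro holomorphic_derivI[of _ "ball z R"]) auto
    then show "((deriv ^^ i) g has_field_derivative (deriv ^^ Suc i) g x) (at x within ?S)"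
      by (simp add: has_field_derivative_at_within)
  next
    fix x assume x: "x \<in> ?S"
    have "cball x (R / 4) \<subseteq> ball z R"
      using x R by (intro subsetI) (simp add: dist_commute, smt (verit) dist_triangle dist_commute)
    then have gx: "g holomorphic_on cball x (R / 4)" and Bx: "\<And>w. w \<in> cball x (R / 4) \<Longrightarrow> cmod (g w) \<le> B"
      using g B by (auto intro: holomorphic_on_subset)
    have "cmod ((deriv ^^ 2) g x) \<le> fact 2 * (B + 1) / (R / 4) ^ 2"
    proof (rule Cauchy_higher_deriv_bound[where y = 0])
      show "g holomorphic_on ball x (R / 4)" using gx holomorphic_on_subset ball_subset_cball by blast
      show "g w \<in> ball 0 (B + 1)" if "w \<in> ball x (R / 4)" for w using Bx[of w] that by auto
    qed (use R gx holomorphic_on_imp_continuous_on in auto)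
    also have "\<dots> = ?C" by (simp add: power2_eq_square)
    finally show "cmod ((deriv ^^ Suc 1) g x) \<le> ?C" by (simp add: numeral_2_eq_2)
  qed (use w R in auto)
  then have *: "cmod (g w - g z - deriv g z * (w - z)) \<le> ?C * cmod (w - z) ^ 2"
    by (simp add: power2_eq_square algebra_simps)
  have "inverse (w - z) * (g w - g z) - deriv g z = (g w - g z - deriv g z * (w - z)) / (w - z)"
    using w by (simp add: field_simps)
  then have "cmod (inverse (w - z) * (g w - g z) - deriv g z)
      = cmod (g w - g z - deriv g z * (w - z)) / cmod (w - z)"
    by (simp add: norm_divide)
  also have "\<dots> \<le> ?C * cmod (w - z) ^ 2 / cmod (w - z)"
    by (intro divide_right_mono *) auto
  also have "\<dots> = ?C * cmod (w - z)" using w by (simp add: power2_eq_square)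
  finally show ?thesis .
qed

lemma power_series_tail:
  fixes c :: "nat \<Rightarrow> complex"
  assumes c: "\<And>n. cmod (c n) \<le> K / \<epsilon> ^ n" and t: "cmod t \<le> \<epsilon> / 2" and \<epsilon>: "\<epsilon> > 0"
    and s: "(\<lambda>n. c n * t ^ n) sums s"
  shows "cmod ((\<Sum>n<N. c n * t ^ n) - s) \<le> 2 * K * (1 / 2) ^ N"
proof -
  have K: "K \<ge> 0" using order_trans[OF norm_ge_zero c[of 0]] by simp
  have b: "cmod (c n * t ^ n) \<le> K * (1 / 2) ^ n" for n
  proof -
    have "cmod (c n * t ^ n) \<le> K / \<epsilon> ^ n * (\<epsilon> / 2) ^ n"
      unfolding norm_mult norm_power using c t \<epsilon> K by (intro mult_mono power_mono) auto
    also have "\<dots> = K * (1 / 2) ^ n" using \<epsilon> by (simp add: power_divide)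
    finally show ?thesis .
  qed
  have geo: "(\<lambda>n. K * (1 / 2) ^ (n + N)) sums (2 * K * (1 / 2) ^ N)"
    using sums_mult[OF geometric_sums[of "1 / 2 :: real"], of "K * (1 / 2) ^ N"]
    by (simp add: power_add algebra_simps)
  have "(\<lambda>n. c (n + N) * t ^ (n + N)) sums (s - (\<Sum>n<N. c n * t ^ n))"
    using sums_split_initial_segment[OF s, of N] by simp
  then have "s - (\<Sum>n<N. c n * t ^ n) = (\<Sum>n. c (n + N) * t ^ (n + N))"
    by (simp add: sums_iff)
  also have "cmod \<dots> \<le> (\<Sum>n. K * (1 / 2) ^ (n + N))"
    by (intro norm_suminf_le b sums_summable[OF geo])
  also have "\<dots> = 2 * K * (1 / 2) ^ N" using geo by (simp add: sums_iff)
  finally show ?thesis by (simp add: norm_minus_commute)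
qed

definition growth_bound :: "'v nmodule \<Rightarrow> real \<Rightarrow> real \<Rightarrow> real \<Rightarrow> real \<Rightarrow> (complex \<Rightarrow> 'v) \<Rightarrow> bool" where
  "growth_bound E k d \<alpha> r f \<longleftrightarrow> (\<forall>\<alpha>'\<in>{0<..<\<alpha>}. \<forall>r'\<in>{0<..<r}. \<exists>A>0. \<exists>B>0.
     \<forall>t\<in>disc_sector d \<alpha>' r'. nrm E (f t) < A * exp (B * cmod t powr k))"

lemma exp_growth_iff:
  "f \<in> exp_growth E k d \<alpha> r \<longleftrightarrow>
     holomorphic_into E f (disc_sector d \<alpha> r) \<and> growth_bound E k d \<alpha> r f"
  by (simp add: exp_growth_def growth_bound_def)

context normed_mod
begin

lemma holomorphic_into_functional:
  assumes f: "holomorphic_into E f S" and l: "functional E l" and S: "open S"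
  shows "(\<lambda>z. l (f z)) holomorphic_on S"
  unfolding holomorphic_on_open[OF S]
proof
  fix z assume z: "z \<in> S"
  have fS: "f w \<in> carrier E" if "w \<in> S" for w using f that by (auto simp: holomorphic_into_def)
  obtain D where D: "D \<in> carrier E"
    and lim: "((\<lambda>w. nrm E (inverse (w - z) \<odot> (f w \<ominus> f z) \<ominus> D)) \<longlongrightarrow> 0) (at z within S)"
    using f z unfolding holomorphic_into_def by blast
  have "((\<lambda>w. inverse (w - z) * (l (f w) - l (f z)) - l D) \<longlongrightarrow> 0) (at z within S)"
  proof (rule Lim_null_comparison[OF _ lim])
    have "\<forall>\<^sub>F w in at z within S. w \<in> S" by (simp add: eventually_at_filter)
    then show "\<forall>\<^sub>F w in at z within S. norm (inverse (w - z) * (l (f w) - l (f z)) - l D)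
        \<le> nrm E (inverse (w - z) \<odot> (f w \<ominus> f z) \<ominus> D)"
    proof eventually_elim
      case (elim w)
      have "inverse (w - z) * (l (f w) - l (f z)) - l D = l (inverse (w - z) \<odot> (f w \<ominus> f z) \<ominus> D)"
        using fS[OF elim] fS[OF z] D l
        by (simp add: functional_minus functional_smult)
      then show ?case using fS[OF elim] fS[OF z] D functional_bound[OF l] by simp
    qed
  qed
  then have "((\<lambda>w. (l (f w) - l (f z)) / (w - z)) \<longlongrightarrow> l D) (at z)"
    unfolding at_within_open[OF z S] LIM_zero_iff divide_inverse by (subst (asm) mult.commute)
  then have "((\<lambda>z. l (f z)) has_field_derivative l D) (at z)"
    by (simp add: has_field_derivative_iff)
  then show "\<exists>f'. ((\<lambda>z. l (f z)) has_field_derivative f') (at z)" by blast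
qed

lemma partial_sums_carrier:
  "(\<And>n. b n \<in> carrier E) \<Longrightarrow> (\<Oplus>n\<in>{..<N::nat}. t ^ n \<odot> b n) \<in> carrier E"
  by (intro finsum_closed) auto

lemma functional_partial_sums:
  "functional E l \<Longrightarrow> (\<And>n. b n \<in> carrier E) \<Longrightarrow>
     l (\<Oplus>n\<in>{..<N::nat}. t ^ n \<odot> b n) = (\<Sum>n<N. l (b n) * t ^ n)"
  by (subst functional_finsum) (auto simp: functional_smult mult.commute)

lemma power_series_functional:
  assumes b: "\<And>n. b n \<in> carrier E" and f: "f t \<in> carrier E" and l: "functional E l"
    and lim: "(\<lambda>N. nrm E ((\<Oplus>n\<in>{..<N::nat}. t ^ n \<odot> b n) \<ominus> f t)) \<longlonglongrightarrow> 0"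
  shows "(\<lambda>n. l (b n) * t ^ n) sums l (f t)"
proof -
  have "(\<lambda>N. (\<Sum>n<N. l (b n) * t ^ n) - l (f t)) \<longlonglongrightarrow> 0"
  proof (rule Lim_null_comparison[OF _ lim], intro always_eventually allI)
    fix N
    have "(\<Sum>n<N. l (b n) * t ^ n) - l (f t) = l ((\<Oplus>n\<in>{..<N::nat}. t ^ n \<odot> b n) \<ominus> f t)"
      using b f l by (simp add: functional_minus functional_partial_sums partial_sums_carrier)
    then show "norm ((\<Sum>n<N. l (b n) * t ^ n) - l (f t)) \<le> nrm E ((\<Oplus>n\<in>{..<N::nat}. t ^ n \<odot> b n) \<ominus> f t)"
      using functional_bound[OF l] b f partial_sums_carrier[OF b] by simp
  qed
  then show ?thesis by (simp add: sums_def LIM_zero_iff)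
qed

lemma power_series_coeff_bound:
  assumes b: "\<And>n. b n \<in> carrier E" and f: "f t \<in> carrier E" and t: "t \<noteq> 0"
    and lim: "(\<lambda>N. nrm E ((\<Oplus>n\<in>{..<N::nat}. t ^ n \<odot> b n) \<ominus> f t)) \<longlonglongrightarrow> 0"
  obtains K where "\<And>n. nrm E (b n) \<le> K / cmod t ^ n" "K > 0"
proof -
  let ?P = "\<lambda>N. (\<Oplus>n\<in>{..<N::nat}. t ^ n \<odot> b n) \<ominus> f t"
  have "Bseq (\<lambda>N. nrm E (?P N))"
    using lim convergentI convergent_imp_Bseq by blast
  then obtain C where C: "C > 0" "\<And>N. norm (nrm E (?P N)) \<le> C" by (auto simp: Bseq_def)
  have P: "?P N \<in> carrier E" for N using partial_sums_carrier[OF b] f by simp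
  show thesis
  proof (rule that[of "2 * C"])
    fix n
    have "t ^ n \<odot> b n = ?P (Suc n) \<oplus> \<ominus> ?P n"
      by (rule norming_eqI[OF norming_functionals])
         (use P b f partial_sums_carrier[OF b] in
           \<open>auto simp: functional_smult functional_add functional_uminus functional_minus functional_partial_sums\<close>)
    then have "nrm E (t ^ n \<odot> b n) \<le> nrm E (?P (Suc n)) + nrm E (?P n)"
      using nrm_triangle[of "?P (Suc n)" "\<ominus> ?P n"] P nrm_minus[OF P] by simp
    also have "\<dots> \<le> 2 * C" using C(2)[of n] C(2)[of "Suc n"] by simp
    finally show "nrm E (b n) \<le> 2 * C / cmod t ^ n"
      using b t by (simp add: nrm_smult norm_power field_simps)
  qed (use C in auto)
qed

lemma power_series_limitI:
  assumes L: "norming E L" and b: "\<And>n. b n \<in> carrier E" and f: "f t \<in> carrier E"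
    and K: "\<And>n. nrm E (b n) \<le> K / \<epsilon> ^ n" and \<epsilon>: "\<epsilon> > 0" and t: "cmod t \<le> \<epsilon> / 2"
    and sums: "\<And>l. l \<in> L \<Longrightarrow> (\<lambda>n. l (b n) * t ^ n) sums l (f t)"
  shows "(\<lambda>N. nrm E ((\<Oplus>n\<in>{..<N::nat}. t ^ n \<odot> b n) \<ominus> f t)) \<longlonglongrightarrow> 0"
proof (rule Lim_null_comparison)
  have "nrm E ((\<Oplus>n\<in>{..<N::nat}. t ^ n \<odot> b n) \<ominus> f t) \<le> 2 * K * (1 / 2) ^ N" for N
  proof (rule normingD[OF L])
    fix l assume l: "l \<in> L"
    then have fl: "functional E l" using norming_functional[OF L] by blast
    have "cmod (l (b n)) \<le> K / \<epsilon> ^ n" for n using functional_bound[OF fl b] K order_trans by blast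
    then have "cmod ((\<Sum>n<N. l (b n) * t ^ n) - l (f t)) \<le> 2 * K * (1 / 2) ^ N"
      by (rule power_series_tail[OF _ t \<epsilon> sums[OF l]])
    then show "cmod (l ((\<Oplus>n\<in>{..<N::nat}. t ^ n \<odot> b n) \<ominus> f t)) \<le> 2 * K * (1 / 2) ^ N"
      using fl b f by (simp add: functional_minus functional_partial_sums partial_sums_carrier)
  qed (use f partial_sums_carrier[OF b] in auto)
  then show "\<forall>\<^sub>F N in sequentially. norm (nrm E ((\<Oplus>n\<in>{..<N::nat}. t ^ n \<odot> b n) \<ominus> f t)) \<le> 2 * K * (1 / 2) ^ N"
    using f partial_sums_carrier[OF b] nrm_nonneg by (auto intro!: always_eventually)
  show "(\<lambda>N. 2 * K * (1 / 2) ^ N) \<longlonglongrightarrow> 0"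
    using tendsto_mult_right_zero[OF LIMSEQ_realpow_zero[of "1 / 2 :: real"], of "2 * K"] by simp
qed

text \<open>
  Everything that is used about a continuation is a norm estimate or a statement about its images
  under functionals.
\<close>

lemma borel_continuationD:
  assumes "borel_continuation E k d u f"
  obtains \<alpha> r \<epsilon> K where "0 < \<alpha>" "\<alpha> \<le> 2 * pi" "0 < r" "0 < \<epsilon>" "0 < K" "\<And>n. u n \<in> carrier E"
    "\<And>t. t \<in> disc_sector d \<alpha> r \<Longrightarrow> f t \<in> carrier E" "holomorphic_into E f (disc_sector d \<alpha> r)"
    "growth_bound E k d \<alpha> r f"
    "\<And>l. functional E l \<Longrightarrow> (\<lambda>t. l (f t)) holomorphic_on disc_sector d \<alpha> r"
    "\<And>n. nrm E (borel_transform E (Gamma_seq (1 / k)) u n) \<le> K / \<epsilon> ^ n"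
    "\<And>l t. functional E l \<Longrightarrow> cmod t < \<epsilon> \<Longrightarrow>
       (\<lambda>n. l (borel_transform E (Gamma_seq (1 / k)) u n) * t ^ n) sums l (f t)"
proof -
  from assms obtain \<alpha> r \<epsilon> where *: "\<And>n. u n \<in> carrier E" "0 < \<alpha>" "\<alpha> \<le> 2 * pi" "0 < r"
    and f: "f \<in> exp_growth E k d \<alpha> r" and \<epsilon>: "\<epsilon> > 0"
    and lim: "\<And>t. t \<in> ball 0 \<epsilon> \<Longrightarrow>
        (\<lambda>N. nrm E ((\<Oplus>n\<in>{..<N}. t ^ n \<odot> borel_transform E (Gamma_seq (1 / k)) u n) \<ominus> f t)) \<longlonglongrightarrow> 0"
    unfolding borel_continuation_def by auto
  let ?b = "borel_transform E (Gamma_seq (1 / k)) u"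
  have hol: "holomorphic_into E f (disc_sector d \<alpha> r)" and gr: "growth_bound E k d \<alpha> r f"
    using f by (auto simp: exp_growth_iff)
  have car: "f t \<in> carrier E" if "t \<in> disc_sector d \<alpha> r" for t
    using hol that by (auto simp: holomorphic_into_def)
  have b: "?b n \<in> carrier E" for n using * by (simp add: borel_transform_def)
  define \<delta> where "\<delta> = min \<epsilon> r / 2"
  have \<delta>: "\<delta> > 0" "\<delta> < \<epsilon>" "\<delta> < r" using \<epsilon> * by (auto simp: \<delta>_def min_def)
  have inb: "f t \<in> carrier E" if "cmod t < r" for t using that by (intro car) (auto simp: disc_sector_def)
  obtain K where K: "\<And>n. nrm E (?b n) \<le> K / cmod (complex_of_real \<delta>) ^ n" "K > 0"
    by (rule power_series_coeff_bound[where t = "complex_of_real \<delta>" and b = ?b and f = f])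
       (use \<delta> b inb lim in auto)
  show thesis
  proof (rule that[of \<alpha> r \<delta> K])
    fix l t assume l: "functional E l" and t: "cmod t < \<delta>"
    show "(\<lambda>n. l (?b n) * t ^ n) sums l (f t)"
      by (rule power_series_functional[OF b inb l lim]) (use t \<delta> in auto)
  qed (use * hol gr car \<delta> K holomorphic_into_functional[OF hol] open_disc_sector in auto)
qed

end

context banach_mod
begin

lemma Cauchy_limit:
  assumes "\<And>n::nat. \<sigma> n \<in> carrier E" and L: "norming E L" and e: "e \<longlonglongrightarrow> 0"
    and bd: "\<And>l i j. l \<in> L \<Longrightarrow> cmod (l (\<sigma> i) - l (\<sigma> j)) \<le> e i + e j"
  obtains x where "x \<in> carrier E" "(\<lambda>n. nrm E (\<sigma> n \<ominus> x)) \<longlonglongrightarrow> 0"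
proof -
  have nb: "nrm E (\<sigma> i \<ominus> \<sigma> j) \<le> e i + e j" for i j
    by (rule normingD[OF L]) (use assms norming_functional[OF L] in \<open>auto simp: functional_minus\<close>)
  have "\<exists>N. \<forall>i\<ge>N. \<forall>j\<ge>N. nrm E (\<sigma> i \<ominus> \<sigma> j) < \<epsilon>" if \<epsilon>: "\<epsilon> > 0" for \<epsilon>
  proof -
    obtain N where N: "\<And>n. n \<ge> N \<Longrightarrow> \<bar>e n\<bar> < \<epsilon> / 2"
      using e \<epsilon> unfolding LIMSEQ_def dist_norm by (metis diff_zero half_gt_zero real_norm_def)
    have "nrm E (\<sigma> i \<ominus> \<sigma> j) < \<epsilon>" if "i \<ge> N" "j \<ge> N" for i j
      using nb[of i j] N[OF that(1)] N[OF that(2)] by linarith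
    then show ?thesis by blast
  qed
  then obtain x where "x \<in> carrier E" "(\<lambda>n. nrm E (\<sigma> n \<ominus> x)) \<longlonglongrightarrow> 0"
    using complete[of \<sigma>] assms(1) by blast
  then show thesis by (rule that)
qed

lemma functional_limit:
  assumes "\<And>n::nat. \<sigma> n \<in> carrier E" "x \<in> carrier E" "(\<lambda>n. nrm E (\<sigma> n \<ominus> x)) \<longlonglongrightarrow> 0" "functional E l"
  shows "(\<lambda>n. l (\<sigma> n)) \<longlonglongrightarrow> l x"
proof -
  have "(\<lambda>n. l (\<sigma> n) - l x) \<longlonglongrightarrow> 0"
    by (rule Lim_null_comparison[OF _ assms(3)], intro always_eventually allI)
       (metis assms(1,2,4) functional_bound functional_minus minus_closed)
  then show ?thesis by (simp add: LIM_zero_iff)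
qed

text \<open>
  Weakly holomorphic and locally bounded functions are holomorphic: the estimate for the
  difference quotients is uniform over a norming family, so they converge in norm.
\<close>

lemma holomorphic_into_weakI:
  assumes L: "norming E L" and S: "open S" and f: "\<And>z. z \<in> S \<Longrightarrow> f z \<in> carrier E"
    and hol: "\<And>l. l \<in> L \<Longrightarrow> (\<lambda>z. l (f z)) holomorphic_on S"
    and bd: "\<And>z. z \<in> S \<Longrightarrow> \<exists>e>0. \<exists>B. \<forall>w\<in>ball z e \<inter> S. nrm E (f w) \<le> B"
  shows "holomorphic_into E f S"
  unfolding holomorphic_into_def
proof (intro conjI ballI f)
  fix z assume z: "z \<in> S"
  obtain e1 B where e1: "e1 > 0" "\<And>w. w \<in> ball z e1 \<inter> S \<Longrightarrow> nrm E (f w) \<le> B" using bd[OF z] by metis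
  obtain e2 where e2: "e2 > 0" "ball z e2 \<subseteq> S" using S z open_contains_ball by blast
  define R where "R = min e1 e2"
  have R: "R > 0" "ball z R \<subseteq> S" and B: "\<And>w. w \<in> ball z R \<Longrightarrow> nrm E (f w) \<le> B"
    using e1 e2 by (auto simp: R_def)
  define C where "C = 32 * (B + 1) / R ^ 2"
  have fn: "functional E l" if "l \<in> L" for l using norming_functional[OF L that] .
  define Q where "Q = (\<lambda>w. inverse (w - z) \<odot> (f w \<ominus> f z))"
  have Q: "Q w \<in> carrier E" if "w \<in> S" for w using that f z by (auto simp: Q_def)
  have est: "cmod (l (Q w) - deriv (\<lambda>z. l (f z)) z) \<le> C * cmod (w - z)"
    if l: "l \<in> L" and w: "w \<in> ball z (R / 2)" "w \<noteq> z" for l w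
  proof -
    have wS: "w \<in> S" using w R by (auto simp: subset_iff)
    have "cmod (inverse (w - z) * (l (f w) - l (f z)) - deriv (\<lambda>z. l (f z)) z) \<le> C * cmod (w - z)"
      unfolding C_def
    proof (rule difference_quotient_estimate[OF _ _ R(1) w])
      show "(\<lambda>z. l (f z)) holomorphic_on ball z R" using hol[OF l] R holomorphic_on_subset by blast
      show "cmod (l (f w)) \<le> B" if "w \<in> ball z R" for w
        using functional_bound[OF fn[OF l] f] B[OF that] R that by (meson order_trans subsetD)
    qed
    then show ?thesis
      using fn[OF l] f[OF z] f[OF wS] by (simp add: Q_def functional_smult functional_minus)
  qed
  define w where "w = (\<lambda>n. z + complex_of_real (R / 4 / real (Suc n)))"
  have w: "w n \<in> ball z (R / 2)" "w n \<noteq> z" "w n \<in> S" for n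
  proof -
    have "R / 4 / real (Suc n) \<le> R / 4 / 1" using R by (intro divide_left_mono) auto
    moreover have "cmod (w n - z) = R / 4 / real (Suc n)"
      unfolding w_def add_diff_cancel_left' norm_of_real using R by simp
    ultimately have "cmod (w n - z) < R / 2" using R by linarith
    then show "w n \<in> ball z (R / 2)" by (simp add: dist_norm norm_minus_commute)
    then show "w n \<in> S" using R by (auto simp: subset_iff)
    have "R / 4 / real (Suc n) \<noteq> 0" using R by simp
    then show "w n \<noteq> z" unfolding w_def by (metis add_cancel_right_right of_real_eq_0_iff)
  qed
  have wz: "(\<lambda>n. cmod (w n - z)) \<longlonglongrightarrow> 0"
  proof -
    have "(\<lambda>n. R / 4 * inverse (real (Suc n))) \<longlonglongrightarrow> R / 4 * 0"
      by (intro tendsto_intros LIMSEQ_inverse_real_of_nat)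
    moreover have "cmod (w n - z) = R / 4 * inverse (real (Suc n))" for n
    proof -
      have "cmod (w n - z) = R / 4 / real (Suc n)"
        unfolding w_def add_diff_cancel_left' norm_of_real using R by simp
      then show ?thesis by (simp only: divide_inverse)
    qed
    ultimately show ?thesis by (simp only: mult_zero_right)
  qed
  obtain D where D: "D \<in> carrier E" "(\<lambda>n. nrm E (Q (w n) \<ominus> D)) \<longlonglongrightarrow> 0"
  proof (rule Cauchy_limit[of "\<lambda>n. Q (w n)" L "\<lambda>n. C * cmod (w n - z)"])
    show "(\<lambda>n. C * cmod (w n - z)) \<longlonglongrightarrow> 0" using tendsto_mult_right_zero[OF wz] by simp
    fix l i j assume l: "l \<in> L"
    show "cmod (l (Q (w i)) - l (Q (w j))) \<le> C * cmod (w i - z) + C * cmod (w j - z)"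
      using est[OF l w(1,2), of i] est[OF l w(1,2), of j] norm_triangle_ineq4[of "l (Q (w i)) - deriv (\<lambda>z. l (f z)) z" "l (Q (w j)) - deriv (\<lambda>z. l (f z)) z"]
      by simp
  qed (use Q w L in auto)
  have lD: "l D = deriv (\<lambda>z. l (f z)) z" if l: "l \<in> L" for l
  proof (rule LIMSEQ_unique)
    show "(\<lambda>n. l (Q (w n))) \<longlonglongrightarrow> l D" by (rule functional_limit[OF Q[OF w(3)] D fn[OF l]])
    have "(\<lambda>n. l (Q (w n)) - deriv (\<lambda>z. l (f z)) z) \<longlonglongrightarrow> 0"
      by (rule Lim_null_comparison[OF _ tendsto_mult_right_zero[OF wz, of C]])
         (use est[OF l w(1,2)] in auto)
    then show "(\<lambda>n. l (Q (w n))) \<longlonglongrightarrow> deriv (\<lambda>z. l (f z)) z" by (simp add: LIM_zero_iff)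
  qed
  have bound: "nrm E (Q v \<ominus> D) \<le> C * cmod (v - z)" if v: "v \<in> ball z (R / 2)" "v \<noteq> z" for v
  proof (rule normingD[OF L])
    have vS: "v \<in> S" using v R by (auto simp: subset_iff)
    show "Q v \<ominus> D \<in> carrier E" using Q[OF vS] D by simp
    show "cmod (l (Q v \<ominus> D)) \<le> C * cmod (v - z)" if "l \<in> L" for l
      using est[OF that v] Q[OF vS] D(1) fn[OF that] by (simp add: functional_minus lD[OF that])
  qed
  have "((\<lambda>v. nrm E (Q v \<ominus> D)) \<longlongrightarrow> 0) (at z within S)"
  proof (rule Lim_null_comparison)
    have "\<forall>\<^sub>F v in at z within S. v \<in> ball z (R / 2) \<and> v \<noteq> z"
      unfolding eventually_at using R by (intro exI[of _ "R / 2"]) (auto simp: dist_commute)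
    moreover have "\<forall>\<^sub>F v in at z within S. v \<in> S" by (simp add: eventually_at_filter)
    ultimately show "\<forall>\<^sub>F v in at z within S. norm (nrm E (Q v \<ominus> D)) \<le> C * cmod (v - z)"
      by eventually_elim (use bound nrm_nonneg Q D in auto)
    have "((\<lambda>v. C * cmod (v - z)) \<longlongrightarrow> C * cmod (z - z)) (at z within S)" by (intro tendsto_intros)
    then show "((\<lambda>v. C * cmod (v - z)) \<longlongrightarrow> 0) (at z within S)" by simp
  qed
  then show "\<exists>D\<in>carrier E. ((\<lambda>w. nrm E (inverse (w - z) \<odot> (f w \<ominus> f z) \<ominus> D)) \<longlongrightarrow> 0) (at z within S)"
    using D unfolding Q_def by blast
qed

text \<open>
  The converse: scalar continuations for a norming family, with estimates in norm, form a continuation.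
  The power series converges in norm on half of its disc, where its tails are small uniformly over the
  family.
\<close>

lemma borel_continuationI:
  assumes L: "norming E L" and u: "\<And>n. u n \<in> carrier E"
    and \<alpha>: "0 < \<alpha>" "\<alpha> \<le> 2 * pi" and r: "0 < r" and \<epsilon>: "0 < \<epsilon>" and k: "0 < k"
    and f: "\<And>t. t \<in> disc_sector d \<alpha> r \<Longrightarrow> f t \<in> carrier E"
    and hol: "\<And>l. l \<in> L \<Longrightarrow> (\<lambda>t. l (f t)) holomorphic_on disc_sector d \<alpha> r"
    and gr: "growth_bound E k d \<alpha> r f"
    and K: "\<And>n. nrm E (borel_transform E (Gamma_seq (1 / k)) u n) \<le> K / \<epsilon> ^ n"
    and sums: "\<And>l t. l \<in> L \<Longrightarrow> cmod t < \<epsilon> \<Longrightarrow>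
       (\<lambda>n. l (borel_transform E (Gamma_seq (1 / k)) u n) * t ^ n) sums l (f t)"
  shows "borel_continuation E k d u f"
proof -
  let ?b = "borel_transform E (Gamma_seq (1 / k)) u"
  have S: "open (disc_sector d \<alpha> r)" using \<alpha> by (rule open_disc_sector)
  have "holomorphic_into E f (disc_sector d \<alpha> r)"
  proof (rule holomorphic_into_weakI[OF L S])
    fix z assume z: "z \<in> disc_sector d \<alpha> r"
    obtain \<alpha>' r' where *: "0 < \<alpha>'" "\<alpha>' < \<alpha>" "0 < r'" "r' < r" "z \<in> disc_sector d \<alpha>' r'"
      by (rule disc_sector_exhaust[OF z \<alpha>(1) r])
    obtain A B where AB: "A > 0" "B > 0"
      "\<And>t. t \<in> disc_sector d \<alpha>' r' \<Longrightarrow> nrm E (f t) < A * exp (B * cmod t powr k)"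
      using gr * unfolding growth_bound_def by (meson greaterThanLessThan_iff)
    have "open (disc_sector d \<alpha>' r')" using * \<alpha> by (intro open_disc_sector) auto
    then obtain e where e: "e > 0" "ball z e \<subseteq> disc_sector d \<alpha>' r'"
      using *(5) open_contains_ball by blast
    have "nrm E (f w) \<le> A * exp (B * (cmod z + e) powr k)" if w: "w \<in> ball z e" for w
    proof -
      have "nrm E (f w) \<le> A * exp (B * cmod w powr k)"
        using AB(3)[of w] e w by auto
      also have "cmod w \<le> cmod z + e"
        using w norm_triangle_ineq2[of w z] by (auto simp: dist_norm norm_minus_commute)
      then have "A * exp (B * cmod w powr k) \<le> A * exp (B * (cmod z + e) powr k)"
        using AB k by (intro mult_left_mono iffD2[OF exp_le_cancel_iff] powr_mono2) auto
      finally show ?thesis .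
    qed
    then show "\<exists>e>0. \<exists>B. \<forall>w\<in>ball z e \<inter> disc_sector d \<alpha> r. nrm E (f w) \<le> B" using e(1) by blast
  qed (use f hol in auto)
  then have "f \<in> exp_growth E k d \<alpha> r" using gr by (simp add: exp_growth_iff)
  moreover have "(\<lambda>N. nrm E ((\<Oplus>n\<in>{..<N}. t ^ n \<odot> ?b n) \<ominus> f t)) \<longlonglongrightarrow> 0"
    if t: "t \<in> ball 0 (min (\<epsilon> / 2) r)" for t
    by (rule power_series_limitI[OF L _ _ K \<epsilon>])
       (use t u f sums \<epsilon> in \<open>auto simp: borel_transform_def disc_sector_def\<close>)
  ultimately show ?thesis
    unfolding borel_continuation_def using u \<alpha> r \<epsilon>
    by (intro conjI allI exI[of _ \<alpha>] exI[of _ r] exI[of _ "min (\<epsilon> / 2) r"]) auto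
qed

text \<open>
  Integrals of continuous functions with values in the space. Approximations with an error
  proportional to the length of the interval exist locally and can be added up.
\<close>

lemma vector_integral:
  fixes F :: "real \<Rightarrow> 'a"
  assumes ab: "a \<le> b" and F: "\<And>x. x \<in> {a..b} \<Longrightarrow> F x \<in> carrier E"
    and cont: "\<And>x. x \<in> {a..b} \<Longrightarrow> ((\<lambda>y. nrm E (F y \<ominus> F x)) \<longlongrightarrow> 0) (at x within {a..b})"
  obtains y where "y \<in> carrier E" "\<And>l. functional E l \<Longrightarrow> l y = integral {a..b} (\<lambda>x. l (F x))"
proof -
  have contl: "continuous_on {a..b} (\<lambda>x. l (F x))" if l: "functional E l" for l
    unfolding continuous_on_def
  proof
    fix x assume x: "x \<in> {a..b}"
    have "((\<lambda>y. l (F y) - l (F x)) \<longlongrightarrow> 0) (at x within {a..b})"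
    proof (rule Lim_null_comparison[OF _ cont[OF x]])
      have "\<forall>\<^sub>F y in at x within {a..b}. y \<in> {a..b}" by (simp add: eventually_at_filter)
      then show "\<forall>\<^sub>F y in at x within {a..b}. norm (l (F y) - l (F x)) \<le> nrm E (F y \<ominus> F x)"
        by eventually_elim (metis F x functional_bound functional_minus l minus_closed)
    qed
    then show "((\<lambda>x. l (F x)) \<longlongrightarrow> l (F x)) (at x within {a..b})" by (simp add: LIM_zero_iff)
  qed
  have approx: "\<exists>y\<in>carrier E. \<forall>l. functional E l \<longrightarrow> cmod (l y - integral {a..b} (\<lambda>x. l (F x))) \<le> \<epsilon> * (b - a)"
    if \<epsilon>: "\<epsilon> > 0" for \<epsilon>
  proof -
    define P where "P = (\<lambda>p q. a \<le> p \<longrightarrow> q \<le> b \<longrightarrow> p \<le> q \<longrightarrow>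
      (\<exists>y\<in>carrier E. \<forall>l. functional E l \<longrightarrow> cmod (l y - integral {p..q} (\<lambda>x. l (F x))) \<le> \<epsilon> * (q - p)))"
    have "P a b"
    proof (rule Bolzano[OF ab])
      fix p q s assume PP: "P p q" "P q s" and le: "p \<le> q" "q \<le> s"
      show "P p s" unfolding P_def
      proof (intro impI)
        assume *: "a \<le> p" "s \<le> b" "p \<le> s"
        obtain y1 where y1: "y1 \<in> carrier E" "\<And>l. functional E l \<Longrightarrow> cmod (l y1 - integral {p..q} (\<lambda>x. l (F x))) \<le> \<epsilon> * (q - p)"
          using PP(1) * le unfolding P_def by auto
        obtain y2 where y2: "y2 \<in> carrier E" "\<And>l. functional E l \<Longrightarrow> cmod (l y2 - integral {q..s} (\<lambda>x. l (F x))) \<le> \<epsilon> * (s - q)"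
          using PP(2) * le unfolding P_def by auto
        show "\<exists>y\<in>carrier E. \<forall>l. functional E l \<longrightarrow> cmod (l y - integral {p..s} (\<lambda>x. l (F x))) \<le> \<epsilon> * (s - p)"
        proof (intro bexI[of _ "y1 \<oplus> y2"] allI impI)
          fix l assume l: "functional E l"
          have "(\<lambda>x. l (F x)) integrable_on {p..s}"
            by (intro integrable_continuous_real continuous_on_subset[OF contl[OF l]]) (use * in auto)
          then have "integral {p..s} (\<lambda>x. l (F x)) = integral {p..q} (\<lambda>x. l (F x)) + integral {q..s} (\<lambda>x. l (F x))"
            using le by (simp add: Henstock_Kurzweil_Integration.integral_combine)
          then have "l (y1 \<oplus> y2) - integral {p..s} (\<lambda>x. l (F x))
              = (l y1 - integral {p..q} (\<lambda>x. l (F x))) + (l y2 - integral {q..s} (\<lambda>x. l (F x)))"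
            using l y1(1) y2(1) by (simp add: functional_add)
          also have "cmod \<dots> \<le> \<epsilon> * (q - p) + \<epsilon> * (s - q)"
            using y1(2)[OF l] y2(2)[OF l] by (intro norm_triangle_mono)
          finally show "cmod (l (y1 \<oplus> y2) - integral {p..s} (\<lambda>x. l (F x))) \<le> \<epsilon> * (s - p)"
            by (simp add: algebra_simps)
        qed (use y1 y2 in auto)
      qed
    next
      fix x assume x: "a \<le> x" "x \<le> b"
      have "\<forall>\<^sub>F y in at x within {a..b}. nrm E (F y \<ominus> F x) < \<epsilon>"
        using order_tendstoD(2)[OF cont \<epsilon>] x by auto
      then obtain \<delta> where \<delta>: "\<delta> > 0" "\<And>y. y \<in> {a..b} \<Longrightarrow> y \<noteq> x \<Longrightarrow> dist y x < \<delta> \<Longrightarrow> nrm E (F y \<ominus> F x) < \<epsilon>"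
        unfolding eventually_at by blast
      have Fx: "F x \<in> carrier E" using F x by auto
      show "\<exists>\<delta>>0. \<forall>p q. p \<le> x \<and> x \<le> q \<and> q - p < \<delta> \<longrightarrow> P p q"
      proof (intro exI[of _ \<delta>] conjI allI impI \<delta>(1))
        fix p q assume pq: "p \<le> x \<and> x \<le> q \<and> q - p < \<delta>"
        show "P p q" unfolding P_def
        proof (intro impI bexI[of _ "complex_of_real (q - p) \<odot> F x"] allI)
          fix l assume *: "a \<le> p" "q \<le> b" "p \<le> q" and l: "functional E l"
          have int: "(\<lambda>x. l (F x)) integrable_on {p..q}"
            by (intro integrable_continuous_real continuous_on_subset[OF contl[OF l]]) (use * in auto)
          have "((\<lambda>y. l (F y) - l (F x)) has_integral
              (integral {p..q} (\<lambda>x. l (F x)) - (q - p) *\<^sub>R l (F x))) {p..q}"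
            using has_integral_diff[OF integrable_integral[OF int] has_integral_const_real[of "l (F x)" p q]] * by simp
          then have "norm (integral {p..q} (\<lambda>x. l (F x)) - (q - p) *\<^sub>R l (F x)) \<le> \<epsilon> * measure lborel {p..q}"
          proof (rule has_integral_bound_real[where S = "{}", rotated 2])
            fix y assume y: "y \<in> {p..q} - {}"
            then have yab: "y \<in> {a..b}" using * by auto
            show "norm (l (F y) - l (F x)) \<le> \<epsilon>"
            proof (cases "y = x")
              case False
              then have "nrm E (F y \<ominus> F x) < \<epsilon>" using \<delta>(2)[OF yab] y pq by (auto simp: dist_real_def)
              moreover have "norm (l (F y) - l (F x)) \<le> nrm E (F y \<ominus> F x)"
                by (metis F[OF yab] Fx functional_bound functional_minus l minus_closed)
              ultimately show ?thesis by simp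
            qed (use \<epsilon> in auto)
          qed (use \<epsilon> in auto)
          then show "cmod (l (complex_of_real (q - p) \<odot> F x) - integral {p..q} (\<lambda>x. l (F x))) \<le> \<epsilon> * (q - p)"
            using l Fx * by (simp add: functional_smult norm_minus_commute scaleR_conv_of_real)
        qed (use Fx in auto)
      qed
    qed
    then show ?thesis using ab by (auto simp: P_def)
  qed
  have "\<forall>n. \<exists>y\<in>carrier E. \<forall>l. functional E l \<longrightarrow>
      cmod (l y - integral {a..b} (\<lambda>x. l (F x))) \<le> inverse (real (Suc n)) * (b - a)"
    using approx by auto
  then obtain \<sigma> where \<sigma>: "\<And>n. \<sigma> n \<in> carrier E"
    "\<And>n l. functional E l \<Longrightarrow> cmod (l (\<sigma> n) - integral {a..b} (\<lambda>x. l (F x))) \<le> inverse (real (Suc n)) * (b - a)"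
    by metis
  have lim: "(\<lambda>n. inverse (real (Suc n)) * (b - a)) \<longlonglongrightarrow> 0"
    using tendsto_mult_left_zero[OF LIMSEQ_inverse_real_of_nat] .
  obtain y where y: "y \<in> carrier E" "(\<lambda>n. nrm E (\<sigma> n \<ominus> y)) \<longlonglongrightarrow> 0"
  proof (rule Cauchy_limit[OF \<sigma>(1) norming_functionals lim])
    fix l i j assume "l \<in> {l. functional E l}"
    then have l: "functional E l" by simp
    show "cmod (l (\<sigma> i) - l (\<sigma> j)) \<le> inverse (real (Suc i)) * (b - a) + inverse (real (Suc j)) * (b - a)"
      using norm_triangle_mono[OF \<sigma>(2)[OF l, of i] \<sigma>(2)[OF l, of j, unfolded norm_minus_commute[of "l (\<sigma> j)"]]]
      by simp
  qed blast
  show thesis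
  proof (rule that[OF y(1)])
    fix l assume l: "functional E l"
    have "(\<lambda>n. l (\<sigma> n) - integral {a..b} (\<lambda>x. l (F x))) \<longlonglongrightarrow> 0"
      by (rule Lim_null_comparison[OF _ lim]) (use \<sigma>(2)[OF l] in \<open>auto intro!: always_eventually\<close>)
    then have "(\<lambda>n. l (\<sigma> n)) \<longlonglongrightarrow> integral {a..b} (\<lambda>x. l (F x))" by (simp add: LIM_zero_iff)
    then show "l y = integral {a..b} (\<lambda>x. l (F x))"
      using functional_limit[OF \<sigma>(1) y l] LIMSEQ_unique by blast
  qed
qed

end

section \<open>Multiplication by moment sequences\<close>

text \<open>
  For every \<open>\<eta>\<close> there is a representation whose nodes \<open>\<psi> x\<close> have argument at most \<open>\<eta>\<close>. It has to be allowed to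
  depend on \<open>\<eta>\<close>: the sequence \<open>1 + S n\<close>, where \<open>S \<noteq> 0\<close>, has representations with nodes on
  small circles around 1, but none with positive nodes.
\<close>

definition narrow_moment :: "(nat \<Rightarrow> complex) \<Rightarrow> bool" where
  "narrow_moment c \<longleftrightarrow> (\<forall>\<eta>>0. \<exists>a b \<kappa> \<psi>. a \<le> b \<and> continuous_on {a..b} \<kappa> \<and> continuous_on {a..b} \<psi> \<and>
     (\<forall>x\<in>{a..b::real}. \<exists>R \<theta>. 0 \<le> R \<and> \<bar>\<theta>\<bar> \<le> \<eta> \<and> \<psi> x = rcis R \<theta>) \<and>
     (\<forall>n. c n = integral {a..b} (\<lambda>x. \<kappa> x * \<psi> x ^ n)))"

lemma narrow_momentE:
  assumes "narrow_moment c" "\<eta> > 0"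
  obtains a b :: real and \<kappa> \<psi> where "a \<le> b" "continuous_on {a..b} \<kappa>" "continuous_on {a..b} \<psi>"
    "\<And>x. x \<in> {a..b} \<Longrightarrow> \<exists>R \<theta>. 0 \<le> R \<and> \<bar>\<theta>\<bar> \<le> \<eta> \<and> \<psi> x = rcis R \<theta>"
    "\<And>n. c n = integral {a..b} (\<lambda>x. \<kappa> x * \<psi> x ^ n)"
proof -
  from assms(1)[unfolded narrow_moment_def, rule_format, OF assms(2)]
  show thesis by (elim exE conjE) (rule that; simp)
qed

lemma holomorphic_on_scaled_integral:
  fixes F :: "complex \<Rightarrow> complex" and \<kappa> \<psi> :: "real \<Rightarrow> complex"
  assumes F: "F holomorphic_on V" and V: "open V" and U: "open U"
    and \<kappa>: "continuous_on {a..b} \<kappa>" and \<psi>: "continuous_on {a..b} \<psi>"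
    and UV: "\<And>x t. x \<in> {a..b} \<Longrightarrow> t \<in> U \<Longrightarrow> \<psi> x * t \<in> V"
  shows "(\<lambda>t. integral {a..b} (\<lambda>x. \<kappa> x * F (\<psi> x * t))) holomorphic_on U"
proof -
  have contF: "continuous_on V F" and contF': "continuous_on V (deriv F)"
    using F V by (auto intro!: holomorphic_on_imp_continuous_on holomorphic_deriv)
  have loc: "(\<lambda>t. integral {a..b} (\<lambda>x. \<kappa> x * F (\<psi> x * t))) holomorphic_on ball z e" if e: "ball z e \<subseteq> U" for z e
  proof -
    have "(\<lambda>t. integral (cbox a b) (\<lambda>x. \<kappa> x * F (\<psi> x * t))) holomorphic_on ball z e"
    proof (rule leibniz_rule_holomorphic[where fx = "\<lambda>t x. \<kappa> x * (deriv F (\<psi> x * t) * \<psi> x)"])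
      fix t x assume t: "t \<in> ball z e" and x: "x \<in> cbox a b"
      have "\<psi> x * t \<in> V" using t x e by (intro UV) auto
      then have "(F has_field_derivative deriv F (\<psi> x * t)) (at (\<psi> x * t))"
        using F V holomorphic_derivI by blast
      then have "((\<lambda>t. F (\<psi> x * t)) has_field_derivative deriv F (\<psi> x * t) * \<psi> x) (at t)"
        by (rule DERIV_chain2) (auto intro!: derivative_eq_intros)
      from has_field_derivative_at_within[OF DERIV_cmult[OF this, of "\<kappa> x"]]
      show "((\<lambda>t. \<kappa> x * F (\<psi> x * t)) has_field_derivative \<kappa> x * (deriv F (\<psi> x * t) * \<psi> x)) (at t within ball z e)" .
    next
      fix t assume t: "t \<in> ball z e"
      have "continuous_on {a..b} (\<lambda>x. \<kappa> x * F (\<psi> x * t))"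
        by (intro continuous_intros \<kappa> continuous_on_compose2[OF contF] \<psi>) (use t e UV in auto)
      then show "(\<lambda>x. \<kappa> x * F (\<psi> x * t)) integrable_on cbox a b"
        by (simp add: integrable_continuous_real)
    next
      have c1: "continuous_on (ball z e \<times> cbox a b) (\<lambda>p. g (snd p))" if "continuous_on {a..b} g" for g :: "real \<Rightarrow> complex"
        by (rule continuous_on_compose2[OF that]) (auto intro!: continuous_intros)
      have "continuous_on (ball z e \<times> cbox a b) (\<lambda>p. \<kappa> (snd p) * (deriv F (\<psi> (snd p) * fst p) * \<psi> (snd p)))"
        by (intro continuous_intros c1 \<kappa> \<psi> continuous_on_compose2[OF contF']) (use e UV in auto)
      then show "continuous_on (ball z e \<times> cbox a b) (\<lambda>(t, x). \<kappa> x * (deriv F (\<psi> x * t) * \<psi> x))"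
        by (simp add: case_prod_unfold)
    qed auto
    then show ?thesis by simp
  qed
  show ?thesis
    unfolding holomorphic_on_open[OF U]
  proof
    fix z assume "z \<in> U"
    then obtain e where e: "e > 0" "ball z e \<subseteq> U" using U open_contains_ball by blast
    then show "\<exists>f'. ((\<lambda>t. integral {a..b} (\<lambda>x. \<kappa> x * F (\<psi> x * t))) has_field_derivative f') (at z)"
      using loc[OF e(2)] holomorphic_on_open[of "ball z e"] by auto
  qed
qed

lemma continuous_on_interval_bounded:
  fixes g :: "real \<Rightarrow> complex"
  assumes "continuous_on {a..b} g"
  obtains M where "M \<ge> 1" "\<And>x. x \<in> {a..b} \<Longrightarrow> cmod (g x) \<le> M"
proof -
  have "bounded (g ` {a..b})" using assms by (intro compact_imp_bounded compact_continuous_image) auto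
  then obtain B where "\<And>x. x \<in> {a..b} \<Longrightarrow> cmod (g x) \<le> B" unfolding bounded_iff by (metis imageI)
  then show thesis by (intro that[of "max 1 B"]) (auto intro: max.coboundedI2)
qed

lemma sums_scaled_integral:
  fixes F :: "complex \<Rightarrow> complex" and \<kappa> \<psi> :: "real \<Rightarrow> complex"
  assumes ab: "a \<le> b" and \<kappa>: "continuous_on {a..b} \<kappa>" and \<psi>: "continuous_on {a..b} \<psi>"
    and M: "M > 0" "\<And>x. x \<in> {a..b} \<Longrightarrow> cmod (\<psi> x) \<le> M"
    and c: "\<And>n. cmod (c n) \<le> K / \<epsilon> ^ n" and \<epsilon>: "\<epsilon> > 0"
    and s: "\<And>t. cmod t < \<epsilon> \<Longrightarrow> (\<lambda>n. c n * t ^ n) sums F t"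
    and t: "cmod t \<le> \<epsilon> / (2 * M)"
  shows "(\<lambda>n. c n * integral {a..b} (\<lambda>x. \<kappa> x * \<psi> x ^ n) * t ^ n) sums integral {a..b} (\<lambda>x. \<kappa> x * F (\<psi> x * t))"
proof -
  obtain C where C: "C \<ge> 1" "\<And>x. x \<in> {a..b} \<Longrightarrow> cmod (\<kappa> x) \<le> C"
    by (rule continuous_on_interval_bounded[OF \<kappa>]) blast
  have small: "cmod (\<psi> x * t) \<le> \<epsilon> / 2" if "x \<in> {a..b}" for x
  proof -
    have "cmod (\<psi> x * t) \<le> M * (\<epsilon> / (2 * M))"
      unfolding norm_mult using M that t by (intro mult_mono) auto
    then show ?thesis using M by simp
  qed
  have K: "K \<ge> 0" using order_trans[OF norm_ge_zero c[of 0]] by simp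
  have contF: "continuous_on (ball 0 \<epsilon>) F"
  proof -
    have "F holomorphic_on ball 0 \<epsilon>"
      by (rule power_series_holomorphic[of _ _ c]) (use s in auto)
    then show ?thesis by (rule holomorphic_on_imp_continuous_on)
  qed
  have small': "cmod (\<psi> x * t) < \<epsilon>" if "x \<in> {a..b}" for x using small[OF that] \<epsilon> by simp
  have i1: "(\<lambda>x. \<kappa> x * F (\<psi> x * t)) integrable_on {a..b}"
    by (intro integrable_continuous_real continuous_intros \<kappa> continuous_on_compose2[OF contF] \<psi>) (use small' in auto)
  have i2: "(\<lambda>x. \<kappa> x * \<psi> x ^ n) integrable_on {a..b}" for n
    by (intro integrable_continuous_real continuous_intros \<kappa> \<psi>)
  have bd: "cmod ((\<Sum>n<N. c n * integral {a..b} (\<lambda>x. \<kappa> x * \<psi> x ^ n) * t ^ n) - integral {a..b} (\<lambda>x. \<kappa> x * F (\<psi> x * t)))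
      \<le> C * (2 * K * (1 / 2) ^ N) * (b - a)" for N
  proof -
    have "(\<Sum>n<N. c n * integral {a..b} (\<lambda>x. \<kappa> x * \<psi> x ^ n) * t ^ n)
        = (\<Sum>n<N. integral {a..b} (\<lambda>x. (c n * t ^ n) * (\<kappa> x * \<psi> x ^ n)))"
      by (intro sum.cong refl) (simp add: mult_ac flip: integral_mult_right)
    also have "\<dots> = integral {a..b} (\<lambda>x. \<Sum>n<N. (c n * t ^ n) * (\<kappa> x * \<psi> x ^ n))"
      by (rule integral_sum[symmetric]) (use i2 in \<open>auto intro!: integrable_on_mult_right\<close>)
    finally have "(\<Sum>n<N. c n * integral {a..b} (\<lambda>x. \<kappa> x * \<psi> x ^ n) * t ^ n) - integral {a..b} (\<lambda>x. \<kappa> x * F (\<psi> x * t))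
        = integral {a..b} (\<lambda>x. (\<Sum>n<N. (c n * t ^ n) * (\<kappa> x * \<psi> x ^ n)) - \<kappa> x * F (\<psi> x * t))"
      using i1 i2 by (subst Henstock_Kurzweil_Integration.integral_diff) (auto intro!: integrable_sum integrable_on_mult_right)
    also have "cmod \<dots> \<le> C * (2 * K * (1 / 2) ^ N) * (b - a)"
    proof (rule integral_bound[OF ab])
      show "continuous_on {a..b} (\<lambda>x. (\<Sum>n<N. (c n * t ^ n) * (\<kappa> x * \<psi> x ^ n)) - \<kappa> x * F (\<psi> x * t))"
        by (intro continuous_intros \<kappa> continuous_on_compose2[OF contF] \<psi>) (use small' in auto)
      fix x assume x: "x \<in> {a..b}"
      have "(\<Sum>n<N. (c n * t ^ n) * (\<kappa> x * \<psi> x ^ n)) - \<kappa> x * F (\<psi> x * t)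
          = \<kappa> x * ((\<Sum>n<N. c n * (\<psi> x * t) ^ n) - F (\<psi> x * t))"
        by (simp add: algebra_simps sum_distrib_left power_mult_distrib)
      also have "cmod \<dots> \<le> C * (2 * K * (1 / 2) ^ N)"
        unfolding norm_mult
      proof (intro mult_mono C(2)[OF x])
        show "cmod ((\<Sum>n<N. c n * (\<psi> x * t) ^ n) - F (\<psi> x * t)) \<le> 2 * K * (1 / 2) ^ N"
          by (rule power_series_tail[OF c small[OF x] \<epsilon> s[OF small'[OF x]]])
      qed (use C in auto)
      finally show "cmod ((\<Sum>n<N. (c n * t ^ n) * (\<kappa> x * \<psi> x ^ n)) - \<kappa> x * F (\<psi> x * t)) \<le> C * (2 * K * (1 / 2) ^ N)" .
    qed
    finally show ?thesis .
  qed
  have "(\<lambda>N. C * (2 * K * (1 / 2) ^ N) * (b - a)) \<longlonglongrightarrow> C * (2 * K * 0) * (b - a)"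
    by (intro tendsto_intros LIMSEQ_realpow_zero) auto
  then have lim: "(\<lambda>N. C * (2 * K * (1 / 2) ^ N) * (b - a)) \<longlonglongrightarrow> 0"
    by (simp only: mult_zero_right mult_zero_left)
  have "(\<lambda>N. (\<Sum>n<N. c n * integral {a..b} (\<lambda>x. \<kappa> x * \<psi> x ^ n) * t ^ n) - integral {a..b} (\<lambda>x. \<kappa> x * F (\<psi> x * t))) \<longlonglongrightarrow> 0"
    by (rule Lim_null_comparison[OF always_eventually lim]) (use bd in blast)
  then show ?thesis by (simp add: sums_def LIM_zero_iff)
qed

lemma (in normed_mod) holomorphic_into_norm_continuous:
  assumes f: "holomorphic_into E f S" and S: "open S" and z: "z \<in> S"
  shows "isCont (\<lambda>w. nrm E (f w \<ominus> f z)) z"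
proof -
  have fS: "f w \<in> carrier E" if "w \<in> S" for w using f that by (auto simp: holomorphic_into_def)
  obtain D where D: "D \<in> carrier E"
    and lim: "((\<lambda>w. nrm E (inverse (w - z) \<odot> (f w \<ominus> f z) \<ominus> D)) \<longlongrightarrow> 0) (at z within S)"
    using f z unfolding holomorphic_into_def by blast
  have "((\<lambda>w. nrm E (f w \<ominus> f z)) \<longlongrightarrow> 0) (at z)"
  proof (rule Lim_null_comparison)
    have "\<forall>\<^sub>F w in at z. w \<in> S" using S z eventually_at_topological by blast
    moreover have "\<forall>\<^sub>F w in at z. w \<noteq> z" by (simp add: eventually_at_filter)
    ultimately show "\<forall>\<^sub>F w in at z. norm (nrm E (f w \<ominus> f z))
        \<le> cmod (w - z) * (nrm E (inverse (w - z) \<odot> (f w \<ominus> f z) \<ominus> D) + nrm E D)"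
    proof eventually_elim
      case (elim w)
      let ?Q = "inverse (w - z) \<odot> (f w \<ominus> f z)"
      have car: "f w \<ominus> f z \<in> carrier E" "?Q \<in> carrier E" using fS elim z by auto
      have "f w \<ominus> f z = (w - z) \<odot> ((?Q \<ominus> D) \<oplus> D)"
        using car D elim by (intro norming_eqI[OF norming_functionals])
          (auto simp: functional_smult functional_add functional_minus)
      then have "nrm E (f w \<ominus> f z) = cmod (w - z) * nrm E ((?Q \<ominus> D) \<oplus> D)"
        using car D nrm_smult[of "(?Q \<ominus> D) \<oplus> D" "w - z"] by simp
      also have "\<dots> \<le> cmod (w - z) * (nrm E (?Q \<ominus> D) + nrm E D)"
        using car D by (intro mult_left_mono nrm_triangle) auto
      finally show ?case using nrm_nonneg[OF car(1)] by simp
    qed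
    have "((\<lambda>w. cmod (w - z) * (nrm E (inverse (w - z) \<odot> (f w \<ominus> f z) \<ominus> D) + nrm E D)) \<longlongrightarrow>
        cmod (z - z) * (0 + nrm E D)) (at z)"
      using lim unfolding at_within_open[OF z S] by (intro tendsto_intros)
    then show "((\<lambda>w. cmod (w - z) * (nrm E (inverse (w - z) \<odot> (f w \<ominus> f z) \<ominus> D) + nrm E D)) \<longlongrightarrow> 0) (at z)"
      by simp
  qed
  moreover have "f z \<ominus> f z = \<zero>" using fS[OF z] by (simp add: a_minus_def r_neg)
  ultimately show ?thesis by (simp add: isCont_def)
qed

text \<open>
  If \<open>f\<close> continues the Borel transform of \<open>u\<close>, then \<open>\<integral> \<kappa> x * f (\<psi> x * t)\<close> continues that of the product.
  It is defined on a sector that is narrower by twice the largest argument of a node, and its growth is still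
  of order \<open>k\<close> because the nodes are bounded.
\<close>

lemma (in banach_mod) narrow_moment_summable:
  assumes k: "k > 0" and c: "narrow_moment c" and su: "summable_in E k d u"
  shows "summable_in E k d (\<lambda>n. c n \<odot> u n)"
proof -
  obtain f where "borel_continuation E k d u f" using su by (auto simp: summable_in_def)
  then obtain \<alpha> r \<epsilon> K where \<alpha>: "0 < \<alpha>" "\<alpha> \<le> 2 * pi" and r: "0 < r" and \<epsilon>: "0 < \<epsilon>" and K: "0 < K"
    and u: "\<And>n. u n \<in> carrier E"
    and f: "\<And>t. t \<in> disc_sector d \<alpha> r \<Longrightarrow> f t \<in> carrier E" and hol: "holomorphic_into E f (disc_sector d \<alpha> r)"
    and gr: "growth_bound E k d \<alpha> r f"
    and lhol: "\<And>l. functional E l \<Longrightarrow> (\<lambda>t. l (f t)) holomorphic_on disc_sector d \<alpha> r"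
    and bK: "\<And>n. nrm E (borel_transform E (Gamma_seq (1 / k)) u n) \<le> K / \<epsilon> ^ n"
    and sums: "\<And>l t. functional E l \<Longrightarrow> cmod t < \<epsilon> \<Longrightarrow>
       (\<lambda>n. l (borel_transform E (Gamma_seq (1 / k)) u n) * t ^ n) sums l (f t)"
    by (rule borel_continuationD) blast
  let ?b = "borel_transform E (Gamma_seq (1 / k)) u"
  have b: "?b n \<in> carrier E" for n using u by (simp add: borel_transform_def)
  have "\<alpha> / 4 > 0" using \<alpha> by simp
  then obtain a b' :: real and \<kappa> \<psi> where ab: "a \<le> b'" and \<kappa>: "continuous_on {a..b'} \<kappa>" and \<psi>: "continuous_on {a..b'} \<psi>"
    and arg: "\<And>x. x \<in> {a..b'} \<Longrightarrow> \<exists>R \<theta>. 0 \<le> R \<and> \<bar>\<theta>\<bar> \<le> \<alpha> / 4 \<and> \<psi> x = rcis R \<theta>"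
    and cint: "\<And>n. c n = integral {a..b'} (\<lambda>x. \<kappa> x * \<psi> x ^ n)"
    by (rule narrow_momentE[OF c]) (rule that, assumption, assumption, assumption, simp_all)
  obtain M where M: "M \<ge> 1" "\<And>x. x \<in> {a..b'} \<Longrightarrow> cmod (\<psi> x) \<le> M"
    by (rule continuous_on_interval_bounded[OF \<psi>]) blast
  obtain C where C: "C \<ge> 1" "\<And>x. x \<in> {a..b'} \<Longrightarrow> cmod (\<kappa> x) \<le> C"
    by (rule continuous_on_interval_bounded[OF \<kappa>]) blast
  let ?V = "disc_sector d \<alpha> r" and ?U = "disc_sector d (\<alpha> / 2) (r / M)"
  have V: "open ?V" and U: "open ?U" using \<alpha> by (auto intro!: open_disc_sector)
  have scale: "\<psi> x * t \<in> disc_sector d (\<alpha>' + \<alpha> / 2) (M * r')"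
    if "x \<in> {a..b'}" "t \<in> disc_sector d \<alpha>' r'" "r' > 0" for x t \<alpha>' r'
  proof -
    obtain R \<theta> where R: "0 \<le> R" "\<bar>\<theta>\<bar> \<le> \<alpha> / 4" "\<psi> x = rcis R \<theta>" using arg \<open>x \<in> {a..b'}\<close> by blast
    then have "R \<le> M" using M(2)[OF that(1)] by simp
    then have "rcis R \<theta> * t \<in> disc_sector d (\<alpha>' + 2 * (\<alpha> / 4)) (M * r')"
      using M R that by (intro disc_sector_rcis_mult) auto
    then show ?thesis by (simp add: R(3))
  qed
  have UV: "\<psi> x * t \<in> ?V" if "x \<in> {a..b'}" "t \<in> ?U" for x t
    using scale[OF that] r M by simp
  define g where "g = (\<lambda>t. SOME y. y \<in> carrier E \<and>
     (\<forall>l. functional E l \<longrightarrow> l y = integral {a..b'} (\<lambda>x. \<kappa> x * l (f (\<psi> x * t)))))"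
  have "g t \<in> carrier E \<and> (\<forall>l. functional E l \<longrightarrow> l (g t) = integral {a..b'} (\<lambda>x. \<kappa> x * l (f (\<psi> x * t))))"
    if t: "t \<in> ?U" for t
    unfolding g_def
  proof (rule someI_ex)
    let ?F = "\<lambda>x. \<kappa> x \<odot> f (\<psi> x * t)"
    have F: "?F x \<in> carrier E" if "x \<in> {a..b'}" for x using f UV[OF that t] by simp
    have cont: "((\<lambda>y. nrm E (?F y \<ominus> ?F x)) \<longlongrightarrow> 0) (at x within {a..b'})" if x: "x \<in> {a..b'}" for x
    proof (rule Lim_null_comparison)
      let ?z = "\<psi> x * t"
      have z: "?z \<in> ?V" using UV[OF x t] .
      have "\<forall>\<^sub>F y in at x within {a..b'}. y \<in> {a..b'}" by (simp add: eventually_at_filter)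
      then show "\<forall>\<^sub>F y in at x within {a..b'}. norm (nrm E (?F y \<ominus> ?F x))
          \<le> cmod (\<kappa> y) * nrm E (f (\<psi> y * t) \<ominus> f ?z) + cmod (\<kappa> y - \<kappa> x) * nrm E (f ?z)"
      proof eventually_elim
        case (elim y)
        have fy: "f (\<psi> y * t) \<in> carrier E" "f ?z \<in> carrier E" using f UV[OF elim t] z by auto
        have "?F y \<ominus> ?F x = \<kappa> y \<odot> (f (\<psi> y * t) \<ominus> f ?z) \<oplus> (\<kappa> y - \<kappa> x) \<odot> f ?z"
          using fy by (intro norming_eqI[OF norming_functionals])
            (auto simp: functional_smult functional_add functional_minus algebra_simps)
        then have "nrm E (?F y \<ominus> ?F x) \<le> nrm E (\<kappa> y \<odot> (f (\<psi> y * t) \<ominus> f ?z)) + nrm E ((\<kappa> y - \<kappa> x) \<odot> f ?z)"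
          using nrm_triangle[of "\<kappa> y \<odot> (f (\<psi> y * t) \<ominus> f ?z)" "(\<kappa> y - \<kappa> x) \<odot> f ?z"] fy by simp
        then show ?case using fy nrm_nonneg[of "?F y \<ominus> ?F x"] by (simp add: nrm_smult)
      qed
      have \<psi>x: "(\<psi> \<longlongrightarrow> \<psi> x) (at x within {a..b'})" and \<kappa>x: "(\<kappa> \<longlongrightarrow> \<kappa> x) (at x within {a..b'})"
        using \<psi> \<kappa> x unfolding continuous_on_def by auto
      have "((\<lambda>y. nrm E (f (\<psi> y * t) \<ominus> f ?z)) \<longlongrightarrow> nrm E (f ?z \<ominus> f ?z)) (at x within {a..b'})"
        by (rule isCont_tendsto_compose[OF holomorphic_into_norm_continuous[OF hol V z]])
           (intro tendsto_intros \<psi>x)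
      moreover have "f ?z \<ominus> f ?z = \<zero>" using f[OF z] by (simp add: a_minus_def r_neg)
      ultimately have "((\<lambda>y. cmod (\<kappa> y) * nrm E (f (\<psi> y * t) \<ominus> f ?z) + cmod (\<kappa> y - \<kappa> x) * nrm E (f ?z))
          \<longlongrightarrow> cmod (\<kappa> x) * 0 + cmod (\<kappa> x - \<kappa> x) * nrm E (f ?z)) (at x within {a..b'})"
        by (intro tendsto_intros \<kappa>x) simp
      then show "((\<lambda>y. cmod (\<kappa> y) * nrm E (f (\<psi> y * t) \<ominus> f ?z) + cmod (\<kappa> y - \<kappa> x) * nrm E (f ?z))
          \<longlongrightarrow> 0) (at x within {a..b'})" by simp
    qed
    obtain y where "y \<in> carrier E" "\<And>l. functional E l \<Longrightarrow> l y = integral {a..b'} (\<lambda>x. l (?F x))"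
      by (rule vector_integral[of a b' ?F, OF ab F cont]) (assumption, assumption, rule that, assumption, simp)
    moreover have "integral {a..b'} (\<lambda>x. l (?F x)) = integral {a..b'} (\<lambda>x. \<kappa> x * l (f (\<psi> x * t)))"
      if "functional E l" for l
      using f UV t that by (intro integral_cong) (simp add: functional_smult)
    ultimately show "\<exists>y. y \<in> carrier E \<and>
        (\<forall>l. functional E l \<longrightarrow> l y = integral {a..b'} (\<lambda>x. \<kappa> x * l (f (\<psi> x * t))))" by auto
  qed
  then have g: "\<And>t. t \<in> ?U \<Longrightarrow> g t \<in> carrier E"
    and lg: "\<And>l t. t \<in> ?U \<Longrightarrow> functional E l \<Longrightarrow> l (g t) = integral {a..b'} (\<lambda>x. \<kappa> x * l (f (\<psi> x * t)))"
    by auto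
  have cn: "cmod (c n) \<le> C * M ^ n * (b' - a)" for n
    unfolding cint
  proof (rule integral_bound[OF ab])
    show "continuous_on {a..b'} (\<lambda>x. \<kappa> x * \<psi> x ^ n)" by (intro continuous_intros \<kappa> \<psi>)
    show "cmod (\<kappa> x * \<psi> x ^ n) \<le> C * M ^ n" if "x \<in> {a..b'}" for x
      unfolding norm_mult norm_power using C M that by (intro mult_mono power_mono) auto
  qed
  have bt: "borel_transform E (Gamma_seq (1 / k)) (\<lambda>n. c n \<odot> u n) n = c n \<odot> ?b n" for n
    using u by (simp add: borel_transform_def smult_smult mult.commute)
  let ?\<epsilon> = "min (\<epsilon> / (2 * M)) (r / M)"
  have \<epsilon>': "0 < ?\<epsilon>" using \<epsilon> r M by auto
  have "borel_continuation E k d (\<lambda>n. c n \<odot> u n) g"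
  proof (rule borel_continuationI[OF norming_functionals, where \<alpha> = "\<alpha> / 2" and r = "r / M" and \<epsilon> = ?\<epsilon>
          and K = "C * (b' - a) * K"])
    fix l assume "l \<in> {l. functional E l}"
    then have l: "functional E l" by simp
    have "(\<lambda>t. integral {a..b'} (\<lambda>x. \<kappa> x * l (f (\<psi> x * t)))) holomorphic_on ?U"
      by (rule holomorphic_on_scaled_integral[OF lhol[OF l] V U \<kappa> \<psi> UV])
    then show "(\<lambda>t. l (g t)) holomorphic_on ?U"
      by (rule holomorphic_transform) (simp add: lg l)
    fix t assume t: "cmod t < ?\<epsilon>"
    have tU: "t \<in> ?U" using t by (auto simp: disc_sector_def)
    have "(\<lambda>n. l (?b n) * integral {a..b'} (\<lambda>x. \<kappa> x * \<psi> x ^ n) * t ^ n) sums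
        integral {a..b'} (\<lambda>x. \<kappa> x * l (f (\<psi> x * t)))"
    proof (rule sums_scaled_integral[OF ab \<kappa> \<psi> _ M(2) _ \<epsilon>])
      show "cmod (l (?b n)) \<le> K / \<epsilon> ^ n" for n
        using functional_bound[OF l b] bK order_trans by blast
    qed (use M t sums l in auto)
    then show "(\<lambda>n. l (borel_transform E (Gamma_seq (1 / k)) (\<lambda>n. c n \<odot> u n) n) * t ^ n) sums l (g t)"
      unfolding bt using l b by (simp add: functional_smult lg[OF tU l] flip: cint) (simp add: mult_ac)
  next
    fix n
    have "nrm E (c n \<odot> ?b n) \<le> (C * M ^ n * (b' - a)) * (K / \<epsilon> ^ n)"
      using cn bK b nrm_nonneg[OF b] order_trans[OF norm_ge_zero cn]
      by (simp only: nrm_smult[OF b]) (intro mult_mono, auto)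
    also have "\<dots> = C * (b' - a) * K / (\<epsilon> / M) ^ n" using M by (simp add: power_divide)
    also have "\<dots> \<le> C * (b' - a) * K / ?\<epsilon> ^ n"
    proof (intro divide_left_mono power_mono)
      have "?\<epsilon> \<le> \<epsilon> / (2 * M)" by simp
      also have "\<dots> \<le> \<epsilon> / M" using \<epsilon> M by (intro divide_left_mono) auto
      finally show "?\<epsilon> \<le> \<epsilon> / M" .
    qed (use \<epsilon>' \<epsilon> M C ab K in auto)
    finally show "nrm E (borel_transform E (Gamma_seq (1 / k)) (\<lambda>n. c n \<odot> u n) n) \<le> C * (b' - a) * K / ?\<epsilon> ^ n"
      unfolding bt .
  next
    show "growth_bound E k d (\<alpha> / 2) (r / M) g"
      unfolding growth_bound_def
    proof (intro ballI)
      fix \<alpha>' r' assume a': "\<alpha>' \<in> {0<..<\<alpha> / 2}" and r': "r' \<in> {0<..<r / M}"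
      have "\<alpha>' + \<alpha> / 2 \<in> {0<..<\<alpha>}" "M * r' \<in> {0<..<r}" using a' r' M \<alpha> by (auto simp: field_simps)
      then obtain A B where AB: "A > 0" "B > 0"
        "\<And>t. t \<in> disc_sector d (\<alpha>' + \<alpha> / 2) (M * r') \<Longrightarrow> nrm E (f t) < A * exp (B * cmod t powr k)"
        using gr unfolding growth_bound_def by meson
      have "nrm E (g t) < (C * A * (b' - a) + 1) * exp (B * M powr k * cmod t powr k)"
        if t: "t \<in> disc_sector d \<alpha>' r'" for t
      proof -
        have tU: "t \<in> ?U" using disc_sector_mono[of \<alpha>' "\<alpha> / 2" r' "r / M" d] t a' r' by auto
        have "nrm E (g t) \<le> C * (A * exp (B * M powr k * cmod t powr k)) * (b' - a)"
        proof (rule normingD[OF norming_functionals g[OF tU]])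
          fix l assume "l \<in> {l. functional E l}"
          then have l: "functional E l" by simp
          show "cmod (l (g t)) \<le> C * (A * exp (B * M powr k * cmod t powr k)) * (b' - a)"
            unfolding lg[OF tU l]
          proof (rule integral_bound[OF ab])
            show "continuous_on {a..b'} (\<lambda>x. \<kappa> x * l (f (\<psi> x * t)))"
              by (intro continuous_intros \<kappa> continuous_on_compose2[OF holomorphic_on_imp_continuous_on[OF lhol[OF l]]] \<psi>)
                 (use UV tU in auto)
            fix x assume x: "x \<in> {a..b'}"
            have "cmod (l (f (\<psi> x * t))) \<le> nrm E (f (\<psi> x * t))"
              by (rule functional_bound[OF l f[OF UV[OF x tU]]])
            also have "\<dots> \<le> A * exp (B * cmod (\<psi> x * t) powr k)"
              using AB(3) scale[OF x t] r' by (intro less_imp_le) auto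
            also have "\<dots> \<le> A * exp (B * (M * cmod t) powr k)"
              using AB M x k by (intro mult_left_mono iffD2[OF exp_le_cancel_iff] powr_mono2)
                (auto simp: norm_mult intro!: mult_right_mono)
            also have "\<dots> = A * exp (B * M powr k * cmod t powr k)"
              using M by (simp add: powr_mult)
            finally show "cmod (\<kappa> x * l (f (\<psi> x * t))) \<le> C * (A * exp (B * M powr k * cmod t powr k))"
              unfolding norm_mult using C x by (intro mult_mono) auto
          qed
        qed
        also have "\<dots> < (C * A * (b' - a) + 1) * exp (B * M powr k * cmod t powr k)"
          by (simp add: algebra_simps)
        finally show ?thesis .
      qed
      moreover have "C * A * (b' - a) + 1 > 0"
        using C AB ab by (intro add_nonneg_pos mult_nonneg_nonneg) auto
      moreover have "B * M powr k > 0" using AB M by auto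
      ultimately show "\<exists>A>0. \<exists>B>0. \<forall>t\<in>disc_sector d \<alpha>' r'. nrm E (g t) < A * exp (B * cmod t powr k)"
        by blast
    qed
  qed (use u g \<alpha> r M k \<epsilon>' in auto)
  then show ?thesis by (auto simp: summable_in_def)
qed

section \<open>Integral representations of quotients of Gamma functions\<close>

definition sc :: "real \<Rightarrow> real" where "sc x = (if x = 0 then 1 else sin x / x)"
definition sc' :: "real \<Rightarrow> real" where "sc' x = (if x = 0 then 0 else (x * cos x - sin x) / x ^ 2)"

lemma sc_deriv: "(sc has_real_derivative sc' x) (at x)"
proof (cases "x = 0")
  case True
  have "((\<lambda>h. (sin h / h - 1) / h) \<longlongrightarrow> (0::real)) (at 0)" by real_asymp
  moreover have "\<forall>\<^sub>F h in at 0. (sin h / h - 1) / h = (sc (0 + h) - sc 0) / h"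
    by (auto simp: eventually_at_filter sc_def)
  ultimately have "((\<lambda>h. (sc (0 + h) - sc 0) / h) \<longlongrightarrow> 0) (at 0)"
    by (rule Lim_transform_eventually)
  then show ?thesis unfolding True by (simp add: DERIV_def sc'_def)
next
  case False
  have c: "((\<lambda>x. sin x / x) has_real_derivative sc' x) (at x)"
    using False by (auto intro!: derivative_eq_intros simp: sc'_def power2_eq_square)
  have "\<forall>\<^sub>F y in nhds x. sin y / y = sc y"
    using False by (auto simp: sc_def eventually_nhds intro!: exI[of _ "- {0}"])
  from DERIV_cong_ev[OF refl this refl] c show ?thesis by simp
qed

lemma sc'_cont: "continuous_on UNIV sc'"
proof -
  have "isCont sc' x" for x
  proof (cases "x = 0")
    case True
    have "((\<lambda>x. (x * cos x - sin x) / x ^ 2) \<longlongrightarrow> (0::real)) (at 0)" by real_asymp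
    moreover have "\<forall>\<^sub>F h in at 0. (h * cos h - sin h) / h ^ 2 = sc' h"
      by (auto simp: eventually_at_filter sc'_def)
    ultimately have "(sc' \<longlongrightarrow> 0) (at 0)" by (rule Lim_transform_eventually)
    then show ?thesis unfolding True by (simp add: isCont_def sc'_def)
  next
    case False
    have c: "isCont (\<lambda>x. (x * cos x - sin x) / x ^ 2) x" using False by (auto intro!: continuous_intros)
    have "\<forall>\<^sub>F y in nhds x. (y * cos y - sin y) / y ^ 2 = sc' y"
      using False by (auto simp: sc'_def eventually_nhds intro!: exI[of _ "- {0}"])
    from isCont_cong[OF this] c show ?thesis by simp
  qed
  then show ?thesis by (simp add: continuous_at_imp_continuous_on)
qed

lemma sc_pos: "\<bar>x\<bar> < pi \<Longrightarrow> sc x > 0"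
proof (cases "x > 0")
  case False
  assume "\<bar>x\<bar> < pi"
  then have "x = 0 \<or> sin (- x) > 0" using False by (cases "x = 0") (auto intro!: sin_gt_zero simp del: sin_minus)
  then show ?thesis using False by (auto simp: sc_def field_simps)
qed (auto simp: sc_def intro!: sin_gt_zero divide_pos_pos)

lemma x_sc: "x * sc x = sin x" by (simp add: sc_def)

text \<open>
  The contour \<open>w\<close>, parametrised by its argument \<open>\<phi> \<in> [-\<pi>, \<pi>]\<close>: the one on which the argument of
  \<open>1 + w\<close> is the fixed multiple \<open>\<alpha> \<phi>\<close>. By the law of sines, \<open>\<bar>w\<bar> = sin (\<alpha> \<phi>) / sin ((1 - \<alpha>) \<phi>)\<close>
  and \<open>\<bar>1 + w\<bar> = sin \<phi> / sin ((1 - \<alpha>) \<phi>)\<close>; these are \<open>\<rho>\<close> and \<open>R\<close>, written with the continuous quotient \<open>sin x / x\<close>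
  so that they make sense at \<open>\<phi> = 0\<close>. The continuous logarithm of \<open>w\<close> is \<open>lw\<close>, and \<open>dw = \<i> w \<kappa> d\<phi>\<close>.
\<close>

locale contour =
  fixes \<alpha> :: real
  assumes \<alpha>: "0 < \<alpha>" "\<alpha> < 1"
begin

definition \<rho> :: "real \<Rightarrow> real" where "\<rho> \<phi> = \<alpha> * sc (\<alpha> * \<phi>) / ((1 - \<alpha>) * sc ((1 - \<alpha>) * \<phi>))"
definition R :: "real \<Rightarrow> real" where "R \<phi> = sc \<phi> / ((1 - \<alpha>) * sc ((1 - \<alpha>) * \<phi>))"
definition lw :: "real \<Rightarrow> complex" where "lw \<phi> = Complex (ln (\<rho> \<phi>)) \<phi>"
definition w :: "real \<Rightarrow> complex" where "w \<phi> = rcis (\<rho> \<phi>) \<phi>"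
definition \<kappa> :: "real \<Rightarrow> complex" where
  "\<kappa> \<phi> = Complex 1 (- (\<alpha> * sc' (\<alpha> * \<phi>) / sc (\<alpha> * \<phi>) - (1 - \<alpha>) * sc' ((1 - \<alpha>) * \<phi>) / sc ((1 - \<alpha>) * \<phi>)))"

lemma mult_less_pi:
  assumes "\<bar>\<phi>\<bar> \<le> pi" shows "\<bar>\<alpha> * \<phi>\<bar> < pi" "\<bar>(1 - \<alpha>) * \<phi>\<bar> < pi"
proof -
  have "\<alpha> * \<bar>\<phi>\<bar> \<le> \<alpha> * pi" "(1 - \<alpha>) * \<bar>\<phi>\<bar> \<le> (1 - \<alpha>) * pi"
    using assms \<alpha> by (auto intro: mult_left_mono)
  moreover have "\<alpha> * pi < 1 * pi" "(1 - \<alpha>) * pi < 1 * pi"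
    using \<alpha> by (intro mult_strict_right_mono; simp)+
  ultimately have "\<alpha> * \<bar>\<phi>\<bar> < pi" "(1 - \<alpha>) * \<bar>\<phi>\<bar> < pi" by linarith+
  then show "\<bar>\<alpha> * \<phi>\<bar> < pi" "\<bar>(1 - \<alpha>) * \<phi>\<bar> < pi" using \<alpha> by (simp_all add: abs_mult)
qed

lemma sc_pos': "\<bar>\<phi>\<bar> \<le> pi \<Longrightarrow> sc (\<alpha> * \<phi>) > 0" "\<bar>\<phi>\<bar> \<le> pi \<Longrightarrow> sc ((1 - \<alpha>) * \<phi>) > 0"
  using mult_less_pi sc_pos by auto

lemma \<rho>_pos: "\<bar>\<phi>\<bar> \<le> pi \<Longrightarrow> \<rho> \<phi> > 0"
  unfolding \<rho>_def using sc_pos' \<alpha> by (intro divide_pos_pos mult_pos_pos) auto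

lemma R_pos: "\<bar>\<phi>\<bar> < pi \<Longrightarrow> R \<phi> > 0"
  unfolding R_def using sc_pos' sc_pos[of \<phi>] \<alpha> by (intro divide_pos_pos mult_pos_pos) auto

lemma sc_pi: "sc pi = 0" "sc (- pi) = 0" by (auto simp: sc_def)

lemma R_pi: "R pi = 0" "R (- pi) = 0" by (simp_all add: R_def sc_pi)

lemma R_nonneg: "\<bar>\<phi>\<bar> \<le> pi \<Longrightarrow> R \<phi> \<ge> 0"
proof (cases "\<bar>\<phi>\<bar> < pi")
  case False
  moreover assume "\<bar>\<phi>\<bar> \<le> pi"
  ultimately have "\<phi> = pi \<or> \<phi> = - pi" by linarith
  then show ?thesis using R_pi by auto
qed (use R_pos[of \<phi>] in auto)

lemma sc_even: "sc (- x) = sc x" by (simp add: sc_def)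

lemma \<rho>_pi: "\<rho> pi = 1" "\<rho> (- pi) = 1"
proof -
  have s: "sin ((1 - \<alpha>) * pi) = sin (\<alpha> * pi)"
    using sin_pi_minus[of "\<alpha> * pi"] by (simp add: algebra_simps)
  have p: "sc ((1 - \<alpha>) * pi) > 0" using sc_pos'(2)[of pi] by simp
  have "\<alpha> * sc (\<alpha> * pi) * pi = (1 - \<alpha>) * sc ((1 - \<alpha>) * pi) * pi"
    using x_sc[of "\<alpha> * pi"] x_sc[of "(1 - \<alpha>) * pi"] s by (simp add: mult_ac)
  then have e: "\<alpha> * sc (\<alpha> * pi) = (1 - \<alpha>) * sc ((1 - \<alpha>) * pi)" by simp
  show 1: "\<rho> pi = 1" unfolding \<rho>_def e using p \<alpha> by simp
  have "\<rho> (- pi) = \<rho> pi" by (simp add: \<rho>_def sc_even)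
  then show "\<rho> (- pi) = 1" using 1 by simp
qed

lemma one_plus_w: "\<bar>\<phi>\<bar> \<le> pi \<Longrightarrow> 1 + w \<phi> = rcis (R \<phi>) (\<alpha> * \<phi>)"
proof -
  assume \<phi>: "\<bar>\<phi>\<bar> \<le> pi"
  let ?s = "(1 - \<alpha>) * sc ((1 - \<alpha>) * \<phi>)"
  have s: "?s > 0" using sc_pos'(2)[OF \<phi>] \<alpha> by simp
  have "\<alpha> * sc (\<alpha> * \<phi>) * \<phi> = sin (\<alpha> * \<phi>)" "?s * \<phi> = sin ((1 - \<alpha>) * \<phi>)" "sc \<phi> * \<phi> = sin \<phi>"
    using x_sc[of "\<alpha> * \<phi>"] x_sc[of "(1 - \<alpha>) * \<phi>"] x_sc[of \<phi>] by (simp_all add: mult_ac)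
  note e = this
  have s1: "sin ((1 - \<alpha>) * \<phi>) = sin \<phi> * cos (\<alpha> * \<phi>) - cos \<phi> * sin (\<alpha> * \<phi>)"
    using sin_diff[of \<phi> "\<alpha> * \<phi>"] by (simp add: algebra_simps)
  have "?s + \<alpha> * sc (\<alpha> * \<phi>) * cos \<phi> = sc \<phi> * cos (\<alpha> * \<phi>)"
  proof (cases "\<phi> = 0")
    case False
    have "(?s + \<alpha> * sc (\<alpha> * \<phi>) * cos \<phi>) * \<phi> = ?s * \<phi> + (\<alpha> * sc (\<alpha> * \<phi>) * \<phi>) * cos \<phi>"
      by (simp add: algebra_simps)
    also have "\<dots> = (sc \<phi> * \<phi>) * cos (\<alpha> * \<phi>)" unfolding e s1 by (simp add: algebra_simps)
    finally show ?thesis using False by (simp add: mult_ac)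
  qed (simp add: sc_def)
  moreover have "\<alpha> * sc (\<alpha> * \<phi>) * sin \<phi> = sc \<phi> * sin (\<alpha> * \<phi>)"
  proof (cases "\<phi> = 0")
    case False
    have "(\<alpha> * sc (\<alpha> * \<phi>) * sin \<phi>) * \<phi> = sc \<phi> * \<phi> * sin (\<alpha> * \<phi>)"
      using e by (metis mult.commute mult.left_commute)
    then show ?thesis using False by (simp add: mult_ac)
  qed simp
  moreover have "1 + A / s * c = B / s * e" if "s > 0" "s + A * c = B * e" for A B s c e :: real
    using that by (simp add: field_simps)
  moreover have "A / s * c = B / s * e" if "A * c = B * e" for A B s c e :: real
    using that by (simp add: field_simps)
  ultimately show ?thesis
    using s by (simp add: complex_eq_iff w_def rcis_def \<rho>_def R_def)
qed

lemma w_slit: "\<bar>\<phi>\<bar> < pi \<Longrightarrow> w \<phi> \<notin> \<real>\<^sub>\<le>\<^sub>0"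
proof
  assume \<phi>: "\<bar>\<phi>\<bar> < pi" and n: "w \<phi> \<in> \<real>\<^sub>\<le>\<^sub>0"
  have p: "\<rho> \<phi> > 0" using \<rho>_pos[of \<phi>] \<phi> by simp
  have *: "\<rho> \<phi> * sin \<phi> = 0" "\<rho> \<phi> * cos \<phi> \<le> 0"
    using n by (auto simp: complex_nonpos_Reals_iff w_def rcis_def)
  have "sin \<phi> = 0" using * p by simp
  moreover have "- pi < \<phi>" "\<phi> < pi" using \<phi> by linarith+
  ultimately have "\<phi> = 0" using sin_eq_0_pi by blast
  then show False using * p by simp
qed

lemma cont_aux: "continuous_on S sc" "continuous_on S (\<lambda>\<phi>. sc (c * \<phi>))" "continuous_on S (\<lambda>\<phi>. sc' (c * \<phi>))"
proof -
  show *: "continuous_on S sc" for S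
    using DERIV_isCont[OF sc_deriv] by (simp add: continuous_at_imp_continuous_on)
  show "continuous_on S (\<lambda>\<phi>. sc (c * \<phi>))"
    by (rule continuous_on_compose2[OF *[of UNIV]]) (auto intro!: continuous_intros)
  show "continuous_on S (\<lambda>\<phi>. sc' (c * \<phi>))"
    by (rule continuous_on_compose2[OF sc'_cont]) (auto intro!: continuous_intros)
qed

lemma cont_\<rho>: "continuous_on {-pi..pi} \<rho>"
  unfolding \<rho>_def using \<alpha> sc_pos'(2) by (intro continuous_intros cont_aux) (auto simp: less_imp_neq[symmetric] abs_le_iff)

lemma cont_R: "continuous_on {-pi..pi} R"
  unfolding R_def using \<alpha> sc_pos'(2) by (intro continuous_intros cont_aux) (auto simp: less_imp_neq[symmetric] abs_le_iff)

lemma cont_lw: "continuous_on {-pi..pi} lw"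
  unfolding lw_def
  by (intro continuous_intros cont_\<rho>) (use \<rho>_pos in \<open>auto simp: less_imp_neq[symmetric] abs_le_iff\<close>)

lemma exp_lw: "\<bar>\<phi>\<bar> \<le> pi \<Longrightarrow> exp (lw \<phi>) = w \<phi>"
  using \<rho>_pos by (simp add: lw_def w_def exp_eq_polar rcis_def)

lemma cont_\<kappa>: "continuous_on {-pi..pi} \<kappa>"
  unfolding \<kappa>_def using sc_pos' by (intro continuous_intros cont_aux) (auto simp: less_imp_neq[symmetric] abs_le_iff)

lemma lw_deriv:
  assumes "\<bar>\<phi>\<bar> \<le> pi" shows "(lw has_vector_derivative \<i> * \<kappa> \<phi>) (at \<phi>)"
proof -
  let ?D = "\<alpha> * sc' (\<alpha> * \<phi>) / sc (\<alpha> * \<phi>) - (1 - \<alpha>) * sc' ((1 - \<alpha>) * \<phi>) / sc ((1 - \<alpha>) * \<phi>)"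
  have sd: "((\<lambda>\<phi>. sc (c * \<phi>)) has_real_derivative sc' (c * \<phi>) * c) (at \<phi>)" for c
    by (rule DERIV_chain2[OF sc_deriv]) (auto intro!: derivative_eq_intros)
  have pos: "sc (\<alpha> * \<phi>) > 0" "sc ((1 - \<alpha>) * \<phi>) > 0" using sc_pos' assms by auto
  have alg: "(\<alpha> * (a' * \<alpha>) * (\<beta> * b) - \<alpha> * a * (\<beta> * (b' * \<beta>))) / ((\<beta> * b) * (\<beta> * b))
      = \<alpha> * a / (\<beta> * b) * (\<alpha> * a' / a - \<beta> * b' / b)"
    if "a > 0" "b > 0" "\<beta> > 0" for a b a' b' \<beta> :: real
    using that \<alpha> by (simp add: field_simps)
  have "(\<rho> has_real_derivative
      ((\<alpha> * (sc' (\<alpha> * \<phi>) * \<alpha>)) * ((1 - \<alpha>) * sc ((1 - \<alpha>) * \<phi>)) -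
       \<alpha> * sc (\<alpha> * \<phi>) * ((1 - \<alpha>) * (sc' ((1 - \<alpha>) * \<phi>) * (1 - \<alpha>)))) /
      (((1 - \<alpha>) * sc ((1 - \<alpha>) * \<phi>)) * ((1 - \<alpha>) * sc ((1 - \<alpha>) * \<phi>)))) (at \<phi>)"
    unfolding \<rho>_def[abs_def] using pos \<alpha> by (intro DERIV_divide DERIV_cmult sd) auto
  then have "(\<rho> has_real_derivative \<rho> \<phi> * ?D) (at \<phi>)"
    using alg[OF pos, of "1 - \<alpha>" "sc' (\<alpha> * \<phi>)" "sc' ((1 - \<alpha>) * \<phi>)"] \<alpha> unfolding \<rho>_def[of \<phi>] by simp
  then have "((\<lambda>\<phi>. ln (\<rho> \<phi>)) has_real_derivative (1 / \<rho> \<phi>) * (\<rho> \<phi> * ?D)) (at \<phi>)"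
    by (rule DERIV_chain2[where f = ln and g = \<rho>, OF DERIV_ln_divide[OF \<rho>_pos[OF assms]]])
  then have "((\<lambda>\<phi>. ln (\<rho> \<phi>)) has_real_derivative ?D) (at \<phi>)"
    using \<rho>_pos[OF assms] by simp
  then have "((\<lambda>\<phi>. complex_of_real (ln (\<rho> \<phi>)) + \<i> * complex_of_real \<phi>) has_vector_derivative
      complex_of_real ?D + \<i> * complex_of_real 1) (at \<phi>)"
    by (intro has_vector_derivative_add has_vector_derivative_of_real has_vector_derivative_mult_right)
       (auto simp: has_real_derivative_iff_has_vector_derivative intro!: derivative_eq_intros)
  moreover have "complex_of_real ?D + \<i> * complex_of_real 1 = \<i> * \<kappa> \<phi>"
    by (simp add: \<kappa>_def complex_eq_iff)
  moreover have "(\<lambda>\<phi>. complex_of_real (ln (\<rho> \<phi>)) + \<i> * complex_of_real \<phi>) = lw"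
    by (auto simp: lw_def complex_eq_iff)
  ultimately show ?thesis by simp
qed

text \<open>The contour winds once around the origin. This is the binomial coefficient with \<open>N = q = 0\<close>.\<close>

lemma integral_\<kappa>: "(\<kappa> has_integral (2 * pi)) {-pi..pi}"
proof -
  have "((\<lambda>\<phi>. \<i> * \<kappa> \<phi>) has_integral (lw pi - lw (-pi))) {-pi..pi}"
  proof (rule fundamental_theorem_of_calculus)
    fix \<phi> :: real assume "\<phi> \<in> {-pi..pi}"
    then have "\<bar>\<phi>\<bar> \<le> pi" by (simp add: abs_le_iff)
    then show "(lw has_vector_derivative \<i> * \<kappa> \<phi>) (at \<phi> within {-pi..pi})"
      by (rule has_vector_derivative_at_within[OF lw_deriv])
  qed simp
  from has_integral_mult_right[OF this, of "- \<i>"]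
  have "(\<kappa> has_integral (- \<i> * (lw pi - lw (-pi)))) {-pi..pi}" by (simp add: mult.assoc[symmetric])
  moreover have "- \<i> * (lw pi - lw (-pi)) = 2 * pi"
    by (simp add: lw_def \<rho>_pi complex_eq_iff)
  ultimately show ?thesis by simp
qed

subsection \<open>Negative exponents\<close>

text \<open>
  The primitive of \<open>w powr (\<sigma> - 1) * (1 + w) powr N\<close> that vanishes at 0 is \<open>z powr \<sigma> / \<sigma> * Q (1 / \<sigma>) N z\<close>, as
  the substitution \<open>w = y powr (1 / \<sigma>) * z\<close> shows. In this form only the factor \<open>z powr \<sigma>\<close> is
  discontinuous across the segment from \<open>- 1\<close> to 0.
\<close>

definition Q :: "real \<Rightarrow> real \<Rightarrow> complex \<Rightarrow> complex" where
  "Q \<tau> N z = integral {0..1} (\<lambda>y. (1 + complex_of_real (y powr \<tau>) * z) powr complex_of_real N)"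

lemma slit_aux:
  assumes "z \<notin> \<real>\<^sub>\<le>\<^sub>0" "0 \<le> x" shows "1 + complex_of_real x * z \<notin> \<real>\<^sub>\<le>\<^sub>0"
proof
  assume "1 + complex_of_real x * z \<in> \<real>\<^sub>\<le>\<^sub>0"
  then have *: "x * Im z = 0" "1 + x * Re z \<le> 0" by (auto simp: complex_nonpos_Reals_iff)
  then have "x \<noteq> 0" by auto
  then have "Im z = 0" "Re z \<le> 0" using * assms(2) by (simp, smt (verit) * assms(2) mult_nonneg_nonneg)
  then show False using assms(1) by (auto simp: complex_nonpos_Reals_iff)
qed

text \<open>
  The differential equation says that \<open>z powr \<sigma> / \<sigma> * Q (1 / \<sigma>) N z\<close> is a primitive. It results from integrating the
  derivative of \<open>y * (1 + y powr \<tau> * z) powr N\<close> over the unit interval.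
\<close>

lemma Q_deriv:
  assumes \<tau>: "\<tau> > 0" and z: "z \<notin> \<real>\<^sub>\<le>\<^sub>0"
  obtains D where "(Q \<tau> N has_field_derivative D) (at z)"
    "Q \<tau> N z + complex_of_real \<tau> * z * D = (1 + z) powr complex_of_real N"
proof -
  let ?N = "complex_of_real N" and ?p = "\<lambda>y. complex_of_real (y powr \<tau>)"
  let ?fx = "\<lambda>z y. ?N * ?p y * (1 + ?p y * z) powr (?N - 1)"
  obtain e where e: "e > 0" "ball z e \<subseteq> - \<real>\<^sub>\<le>\<^sub>0"
    using z open_contains_ball[of "- \<real>\<^sub>\<le>\<^sub>0 :: complex set"] closed_nonpos_Reals_complex by (auto simp: open_Compl)
  have sl: "1 + ?p y * v \<notin> \<real>\<^sub>\<le>\<^sub>0" if "v \<in> ball z e" for v y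
    using e that by (intro slit_aux) auto
  have contp: "continuous_on {0..1} (\<lambda>y. y powr \<tau>)" using \<tau> by (intro continuous_on_powr' continuous_intros) auto
  have sub: "v \<notin> \<real>\<^sub>\<le>\<^sub>0 \<Longrightarrow> Re v \<ge> 0 \<or> Im v \<noteq> 0" for v :: complex by (auto simp: complex_nonpos_Reals_iff)
  have contpp: "continuous_on (ball z e \<times> {0..1}) (\<lambda>p. snd p powr \<tau>)"
    by (intro continuous_on_compose2[OF contp] continuous_intros) auto
  have cont2: "continuous_on (ball z e \<times> {0..1}) (\<lambda>p. (1 + ?p (snd p) * fst p) powr c)" for c
  proof (rule continuous_on_powr_complex)
    have *: "1 + ?p (snd p) * fst p \<notin> \<real>\<^sub>\<le>\<^sub>0" if "p \<in> ball z e \<times> {0..1}" for p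
      using that by (intro sl) auto
    then show "ball z e \<times> {0..1} \<subseteq> {p. 0 \<le> Re (1 + ?p (snd p) * fst p) \<or> Im (1 + ?p (snd p) * fst p) \<noteq> 0}"
      using sub by blast
    show "0 < Re c" if "p \<in> ball z e \<times> {0..1}" "1 + ?p (snd p) * fst p = 0" for p
      using *[OF that(1)] that(2) by simp
  qed (intro continuous_intros contpp)+
  have cont1: "continuous_on {0..1} (\<lambda>y. (1 + ?p y * v) powr c)" if v: "v \<in> ball z e" for v c
  proof (rule continuous_on_powr_complex)
    show "{0..1} \<subseteq> {y. 0 \<le> Re (1 + ?p y * v) \<or> Im (1 + ?p y * v) \<noteq> 0}"
      using sub sl[OF v] by blast
    show "0 < Re c" if "1 + ?p y * v = 0" for y
      using sl[OF v, of y] that by simp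
  qed (intro continuous_intros contp)+
  have zb: "z \<in> ball z e" using e by simp
  have "((\<lambda>v. integral (cbox 0 1) (\<lambda>y. (1 + ?p y * v) powr ?N)) has_field_derivative
      integral (cbox 0 1) (?fx z)) (at z within ball z e)"
  proof (rule leibniz_rule_field_derivative[where fx = ?fx])
    fix v and y :: real assume v: "v \<in> ball z e"
    show "((\<lambda>v. (1 + ?p y * v) powr ?N) has_field_derivative ?fx v y) (at v within ball z e)"
      by (rule has_field_derivative_at_within) (use sl[OF v] in \<open>auto intro!: derivative_eq_intros\<close>)
  next
    fix v assume v: "v \<in> ball z e"
    show "(\<lambda>y. (1 + ?p y * v) powr ?N) integrable_on cbox 0 1"
      using cont1[OF v] by (simp add: integrable_continuous_real)
  next
    show "continuous_on (ball z e \<times> cbox 0 1) (\<lambda>(v, y). ?fx v y)"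
      unfolding case_prod_unfold cbox_interval
      by (intro continuous_on_mult continuous_on_const continuous_on_of_real contpp cont2)
  qed (use zb in auto)
  then have D: "(Q \<tau> N has_field_derivative integral {0..1} (?fx z)) (at z)"
    unfolding Q_def[abs_def] using at_within_open[OF zb] by simp
  have "((\<lambda>y. (1 + ?p y * z) powr ?N + complex_of_real \<tau> * z * ?fx z y) has_integral
      (complex_of_real 1 * (1 + ?p 1 * z) powr ?N - complex_of_real 0 * (1 + ?p 0 * z) powr ?N)) {0..1}"
  proof (rule fundamental_theorem_of_calculus_interior)
    show "continuous_on {0..1} (\<lambda>y. complex_of_real y * (1 + ?p y * z) powr ?N)"
      by (intro continuous_intros cont1[OF zb])
    fix y :: real assume y: "y \<in> {0<..<1}"
    have dp: "((\<lambda>y. ?p y) has_vector_derivative complex_of_real (\<tau> * y powr (\<tau> - 1))) (at y)"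
      using y by (intro has_vector_derivative_of_real)
        (auto simp: has_real_derivative_iff_has_vector_derivative[symmetric] intro!: derivative_eq_intros)
    have "((\<lambda>y. 1 + ?p y * z) has_vector_derivative complex_of_real (\<tau> * y powr (\<tau> - 1)) * z) (at y)"
      using has_vector_derivative_add[OF has_vector_derivative_const has_vector_derivative_mult_left[OF dp]] by simp
    from field_vector_diff_chain_at[where f = "\<lambda>y. 1 + ?p y * z" and g = "\<lambda>v. v powr ?N",
        OF this has_field_derivative_powr[OF sl[OF zb]]]
    have "((\<lambda>y. (1 + ?p y * z) powr ?N) has_vector_derivative
       (complex_of_real (\<tau> * y powr (\<tau> - 1)) * z) * (?N * (1 + ?p y * z) powr (?N - 1))) (at y)"
      by (simp only: o_def)
    then have "((\<lambda>y. complex_of_real y * (1 + ?p y * z) powr ?N) has_vector_derivative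
       complex_of_real y * ((complex_of_real (\<tau> * y powr (\<tau> - 1)) * z) * (?N * (1 + ?p y * z) powr (?N - 1)))
       + 1 * (1 + ?p y * z) powr ?N) (at y)"
      by (rule has_vector_derivative_mult[rotated])
         (use has_vector_derivative_of_real[OF DERIV_ident] in simp)
    moreover have e: "complex_of_real y * (complex_of_real (y powr (\<tau> - 1))) = ?p y"
      using y by (simp add: powr_mult_base flip: of_real_mult)
    have "complex_of_real y * (complex_of_real (\<tau> * y powr (\<tau> - 1)) * z * (?N * X)) + 1 * Y
        = Y + complex_of_real \<tau> * z * (?N * ?p y * X)" for X Y
      unfolding e[symmetric] by (simp add: algebra_simps)
    ultimately show "((\<lambda>y. complex_of_real y * (1 + ?p y * z) powr ?N) has_vector_derivative
       (1 + ?p y * z) powr ?N + complex_of_real \<tau> * z * ?fx z y) (at y)"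
      by (simp only:)
  qed simp
  then have "integral {0..1} (\<lambda>y. (1 + ?p y * z) powr ?N + complex_of_real \<tau> * z * ?fx z y) = (1 + z) powr ?N"
    by (simp add: integral_unique)
  moreover have "integral {0..1} (\<lambda>y. (1 + ?p y * z) powr ?N + complex_of_real \<tau> * z * ?fx z y)
      = Q \<tau> N z + complex_of_real \<tau> * z * integral {0..1} (?fx z)"
    unfolding Q_def
    by (subst integral_add) (auto intro!: integrable_continuous_real continuous_intros cont1[OF zb] contp)
  ultimately have "Q \<tau> N z + complex_of_real \<tau> * z * integral {0..1} (?fx z) = (1 + z) powr ?N" by simp
  then show thesis by (rule that[OF D])
qed

lemma Q_minus_one:
  assumes \<sigma>: "0 < \<sigma>" and N: "0 < N"
  shows "Q (1 / \<sigma>) N (- 1) = complex_of_real (\<sigma> * Beta \<sigma> (N + 1))"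
proof -
  define h where "h = (\<lambda>y. (1 - y powr (1 / \<sigma>)) powr N)"
  define H where "H = (\<lambda>y. integral {0..y} h)"
  have le1: "y powr (1 / \<sigma>) \<le> 1" if "y \<in> {0..1}" for y :: real
    using that \<sigma> by (intro powr_le1) auto
  have conth: "continuous_on {0..1} h"
    unfolding h_def using \<sigma> N le1 by (intro continuous_on_powr' continuous_intros) auto
  have hint: "(h has_integral H 1) {0..1}"
    unfolding H_def by (intro integrable_integral integrable_continuous_real conth)
  have contH: "continuous_on {0..1} H"
    unfolding H_def by (intro indefinite_integral_continuous_1 integrable_continuous_real conth)
  have "((\<lambda>x. \<sigma> * (x powr (\<sigma> - 1) * (1 - x) powr (N + 1 - 1))) has_integral (H (1 powr \<sigma>) - H (0 powr \<sigma>))) {0..1}"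
  proof (rule fundamental_theorem_of_calculus_interior)
    show "continuous_on {0..1} (\<lambda>x. H (x powr \<sigma>))"
      using \<sigma> by (intro continuous_on_compose2[OF contH] continuous_on_powr' continuous_intros) (auto intro!: powr_le1)
    fix x :: real assume x: "x \<in> {0<..<1}"
    have xs: "x powr \<sigma> \<in> {0<..<1}" using x \<sigma> powr_less_mono2[of \<sigma> x 1] by auto
    have "(H has_real_derivative h (x powr \<sigma>)) (at (x powr \<sigma>) within {0..1})"
      unfolding H_def using xs by (intro integral_has_real_derivative conth) auto
    then have "(H has_real_derivative h (x powr \<sigma>)) (at (x powr \<sigma>))"
      using xs by (simp add: at_within_Icc_at)
    then have "((\<lambda>x. H (x powr \<sigma>)) has_real_derivative h (x powr \<sigma>) * (\<sigma> * x powr (\<sigma> - 1))) (at x)"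
      by (rule DERIV_chain2) (use x in \<open>auto intro!: derivative_eq_intros\<close>)
    moreover have "h (x powr \<sigma>) = (1 - x) powr N" using x \<sigma> by (simp add: h_def powr_powr)
    ultimately show "((\<lambda>x. H (x powr \<sigma>)) has_vector_derivative
        \<sigma> * (x powr (\<sigma> - 1) * (1 - x) powr (N + 1 - 1))) (at x)"
      by (simp add: has_real_derivative_iff_has_vector_derivative mult_ac)
  qed simp
  moreover have "((\<lambda>x. \<sigma> * (x powr (\<sigma> - 1) * (1 - x) powr (N + 1 - 1))) has_integral (\<sigma> * Beta \<sigma> (N + 1))) {0..1}"
    using \<sigma> N by (intro has_integral_mult_right has_integral_Beta_real) auto
  ultimately have "H (1 powr \<sigma>) - H (0 powr \<sigma>) = \<sigma> * Beta \<sigma> (N + 1)"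
    by (rule has_integral_unique)
  then have "H 1 = \<sigma> * Beta \<sigma> (N + 1)" using \<sigma> by (simp add: H_def)
  moreover have "((\<lambda>y. complex_of_real (h y)) has_integral complex_of_real (H 1)) {0..1}"
    using has_integral_linear[OF hint bounded_linear_of_real] by (simp add: o_def)
  moreover have "complex_of_real (h y) = (1 + complex_of_real (y powr (1 / \<sigma>)) * (- 1)) powr complex_of_real N"
    if "y \<in> {0..1}" for y
  proof -
    have "complex_of_real (h y) = complex_of_real (1 - y powr (1 / \<sigma>)) powr complex_of_real N"
      using le1[OF that] unfolding h_def by (intro powr_of_real[symmetric]) auto
    then show ?thesis by simp
  qed
  ultimately have "((\<lambda>y. (1 + complex_of_real (y powr (1 / \<sigma>)) * (- 1)) powr complex_of_real N) has_integral
      complex_of_real (\<sigma> * Beta \<sigma> (N + 1))) {0..1}"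
    using has_integral_cong by (metis (no_types, lifting))
  then show ?thesis unfolding Q_def by (rule integral_unique)
qed

lemma one_plus_w_powr:
  assumes "\<bar>\<phi>\<bar> < pi"
  shows "(1 + w \<phi>) powr complex_of_real N = complex_of_real (R \<phi> powr N) * cis (N * (\<alpha> * \<phi>))"
proof -
  have R: "R \<phi> > 0" using R_pos assms by simp
  let ?z = "Complex (ln (R \<phi>)) (\<alpha> * \<phi>)"
  have "1 + w \<phi> = exp ?z"
    using one_plus_w[of \<phi>] assms R by (simp add: exp_eq_polar rcis_def)
  moreover have "Ln (exp ?z) = ?z" using mult_less_pi[of \<phi>] assms by (intro Ln_exp) auto
  ultimately have "(1 + w \<phi>) powr complex_of_real N = exp (complex_of_real N * ?z)"
    by (simp add: powr_def)
  also have "\<dots> = complex_of_real (exp (N * ln (R \<phi>))) * cis (N * (\<alpha> * \<phi>))"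
    by (simp add: exp_eq_polar)
  finally show ?thesis using R by (simp add: powr_def)
qed

text \<open>
  For the exponent \<open>\<sigma>\<close> the integrand is integrable at 0, so it has the primitive given by \<open>Q\<close>. The contour starts and ends at \<open>- 1\<close>, on the two
  sides of the cut, where \<open>w powr \<sigma>\<close> takes the values \<open>cis (\<mp> \<pi> \<sigma>)\<close> and \<open>Q\<close> is a Beta integral; the reflection
  formula turns the resulting \<open>sin (\<pi> \<sigma>)\<close> into Gamma values.
\<close>

lemma contour_integral_negative:
  assumes \<sigma>: "0 < \<sigma>" "\<sigma> < 1" and N: "0 < N"
  shows "((\<lambda>\<phi>. complex_of_real (R \<phi> powr N) * cis (N * (\<alpha> * \<phi>)) * exp (complex_of_real \<sigma> * lw \<phi>) * \<kappa> \<phi>) has_integral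
     complex_of_real (2 * pi * (Gamma (1 + N) * rGamma (1 - \<sigma>) * rGamma (1 + N + \<sigma>)))) {-pi..pi}"
proof -
  let ?\<tau> = "1 / \<sigma>" and ?N = "complex_of_real N" and ?s = "complex_of_real \<sigma>"
  define P where "P = (\<lambda>\<phi>. 1 / ?s * (exp (?s * lw \<phi>) * Q ?\<tau> N (exp (lw \<phi>))))"
  have contp: "continuous_on {0..1} (\<lambda>y. y powr ?\<tau>)" using \<sigma> by (intro continuous_on_powr' continuous_intros) auto
  have contpp: "continuous_on ({-pi..pi} \<times> {0..1}) (\<lambda>p. snd p powr ?\<tau>)"
    by (intro continuous_on_compose2[OF contp] continuous_intros) auto
  have contlw2: "continuous_on ({-pi..pi} \<times> {0..1::real}) (\<lambda>p. lw (fst p))"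
    by (intro continuous_on_compose2[OF cont_lw] continuous_intros) auto
  have w_pi: "w pi = -1" "w (- pi) = -1" by (simp_all add: w_def \<rho>_pi rcis_def complex_eq_iff)
  have contQ: "continuous_on {-pi..pi} (\<lambda>\<phi>. integral (cbox 0 1) (\<lambda>y. (1 + complex_of_real (y powr ?\<tau>) * exp (lw \<phi>)) powr ?N))"
  proof (rule integral_continuous_on_param)
    have *: "0 \<le> Re (1 + complex_of_real (y powr ?\<tau>) * exp (lw \<phi>)) \<or> Im (1 + complex_of_real (y powr ?\<tau>) * exp (lw \<phi>)) \<noteq> 0"
      if \<phi>: "\<phi> \<in> {-pi..pi}" and y: "y \<in> {0..1}" for \<phi> y :: real
    proof (cases "\<bar>\<phi>\<bar> < pi")
      case True
      then show ?thesis
        using slit_aux[OF w_slit[OF True], of "y powr ?\<tau>"] exp_lw[of \<phi>]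
        by (auto simp: complex_nonpos_Reals_iff)
    next
      case False
      then have "\<phi> = pi \<or> \<phi> = - pi" using \<phi> by (auto simp: abs_if split: if_splits)
      then have "exp (lw \<phi>) = -1" using exp_lw[of \<phi>] w_pi \<phi> by auto
      moreover have "y powr ?\<tau> \<le> 1" using y \<sigma> by (intro powr_le1) auto
      ultimately show ?thesis by simp
    qed
    show "continuous_on ({-pi..pi} \<times> cbox 0 1) (\<lambda>(\<phi>, y). (1 + complex_of_real (y powr ?\<tau>) * exp (lw \<phi>)) powr ?N)"
      unfolding case_prod_unfold cbox_interval
    proof (rule continuous_on_powr_complex)
      show "{- pi..pi} \<times> {0..1} \<subseteq> {p. 0 \<le> Re (1 + complex_of_real (snd p powr ?\<tau>) * exp (lw (fst p))) \<or>
          Im (1 + complex_of_real (snd p powr ?\<tau>) * exp (lw (fst p))) \<noteq> 0}"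
        using * by (intro subsetI CollectI) (metis mem_Times_iff)
    qed (use N in \<open>auto intro!: continuous_intros contpp contlw2\<close>)
  qed
  have "((\<lambda>\<phi>. \<i> * (complex_of_real (R \<phi> powr N) * cis (N * (\<alpha> * \<phi>)) * exp (?s * lw \<phi>) * \<kappa> \<phi>)) has_integral (P pi - P (- pi))) {-pi..pi}"
  proof (rule fundamental_theorem_of_calculus_interior)
    show "continuous_on {-pi..pi} P"
      unfolding P_def Q_def using contQ by (intro continuous_intros cont_lw) simp
    fix \<phi> assume "\<phi> \<in> {-pi<..<pi}"
    then have \<phi>: "\<bar>\<phi>\<bar> < pi" by (simp add: abs_less_iff)
    obtain D where D: "(Q ?\<tau> N has_field_derivative D) (at (w \<phi>))"
      "Q ?\<tau> N (w \<phi>) + complex_of_real ?\<tau> * w \<phi> * D = (1 + w \<phi>) powr ?N"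
      using Q_deriv[OF _ w_slit[OF \<phi>], of ?\<tau> N] \<sigma> by auto
    have ew: "exp (lw \<phi>) = w \<phi>" using exp_lw \<phi> by simp
    have l: "(lw has_vector_derivative \<i> * \<kappa> \<phi>) (at \<phi>)" using lw_deriv \<phi> by simp
    have "((\<lambda>\<phi>. exp (lw \<phi>)) has_vector_derivative \<i> * \<kappa> \<phi> * w \<phi>) (at \<phi>)"
      using field_vector_diff_chain_at[where f = lw and g = exp, OF l DERIV_exp] by (simp add: o_def ew)
    then have dQ: "((\<lambda>\<phi>. Q ?\<tau> N (exp (lw \<phi>))) has_vector_derivative \<i> * \<kappa> \<phi> * w \<phi> * D) (at \<phi>)"
      using field_vector_diff_chain_at[where f = "\<lambda>\<phi>. exp (lw \<phi>)" and g = "Q ?\<tau> N"] D(1) by (simp add: o_def ew)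
    have "((\<lambda>\<phi>. exp (?s * lw \<phi>)) has_vector_derivative ?s * (\<i> * \<kappa> \<phi>) * exp (?s * lw \<phi>)) (at \<phi>)"
      using field_vector_diff_chain_at[where f = "\<lambda>\<phi>. ?s * lw \<phi>" and g = exp, OF has_vector_derivative_mult_right[OF l] DERIV_exp]
      by (simp add: o_def)
    from has_vector_derivative_mult_right[OF has_vector_derivative_mult[OF this dQ], of "1 / ?s"]
    have "(P has_vector_derivative 1 / ?s * (exp (?s * lw \<phi>) * (\<i> * \<kappa> \<phi> * w \<phi> * D) +
        ?s * (\<i> * \<kappa> \<phi>) * exp (?s * lw \<phi>) * Q ?\<tau> N (exp (lw \<phi>)))) (at \<phi>)"
      unfolding P_def .
    moreover have "1 / ?s * (exp (?s * lw \<phi>) * (\<i> * \<kappa> \<phi> * w \<phi> * D) +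
        ?s * (\<i> * \<kappa> \<phi>) * exp (?s * lw \<phi>) * Q ?\<tau> N (exp (lw \<phi>)))
        = \<i> * \<kappa> \<phi> * exp (?s * lw \<phi>) * (Q ?\<tau> N (w \<phi>) + complex_of_real ?\<tau> * w \<phi> * D)"
      using \<sigma> by (simp add: ew field_simps)
    ultimately show "(P has_vector_derivative
        \<i> * (complex_of_real (R \<phi> powr N) * cis (N * (\<alpha> * \<phi>)) * exp (?s * lw \<phi>) * \<kappa> \<phi>)) (at \<phi>)"
      unfolding D(2) one_plus_w_powr[OF \<phi>] by (simp add: mult_ac)
  qed simp
  moreover have "P pi - P (- pi) = \<i> * complex_of_real (2 * sin (pi * \<sigma>) * Beta \<sigma> (N + 1))"
  proof -
    have e1: "exp (?s * lw pi) = cis (pi * \<sigma>)" "exp (?s * lw (- pi)) = cis (- (pi * \<sigma>))"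
      by (simp_all add: lw_def \<rho>_pi exp_eq_polar mult.commute)
    have "P pi - P (- pi) = 1 / ?s * ((cis (pi * \<sigma>) - cis (- (pi * \<sigma>))) * Q ?\<tau> N (-1))"
      using exp_lw[of pi] exp_lw[of "- pi"] w_pi by (simp add: P_def e1 algebra_simps)
    also have "cis (pi * \<sigma>) - cis (- (pi * \<sigma>)) = \<i> * complex_of_real (2 * sin (pi * \<sigma>))"
      by (simp add: complex_eq_iff)
    finally show ?thesis using \<sigma> unfolding Q_minus_one[OF \<sigma>(1) N] by simp
  qed
  ultimately have "((\<lambda>\<phi>. \<i> * (complex_of_real (R \<phi> powr N) * cis (N * (\<alpha> * \<phi>)) * exp (?s * lw \<phi>) * \<kappa> \<phi>)) has_integral
      \<i> * complex_of_real (2 * sin (pi * \<sigma>) * Beta \<sigma> (N + 1))) {-pi..pi}" by simp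
  from has_integral_mult_right[OF this, of "- \<i>"]
  have "((\<lambda>\<phi>. complex_of_real (R \<phi> powr N) * cis (N * (\<alpha> * \<phi>)) * exp (?s * lw \<phi>) * \<kappa> \<phi>) has_integral
      complex_of_real (2 * sin (pi * \<sigma>) * Beta \<sigma> (N + 1))) {-pi..pi}" by (simp flip: mult.assoc)
  moreover have "2 * sin (pi * \<sigma>) * Beta \<sigma> (N + 1) = 2 * pi * (Gamma (1 + N) * rGamma (1 - \<sigma>) * rGamma (1 + N + \<sigma>))"
  proof -
    have "complex_of_real (rGamma \<sigma> * rGamma (1 - \<sigma>)) = complex_of_real (sin (pi * \<sigma>) / pi)"
    proof -
      have "complex_of_real (rGamma \<sigma> * rGamma (1 - \<sigma>)) = rGamma ?s * rGamma (1 - ?s)"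
        using rGamma_complex_of_real[of "1 - \<sigma>"] by (simp add: rGamma_complex_of_real)
      also have "\<dots> = complex_of_real (sin (pi * \<sigma>) / pi)"
        unfolding rGamma_reflection_complex of_real_divide sin_of_real[symmetric] of_real_mult ..
      finally show ?thesis .
    qed
    then have "rGamma \<sigma> * rGamma (1 - \<sigma>) = sin (pi * \<sigma>) / pi" by (simp only: of_real_eq_iff)
    then have "sin (pi * \<sigma>) * Gamma \<sigma> = pi * rGamma (1 - \<sigma>) * (rGamma \<sigma> * Gamma \<sigma>)" by (simp add: field_simps)
    also have "rGamma \<sigma> * Gamma \<sigma> = 1" using Gamma_real_pos[OF \<sigma>(1)] by (simp add: rGamma_inverse_Gamma)
    finally show ?thesis by (simp add: Beta_altdef add_ac mult_ac)
  qed
  ultimately show ?thesis by simp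
qed

text \<open>
  For integers this is Cauchy's formula for the binomial coefficients in \<open>(1 + w)\<^sup>N\<close>. For a real
  exponent the integrand is not single-valued, but the contour meets the cut only at \<open>- 1\<close>, where \<open>(1 + w)\<^sup>N\<close>
  vanishes. Both sides are entire in \<open>q\<close>, so the case \<open>- 1 < q < 0\<close> suffices.
\<close>

theorem contour_integral_binomial:
  assumes N: "0 < N"
  shows "((\<lambda>\<phi>. complex_of_real (R \<phi> powr N) * cis (N * (\<alpha> * \<phi>)) * exp (- complex_of_real q * lw \<phi>) * \<kappa> \<phi>) has_integral
     complex_of_real (2 * pi * (Gamma (1 + N) * rGamma (1 + q) * rGamma (1 + N - q)))) {-pi..pi}"
proof -
  define F where "F = (\<lambda>q \<phi>. complex_of_real (R \<phi> powr N) * cis (N * (\<alpha> * \<phi>)) * exp (- q * lw \<phi>) * \<kappa> \<phi>)"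
  have contR: "continuous_on {-pi..pi} (\<lambda>\<phi>. R \<phi> powr N)"
    using N R_nonneg by (intro continuous_on_powr' cont_R continuous_intros) (auto simp: abs_le_iff)
  have contc: "continuous_on {-pi..pi} (\<lambda>\<phi>. cis (N * (\<alpha> * \<phi>)))"
    unfolding cis_conv_exp by (intro continuous_intros)
  have contF: "continuous_on {-pi..pi} (F q)" for q
    unfolding F_def by (intro continuous_intros contR contc cont_lw cont_\<kappa>)
  have snd: "continuous_on (UNIV \<times> {-pi..pi}) (\<lambda>p. g (snd p))" if "continuous_on {-pi..pi} g" for g :: "real \<Rightarrow> complex"
    by (rule continuous_on_compose2[OF that]) (auto intro!: continuous_intros)
  have "(\<lambda>q. integral (cbox (-pi) pi) (F q)) holomorphic_on UNIV"
  proof (rule leibniz_rule_holomorphic[where fx = "\<lambda>q \<phi>. - lw \<phi> * F q \<phi>"])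
    fix q \<phi> show "((\<lambda>q. F q \<phi>) has_field_derivative - lw \<phi> * F q \<phi>) (at q within UNIV)"
      unfolding F_def by (auto intro!: derivative_eq_intros)
  next
    fix q show "F q integrable_on cbox (-pi) pi" using contF by (simp add: integrable_continuous_real)
  next
    have "continuous_on (UNIV \<times> {-pi..pi}) (\<lambda>p. - lw (snd p) * (complex_of_real (R (snd p) powr N) *
        cis (N * (\<alpha> * snd p)) * exp (- fst p * lw (snd p)) * \<kappa> (snd p)))"
      by (intro continuous_intros snd cont_lw cont_\<kappa> contc snd[OF continuous_on_of_real[OF contR]])
    then show "continuous_on (UNIV \<times> cbox (-pi) pi) (\<lambda>(q, \<phi>). - lw \<phi> * F q \<phi>)"
      by (simp add: case_prod_unfold F_def)
  qed auto
  then have hol: "(\<lambda>q. integral {-pi..pi} (F q) - 2 * pi * (Gamma (1 + N) * rGamma (1 + q) * rGamma (1 + N - q))) holomorphic_on UNIV"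
    by (intro holomorphic_intros) simp_all
  have "integral {-pi..pi} (F (complex_of_real q)) - 2 * pi * (Gamma (1 + N) * rGamma (1 + complex_of_real q) * rGamma (1 + N - complex_of_real q)) = 0"
  proof (rule analytic_continuation[OF hol])
    show "complex_of_real ` {-1<..<0} \<subseteq> UNIV" "complex_of_real q \<in> UNIV" "complex_of_real (- 1 / 2) \<in> UNIV" by auto
    show "complex_of_real (- 1 / 2) islimpt complex_of_real ` {-1<..<0}"
    proof -
      define c where "c = (- 1 / 2 :: real)"
      have "c islimpt {-1<..<0}" unfolding c_def by (intro interior_limit_point) auto
      then obtain f where f: "\<And>n. f n \<in> {-1<..<0} - {c}" "f \<longlonglongrightarrow> c"
        unfolding islimpt_sequential by blast
      have "complex_of_real c islimpt complex_of_real ` {-1<..<0}"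
        unfolding islimpt_sequential using f
        by (intro exI[of _ "\<lambda>n. complex_of_real (f n)"]) (auto intro!: tendsto_of_real simp: image_iff)
      then show ?thesis unfolding c_def .
    qed
    fix z assume "z \<in> complex_of_real ` {-1<..<0}"
    then obtain x where x: "z = complex_of_real x" "-1 < x" "x < 0" by auto
    have "(F z has_integral complex_of_real (2 * pi * (Gamma (1 + N) * rGamma (1 + x) * rGamma (1 + N - x)))) {-pi..pi}"
      using contour_integral_negative[of "- x" N] x N by (simp add: F_def)
    then have "integral {-pi..pi} (F z) = complex_of_real (2 * pi * (Gamma (1 + N) * rGamma (1 + x) * rGamma (1 + N - x)))"
      by (rule integral_unique)
    then show "integral {-pi..pi} (F z) - 2 * pi * (Gamma (1 + N) * rGamma (1 + z) * rGamma (1 + N - z)) = 0"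
      by (simp add: x(1) flip: rGamma_complex_of_real)
  qed auto
  then have "integral {-pi..pi} (F (complex_of_real q)) = complex_of_real (2 * pi * (Gamma (1 + N) * rGamma (1 + q) * rGamma (1 + N - q)))"
    by (simp flip: rGamma_complex_of_real)
  then show ?thesis
    using integrable_integral[OF integrable_continuous_real[OF contF[of "complex_of_real q"]]] unfolding F_def by simp
qed

end

section \<open>Quotients of Gamma functions preserve summability\<close>

text \<open>
  Euler's integral has the positive nodes \<open>x powr s1 * (1 - x) powr s\<close>.
\<close>

lemma narrow_moment_Beta:
  assumes "s1 > 0" "s > 0"
  shows "narrow_moment (\<lambda>n. complex_of_real (Beta (1 + s1 * real n) (1 + s * real n)))"
  unfolding narrow_moment_def
proof (intro allI impI)
  fix \<eta> :: real assume \<eta>: "\<eta> > 0"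
  define p where "p = (\<lambda>x::real. x powr s1 * (1 - x) powr s)"
  have "complex_of_real (Beta (1 + s1 * real n) (1 + s * real n)) = integral {0..1} (\<lambda>x. 1 * complex_of_real (p x) ^ n)" for n
  proof -
    have "((\<lambda>x. x powr (1 + s1 * real n - 1) * (1 - x) powr (1 + s * real n - 1)) has_integral
        Beta (1 + s1 * real n) (1 + s * real n)) {0..1}"
      using assms by (intro has_integral_Beta_real) (auto intro: add_pos_nonneg)
    then have "((\<lambda>x. p x ^ n) has_integral Beta (1 + s1 * real n) (1 + s * real n)) {0..1}"
    proof (rule has_integral_spike_finite[rotated 2, of _ _ _ "{0, 1}"])
      fix x :: real assume "x \<in> {0..1} - {0, 1}"
      then have x: "0 < x" "x < 1" by auto
      show "p x ^ n = x powr (1 + s1 * real n - 1) * (1 - x) powr (1 + s * real n - 1)"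
        using x by (simp add: p_def power_mult_distrib powr_powr flip: powr_realpow)
    qed auto
    from has_integral_linear[OF this bounded_linear_of_real]
    have "((\<lambda>x. 1 * complex_of_real (p x) ^ n) has_integral complex_of_real (Beta (1 + s1 * real n) (1 + s * real n))) {0..1}"
      by (simp add: o_def)
    then show ?thesis by (simp add: integral_unique)
  qed
  moreover have "continuous_on {0..1} (\<lambda>x. complex_of_real (p x))"
    unfolding p_def using assms by (intro continuous_intros continuous_on_powr') auto
  moreover have "\<exists>R \<theta>. 0 \<le> R \<and> \<bar>\<theta>\<bar> \<le> \<eta> \<and> complex_of_real (p x) = rcis R \<theta>" for x
    using \<eta> by (intro exI[of _ "p x"] exI[of _ 0]) (auto simp: rcis_def p_def)
  ultimately show "\<exists>a b \<kappa> \<psi>. a \<le> b \<and> continuous_on {a..b} \<kappa> \<and> continuous_on {a..b} \<psi> \<and>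
     (\<forall>x\<in>{a..b::real}. \<exists>R \<theta>. 0 \<le> R \<and> \<bar>\<theta>\<bar> \<le> \<eta> \<and> \<psi> x = rcis R \<theta>) \<and>
     (\<forall>n. complex_of_real (Beta (1 + s1 * real n) (1 + s * real n)) = integral {a..b} (\<lambda>x. \<kappa> x * \<psi> x ^ n))"
    by (intro exI[of _ 0] exI[of _ 1] exI[of _ "\<lambda>_. 1"] exI[of _ "\<lambda>x. complex_of_real (p x)"]) auto
qed

lemma has_integral_cis:
  "((\<lambda>\<theta>. cis (of_int m * \<theta>)) has_integral (if m = 0 then 2 * complex_of_real pi else 0)) {-pi..pi}"
proof (cases "m = 0")
  case True
  then show ?thesis using has_integral_const_real[of "1::complex" "-pi" pi] by (simp add: scaleR_conv_of_real)
next
  case False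
  define c where "c = \<i> * complex_of_int m"
  have c: "c \<noteq> 0" using False by (simp add: c_def)
  have e: "cis (of_int m * \<theta>) = exp (c * complex_of_real \<theta>)" for \<theta>
    by (simp add: cis_conv_exp c_def mult_ac)
  have "((\<lambda>\<theta>. exp (c * complex_of_real \<theta>)) has_integral (1 / c * exp (c * complex_of_real pi) - 1 / c * exp (c * complex_of_real (- pi)))) {-pi..pi}"
  proof (rule fundamental_theorem_of_calculus)
    fix \<theta> :: real
    have "((\<lambda>z. 1 / c * exp (c * z)) has_field_derivative exp (c * complex_of_real \<theta>)) (at (complex_of_real \<theta>))"
      using c by (auto intro!: derivative_eq_intros)
    from has_vector_derivative_real_field[OF this]
    show "((\<lambda>\<theta>. 1 / c * exp (c * complex_of_real \<theta>)) has_vector_derivative exp (c * complex_of_real \<theta>)) (at \<theta> within {-pi..pi})"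
      by (simp add: has_vector_derivative_at_within)
  qed simp
  moreover have "exp (c * complex_of_real pi) = exp (c * complex_of_real (- pi))"
    unfolding e[symmetric] by (simp add: complex_eq_iff sin_zero_iff_int2)
  ultimately show ?thesis using False unfolding e by simp
qed

lemma abs_Arg_le:
  assumes "Re z > 0" shows "\<bar>Arg z\<bar> \<le> \<bar>Im z\<bar> / Re z"
  using abs_arctan_le[of "Im z / Re z"] arg_conv_arctan[OF assms] assms by (simp add: abs_divide)

text \<open>
  The value and the derivative of \<open>w\<^sup>n\<close> at \<open>w = 1\<close> are Cauchy integrals over a circle around 1, and the points of a
  small circle have small arguments.
\<close>

lemma narrow_moment_linear:
  assumes "S \<ge> 0"
  shows "narrow_moment (\<lambda>n. complex_of_real (1 + S * real n))"
  unfolding narrow_moment_def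
proof (intro allI impI)
  fix \<eta> :: real assume \<eta>: "\<eta> > 0"
  \<comment> \<open>The points of the circle of radius \<open>\<delta>\<close> around 1 have arguments of at most \<open>\<delta> / (1 - \<delta>) = \<eta>\<close>.\<close>
  define \<delta> where "\<delta> = \<eta> / (1 + \<eta>)"
  have \<delta>: "0 < \<delta>" "\<delta> < 1" "\<delta> / (1 - \<delta>) = \<eta>" using \<eta> by (auto simp: \<delta>_def field_simps)
  define \<psi> where "\<psi> = (\<lambda>\<theta>. 1 + complex_of_real \<delta> * cis \<theta>)"
  define \<kappa> where "\<kappa> = (\<lambda>\<theta>. (1 + complex_of_real (S / \<delta>) * cis (- \<theta>)) / (2 * complex_of_real pi))"
  have "complex_of_real (1 + S * real n) = integral {-pi..pi} (\<lambda>\<theta>. \<kappa> \<theta> * \<psi> \<theta> ^ n)" for n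
  proof -
    let ?c = "\<lambda>k. complex_of_real (real (n choose k) * \<delta> ^ k)"
    let ?I = "\<lambda>m::int. if m = 0 then 2 * complex_of_real pi else 0"
    have "((\<lambda>\<theta>. \<Sum>k\<le>n. ?c k * (cis (of_int (int k) * \<theta>) + complex_of_real (S / \<delta>) * cis (of_int (int k - 1) * \<theta>)))
        has_integral (\<Sum>k\<le>n. ?c k * (?I (int k) + complex_of_real (S / \<delta>) * ?I (int k - 1)))) {-pi..pi}"
      by (intro has_integral_sum has_integral_mult_right has_integral_add has_integral_cis) auto
    moreover have "(\<Sum>k\<le>n. ?c k * (cis (of_int (int k) * \<theta>) + complex_of_real (S / \<delta>) * cis (of_int (int k - 1) * \<theta>)))
        = (1 + complex_of_real (S / \<delta>) * cis (- \<theta>)) * \<psi> \<theta> ^ n" for \<theta>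
    proof -
      have "\<psi> \<theta> ^ n = (\<Sum>k\<le>n. ?c k * cis (of_int (int k) * \<theta>))"
        unfolding \<psi>_def add.commute[of 1] binomial_ring
        by (intro sum.cong refl) (simp add: power_mult_distrib Complex.DeMoivre)
      moreover have "cis (of_int (int k - 1) * \<theta>) = cis (- \<theta>) * cis (of_int (int k) * \<theta>)" for k
        by (simp add: cis_mult algebra_simps)
      ultimately show ?thesis by (simp add: sum_distrib_left algebra_simps)
    qed
    moreover have "(\<Sum>k\<le>n. ?c k * (?I (int k) + complex_of_real (S / \<delta>) * ?I (int k - 1)))
        = 2 * complex_of_real pi * complex_of_real (1 + S * real n)"
    proof -
      have "?c k * (?I (int k) + complex_of_real (S / \<delta>) * ?I (int k - 1)) =
          (if k = 0 then 2 * complex_of_real pi else 0) +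
          (if k = 1 then 2 * complex_of_real pi * complex_of_real (S * real n) else 0)" for k
        using \<delta> by auto
      then have "(\<Sum>k\<le>n. ?c k * (?I (int k) + complex_of_real (S / \<delta>) * ?I (int k - 1))) =
          (\<Sum>k\<le>n. if k = 0 then 2 * complex_of_real pi else 0) +
          (\<Sum>k\<le>n. if k = 1 then 2 * complex_of_real pi * complex_of_real (S * real n) else 0)"
        by (simp add: sum.distrib)
      also have "\<dots> = 2 * complex_of_real pi * complex_of_real (1 + S * real n)"
        by (cases "n = 0") (auto simp: sum.delta algebra_simps)
      finally show ?thesis .
    qed
    ultimately have "((\<lambda>\<theta>. (1 + complex_of_real (S / \<delta>) * cis (- \<theta>)) * \<psi> \<theta> ^ n) has_integral
        2 * complex_of_real pi * complex_of_real (1 + S * real n)) {-pi..pi}" by simp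
    from has_integral_divide[OF this, of "2 * complex_of_real pi"]
    have "((\<lambda>\<theta>. \<kappa> \<theta> * \<psi> \<theta> ^ n) has_integral complex_of_real (1 + S * real n)) {-pi..pi}"
      by (simp add: \<kappa>_def)
    then show ?thesis by (simp add: integral_unique)
  qed
  moreover have "continuous_on {-pi..pi} \<kappa>" "continuous_on {-pi..pi} \<psi>"
    unfolding \<kappa>_def \<psi>_def cis_conv_exp by (intro continuous_intros; simp)+
  moreover have "\<exists>R t. 0 \<le> R \<and> \<bar>t\<bar> \<le> \<eta> \<and> \<psi> \<theta> = rcis R t" for \<theta>
  proof (intro exI conjI)
    show "\<psi> \<theta> = rcis (cmod (\<psi> \<theta>)) (Arg (\<psi> \<theta>))" by (simp add: rcis_cmod_Arg)
    have "\<delta> * cos \<theta> \<ge> \<delta> * (- 1)" using \<delta> by (intro mult_left_mono) auto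
    then have re: "Re (\<psi> \<theta>) \<ge> 1 - \<delta>" by (simp add: \<psi>_def)
    have im: "\<bar>Im (\<psi> \<theta>)\<bar> \<le> \<delta>"
      using \<delta> by (simp add: \<psi>_def abs_mult mult_left_le)
    have "\<bar>Arg (\<psi> \<theta>)\<bar> \<le> \<bar>Im (\<psi> \<theta>)\<bar> / Re (\<psi> \<theta>)" using re \<delta> by (intro abs_Arg_le) auto
    also have "\<dots> \<le> \<delta> / (1 - \<delta>)" using re im \<delta> by (intro frac_le) auto
    finally show "\<bar>Arg (\<psi> \<theta>)\<bar> \<le> \<eta>" using \<delta> by simp
  qed auto
  ultimately show "\<exists>a b \<kappa> \<psi>. a \<le> b \<and> continuous_on {a..b} \<kappa> \<and> continuous_on {a..b} \<psi> \<and>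
     (\<forall>x\<in>{a..b::real}. \<exists>R \<theta>. 0 \<le> R \<and> \<bar>\<theta>\<bar> \<le> \<eta> \<and> \<psi> x = rcis R \<theta>) \<and>
     (\<forall>n. complex_of_real (1 + S * real n) = integral {a..b} (\<lambda>x. \<kappa> x * \<psi> x ^ n))"
    by (intro exI[of _ "-pi"] exI[of _ pi] exI[of _ \<kappa>] exI[of _ \<psi>]) auto
qed

context contour
begin

lemma cont_R_powr: "N > 0 \<Longrightarrow> continuous_on {-pi..pi} (\<lambda>\<phi>. R \<phi> powr N)"
  using R_nonneg by (intro continuous_on_powr' cont_R continuous_intros) (auto simp: abs_le_iff)

lemma exp_neg_lw: "\<bar>\<phi>\<bar> \<le> pi \<Longrightarrow> exp (- complex_of_real q * lw \<phi>) = complex_of_real (\<rho> \<phi> powr (- q)) * cis (- q * \<phi>)"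
  using \<rho>_pos[of \<phi>] by (simp add: lw_def exp_eq_polar powr_def)

text \<open>
  The factors \<open>(1 + w) powr \<sigma>\<close> and \<open>((1 + w) / w) powr \<sigma>\<close> along the contour. The argument of \<open>A\<close> is at most
  \<open>\<sigma> \<alpha> \<pi>\<close>, which is small for small \<open>\<alpha>\<close>, whereas \<open>B\<close> winds around the origin.
\<close>

definition A :: "real \<Rightarrow> real \<Rightarrow> complex" where "A \<sigma> \<phi> = rcis (R \<phi> powr \<sigma>) (\<sigma> * (\<alpha> * \<phi>))"
definition B :: "real \<Rightarrow> real \<Rightarrow> complex" where "B \<sigma> \<phi> = A \<sigma> \<phi> * exp (- complex_of_real \<sigma> * lw \<phi>)"

lemma cont_A: "\<sigma> > 0 \<Longrightarrow> continuous_on {-pi..pi} (A \<sigma>)"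
  unfolding A_def rcis_def cis_conv_exp by (intro continuous_intros cont_R_powr)

lemma cont_B: "\<sigma> > 0 \<Longrightarrow> continuous_on {-pi..pi} (B \<sigma>)"
  unfolding B_def by (intro continuous_intros cont_A cont_lw)

lemma integral_binomial_powers:
  assumes \<sigma>: "\<sigma> > 0"
  shows "((\<lambda>\<phi>. \<kappa> \<phi> * A \<sigma> \<phi> ^ n * B \<sigma> \<phi> ^ j) has_integral complex_of_real (2 * pi *
     (Gamma_seq \<sigma> (n + j) / (Gamma_seq \<sigma> n * Gamma_seq \<sigma> j)))) {-pi..pi}"
proof (cases "n + j = 0")
  case True
  then show ?thesis using integral_\<kappa> by (simp add: Gamma_seq_def)
next
  case False
  define N where "N = \<sigma> * real (n + j)"
  have "real (n + j) > 0" using False by linarith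
  then have N: "N > 0" using \<sigma> unfolding N_def by (rule mult_pos_pos[rotated])
  have I: "((\<lambda>\<phi>. complex_of_real (R \<phi> powr N) * cis (N * (\<alpha> * \<phi>)) * exp (- complex_of_real (\<sigma> * real j) * lw \<phi>) * \<kappa> \<phi>) has_integral
     complex_of_real (2 * pi * (Gamma (1 + N) * rGamma (1 + \<sigma> * real j) * rGamma (1 + N - \<sigma> * real j)))) {-pi..pi}"
    by (rule contour_integral_binomial[OF N])
  have eq: "complex_of_real (R \<phi> powr N) * cis (N * (\<alpha> * \<phi>)) * exp (- complex_of_real (\<sigma> * real j) * lw \<phi>) * \<kappa> \<phi>
      = \<kappa> \<phi> * A \<sigma> \<phi> ^ n * B \<sigma> \<phi> ^ j" if "\<phi> \<in> {-pi..pi}" for \<phi>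
  proof -
    have "R \<phi> \<ge> 0" using R_nonneg that by (auto simp: abs_le_iff)
    then have "(R \<phi> powr \<sigma>) ^ (n + j) = R \<phi> powr N"
      using False by (cases "R \<phi> = 0") (auto simp: N_def powr_powr simp flip: powr_realpow)
    then have "A \<sigma> \<phi> ^ (n + j) = rcis (R \<phi> powr N) (N * (\<alpha> * \<phi>))"
      by (simp only: A_def DeMoivre2) (simp add: N_def mult_ac)
    moreover have "exp (- complex_of_real (\<sigma> * real j) * lw \<phi>) = exp (- complex_of_real \<sigma> * lw \<phi>) ^ j"
      by (simp add: mult_ac flip: exp_of_nat_mult)
    ultimately show ?thesis
      by (simp add: B_def power_mult_distrib power_add rcis_def mult_ac)
  qed
  have "((\<lambda>\<phi>. \<kappa> \<phi> * A \<sigma> \<phi> ^ n * B \<sigma> \<phi> ^ j) has_integral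
      complex_of_real (2 * pi * (Gamma (1 + N) * rGamma (1 + \<sigma> * real j) * rGamma (1 + N - \<sigma> * real j)))) {-pi..pi}"
    by (rule has_integral_eq[OF eq I])
  moreover have "1 + N - \<sigma> * real j = 1 + \<sigma> * real n" by (simp add: N_def algebra_simps)
  ultimately show ?thesis
    by (simp add: Gamma_seq_def N_def rGamma_inverse_Gamma field_simps)
qed

end

text \<open>
  With \<open>\<alpha> = s / (s1 + s)\<close> the arguments of \<open>(1 + w) powr (s1 + s)\<close> and \<open>w powr s\<close> agree along the
  contour, so the nodes are positive.
\<close>

lemma narrow_moment_binomial:
  assumes "s1 > 0" "s > 0"
  shows "narrow_moment (\<lambda>n. complex_of_real (Gamma_seq (s1 + s) n / (Gamma_seq s1 n * Gamma_seq s n)))"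
  unfolding narrow_moment_def
proof (intro allI impI)
  fix \<eta> :: real assume \<eta>: "\<eta> > 0"
  define \<alpha> where "\<alpha> = s / (s1 + s)"
  interpret contour \<alpha> by unfold_locales (use assms in \<open>auto simp: \<alpha>_def\<close>)
  define p where "p = (\<lambda>\<phi>. R \<phi> powr (s1 + s) * \<rho> \<phi> powr (- s))"
  have "complex_of_real (Gamma_seq (s1 + s) n / (Gamma_seq s1 n * Gamma_seq s n))
      = integral {-pi..pi} (\<lambda>\<phi>. \<kappa> \<phi> / (2 * pi) * complex_of_real (p \<phi>) ^ n)" for n
  proof (cases "n = 0")
    case True
    then show ?thesis using integral_unique[OF integral_\<kappa>] by (simp add: Gamma_seq_def)
  next
    case False
    define N where "N = (s1 + s) * real n"
    have N: "N > 0" using False assms by (simp add: N_def)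
    have I: "((\<lambda>\<phi>. complex_of_real (R \<phi> powr N) * cis (N * (\<alpha> * \<phi>)) * exp (- complex_of_real (s * real n) * lw \<phi>) * \<kappa> \<phi>) has_integral
       complex_of_real (2 * pi * (Gamma (1 + N) * rGamma (1 + s * real n) * rGamma (1 + N - s * real n)))) {-pi..pi}"
      by (rule contour_integral_binomial[OF N])
    have eq: "complex_of_real (R \<phi> powr N) * cis (N * (\<alpha> * \<phi>)) * exp (- complex_of_real (s * real n) * lw \<phi>) * \<kappa> \<phi>
        = \<kappa> \<phi> * complex_of_real (p \<phi>) ^ n" if "\<phi> \<in> {-pi..pi}" for \<phi>
    proof -
      have \<phi>: "\<bar>\<phi>\<bar> \<le> pi" using that by (simp add: abs_le_iff)
      have "R \<phi> \<ge> 0" "\<rho> \<phi> > 0" using R_nonneg \<rho>_pos \<phi> by auto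
      then have pn: "p \<phi> ^ n = R \<phi> powr N * \<rho> \<phi> powr (- (s * real n))"
        using False by (cases "R \<phi> = 0")
          (auto simp: p_def N_def powr_powr power_mult_distrib simp flip: powr_realpow)
      have Na: "N * (\<alpha> * \<phi>) = s * real n * \<phi>" using assms by (simp add: N_def \<alpha>_def)
      show ?thesis
        unfolding exp_neg_lw[OF \<phi>] of_real_power[symmetric] pn Na by (simp add: cis_mult mult_ac)
    qed
    have "((\<lambda>\<phi>. \<kappa> \<phi> * complex_of_real (p \<phi>) ^ n) has_integral
        complex_of_real (2 * pi * (Gamma (1 + N) * rGamma (1 + s * real n) * rGamma (1 + N - s * real n)))) {-pi..pi}"
      by (rule has_integral_eq[OF eq I])
    from has_integral_divide[OF this, of "2 * complex_of_real pi"]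
    have "((\<lambda>\<phi>. \<kappa> \<phi> / (2 * pi) * complex_of_real (p \<phi>) ^ n) has_integral
        complex_of_real (Gamma (1 + N) * rGamma (1 + s * real n) * rGamma (1 + N - s * real n))) {-pi..pi}"
      by simp
    moreover have e: "1 + N - s * real n = 1 + s1 * real n" by (simp add: N_def algebra_simps)
    have "Gamma (1 + N) * rGamma (1 + s * real n) * rGamma (1 + N - s * real n)
        = Gamma_seq (s1 + s) n / (Gamma_seq s1 n * Gamma_seq s n)"
      unfolding e by (simp add: Gamma_seq_def N_def rGamma_inverse_Gamma divide_inverse mult_ac)
    ultimately show ?thesis by (simp only: integral_unique)
  qed
  moreover have "continuous_on {-pi..pi} (\<lambda>\<phi>. complex_of_real (p \<phi>))"
  proof -
    have pos: "\<rho> x > 0" if "x \<in> {-pi..pi}" for x using \<rho>_pos[of x] that by (simp add: abs_le_iff)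
    have "continuous_on {-pi..pi} (\<lambda>\<phi>. \<rho> \<phi> powr (- s))"
      by (intro continuous_on_powr' cont_\<rho> continuous_on_const) (use pos in force)
    then show ?thesis
      unfolding p_def using cont_R_powr[of "s1 + s"] assms by (intro continuous_on_of_real continuous_on_mult) auto
  qed
  moreover have "continuous_on {-pi..pi} (\<lambda>\<phi>. \<kappa> \<phi> / (2 * complex_of_real pi))"
    by (intro continuous_intros cont_\<kappa>) auto
  moreover have "\<exists>R \<theta>. 0 \<le> R \<and> \<bar>\<theta>\<bar> \<le> \<eta> \<and> complex_of_real (p x) = rcis R \<theta>" for x
    using \<eta> by (intro exI[of _ "p x"] exI[of _ 0]) (auto simp: rcis_def p_def)
  ultimately show "\<exists>a b \<kappa> \<psi>. a \<le> b \<and> continuous_on {a..b} \<kappa> \<and> continuous_on {a..b} \<psi> \<and>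
     (\<forall>x\<in>{a..b::real}. \<exists>R \<theta>. 0 \<le> R \<and> \<bar>\<theta>\<bar> \<le> \<eta> \<and> \<psi> x = rcis R \<theta>) \<and>
     (\<forall>n. complex_of_real (Gamma_seq (s1 + s) n / (Gamma_seq s1 n * Gamma_seq s n)) = integral {a..b} (\<lambda>x. \<kappa> x * \<psi> x ^ n))"
    by (intro exI[of _ "-pi"] exI[of _ pi] exI[of _ "\<lambda>\<phi>. \<kappa> \<phi> / (2 * complex_of_real pi)"] exI[of _ "\<lambda>x. complex_of_real (p x)"]) auto
qed

lemma Gamma_seq_pos: "s \<ge> 0 \<Longrightarrow> Gamma_seq s n > 0"
  by (simp add: Gamma_seq_def Gamma_real_pos add_pos_nonneg)

lemma Gamma_seq_0 [simp]: "Gamma_seq s 0 = 1" "Gamma_seq 0 n = 1"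
  by (simp_all add: Gamma_seq_def)

text \<open>
  Preservation is an equivalence, so both the sequence and its inverse have to act. The inverse is the
  Beta sequence times the linear sequence with slope \<open>s1 + s\<close>, by the functional equation of the Gamma function.
\<close>

theorem preserves_summability_binomial:
  assumes "s1 \<ge> 0" "s > 0"
  shows "preserves_summability (\<lambda>n. Gamma_seq (s1 + s) n / (Gamma_seq s1 n * Gamma_seq s n))"
proof (cases "s1 = 0")
  case True
  then have "(\<lambda>n. Gamma_seq (s1 + s) n / (Gamma_seq s1 n * Gamma_seq s n)) = (\<lambda>n. 1)"
    using Gamma_seq_pos[of s] assms by (auto simp: less_imp_neq[symmetric])
  moreover have "borel_transform E (\<lambda>n. 1) u = u" if "complex_banach E" "\<forall>n. u n \<in> carrier E" for E :: "(nat \<Rightarrow> complex) nmodule" and u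
  proof -
    interpret banach_mod E using that by (simp add: complex_banach_iff)
    show ?thesis using that by (auto simp: borel_transform_def)
  qed
  ultimately show ?thesis by (auto simp: preserves_summability_def)
next
  case False
  then have s1: "s1 > 0" using assms by simp
  define b where "b = (\<lambda>n. Gamma_seq (s1 + s) n / (Gamma_seq s1 n * Gamma_seq s n))"
  have b: "b n > 0" for n unfolding b_def using Gamma_seq_pos assms by auto
  have inv: "1 / b n = (1 + (s1 + s) * real n) * Beta (1 + s1 * real n) (1 + s * real n)" for n
  proof -
    have p: "1 + (s1 + s) * real n > 0" using assms by (intro add_pos_nonneg) auto
    have e: "(1 + s1 * real n) + (1 + s * real n) = (1 + (s1 + s) * real n) + 1" by (simp add: algebra_simps)
    have "Gamma ((1 + (s1 + s) * real n) + 1) = (1 + (s1 + s) * real n) * Gamma (1 + (s1 + s) * real n)"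
      using p by (intro Gamma_plus1) (auto dest: nonpos_Ints_nonpos)
    note G = this
    have alg: "1 / (C / (A * B)) = P * (A * B / (P * C))" if "P > 0" "C > 0" for A B C P :: real
      using that by (simp add: field_simps)
    show ?thesis
      unfolding b_def Gamma_seq_def Beta_def e G by (rule alg[OF p Gamma_real_pos[OF p]])
  qed
  have "summable_in E k d u \<longleftrightarrow> summable_in E k d (borel_transform E b u)"
    if k: "k > 0" and E: "complex_banach E" and u: "\<forall>n. u n \<in> carrier E" for k d and E :: "(nat \<Rightarrow> complex) nmodule" and u
  proof
    interpret banach_mod E using E by (simp add: complex_banach_iff)
    assume "summable_in E k d u"
    from narrow_moment_summable[OF k narrow_moment_linear[of "s1 + s"] narrow_moment_summable[OF k narrow_moment_Beta[OF s1 assms(2)] this]]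
    have "summable_in E k d (\<lambda>n. complex_of_real (1 + (s1 + s) * real n) \<odot>\<^bsub>E\<^esub> (complex_of_real (Beta (1 + s1 * real n) (1 + s * real n)) \<odot>\<^bsub>E\<^esub> u n))"
      using assms by simp
    also have "(\<lambda>n. complex_of_real (1 + (s1 + s) * real n) \<odot>\<^bsub>E\<^esub> (complex_of_real (Beta (1 + s1 * real n) (1 + s * real n)) \<odot>\<^bsub>E\<^esub> u n)) = borel_transform E b u"
      using u by (intro ext) (simp only: smult_smult borel_transform_def inv of_real_mult)
    finally show "summable_in E k d (borel_transform E b u)" .
  next
    interpret banach_mod E using E by (simp add: complex_banach_iff)
    assume "summable_in E k d (borel_transform E b u)"
    from narrow_moment_summable[OF k narrow_moment_binomial[OF s1 assms(2)] this]
    have "summable_in E k d (\<lambda>n. complex_of_real (b n) \<odot>\<^bsub>E\<^esub> borel_transform E b u n)"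
      by (simp add: b_def)
    also have "(\<lambda>n. complex_of_real (b n) \<odot>\<^bsub>E\<^esub> borel_transform E b u n) = u"
      using u b[THEN less_imp_neq] by (intro ext) (simp add: borel_transform_def smult_smult less_imp_neq[symmetric])
    finally show "summable_in E k d u" .
  qed
  moreover have "b 0 = 1" by (simp add: b_def)
  ultimately show ?thesis using b unfolding preserves_summability_def b_def by blast
qed

theorem preserves_summability_mult_divide:
  assumes b: "preserves_summability b" and m1: "preserves_summability m1" and m2: "preserves_summability m2"
  shows "preserves_summability (\<lambda>n. b n * (m2 n / m1 n))"
proof -
  note pos = b[unfolded preserves_summability_def] m1[unfolded preserves_summability_def] m2[unfolded preserves_summability_def]
  have "summable_in E k d u \<longleftrightarrow> summable_in E k d (borel_transform E (\<lambda>n. b n * (m2 n / m1 n)) u)"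
    if k: "k > 0" and E: "complex_banach E" and u: "\<forall>n. u n \<in> carrier E" for k d and E :: "(nat \<Rightarrow> complex) nmodule" and u
  proof -
    interpret banach_mod E using E by (simp add: complex_banach_iff)
    define v where "v = (\<lambda>n. complex_of_real (m1 n) \<odot>\<^bsub>E\<^esub> u n)"
    have v: "\<forall>n. v n \<in> carrier E" using u by (simp add: v_def)
    have v2: "\<forall>n. borel_transform E m2 v n \<in> carrier E" using v by (simp add: borel_transform_def)
    have "borel_transform E m1 v = u"
    proof
      fix n show "borel_transform E m1 v n = u n"
        using u pos(2) by (simp add: v_def borel_transform_def smult_smult) (metis less_irrefl divide_self of_real_eq_0_iff smult_1)
    qed
    moreover have "borel_transform E b (borel_transform E m2 v) = borel_transform E (\<lambda>n. b n * (m2 n / m1 n)) u"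
      using u by (intro ext) (simp add: v_def borel_transform_def smult_smult)
    ultimately show ?thesis using k E v v2 pos by metis
  qed
  then show ?thesis using pos unfolding preserves_summability_def by auto
qed

section \<open>Weighted sequence spaces and scalar series\<close>

text \<open>
  Taylor coefficients at 0 of functions of \<open>z\<close>, with \<open>\<rho>\<close> as a radius. The elements are sequences, so the definition of
  preserving summability applies to this space; its coordinates are norming.
\<close>

definition wseq :: "real \<Rightarrow> (nat \<Rightarrow> complex) nmodule" where
  "wseq \<rho> = \<lparr>carrier = {c. bdd_above (range (\<lambda>j. cmod (c j) * \<rho> ^ j))},
     mult = (\<lambda>c d j. c j * d j), one = (\<lambda>j. 1), zero = (\<lambda>j. 0), add = (\<lambda>c d j. c j + d j),
     smult = (\<lambda>a c j. a * c j), nrm = (\<lambda>c. SUP j. cmod (c j) * \<rho> ^ j)\<rparr>"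

lemma wseq_simps [simp]:
  "\<zero>\<^bsub>wseq \<rho>\<^esub> = (\<lambda>j. 0)" "c \<oplus>\<^bsub>wseq \<rho>\<^esub> d = (\<lambda>j. c j + d j)" "a \<odot>\<^bsub>wseq \<rho>\<^esub> c = (\<lambda>j. a * c j)"
  "nrm (wseq \<rho>) c = (SUP j. cmod (c j) * \<rho> ^ j)"
  by (simp_all add: wseq_def)

lemma wseq_carrier: "c \<in> carrier (wseq \<rho>) \<longleftrightarrow> bdd_above (range (\<lambda>j. cmod (c j) * \<rho> ^ j))"
  by (simp add: wseq_def)

lemma wseq_carrierI: "(\<And>j. cmod (c j) * \<rho> ^ j \<le> B) \<Longrightarrow> c \<in> carrier (wseq \<rho>)"
  unfolding wseq_carrier by (rule bdd_aboveI2)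

lemma wseq_nrm_upper: "c \<in> carrier (wseq \<rho>) \<Longrightarrow> cmod (c j) * \<rho> ^ j \<le> nrm (wseq \<rho>) c"
  unfolding wseq_carrier wseq_simps by (rule cSUP_upper[OF UNIV_I])

lemma wseq_nrm_least: "(\<And>j. cmod (c j) * \<rho> ^ j \<le> B) \<Longrightarrow> nrm (wseq \<rho>) c \<le> B"
  by (simp add: cSUP_least)

lemma module_wseq:
  assumes \<rho>: "\<rho> > 0" shows "module complex_ring (wseq \<rho>)"
proof (rule moduleI[OF cring_complex_ring])
  have add: "c \<oplus>\<^bsub>wseq \<rho>\<^esub> d \<in> carrier (wseq \<rho>)" if "c \<in> carrier (wseq \<rho>)" "d \<in> carrier (wseq \<rho>)" for c d
  proof (rule wseq_carrierI)
    fix j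
    have "cmod (c j + d j) * \<rho> ^ j \<le> (cmod (c j) + cmod (d j)) * \<rho> ^ j"
      using \<rho> by (intro mult_right_mono norm_triangle_ineq) auto
    also have "\<dots> \<le> nrm (wseq \<rho>) c + nrm (wseq \<rho>) d"
      using wseq_nrm_upper[OF that(1), of j] wseq_nrm_upper[OF that(2), of j] by (simp add: algebra_simps)
    finally show "cmod ((c \<oplus>\<^bsub>wseq \<rho>\<^esub> d) j) * \<rho> ^ j \<le> nrm (wseq \<rho>) c + nrm (wseq \<rho>) d" by simp
  qed
  show smult: "a \<odot>\<^bsub>wseq \<rho>\<^esub> c \<in> carrier (wseq \<rho>)" if "c \<in> carrier (wseq \<rho>)" for a c
  proof (rule wseq_carrierI)
    fix j
    have "cmod a * (cmod (c j) * \<rho> ^ j) \<le> cmod a * nrm (wseq \<rho>) c"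
      using wseq_nrm_upper[OF that, of j] by (intro mult_left_mono) auto
    then show "cmod ((a \<odot>\<^bsub>wseq \<rho>\<^esub> c) j) * \<rho> ^ j \<le> cmod a * nrm (wseq \<rho>) c" by (simp add: norm_mult mult_ac)
  qed
  show "abelian_group (wseq \<rho>)"
  proof (rule abelian_groupI)
    show "\<exists>y\<in>carrier (wseq \<rho>). y \<oplus>\<^bsub>wseq \<rho>\<^esub> c = \<zero>\<^bsub>wseq \<rho>\<^esub>" if "c \<in> carrier (wseq \<rho>)" for c
      using smult[OF that, of "-1"] by (intro bexI[of _ "\<lambda>j. - c j"]) auto
    show "\<zero>\<^bsub>wseq \<rho>\<^esub> \<in> carrier (wseq \<rho>)" by (rule wseq_carrierI[of _ _ 0]) simp
  qed (use add in \<open>auto simp: algebra_simps\<close>)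
qed (auto simp: algebra_simps)

lemma wseq_eq_0:
  assumes \<rho>: "\<rho> > 0" and c: "c \<in> carrier (wseq \<rho>)" and 0: "nrm (wseq \<rho>) c \<le> 0"
  shows "c = (\<lambda>j. 0)"
proof
  fix j
  have "cmod (c j) * \<rho> ^ j \<le> 0" using wseq_nrm_upper[OF c, of j] 0 by simp
  then show "c j = 0" using zero_less_power[OF \<rho>, of j] by (auto simp: mult_le_0_iff)
qed

lemma normed_wseq:
  assumes \<rho>: "\<rho> > 0" shows "normed_mod (wseq \<rho>)"
proof (rule normed_mod.intro)
  show "module complex_ring (wseq \<rho>)" by (rule module_wseq[OF \<rho>])
  fix c assume c: "c \<in> carrier (wseq \<rho>)"
  show nn: "0 \<le> nrm (wseq \<rho>) c"
    by (rule order_trans[OF _ wseq_nrm_upper[OF c, of 0]]) simp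
  show "nrm (wseq \<rho>) c = 0 \<longleftrightarrow> c = \<zero>\<^bsub>wseq \<rho>\<^esub>"
    using wseq_eq_0[OF \<rho> c] by auto
  show "nrm (wseq \<rho>) (c \<oplus>\<^bsub>wseq \<rho>\<^esub> d) \<le> nrm (wseq \<rho>) c + nrm (wseq \<rho>) d" if d: "d \<in> carrier (wseq \<rho>)" for d
  proof (rule wseq_nrm_least)
    fix j
    have "cmod (c j + d j) * \<rho> ^ j \<le> (cmod (c j) + cmod (d j)) * \<rho> ^ j"
      using \<rho> by (intro mult_right_mono norm_triangle_ineq) auto
    also have "\<dots> \<le> nrm (wseq \<rho>) c + nrm (wseq \<rho>) d"
      using wseq_nrm_upper[OF c, of j] wseq_nrm_upper[OF d, of j] by (simp add: algebra_simps)
    finally show "cmod ((c \<oplus>\<^bsub>wseq \<rho>\<^esub> d) j) * \<rho> ^ j \<le> nrm (wseq \<rho>) c + nrm (wseq \<rho>) d" by simp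
  qed
  have le: "nrm (wseq \<rho>) (a \<odot>\<^bsub>wseq \<rho>\<^esub> c) \<le> cmod a * nrm (wseq \<rho>) c" if c: "c \<in> carrier (wseq \<rho>)" for a c
  proof (rule wseq_nrm_least)
    fix j
    have "cmod a * (cmod (c j) * \<rho> ^ j) \<le> cmod a * nrm (wseq \<rho>) c"
      using wseq_nrm_upper[OF c, of j] by (intro mult_left_mono) auto
    then show "cmod ((a \<odot>\<^bsub>wseq \<rho>\<^esub> c) j) * \<rho> ^ j \<le> cmod a * nrm (wseq \<rho>) c" by (simp add: norm_mult mult_ac)
  qed
  show "nrm (wseq \<rho>) (a \<odot>\<^bsub>wseq \<rho>\<^esub> c) = cmod a * nrm (wseq \<rho>) c" for a
  proof (rule antisym[OF le[OF c]])
    interpret m: module complex_ring "wseq \<rho>" by (rule module_wseq[OF \<rho>])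
    show "cmod a * nrm (wseq \<rho>) c \<le> nrm (wseq \<rho>) (a \<odot>\<^bsub>wseq \<rho>\<^esub> c)"
    proof (cases "a = 0")
      case False
      have "inverse a \<odot>\<^bsub>wseq \<rho>\<^esub> (a \<odot>\<^bsub>wseq \<rho>\<^esub> c) = c" using False by (simp add: mult.assoc[symmetric])
      then have "nrm (wseq \<rho>) c \<le> cmod (inverse a) * nrm (wseq \<rho>) (a \<odot>\<^bsub>wseq \<rho>\<^esub> c)"
        using le[of "a \<odot>\<^bsub>wseq \<rho>\<^esub> c" "inverse a"] m.smult_closed[of a c] c by simp
      moreover have "x \<le> inverse b * y \<Longrightarrow> b > 0 \<Longrightarrow> b * x \<le> y" for b x y :: real by (simp add: field_simps)
      ultimately show ?thesis using False unfolding norm_inverse by (meson zero_less_norm_iff)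
    qed simp
  qed
qed

lemma wseq_minus:
  assumes "\<rho> > 0" "c \<in> carrier (wseq \<rho>)" "d \<in> carrier (wseq \<rho>)"
  shows "c \<ominus>\<^bsub>wseq \<rho>\<^esub> d = (\<lambda>j. c j - d j)"
proof -
  interpret normed_mod "wseq \<rho>" by (rule normed_wseq[OF assms(1)])
  show ?thesis using minus_smult[OF assms(3)] by (simp add: a_minus_def)
qed

lemma banach_wseq:
  assumes \<rho>: "\<rho> > 0" shows "banach_mod (wseq \<rho>)"
proof -
  interpret normed_mod "wseq \<rho>" by (rule normed_wseq[OF \<rho>])
  show ?thesis
  proof unfold_locales
    fix \<sigma> :: "nat \<Rightarrow> nat \<Rightarrow> complex"
    assume \<sigma>: "\<And>n. \<sigma> n \<in> carrier (wseq \<rho>)"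
      and C: "\<And>\<epsilon>. \<epsilon> > 0 \<Longrightarrow> \<exists>N. \<forall>i\<ge>N. \<forall>j\<ge>N. nrm (wseq \<rho>) (\<sigma> i \<ominus>\<^bsub>wseq \<rho>\<^esub> \<sigma> j) < \<epsilon>"
    have C': "\<exists>N. \<forall>i\<ge>N. \<forall>l\<ge>N. \<forall>j. cmod (\<sigma> i j - \<sigma> l j) * \<rho> ^ j < \<epsilon>" if \<epsilon>: "\<epsilon> > 0" for \<epsilon>
    proof -
      obtain N where N: "\<And>i l. i \<ge> N \<Longrightarrow> l \<ge> N \<Longrightarrow> nrm (wseq \<rho>) (\<sigma> i \<ominus>\<^bsub>wseq \<rho>\<^esub> \<sigma> l) < \<epsilon>" using C[OF \<epsilon>] by blast
      have "cmod (\<sigma> i j - \<sigma> l j) * \<rho> ^ j < \<epsilon>" if "i \<ge> N" "l \<ge> N" for i l j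
        using wseq_nrm_upper[of "\<sigma> i \<ominus>\<^bsub>wseq \<rho>\<^esub> \<sigma> l" \<rho> j] N[OF that] minus_closed[OF \<sigma>[of i] \<sigma>[of l]]
          wseq_minus[OF \<rho> \<sigma>[of i] \<sigma>[of l]] by simp
      then show ?thesis by blast
    qed
    have "Cauchy (\<lambda>i. \<sigma> i j)" for j
    proof (rule CauchyI)
      fix e :: real assume "e > 0"
      show "\<exists>M. \<forall>m\<ge>M. \<forall>n\<ge>M. norm (\<sigma> m j - \<sigma> n j) < e"
      proof -
        obtain N where N: "\<And>i l. i \<ge> N \<Longrightarrow> l \<ge> N \<Longrightarrow> cmod (\<sigma> i j - \<sigma> l j) * \<rho> ^ j < e * \<rho> ^ j"
          using C'[of "e * \<rho> ^ j"] \<rho> \<open>e > 0\<close> by fastforce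
        then show ?thesis using \<rho> by (intro exI[of _ N]) auto
      qed
    qed
    then have "\<exists>l. (\<lambda>i. \<sigma> i j) \<longlonglongrightarrow> l" for j by (simp add: Cauchy_convergent_iff convergent_def)
    then obtain x where x: "\<And>j. (\<lambda>i. \<sigma> i j) \<longlonglongrightarrow> x j" by metis
    have lim: "\<exists>N. \<forall>i\<ge>N. \<forall>j. cmod (\<sigma> i j - x j) * \<rho> ^ j \<le> \<epsilon>" if \<epsilon>: "\<epsilon> > 0" for \<epsilon>
    proof -
      obtain N where N: "\<And>i l j. i \<ge> N \<Longrightarrow> l \<ge> N \<Longrightarrow> cmod (\<sigma> i j - \<sigma> l j) * \<rho> ^ j < \<epsilon>" using C'[OF \<epsilon>] by blast
      have "cmod (\<sigma> i j - x j) * \<rho> ^ j \<le> \<epsilon>" if i: "i \<ge> N" for i j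
      proof (rule tendsto_upperbound)
        show "(\<lambda>l. cmod (\<sigma> i j - \<sigma> l j) * \<rho> ^ j) \<longlonglongrightarrow> cmod (\<sigma> i j - x j) * \<rho> ^ j" by (intro tendsto_intros x)
        show "\<forall>\<^sub>F l in sequentially. cmod (\<sigma> i j - \<sigma> l j) * \<rho> ^ j \<le> \<epsilon>"
          using eventually_ge_at_top[of N] by eventually_elim (use N i in \<open>auto intro: less_imp_le\<close>)
      qed simp
      then show ?thesis by blast
    qed
    have dc: "(\<lambda>j. \<sigma> i j - x j) \<in> carrier (wseq \<rho>)" if "\<forall>j. cmod (\<sigma> i j - x j) * \<rho> ^ j \<le> \<epsilon>" for i \<epsilon>
      using that by (intro wseq_carrierI) auto
    obtain N where N: "\<forall>i\<ge>N. \<forall>j. cmod (\<sigma> i j - x j) * \<rho> ^ j \<le> 1" using lim[of 1] by auto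
    have "\<sigma> N \<ominus>\<^bsub>wseq \<rho>\<^esub> (\<lambda>j. \<sigma> N j - x j) = x" using N dc wseq_minus[OF \<rho> \<sigma>] by auto
    then have xc: "x \<in> carrier (wseq \<rho>)"
      using minus_closed[OF \<sigma>[of N] dc[of N 1]] N by auto
    have "(\<lambda>n. nrm (wseq \<rho>) (\<sigma> n \<ominus>\<^bsub>wseq \<rho>\<^esub> x)) \<longlonglongrightarrow> 0"
    proof (rule LIMSEQ_I)
      fix r :: real assume r: "r > 0"
      obtain N where N: "\<forall>i\<ge>N. \<forall>j. cmod (\<sigma> i j - x j) * \<rho> ^ j \<le> r / 2" using lim[of "r / 2"] r by auto
      have "nrm (wseq \<rho>) (\<sigma> n \<ominus>\<^bsub>wseq \<rho>\<^esub> x) \<le> r / 2" if "n \<ge> N" for n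
        unfolding wseq_minus[OF \<rho> \<sigma> xc] using N that by (intro wseq_nrm_least) auto
      then show "\<exists>no. \<forall>n\<ge>no. norm (nrm (wseq \<rho>) (\<sigma> n \<ominus>\<^bsub>wseq \<rho>\<^esub> x) - 0) < r"
        using r nrm_nonneg[OF minus_closed[OF \<sigma> xc]] by (intro exI[of _ N]) (fastforce simp del: wseq_simps)
    qed
    then show "\<exists>x\<in>carrier (wseq \<rho>). (\<lambda>n. nrm (wseq \<rho>) (\<sigma> n \<ominus>\<^bsub>wseq \<rho>\<^esub> x)) \<longlonglongrightarrow> 0" using xc by blast
  qed
qed

lemma functional_wseq:
  assumes "\<rho> > 0" shows "functional (wseq \<rho>) (\<lambda>c. c j * complex_of_real (\<rho> ^ j))"
  unfolding functional_def using assms wseq_nrm_upper[of _ \<rho> j]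
  by (auto simp: algebra_simps norm_mult norm_power simp del: wseq_simps(4))

lemma norming_wseq:
  assumes "\<rho> > 0" shows "norming (wseq \<rho>) (range (\<lambda>j c. c j * complex_of_real (\<rho> ^ j)))"
  unfolding norming_def using assms functional_wseq
  by (auto simp: norm_mult norm_power simp del: wseq_simps(4) intro!: wseq_nrm_least)

text \<open>
  The scalar counterpart of \<open>borel_continuation\<close>, for a series \<open>c\<close> from which the Gamma factors have already
  been divided out.
\<close>

definition continues :: "real \<Rightarrow> real \<Rightarrow> (nat \<Rightarrow> complex) \<Rightarrow> (complex \<Rightarrow> complex) \<Rightarrow> bool" where
  "continues k d c f \<longleftrightarrow> (\<exists>\<alpha> r \<epsilon>. 0 < \<alpha> \<and> \<alpha> \<le> 2 * pi \<and> 0 < r \<and> 0 < \<epsilon> \<and>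
     f holomorphic_on disc_sector d \<alpha> r \<and> growth_bound complex_space k d \<alpha> r f \<and>
     (\<forall>t. cmod t < \<epsilon> \<longrightarrow> (\<lambda>n. c n * t ^ n) sums f t))"

lemma continuesE:
  assumes "continues k d c f"
  obtains \<alpha> r \<epsilon> where "0 < \<alpha>" "\<alpha> \<le> 2 * pi" "0 < r" "0 < \<epsilon>" "f holomorphic_on disc_sector d \<alpha> r"
    "growth_bound complex_space k d \<alpha> r f" "\<And>t. cmod t < \<epsilon> \<Longrightarrow> (\<lambda>n. c n * t ^ n) sums f t"
  using assms unfolding continues_def by blast

lemma complex_space_nrm [simp]: "nrm complex_space = cmod"
  by (simp add: complex_space_def)

lemma (in normed_mod) growth_bound_functional:
  assumes g: "growth_bound E k d \<alpha> r f" and f: "\<And>t. t \<in> disc_sector d \<alpha> r \<Longrightarrow> f t \<in> carrier E" and l: "functional E l"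
  shows "growth_bound complex_space k d \<alpha> r (\<lambda>t. l (f t))"
  unfolding growth_bound_def
proof (intro ballI)
  fix \<alpha>' r' assume *: "\<alpha>' \<in> {0<..<\<alpha>}" "r' \<in> {0<..<r}"
  then obtain A B where AB: "A > 0" "B > 0" "\<And>t. t \<in> disc_sector d \<alpha>' r' \<Longrightarrow> nrm E (f t) < A * exp (B * cmod t powr k)"
    using g unfolding growth_bound_def by meson
  have "cmod (l (f t)) < A * exp (B * cmod t powr k)" if t: "t \<in> disc_sector d \<alpha>' r'" for t
  proof -
    have "t \<in> disc_sector d \<alpha> r" using disc_sector_mono[of \<alpha>' \<alpha> r' r d] * t by auto
    then show ?thesis using AB(3)[OF t] functional_bound[OF l f] by (meson le_less_trans)
  qed
  then show "\<exists>A>0. \<exists>B>0. \<forall>t\<in>disc_sector d \<alpha>' r'. nrm complex_space (l (f t)) < A * exp (B * cmod t powr k)"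
    using AB by auto
qed

lemma (in normed_mod) continues_functional:
  assumes f: "borel_continuation E k d u f" and l: "functional E l"
  shows "continues k d (\<lambda>n. l (u n) / complex_of_real (Gamma_seq (1 / k) n)) (\<lambda>t. l (f t))"
proof -
  from f obtain \<alpha> r \<epsilon> K where *: "0 < \<alpha>" "\<alpha> \<le> 2 * pi" "0 < r" "0 < \<epsilon>" "\<And>n. u n \<in> carrier E"
    "\<And>t. t \<in> disc_sector d \<alpha> r \<Longrightarrow> f t \<in> carrier E" "growth_bound E k d \<alpha> r f"
    and hol: "\<And>l. functional E l \<Longrightarrow> (\<lambda>t. l (f t)) holomorphic_on disc_sector d \<alpha> r"
    and sums: "\<And>l t. functional E l \<Longrightarrow> cmod t < \<epsilon> \<Longrightarrow>
       (\<lambda>n. l (borel_transform E (Gamma_seq (1 / k)) u n) * t ^ n) sums l (f t)"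
    by (rule borel_continuationD) blast
  have "l (borel_transform E (Gamma_seq (1 / k)) u n) = l (u n) / complex_of_real (Gamma_seq (1 / k) n)" for n
    using l *(5) by (simp add: borel_transform_def functional_smult)
  then show ?thesis
    unfolding continues_def using * hol[OF l] sums[OF l] growth_bound_functional[OF *(7,6) l]
    by (intro exI[of _ \<alpha>] exI[of _ r] exI[of _ \<epsilon>]) simp
qed

lemma power_series_coefficient_bound:
  fixes c :: "nat \<Rightarrow> complex"
  assumes "\<epsilon> > 0" "summable (\<lambda>n. c n * complex_of_real \<epsilon> ^ n)"
  obtains K where "K > 0" "\<And>n. cmod (c n) \<le> K / \<epsilon> ^ n"
proof -
  have "Bseq (\<lambda>n. c n * complex_of_real \<epsilon> ^ n)"
    using assms(2) summable_LIMSEQ_zero convergent_imp_Bseq convergentI by blast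
  then obtain K where "K > 0" "\<And>n. cmod (c n * complex_of_real \<epsilon> ^ n) \<le> K" by (auto simp: Bseq_def)
  then show thesis using assms(1) by (intro that[of K]) (auto simp: norm_mult norm_power field_simps)
qed

lemma summable_wseq_embed:
  assumes k: "k > 0" and f: "continues k d c f"
  shows "summable_in (wseq 1) k d (\<lambda>n j. if j = 0 then complex_of_real (Gamma_seq (1 / k) n) * c n else 0)"
proof -
  interpret banach_mod "wseq 1" by (rule banach_wseq) simp
  obtain \<alpha> r \<epsilon> where *: "0 < \<alpha>" "\<alpha> \<le> 2 * pi" "0 < r" "0 < \<epsilon>" "f holomorphic_on disc_sector d \<alpha> r"
    "growth_bound complex_space k d \<alpha> r f" "\<And>t. cmod t < \<epsilon> \<Longrightarrow> (\<lambda>n. c n * t ^ n) sums f t"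
    using f unfolding continues_def by blast
  let ?e = "\<lambda>x j. if j = (0::nat) then x else (0::complex)"
  have car: "?e x \<in> carrier (wseq 1)" for x by (rule wseq_carrierI[of _ _ "cmod x"]) auto
  have nrm: "nrm (wseq 1) (?e x) = cmod x" for x
  proof (rule antisym)
    show "nrm (wseq 1) (?e x) \<le> cmod x" by (rule wseq_nrm_least) auto
    show "cmod x \<le> nrm (wseq 1) (?e x)" using wseq_nrm_upper[OF car, of 0 x] by simp
  qed
  obtain K where K: "K > 0" "\<And>n. cmod (c n) \<le> K / (\<epsilon> / 2) ^ n"
    by (rule power_series_coefficient_bound[of "\<epsilon> / 2" c])
       (use *(4) *(7)[of "complex_of_real (\<epsilon> / 2)"] in \<open>auto simp: sums_iff\<close>)
  have bt: "borel_transform (wseq 1) (Gamma_seq (1 / k)) (\<lambda>n. ?e (complex_of_real (Gamma_seq (1 / k) n) * c n)) n = ?e (c n)" for n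
    using Gamma_seq_pos[of "1 / k" n] k by (auto simp: borel_transform_def)
  have "borel_continuation (wseq 1) k d (\<lambda>n. ?e (complex_of_real (Gamma_seq (1 / k) n) * c n)) (\<lambda>t. ?e (f t))"
  proof (rule borel_continuationI[OF norming_wseq, where \<alpha> = \<alpha> and r = r and \<epsilon> = "\<epsilon> / 2" and K = K])
    show "growth_bound (wseq 1) k d \<alpha> r (\<lambda>t. ?e (f t))"
      using *(6) by (simp only: growth_bound_def nrm complex_space_nrm)
    show "nrm (wseq 1) (borel_transform (wseq 1) (Gamma_seq (1 / k)) (\<lambda>n. ?e (complex_of_real (Gamma_seq (1 / k) n) * c n)) n) \<le> K / (\<epsilon> / 2) ^ n" for n
      unfolding bt nrm by (rule K)
  next
    fix l assume "l \<in> range (\<lambda>j c. c j * complex_of_real (1 ^ j))"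
    then obtain j where j: "l = (\<lambda>c. c j * complex_of_real (1 ^ j))" by blast
    show "(\<lambda>t. l (?e (f t))) holomorphic_on disc_sector d \<alpha> r"
      using *(5) unfolding j by (cases "j = 0") (auto intro!: holomorphic_intros)
    fix t assume "cmod t < \<epsilon> / 2"
    then have "cmod t < \<epsilon>" using *(4) by simp
    from *(7)[OF this] show "(\<lambda>n. l (borel_transform (wseq 1) (Gamma_seq (1 / k)) (\<lambda>n. ?e (complex_of_real (Gamma_seq (1 / k) n) * c n)) n) * t ^ n) sums l (?e (f t))"
      unfolding bt j by (cases "j = 0") auto
  qed (use * k car in auto)
  then show ?thesis by (auto simp: summable_in_def)
qed

lemma preserves_summabilityD:
  fixes E :: "(nat \<Rightarrow> complex) nmodule"
  assumes "preserves_summability m" "k > 0" "complex_banach E" "\<And>n. u n \<in> carrier E"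
  shows "summable_in E k d u \<longleftrightarrow> summable_in E k d (borel_transform E m u)"
  using assms(1)[unfolded preserves_summability_def, THEN conjunct2, THEN conjunct2, rule_format, OF assms(2,3)]
    assms(4) by blast

text \<open>
  A scalar series becomes a series in a sequence space when it is placed in the coordinate 0.
\<close>

lemma preserves_summability_continues:
  assumes m: "preserves_summability m" and k: "k > 0"
  shows "(\<exists>f. continues k d c f) \<longleftrightarrow> (\<exists>f. continues k d (\<lambda>n. c n / complex_of_real (m n)) f)"
proof -
  interpret banach_mod "wseq 1" by (rule banach_wseq) simp
  let ?G = "\<lambda>n. complex_of_real (Gamma_seq (1 / k) n)"
  have G: "?G n \<noteq> 0" for n using Gamma_seq_pos[of "1 / k" n] k by simp
  have l0: "functional (wseq 1) (\<lambda>c. c 0)" using functional_wseq[of 1 0] by simp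
  have sum: "(\<exists>f. continues k d c f) \<longleftrightarrow> summable_in (wseq 1) k d (\<lambda>n j. if j = 0 then ?G n * c n else 0)" for c
  proof
    assume "\<exists>f. continues k d c f"
    then show "summable_in (wseq 1) k d (\<lambda>n j. if j = 0 then ?G n * c n else 0)" using summable_wseq_embed[OF k] by blast
  next
    assume "summable_in (wseq 1) k d (\<lambda>n j. if j = 0 then ?G n * c n else 0)"
    then obtain f where "borel_continuation (wseq 1) k d (\<lambda>n j. if j = 0 then ?G n * c n else 0) f"
      by (auto simp: summable_in_def)
    from continues_functional[OF this l0] show "\<exists>f. continues k d c f" using G by auto
  qed
  let ?u = "\<lambda>n j. if j = 0 then ?G n * c n else 0"
  have "?u n \<in> carrier (wseq 1)" for n by (rule wseq_carrierI[of _ _ "cmod (?G n * c n)"]) auto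
  then have "summable_in (wseq 1) k d ?u \<longleftrightarrow> summable_in (wseq 1) k d (borel_transform (wseq 1) m ?u)"
    by (intro preserves_summabilityD[OF m k]) (auto simp: complex_banach_iff banach_mod_axioms)
  also have "borel_transform (wseq 1) m ?u = (\<lambda>n j. if j = 0 then ?G n * (c n / complex_of_real (m n)) else 0)"
    by (auto simp: borel_transform_def fun_eq_iff)
  finally show ?thesis unfolding sum .
qed

lemma growth_bound_bounded:
  assumes "\<And>t. t \<in> disc_sector d \<alpha> r \<Longrightarrow> cmod (f t) \<le> C"
  shows "growth_bound complex_space k d \<alpha> r f"
  unfolding growth_bound_def
proof (intro ballI)
  fix \<alpha>' r' assume *: "\<alpha>' \<in> {0<..<\<alpha>}" "r' \<in> {0<..<r}"
  have "cmod (f t) < (\<bar>C\<bar> + 1) * exp (1 * cmod t powr k)" if "t \<in> disc_sector d \<alpha>' r'" for t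
  proof -
    have "t \<in> disc_sector d \<alpha> r" using disc_sector_mono[of \<alpha>' \<alpha> r' r d] * that by auto
    then have "cmod (f t) < (\<bar>C\<bar> + 1) * 1" using assms by fastforce
    also have "\<dots> \<le> (\<bar>C\<bar> + 1) * exp (1 * cmod t powr k)" by (intro mult_left_mono) auto
    finally show ?thesis .
  qed
  then show "\<exists>A>0. \<exists>B>0. \<forall>t\<in>disc_sector d \<alpha>' r'. nrm complex_space (f t) < A * exp (B * cmod t powr k)"
    by (intro exI[of _ "\<bar>C\<bar> + 1"] exI[of _ 1] conjI) auto
qed

lemma cos_le_cos_away:
  assumes "0 \<le> \<delta>" "\<delta> \<le> \<bar>\<psi>\<bar>" "\<bar>\<psi>\<bar> \<le> 2 * pi - \<delta>"
  shows "cos \<psi> \<le> cos \<delta>"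
proof (cases "\<bar>\<psi>\<bar> \<le> pi")
  case True
  then have "cos \<bar>\<psi>\<bar> \<le> cos \<delta>" using assms by (intro cos_monotone_0_pi_le) auto
  then show ?thesis by simp
next
  case False
  then have "cos (2 * pi - \<bar>\<psi>\<bar>) \<le> cos \<delta>" using assms by (intro cos_monotone_0_pi_le) auto
  moreover have "cos (2 * pi - \<bar>\<psi>\<bar>) = cos \<psi>" by (simp add: cos_diff)
  ultimately show ?thesis by simp
qed

text \<open>
  Along directions close to \<open>d\<close> the product \<open>z * t\<close> keeps away from the positive half-line, and hence from 1.
\<close>

lemma continues_geometric:
  assumes z: "z * cis d \<notin> \<real>\<^sub>\<ge>\<^sub>0 \<or> z = 0"
  shows "continues k d (\<lambda>n. z ^ n) (\<lambda>t. 1 / (1 - z * t))"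
proof (cases "z = 0")
  case True
  have "(\<lambda>n. 0 ^ n * t ^ n) sums (1::complex)" for t :: complex
    using sums_single[of 0 "\<lambda>n. 1::complex"] by (rule sums_cong[THEN iffD1, rotated]) auto
  then show ?thesis
    unfolding continues_def True
    by (intro exI[of _ 1] conjI growth_bound_bounded[where C = 1]) (use pi_gt3 in auto)
next
  case False
  define \<theta> where "\<theta> = Arg (z * cis d)"
  define \<delta> where "\<delta> = \<bar>\<theta>\<bar> / 2"
  have zc: "z * cis d \<notin> \<real>\<^sub>\<ge>\<^sub>0" "z * cis d \<noteq> 0" using z False by auto
  have "\<theta> \<noteq> 0"
  proof
    assume "\<theta> = 0"
    then have "z * cis d = complex_of_real (cmod (z * cis d))"
      using rcis_cmod_Arg[of "z * cis d"] unfolding \<theta>_def rcis_def by simp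
    then show False using zc(1) by (metis nonneg_Reals_of_real_iff norm_ge_zero)
  qed
  moreover have "\<bar>\<theta>\<bar> \<le> pi" using Arg_bounded[of "z * cis d"] by (auto simp: \<theta>_def)
  ultimately have \<delta>: "0 < \<delta>" "\<delta> \<le> pi / 2" by (auto simp: \<delta>_def)
  have sin: "sin \<delta> > 0" using \<delta> pi_gt_zero by (intro sin_gt_zero) linarith+
  have cos: "cos \<delta> \<ge> 0" using \<delta> by (intro cos_ge_zero) auto
  define r where "r = 1 / (2 * cmod z)"
  have r: "r > 0" using False by (simp add: r_def)
  have bd: "cmod (1 - z * t) \<ge> min (1 / 2) (sin \<delta>)" if t: "t \<in> disc_sector d (2 * \<delta>) r" for t
  proof (cases "t \<in> ball 0 r")
    case True
    then have "cmod (z * t) \<le> 1 / 2" using False by (simp add: norm_mult r_def field_simps)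
    moreover have "1 - cmod (z * t) \<le> cmod (1 - z * t)" using norm_triangle_ineq2[of 1 "z * t"] by simp
    ultimately show ?thesis by linarith
  next
    case nb: False
    then obtain \<rho> \<phi> where p: "t = rcis \<rho> \<phi>" "\<rho> > 0" "\<bar>\<phi> - d\<bar> < \<delta>" using t by (auto simp: disc_sector_def sector_def)
    define x where "x = cmod z * \<rho>"
    define \<psi> where "\<psi> = \<theta> + (\<phi> - d)"
    have "z * t = (z * cis d) * rcis \<rho> (\<phi> - d)" by (simp add: p cis_rcis_eq rcis_mult mult.assoc)
    also have "z * cis d = rcis (cmod z) \<theta>" using rcis_cmod_Arg[of "z * cis d"] by (simp add: \<theta>_def norm_mult)
    also have "rcis (cmod z) \<theta> * rcis \<rho> (\<phi> - d) = rcis x \<psi>" by (simp add: rcis_mult x_def \<psi>_def)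
    finally have zt: "z * t = rcis x \<psi>" .
    have "\<delta> \<le> \<bar>\<psi>\<bar>" "\<bar>\<psi>\<bar> \<le> 2 * pi - \<delta>"
      using p(3) \<delta> by (auto simp: \<psi>_def \<delta>_def abs_if split: if_splits)
    then have c: "cos \<psi> \<le> cos \<delta>" using \<delta> by (intro cos_le_cos_away) auto
    have "x > 0" using False p by (simp add: x_def)
    have "(sin \<delta>)\<^sup>2 \<le> (sin \<delta>)\<^sup>2 + (x - cos \<delta>)\<^sup>2" by simp
    also have "\<dots> = 1 - 2 * x * cos \<delta> + x\<^sup>2" using sin_cos_squared_add[of \<delta>] by (simp add: power2_eq_square algebra_simps)
    also have "\<dots> \<le> 1 - 2 * x * cos \<psi> + x\<^sup>2" using c \<open>x > 0\<close> by simp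
    also have "\<dots> = (cmod (1 - z * t))\<^sup>2"
    proof -
      have "(cmod (1 - z * t))\<^sup>2 = (1 - x * cos \<psi>)\<^sup>2 + (x * sin \<psi>)\<^sup>2" unfolding zt by (simp add: cmod_power2 rcis_def)
      also have "\<dots> = 1 - 2 * x * cos \<psi> + x\<^sup>2 * ((sin \<psi>)\<^sup>2 + (cos \<psi>)\<^sup>2)"
      proof -
        have "(1 - x * c)\<^sup>2 + (x * s)\<^sup>2 = 1 - 2 * x * c + x\<^sup>2 * (s\<^sup>2 + c\<^sup>2)" for c s :: real
          by (simp add: power2_eq_square algebra_simps)
        then show ?thesis .
      qed
      finally show ?thesis by simp
    qed
    finally have "sin \<delta> \<le> cmod (1 - z * t)" by (rule power2_le_imp_le) simp
    then show ?thesis by simp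
  qed
  define C where "C = 1 / min (1 / 2) (sin \<delta>)"
  have mpos: "min (1 / 2) (sin \<delta>) > 0" using sin by simp
  show ?thesis
    unfolding continues_def
  proof (rule exI[of _ "2 * \<delta>"], rule exI[of _ r], rule exI[of _ r], intro conjI allI impI)
    show "growth_bound complex_space k d (2 * \<delta>) r (\<lambda>t. 1 / (1 - z * t))"
    proof (rule growth_bound_bounded[where C = C])
      fix t assume "t \<in> disc_sector d (2 * \<delta>) r"
      then have "1 / cmod (1 - z * t) \<le> C"
        unfolding C_def using bd[of t] mpos by (intro frac_le) auto
      then show "cmod (1 / (1 - z * t)) \<le> C" by (simp add: norm_divide)
    qed
    have "1 - z * t \<noteq> 0" if "t \<in> disc_sector d (2 * \<delta>) r" for t using bd[OF that] mpos by auto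
    then show "(\<lambda>t. 1 / (1 - z * t)) holomorphic_on disc_sector d (2 * \<delta>) r" by (intro holomorphic_intros) auto
    show "(\<lambda>n. z ^ n * t ^ n) sums (1 / (1 - z * t))" if "cmod t < r" for t
    proof -
      have "cmod (z * t) < 1" using that False by (simp add: r_def norm_mult field_simps)
      from geometric_sums[OF this] show ?thesis by (simp add: power_mult_distrib)
    qed
  qed (use \<delta> r pi_gt_zero in auto)
qed

section \<open>Kernel series and their shifts\<close>

lemma continues_moment:
  assumes m: "preserves_summability m" and k: "k > 0" and z: "z * cis d \<notin> \<real>\<^sub>\<ge>\<^sub>0 \<or> z = 0"
  shows "\<exists>f. continues k d (\<lambda>n. complex_of_real (m n) * z ^ n) f"
proof -
  have "m n \<noteq> 0" for n using m by (auto simp: preserves_summability_def less_le)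
  then have "(\<lambda>n. complex_of_real (m n) * z ^ n / complex_of_real (m n)) = (\<lambda>n. z ^ n)" by auto
  then show ?thesis
    using preserves_summability_continues[OF m k, of d "\<lambda>n. complex_of_real (m n) * z ^ n"] continues_geometric[OF z, of k]
    by auto
qed

lemma continues_inverse_moment:
  assumes m: "preserves_summability m" and k: "k > 0" and z: "z * cis d \<notin> \<real>\<^sub>\<ge>\<^sub>0 \<or> z = 0"
  shows "\<exists>f. continues k d (\<lambda>n. z ^ n / complex_of_real (m n)) f"
  using preserves_summability_continues[OF m k, of d "\<lambda>n. z ^ n"] continues_geometric[OF z, of k] by auto

text \<open>
  The power series with coefficients \<open>m n\<close> and \<open>1 / m n\<close> continue in the direction \<open>\<pi>\<close>; in particular they have
  positive radii of convergence.
\<close>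

lemma preserves_summability_bounds:
  assumes m: "preserves_summability m"
  obtains K C where "K \<ge> 1" "C \<ge> 1" "\<And>n. m n \<le> K * C ^ n" "\<And>n. 1 / m n \<le> K * C ^ n"
proof -
  have pos: "m n > 0" for n using m by (auto simp: preserves_summability_def)
  have z: "1 * cis pi \<notin> \<real>\<^sub>\<ge>\<^sub>0 \<or> (1::complex) = 0" by (simp add: complex_nonneg_Reals_iff)
  have bound: "\<exists>K C. K \<ge> 1 \<and> C \<ge> 1 \<and> (\<forall>n. cmod (c n) \<le> K * C ^ n)" if c: "continues 1 pi c f" for c f
  proof -
    obtain \<epsilon> where \<epsilon>: "\<epsilon> > 0" "\<And>t. cmod t < \<epsilon> \<Longrightarrow> (\<lambda>n. c n * t ^ n) sums f t"
      using c unfolding continues_def by blast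
    obtain K where K: "K > 0" "\<And>n. cmod (c n) \<le> K / (\<epsilon> / 2) ^ n"
      by (rule power_series_coefficient_bound[of "\<epsilon> / 2" c])
         (use \<epsilon>(1) \<epsilon>(2)[of "complex_of_real (\<epsilon> / 2)"] in \<open>auto simp: sums_iff\<close>)
    have "cmod (c n) \<le> max K 1 * (max (2 / \<epsilon>) 1) ^ n" for n
    proof -
      have "cmod (c n) \<le> K * (2 / \<epsilon>) ^ n" using K(2)[of n] by (simp add: power_divide field_simps)
      also have "\<dots> \<le> max K 1 * (max (2 / \<epsilon>) 1) ^ n" using \<epsilon> K by (intro mult_mono power_mono) auto
      finally show ?thesis .
    qed
    then show ?thesis by (intro exI[of _ "max K 1"] exI[of _ "max (2 / \<epsilon>) 1"]) auto
  qed
  obtain f where "continues 1 pi (\<lambda>n. complex_of_real (m n) * 1 ^ n) f" using continues_moment[OF m _ z, of 1] by auto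
  from bound[OF this] obtain K1 C1 where 1: "K1 \<ge> 1" "C1 \<ge> 1" "\<And>n. m n \<le> K1 * C1 ^ n"
    using pos by (auto simp: less_imp_le)
  obtain g where "continues 1 pi (\<lambda>n. 1 ^ n / complex_of_real (m n)) g" using continues_inverse_moment[OF m _ z, of 1] by auto
  from bound[OF this] obtain K2 C2 where 2: "K2 \<ge> 1" "C2 \<ge> 1" "\<And>n. 1 / m n \<le> K2 * C2 ^ n"
    using pos by (auto simp: less_imp_le norm_divide)
  have mx: "K * C ^ n \<le> max K1 K2 * (max C1 C2) ^ n" if "K \<le> max K1 K2" "C \<le> max C1 C2" "0 \<le> K" "0 \<le> C" for K C :: real and n
    using that by (intro mult_mono power_mono) auto
  show thesis
  proof (rule that[of "max K1 K2" "max C1 C2"])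
    show "m n \<le> max K1 K2 * max C1 C2 ^ n" for n
      by (rule order_trans[OF 1(3) mx]) (use 1 in auto)
    show "1 / m n \<le> max K1 K2 * max C1 C2 ^ n" for n
      by (rule order_trans[OF 2(3) mx]) (use 2 in auto)
  qed (use 1 in auto)
qed

text \<open>
  All shifts of the kernel series continue to one disc-sector, with bounds that deteriorate only
  geometrically: outside a disc one subtracts the initial terms and divides by a power of \<open>z t\<close>.
\<close>

lemma shifted_kernels:
  fixes z :: complex
  assumes m: "preserves_summability m" and k: "k > 0" and z: "z * cis d \<notin> \<real>\<^sub>\<ge>\<^sub>0 \<or> z = 0"
  obtains \<alpha> r L and h :: "nat \<Rightarrow> complex \<Rightarrow> complex" where "0 < \<alpha>" "\<alpha> \<le> 2 * pi" "0 < r" "L \<ge> 1"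
    "\<And>j. h j holomorphic_on disc_sector d \<alpha> r"
    "\<And>j t. cmod t < r \<Longrightarrow> (\<lambda>n. complex_of_real (m (n + j)) * z ^ n * t ^ n) sums h j t"
    "\<And>\<alpha>' r'. 0 < \<alpha>' \<Longrightarrow> \<alpha>' < \<alpha> \<Longrightarrow> 0 < r' \<Longrightarrow> r' < r \<Longrightarrow>
       \<exists>A>0. \<exists>B>0. \<forall>j. \<forall>t\<in>disc_sector d \<alpha>' r'. cmod (h j t) \<le> A * L ^ j * exp (B * cmod t powr k)"
proof (cases "z = 0")
  case True
  obtain K C where KC: "K \<ge> 1" "C \<ge> 1" "\<And>n. m n \<le> K * C ^ n" "\<And>n. 1 / m n \<le> K * C ^ n"
    using preserves_summability_bounds[OF m] by metis
  have pos: "m n > 0" for n using m by (auto simp: preserves_summability_def)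
  show thesis
  proof (rule that[of 1 1 C "\<lambda>j t. complex_of_real (m j)"])
    fix j and t :: complex
    have "(\<lambda>n. complex_of_real (m (n + j)) * 0 ^ n * t ^ n) = (\<lambda>n. if n = 0 then complex_of_real (m j) else 0)" by auto
    then show "(\<lambda>n. complex_of_real (m (n + j)) * z ^ n * t ^ n) sums complex_of_real (m j)"
      using sums_single[of 0 "\<lambda>_. complex_of_real (m j)"] True by simp
  next
    fix \<alpha>' r' :: real
    have "cmod (complex_of_real (m j)) \<le> K * C ^ j * exp (1 * cmod t powr k)" for j t
    proof -
      have "m j \<le> K * C ^ j * 1" using KC by simp
      also have "\<dots> \<le> K * C ^ j * exp (1 * cmod t powr k)" using KC by (intro mult_left_mono) auto
      finally show ?thesis using pos[of j] by simp
    qed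
    then show "\<exists>A>0. \<exists>B>0. \<forall>j. \<forall>t\<in>disc_sector d \<alpha>' r'. cmod (complex_of_real (m j)) \<le> A * C ^ j * exp (B * cmod t powr k)"
      using KC by (intro exI[of _ K] exI[of _ 1] conjI) auto
  qed (use KC pi_gt3 in auto)
next
  case False
  obtain K C where KC: "K \<ge> 1" "C \<ge> 1" "\<And>n. m n \<le> K * C ^ n" "\<And>n. 1 / m n \<le> K * C ^ n"
    using preserves_summability_bounds[OF m] by metis
  have pos: "m n > 0" for n using m by (auto simp: preserves_summability_def)
  obtain H where "continues k d (\<lambda>n. complex_of_real (m n) * z ^ n) H" using continues_moment[OF m k z] by auto
  then obtain \<alpha> r0 \<epsilon>0 where H: "0 < \<alpha>" "\<alpha> \<le> 2 * pi" "0 < r0" "0 < \<epsilon>0" "H holomorphic_on disc_sector d \<alpha> r0"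
    "growth_bound complex_space k d \<alpha> r0 H" "\<And>t. cmod t < \<epsilon>0 \<Longrightarrow> (\<lambda>n. complex_of_real (m n) * z ^ n * t ^ n) sums H t"
    unfolding continues_def by blast
  define C1 where "C1 = C * cmod z"
  have C1: "C1 > 0" using KC False by (simp add: C1_def)
  define r where "r = min (min r0 \<epsilon>0) (1 / (2 * C1))"
  have r: "0 < r" "r \<le> r0" "r \<le> \<epsilon>0" "r \<le> 1 / (2 * C1)" using H C1 by (auto simp: r_def)
  have coeff: "cmod (complex_of_real (m (n + j)) * z ^ n * t ^ n) \<le> K * C ^ j * (1 / 2) ^ n" if t: "cmod t < r" for t n j
  proof -
    have "C1 * cmod t \<le> C1 * (1 / (2 * C1))" using t r C1 by (intro mult_left_mono) auto
    then have c: "C1 * cmod t \<le> 1 / 2" using C1 by simp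
    have "cmod (complex_of_real (m (n + j)) * z ^ n * t ^ n) = m (n + j) * (cmod z * cmod t) ^ n"
      using pos[of "n + j"] by (simp add: norm_mult norm_power power_mult_distrib)
    also have "\<dots> \<le> K * C ^ (n + j) * (cmod z * cmod t) ^ n" by (intro mult_right_mono KC(3)) auto
    also have "\<dots> = K * C ^ j * (C1 * cmod t) ^ n" by (simp add: C1_def power_add power_mult_distrib)
    also have "\<dots> \<le> K * C ^ j * (1 / 2) ^ n" using c C1 KC by (intro mult_left_mono power_mono) auto
    finally show ?thesis .
  qed
  have summ: "summable (\<lambda>n. complex_of_real (m (n + j)) * z ^ n * t ^ n)" if t: "cmod t < r" for t j
    by (rule summable_comparison_test'[of "\<lambda>n. K * C ^ j * (1 / 2) ^ n" 0]) (use coeff[OF t] in \<open>auto intro!: summable_mult summable_geometric\<close>)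
  define S where "S = (\<lambda>j t. \<Sum>n. complex_of_real (m (n + j)) * z ^ n * t ^ n)"
  have Ssums: "(\<lambda>n. complex_of_real (m (n + j)) * z ^ n * t ^ n) sums S j t" if "cmod t < r" for t j
    using summ[OF that] by (simp add: S_def summable_sums)
  have Sbd: "cmod (S j t) \<le> 2 * K * C ^ j" if t: "cmod t < r" for t j
  proof -
    have "cmod (S j t) \<le> (\<Sum>n. K * C ^ j * (1 / 2) ^ n)"
      unfolding S_def by (intro norm_suminf_le coeff[OF t]) (auto intro!: summable_mult summable_geometric)
    also have "\<dots> = 2 * K * C ^ j" using suminf_mult[of "\<lambda>n. (1 / 2 :: real) ^ n" "K * C ^ j"] by (simp add: suminf_geometric)
    finally show ?thesis .
  qed
  define h where "h = (\<lambda>j t. if t = 0 then complex_of_real (m j)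
     else (H t - (\<Sum>n<j. complex_of_real (m n) * z ^ n * t ^ n)) / (z * t) ^ j)"
  have hS: "h j t = S j t" if t: "cmod t < r" for j t
  proof (cases "t = 0")
    case True
    have "(\<lambda>n. complex_of_real (m (n + j)) * z ^ n * 0 ^ n) = (\<lambda>n. if n = 0 then complex_of_real (m j) else 0)" by auto
    then have "(\<lambda>n. complex_of_real (m (n + j)) * z ^ n * t ^ n) sums complex_of_real (m j)"
      using sums_single[of 0 "\<lambda>_. complex_of_real (m j)"] True by simp
    then show ?thesis using Ssums[OF t] True sums_unique2 by (simp add: h_def)
  next
    case t0: False
    have "(\<lambda>n. complex_of_real (m (n + j)) * z ^ (n + j) * t ^ (n + j)) sums (H t - (\<Sum>n<j. complex_of_real (m n) * z ^ n * t ^ n))"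
      using H(7)[of t] t r by (intro sums_split_initial_segment) auto
    moreover have "(\<lambda>n. (z * t) ^ j * (complex_of_real (m (n + j)) * z ^ n * t ^ n)) sums ((z * t) ^ j * S j t)"
      by (intro sums_mult Ssums t)
    moreover have "(z * t) ^ j * (complex_of_real (m (n + j)) * z ^ n * t ^ n) = complex_of_real (m (n + j)) * z ^ (n + j) * t ^ (n + j)" for n
      by (simp add: power_add power_mult_distrib mult_ac)
    ultimately have e: "H t - (\<Sum>n<j. complex_of_real (m n) * z ^ n * t ^ n) = (z * t) ^ j * S j t"
      using sums_unique2 by simp
    have "(z * t) ^ j \<noteq> 0" using t0 False by simp
    then show ?thesis unfolding h_def e using t0 by simp
  qed
  define D where "D = max 1 (1 / (cmod z * r))"
  have D: "D \<ge> 1" "1 / (cmod z * r) \<le> D" by (auto simp: D_def)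
  have sub: "disc_sector d \<alpha> r \<subseteq> disc_sector d \<alpha> r0" using r by (intro disc_sector_mono) auto
  show thesis
  \<comment> \<open>The factor 2 absorbs the number \<open>j \<le> 2 ^ j\<close> of subtracted terms.\<close>
  proof (rule that[of \<alpha> r "2 * C * D" h])
    fix j
    have "S j holomorphic_on ball 0 r"
      by (rule power_series_holomorphic[of _ _ "\<lambda>n. complex_of_real (m (n + j)) * z ^ n"]) (use Ssums in auto)
    then have h1: "h j holomorphic_on ball 0 r" by (rule holomorphic_transform) (simp add: hS)
    have "(\<lambda>t. (H t - (\<Sum>n<j. complex_of_real (m n) * z ^ n * t ^ n)) / (z * t) ^ j) holomorphic_on disc_sector d \<alpha> r - {0}"
      using False by (intro holomorphic_intros holomorphic_on_subset[OF H(5)]) (use sub in auto)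
    then have h2: "h j holomorphic_on disc_sector d \<alpha> r - {0}" by (rule holomorphic_transform) (auto simp: h_def)
    have "h j holomorphic_on (ball 0 r \<union> (disc_sector d \<alpha> r - {0}))"
      by (intro holomorphic_on_Un h1 h2 open_Diff open_disc_sector H) auto
    moreover have "ball 0 r \<union> (disc_sector d \<alpha> r - {0}) = disc_sector d \<alpha> r" using ball_subset_disc_sector r by fastforce
    ultimately show "h j holomorphic_on disc_sector d \<alpha> r" by simp
  next
    fix \<alpha>' r' assume *: "0 < \<alpha>'" "\<alpha>' < \<alpha>" "0 < r'" "r' < r"
    then have "\<alpha>' \<in> {0<..<\<alpha>}" "r' \<in> {0<..<r0}" using r by auto
    then obtain A B where AB: "A > 0" "B > 0" "\<And>t. t \<in> disc_sector d \<alpha>' r' \<Longrightarrow> cmod (H t) < A * exp (B * cmod t powr k)"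
      using H(6) unfolding growth_bound_def complex_space_nrm by meson
    have "C * 1 \<le> (2 * C) * D" using KC D by (intro mult_mono) auto
    then have CD: "C \<le> 2 * C * D" by simp
    have "cmod (h j t) \<le> (A + 2 * K) * (2 * C * D) ^ j * exp (B * cmod t powr k)" if t: "t \<in> disc_sector d \<alpha>' r'" for j t
    proof (cases "cmod t < r")
      case True
      have "cmod (h j t) \<le> 2 * K * C ^ j * 1" using hS[OF True] Sbd[OF True] by simp
      also have "\<dots> \<le> (A + 2 * K) * (2 * C * D) ^ j * exp (B * cmod t powr k)"
        using AB KC D CD by (intro mult_mono power_mono) auto
      finally show ?thesis .
    next
      case far: False
      then have t0: "t \<noteq> 0" using r by auto
      define q where "q = cmod z * cmod t"
      have q0: "q > 0" using t0 False by (simp add: q_def)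
      have "cmod z * r \<le> q" unfolding q_def using far by (intro mult_left_mono) auto
      then have "1 / q \<le> 1 / (cmod z * r)" using r False by (intro frac_le) auto
      then have qD: "1 / q \<le> D" using D by linarith
      have E1: "1 \<le> exp (B * cmod t powr k)" using AB by simp
      have T: "cmod (\<Sum>n<j. complex_of_real (m n) * z ^ n * t ^ n) / q ^ j \<le> K * (2 * C * D) ^ j"
      proof -
        have "cmod (\<Sum>n<j. complex_of_real (m n) * z ^ n * t ^ n) / q ^ j \<le> (\<Sum>n<j. m n * q ^ n) / q ^ j"
          using pos q0 by (intro divide_right_mono sum_norm_le)
            (auto simp: norm_mult norm_power q_def power_mult_distrib less_imp_le abs_of_pos)
        also have "\<dots> = (\<Sum>n<j. m n * (1 / q) ^ (j - n))"
          unfolding sum_divide_distrib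
        proof (intro sum.cong refl)
          fix n assume "n \<in> {..<j}"
          then have "q ^ j = q ^ n * q ^ (j - n)" by (simp flip: power_add)
          then show "m n * q ^ n / q ^ j = m n * (1 / q) ^ (j - n)" using q0 by (simp add: power_divide)
        qed
        also have "\<dots> \<le> (\<Sum>n<j. K * C ^ j * D ^ j)"
        proof (intro sum_mono)
          fix n assume n: "n \<in> {..<j}"
          have "m n * (1 / q) ^ (j - n) \<le> (K * C ^ n) * D ^ (j - n)"
            using KC(3)[of n] qD q0 pos[of n] KC by (intro mult_mono power_mono) (auto intro: less_imp_le)
          also have "\<dots> \<le> (K * C ^ j) * D ^ j"
            using n KC D by (intro mult_mono power_increasing) auto
          finally show "m n * (1 / q) ^ (j - n) \<le> K * C ^ j * D ^ j" .
        qed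
        also have "\<dots> = real j * (K * C ^ j * D ^ j)" by simp
        also have "\<dots> \<le> 2 ^ j * (K * C ^ j * D ^ j)"
          using KC D by (intro mult_right_mono) (auto simp: less_imp_le of_nat_less_two_power)
        also have "\<dots> = K * (2 * C * D) ^ j" by (simp add: power_mult_distrib)
        finally show ?thesis .
      qed
      have "cmod (h j t) \<le> (cmod (H t) + cmod (\<Sum>n<j. complex_of_real (m n) * z ^ n * t ^ n)) / q ^ j"
        using t0 norm_triangle_ineq4[of "H t" "\<Sum>n<j. complex_of_real (m n) * z ^ n * t ^ n"] q0
        by (simp add: h_def norm_divide norm_power norm_mult q_def divide_right_mono)
      also have "\<dots> = cmod (H t) * (1 / q) ^ j + cmod (\<Sum>n<j. complex_of_real (m n) * z ^ n * t ^ n) / q ^ j"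
        by (simp add: add_divide_distrib power_divide)
      also have "\<dots> \<le> A * exp (B * cmod t powr k) * (2 * C * D) ^ j + K * (2 * C * D) ^ j * exp (B * cmod t powr k)"
      proof (intro add_mono mult_mono)
        have "D \<le> (2 * C) * D" using KC D by simp
        then show "(1 / q) ^ j \<le> (2 * C * D) ^ j" using qD q0 by (intro power_mono) auto
        have "K * (2 * C * D) ^ j * 1 \<le> K * (2 * C * D) ^ j * exp (B * cmod t powr k)"
          using E1 KC D by (intro mult_left_mono) auto
        then show "cmod (\<Sum>n<j. complex_of_real (m n) * z ^ n * t ^ n) / q ^ j \<le> K * (2 * C * D) ^ j * exp (B * cmod t powr k)"
          using T by simp
      qed (use AB(3)[OF t] q0 AB in \<open>auto intro: less_imp_le\<close>)
      also have "\<dots> = (A + K) * (2 * C * D) ^ j * exp (B * cmod t powr k)" by (simp add: algebra_simps)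
      also have "\<dots> \<le> (A + 2 * K) * (2 * C * D) ^ j * exp (B * cmod t powr k)"
        using KC D by (intro mult_right_mono) auto
      finally show ?thesis .
    qed
    then show "\<exists>A>0. \<exists>B>0. \<forall>j. \<forall>t\<in>disc_sector d \<alpha>' r'. cmod (h j t) \<le> A * (2 * C * D) ^ j * exp (B * cmod t powr k)"
      using AB KC by (intro exI[of _ "A + 2 * K"] exI[of _ B] conjI) auto
  next
    show "2 * C * D \<ge> 1" using KC D mult_mono[of 1 "2 * C" 1 D] by auto
  qed (use H r hS Ssums in auto)
qed

section \<open>Summability of the solution\<close>

text \<open>
  The Gamma factor is the integral of \<open>\<kappa> * A ^ n * B ^ j\<close> over the contour, so the coordinate \<open>j\<close> of the
  continuation is an integral of \<open>B ^ j * h j (A * t)\<close>, where \<open>h j\<close> is a shifted kernel. A contour with a small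
  parameter keeps \<open>A * t\<close> in the sector on which all \<open>h j\<close> are defined; \<open>B\<close> is merely bounded, which only makes
  the radius \<open>\<rho>\<close> smaller.
\<close>

lemma summable_binomial_series:
  fixes z \<zeta> :: complex
  assumes m: "preserves_summability m" and k: "k > 0" and \<sigma>: "\<sigma> > 0" and z: "z * cis d \<notin> \<real>\<^sub>\<ge>\<^sub>0 \<or> z = 0"
  obtains \<rho> where "\<rho> > 0" "summable_in (wseq \<rho>) k d (\<lambda>n j. complex_of_real (Gamma_seq (1 / k) n) *
     (z ^ n * \<zeta> ^ j * complex_of_real (Gamma_seq \<sigma> (n + j) / (Gamma_seq \<sigma> n * Gamma_seq \<sigma> j) * (m (n + j) / m j))))"
proof -
  obtain \<alpha> r L h where \<alpha>: "0 < \<alpha>" "\<alpha> \<le> 2 * pi" and r: "0 < r" and L: "L \<ge> (1::real)"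
    and hol: "\<And>j. h j holomorphic_on disc_sector d \<alpha> r"
    and sums: "\<And>j t. cmod t < r \<Longrightarrow> (\<lambda>n. complex_of_real (m (n + j)) * z ^ n * t ^ n) sums h j t"
    and gr: "\<And>\<alpha>' r'. 0 < \<alpha>' \<Longrightarrow> \<alpha>' < \<alpha> \<Longrightarrow> 0 < r' \<Longrightarrow> r' < r \<Longrightarrow>
       \<exists>A>0. \<exists>B>0. \<forall>j. \<forall>t\<in>disc_sector d \<alpha>' r'. cmod (h j t) \<le> A * L ^ j * exp (B * cmod t powr k)"
    by (rule shifted_kernels[OF m k z]) blast
  obtain K C where KC: "K \<ge> 1" "C \<ge> 1" "\<And>n. m n \<le> K * C ^ n" "\<And>n. 1 / m n \<le> K * C ^ n"
    using preserves_summability_bounds[OF m] by metis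
  have pos: "m n > 0" for n using m by (auto simp: preserves_summability_def)
  \<comment> \<open>With this parameter the arguments of \<open>A\<close> are at most \<open>\<alpha> / 4\<close>.\<close>
  define a where "a = min (1 / 2) (\<alpha> / (4 * \<sigma> * pi))"
  have a: "0 < a" "a < 1" "a \<le> \<alpha> / (4 * \<sigma> * pi)" using \<alpha> \<sigma> by (auto simp: a_def)
  interpret c: contour a by unfold_locales (use a in auto)
  let ?I = "{-pi..pi}"
  have cA: "continuous_on ?I (c.A \<sigma>)" and cB: "continuous_on ?I (c.B \<sigma>)" using c.cont_A c.cont_B \<sigma> by auto
  obtain M where M: "M \<ge> 1" "\<And>\<phi>. \<phi> \<in> ?I \<Longrightarrow> cmod (c.A \<sigma> \<phi>) \<le> M" by (rule continuous_on_interval_bounded[OF cA]) blast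
  obtain M' where M': "M' \<ge> 1" "\<And>\<phi>. \<phi> \<in> ?I \<Longrightarrow> cmod (c.B \<sigma> \<phi>) \<le> M'" by (rule continuous_on_interval_bounded[OF cB]) blast
  obtain Ck where Ck: "Ck \<ge> 1" "\<And>\<phi>. \<phi> \<in> ?I \<Longrightarrow> cmod (c.\<kappa> \<phi>) \<le> Ck" by (rule continuous_on_interval_bounded[OF c.cont_\<kappa>]) blast
  have angle: "\<bar>\<sigma> * (a * \<phi>)\<bar> \<le> \<alpha> / 4" if "\<phi> \<in> ?I" for \<phi>
  proof -
    have "\<sigma> * a * \<bar>\<phi>\<bar> \<le> \<sigma> * (\<alpha> / (4 * \<sigma> * pi)) * pi"
      using that a \<sigma> \<alpha> by (intro mult_mono) auto
    also have "\<dots> = \<alpha> / 4" using \<sigma> by simp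
    finally show ?thesis using a \<sigma> by (simp add: abs_mult mult_ac)
  qed
  have scale: "c.A \<sigma> \<phi> * t \<in> disc_sector d (\<alpha>' + \<alpha> / 2) (M * r')"
    if "\<phi> \<in> ?I" "t \<in> disc_sector d \<alpha>' r'" "r' > 0" for \<phi> t \<alpha>' r'
  proof -
    have "c.R \<phi> powr \<sigma> \<le> M" using M(2)[OF that(1)] by (simp add: c.A_def)
    then have "rcis (c.R \<phi> powr \<sigma>) (\<sigma> * (a * \<phi>)) * t \<in> disc_sector d (\<alpha>' + 2 * (\<alpha> / 4)) (M * r')"
      using M that angle[OF that(1)] by (intro disc_sector_rcis_mult) auto
    then show ?thesis by (simp add: c.A_def)
  qed
  define \<beta> where "\<beta> = (\<lambda>n j. Gamma_seq \<sigma> (n + j) / (Gamma_seq \<sigma> n * Gamma_seq \<sigma> j))"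
  have \<beta>int: "integral ?I (\<lambda>\<phi>. c.\<kappa> \<phi> * c.B \<sigma> \<phi> ^ j * c.A \<sigma> \<phi> ^ n) = complex_of_real (2 * pi * \<beta> n j)" for n j
    using integral_unique[OF c.integral_binomial_powers[OF \<sigma>, of n j]] by (simp add: \<beta>_def mult_ac)
  have \<beta>bd: "\<bar>\<beta> n j\<bar> \<le> Ck * M ^ n * M' ^ j" for n j
  proof -
    have "cmod (integral ?I (\<lambda>\<phi>. c.\<kappa> \<phi> * c.B \<sigma> \<phi> ^ j * c.A \<sigma> \<phi> ^ n)) \<le> (Ck * M' ^ j * M ^ n) * (pi - (- pi))"
    proof (rule integral_bound)
      show "continuous_on ?I (\<lambda>\<phi>. c.\<kappa> \<phi> * c.B \<sigma> \<phi> ^ j * c.A \<sigma> \<phi> ^ n)"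
        by (intro continuous_intros cA cB c.cont_\<kappa>)
      show "cmod (c.\<kappa> \<phi> * c.B \<sigma> \<phi> ^ j * c.A \<sigma> \<phi> ^ n) \<le> Ck * M' ^ j * M ^ n" if "\<phi> \<in> ?I" for \<phi>
        unfolding norm_mult norm_power using Ck M M' that by (intro mult_mono power_mono) auto
    qed simp
    then have "2 * pi * \<bar>\<beta> n j\<bar> \<le> 2 * pi * (Ck * M' ^ j * M ^ n)"
      unfolding \<beta>int by (simp add: norm_mult abs_mult mult_ac)
    then show ?thesis by (simp add: mult_ac)
  qed
  \<comment> \<open>The radius absorbs the geometric growth in \<open>j\<close> of \<open>\<zeta> ^ j\<close>, of \<open>m (n + j) / m j\<close>, of \<open>B ^ j\<close> and of the shifted kernels.\<close>
  define \<rho> where "\<rho> = 1 / ((cmod \<zeta> + 1) * C ^ 2 * M' * L)"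
  have \<rho>: "\<rho> > 0" using KC M' L by (auto simp: \<rho>_def add_nonneg_pos)
  have small1: "cmod \<zeta> * C ^ 2 * M' * \<rho> \<le> 1"
  proof -
    have "cmod \<zeta> * C ^ 2 * M' * 1 \<le> (cmod \<zeta> + 1) * C ^ 2 * M' * L"
      using KC M' L by (intro mult_mono) auto
    then show ?thesis using KC M' L by (simp add: \<rho>_def divide_le_eq add_nonneg_pos)
  qed
  have small2: "cmod \<zeta> * C * M' * L * \<rho> \<le> 1"
  proof -
    have "C * 1 \<le> C * C" using KC by (intro mult_left_mono) auto
    then have "cmod \<zeta> * C * M' * L \<le> (cmod \<zeta> + 1) * C ^ 2 * M' * L"
      using KC M' L by (intro mult_mono) (auto simp: power2_eq_square)
    then show ?thesis using KC M' L by (simp add: \<rho>_def divide_le_eq add_nonneg_pos)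
  qed
  define F where "F = (\<lambda>t j. \<zeta> ^ j / complex_of_real (m j) / complex_of_real (2 * pi) *
      integral ?I (\<lambda>\<phi>. c.\<kappa> \<phi> * c.B \<sigma> \<phi> ^ j * h j (c.A \<sigma> \<phi> * t)))"
  let ?V = "disc_sector d \<alpha> r" and ?U = "disc_sector d (\<alpha> / 2) (r / M)"
  have V: "open ?V" and U: "open ?U" using \<alpha> by (auto intro!: open_disc_sector)
  have UV: "c.A \<sigma> \<phi> * t \<in> ?V" if "\<phi> \<in> ?I" "t \<in> ?U" for \<phi> t
    using scale[OF that] r M by simp
  have cBj: "continuous_on ?I (\<lambda>\<phi>. c.\<kappa> \<phi> * c.B \<sigma> \<phi> ^ j)" for j
    by (intro continuous_intros cB c.cont_\<kappa>)
  have est: "\<exists>A>0. \<exists>B>0. \<forall>t\<in>disc_sector d \<alpha>' r'. \<forall>j. cmod (F t j) * \<rho> ^ j \<le> A * exp (B * cmod t powr k)"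
    if *: "0 < \<alpha>'" "\<alpha>' < \<alpha> / 2" "0 < r'" "r' < r / M" for \<alpha>' r'
  proof -
    have "0 < M * r'" "M * r' < r" using * M by (auto simp: field_simps)
    then obtain A B where AB: "A > 0" "B > 0"
      "\<And>j t. t \<in> disc_sector d (\<alpha>' + \<alpha> / 2) (M * r') \<Longrightarrow> cmod (h j t) \<le> A * L ^ j * exp (B * cmod t powr k)"
      using gr[of "\<alpha>' + \<alpha> / 2" "M * r'"] * \<alpha> by auto
    have "cmod (F t j) * \<rho> ^ j \<le> K * Ck * A * exp (B * M powr k * cmod t powr k)"
      if t: "t \<in> disc_sector d \<alpha>' r'" for t j
    proof -
      let ?E = "exp (B * M powr k * cmod t powr k)"
      have tU: "t \<in> ?U" using disc_sector_mono[of \<alpha>' "\<alpha> / 2" r' "r / M" d] t * by auto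
      have "cmod (integral ?I (\<lambda>\<phi>. c.\<kappa> \<phi> * c.B \<sigma> \<phi> ^ j * h j (c.A \<sigma> \<phi> * t)))
          \<le> (Ck * M' ^ j * (A * L ^ j * ?E)) * (pi - (- pi))"
      proof (rule integral_bound)
        show "continuous_on ?I (\<lambda>\<phi>. c.\<kappa> \<phi> * c.B \<sigma> \<phi> ^ j * h j (c.A \<sigma> \<phi> * t))"
          by (intro continuous_intros cBj continuous_on_compose2[OF holomorphic_on_imp_continuous_on[OF hol]] cA)
             (use UV tU in auto)
        fix \<phi> assume \<phi>: "\<phi> \<in> ?I"
        have "cmod (h j (c.A \<sigma> \<phi> * t)) \<le> A * L ^ j * exp (B * cmod (c.A \<sigma> \<phi> * t) powr k)"
          using AB(3) scale[OF \<phi> t] * by auto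
        also have "\<dots> \<le> A * L ^ j * exp (B * (M * cmod t) powr k)"
        proof -
          have "cmod (c.A \<sigma> \<phi> * t) powr k \<le> (M * cmod t) powr k"
            using M(2)[OF \<phi>] k by (intro powr_mono2) (auto simp: norm_mult intro: mult_right_mono)
          then show ?thesis using AB L by simp
        qed
        also have "(M * cmod t) powr k = M powr k * cmod t powr k" using M by (simp add: powr_mult)
        finally show "cmod (c.\<kappa> \<phi> * c.B \<sigma> \<phi> ^ j * h j (c.A \<sigma> \<phi> * t)) \<le> Ck * M' ^ j * (A * L ^ j * ?E)"
          unfolding norm_mult norm_power using Ck M' \<phi> by (intro mult_mono power_mono) (auto simp: mult.assoc)
      qed simp
      then have "cmod (F t j) \<le> cmod \<zeta> ^ j * (1 / m j) / (2 * pi) * ((Ck * M' ^ j * (A * L ^ j * ?E)) * (2 * pi))"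
        unfolding F_def norm_mult norm_divide norm_power using pos[of j] by (intro mult_mono) auto
      also have "\<dots> = cmod \<zeta> ^ j * (1 / m j) * (Ck * M' ^ j * (A * L ^ j * ?E))" by simp
      also have "\<dots> \<le> cmod \<zeta> ^ j * (K * C ^ j) * (Ck * M' ^ j * (A * L ^ j * ?E))"
        using KC(4)[of j] Ck M' AB L by (intro mult_right_mono mult_left_mono) auto
      also have "\<dots> = K * Ck * A * ?E * (cmod \<zeta> * C * M' * L) ^ j" by (simp add: power_mult_distrib)
      finally have "cmod (F t j) * \<rho> ^ j \<le> K * Ck * A * ?E * (cmod \<zeta> * C * M' * L) ^ j * \<rho> ^ j"
        using \<rho> by (intro mult_right_mono) auto
      also have "\<dots> = K * Ck * A * ?E * (cmod \<zeta> * C * M' * L * \<rho>) ^ j" by (simp add: power_mult_distrib)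
      also have "\<dots> \<le> K * Ck * A * ?E * 1"
        using small2 KC Ck AB M' L \<rho> by (intro mult_left_mono power_le_one) auto
      finally show ?thesis by simp
    qed
    moreover have "K * Ck * A > 0" "B * M powr k > 0" using KC Ck AB M by auto
    ultimately show ?thesis by blast
  qed
  have Fcar: "F t \<in> carrier (wseq \<rho>)" if t: "t \<in> ?U" for t
  proof -
    obtain \<alpha>' r' where "0 < \<alpha>'" "\<alpha>' < \<alpha> / 2" "0 < r'" "r' < r / M" "t \<in> disc_sector d \<alpha>' r'"
      by (rule disc_sector_exhaust[OF t]) (use \<alpha> r M in auto)
    with est[of \<alpha>' r'] show ?thesis by (meson wseq_carrierI)
  qed
  interpret W: banach_mod "wseq \<rho>" by (rule banach_wseq[OF \<rho>])
  define x where "x = (\<lambda>n j. z ^ n * \<zeta> ^ j * complex_of_real (\<beta> n j * (m (n + j) / m j)))"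
  have xbd: "cmod (x n j) * \<rho> ^ j \<le> K\<^sup>2 * Ck * (cmod z * M * C) ^ n" for n j
  proof -
    have "cmod (x n j) = cmod z ^ n * cmod \<zeta> ^ j * (\<bar>\<beta> n j\<bar> * (m (n + j) * (1 / m j)))"
      using pos[of "n + j"] pos[of j] by (simp add: x_def norm_mult norm_power norm_divide abs_mult)
    also have "\<dots> \<le> cmod z ^ n * cmod \<zeta> ^ j * ((Ck * M ^ n * M' ^ j) * ((K * C ^ (n + j)) * (K * C ^ j)))"
      using \<beta>bd[of n j] KC(3)[of "n + j"] KC(4)[of j] pos[of "n + j"] pos[of j] KC Ck M M'
      by (intro mult_left_mono mult_mono) (auto intro!: mult_nonneg_nonneg intro: less_imp_le)
    also have "\<dots> = K\<^sup>2 * Ck * (cmod z * M * C) ^ n * (cmod \<zeta> * C ^ 2 * M') ^ j"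
      by (simp add: power_mult_distrib power_add power2_eq_square)
    finally have "cmod (x n j) * \<rho> ^ j \<le> K\<^sup>2 * Ck * (cmod z * M * C) ^ n * (cmod \<zeta> * C ^ 2 * M') ^ j * \<rho> ^ j"
      using \<rho> by (intro mult_right_mono) auto
    also have "\<dots> = K\<^sup>2 * Ck * (cmod z * M * C) ^ n * (cmod \<zeta> * C ^ 2 * M' * \<rho>) ^ j" by (simp add: power_mult_distrib)
    also have "\<dots> \<le> K\<^sup>2 * Ck * (cmod z * M * C) ^ n * 1"
      using small1 KC Ck M M' \<rho> by (intro mult_left_mono power_le_one) auto
    finally show ?thesis by simp
  qed
  have xcar: "x n \<in> carrier (wseq \<rho>)" for n by (rule wseq_carrierI[OF xbd])
  let ?G = "\<lambda>n. complex_of_real (Gamma_seq (1 / k) n)"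
  have G: "?G n \<noteq> 0" for n using Gamma_seq_pos[of "1 / k" n] k by simp
  have bt: "borel_transform (wseq \<rho>) (Gamma_seq (1 / k)) (\<lambda>n j. ?G n * x n j) n = x n" for n
    using G[of n] by (auto simp: borel_transform_def)
  have Gcar: "(\<lambda>j. ?G n * x n j) \<in> carrier (wseq \<rho>)" for n using W.smult_closed'[OF xcar, of "?G n"] by simp
  define \<epsilon> where "\<epsilon> = min (r / (4 * M)) (1 / (cmod z * M * C + 1))"
  have zM: "cmod z * M * C \<ge> 0" using M KC by simp
  have \<epsilon>: "0 < \<epsilon>" "\<epsilon> \<le> r / (4 * M)" "\<epsilon> \<le> 1 / (cmod z * M * C + 1)" using r M zM by (auto simp: \<epsilon>_def)
  have "borel_continuation (wseq \<rho>) k d (\<lambda>n j. ?G n * x n j) F"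
  proof (rule W.borel_continuationI[OF norming_wseq[OF \<rho>], where \<alpha> = "\<alpha> / 2" and r = "r / M" and \<epsilon> = \<epsilon> and K = "K\<^sup>2 * Ck"])
    fix l assume "l \<in> range (\<lambda>j c. c j * complex_of_real (\<rho> ^ j))"
    then obtain j where l: "l = (\<lambda>c. c j * complex_of_real (\<rho> ^ j))" by blast
    show "(\<lambda>t. l (F t)) holomorphic_on ?U"
      unfolding l F_def
      by (intro holomorphic_intros holomorphic_on_scaled_integral[OF hol V U cBj cA UV]) (use pos[of j] in auto)
    fix t assume t: "cmod t < \<epsilon>"
    obtain Kj where Kj: "Kj > 0" "\<And>n. cmod (complex_of_real (m (n + j)) * z ^ n) \<le> Kj / (r / 2) ^ n"
      by (rule power_series_coefficient_bound[of "r / 2" "\<lambda>n. complex_of_real (m (n + j)) * z ^ n"])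
         (use r sums[of "complex_of_real (r / 2)" j] in \<open>auto simp: sums_iff\<close>)
    have "(\<lambda>n. (complex_of_real (m (n + j)) * z ^ n) * integral ?I (\<lambda>\<phi>. (c.\<kappa> \<phi> * c.B \<sigma> \<phi> ^ j) * c.A \<sigma> \<phi> ^ n) * t ^ n)
        sums integral ?I (\<lambda>\<phi>. (c.\<kappa> \<phi> * c.B \<sigma> \<phi> ^ j) * h j (c.A \<sigma> \<phi> * t))"
    proof (rule sums_scaled_integral[OF _ cBj cA _ M(2) Kj(2)])
      show "cmod t \<le> r / 2 / (2 * M)" using t \<epsilon> by simp
    qed (use M r sums in auto)
    from sums_mult[OF this, of "\<zeta> ^ j / complex_of_real (m j) / complex_of_real (2 * pi) * complex_of_real (\<rho> ^ j)"]
    show "(\<lambda>n. l (borel_transform (wseq \<rho>) (Gamma_seq (1 / k)) (\<lambda>n j. ?G n * x n j) n) * t ^ n) sums l (F t)"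
      unfolding bt unfolding l F_def \<beta>int x_def by (simp add: mult_ac)
  next
    fix n
    have "nrm (wseq \<rho>) (x n) \<le> K\<^sup>2 * Ck * (cmod z * M * C) ^ n" by (rule wseq_nrm_least[OF xbd])
    also have "\<dots> \<le> K\<^sup>2 * Ck * (1 / \<epsilon>) ^ n"
    proof (intro mult_left_mono power_mono)
      have "cmod z * M * C + 1 \<le> 1 / \<epsilon>" using \<epsilon> zM by (simp add: le_divide_eq mult.commute pos_le_divide_eq)
      then show "cmod z * M * C \<le> 1 / \<epsilon>" by simp
    qed (use zM Ck in auto)
    finally show "nrm (wseq \<rho>) (borel_transform (wseq \<rho>) (Gamma_seq (1 / k)) (\<lambda>n j. ?G n * x n j) n) \<le> K\<^sup>2 * Ck / \<epsilon> ^ n"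
      unfolding bt by (simp add: power_divide)
  next
    show "growth_bound (wseq \<rho>) k d (\<alpha> / 2) (r / M) F"
      unfolding growth_bound_def
    proof (intro ballI)
      fix \<alpha>' r' assume *: "\<alpha>' \<in> {0<..<\<alpha> / 2}" "r' \<in> {0<..<r / M}"
      then obtain A B where AB: "A > 0" "B > 0"
        "\<And>t j. t \<in> disc_sector d \<alpha>' r' \<Longrightarrow> cmod (F t j) * \<rho> ^ j \<le> A * exp (B * cmod t powr k)"
        using est[of \<alpha>' r'] by auto
      have "nrm (wseq \<rho>) (F t) < (A + 1) * exp (B * cmod t powr k)" if "t \<in> disc_sector d \<alpha>' r'" for t
        by (rule le_less_trans[OF wseq_nrm_least[OF AB(3)[OF that]]]) simp
      then show "\<exists>A>0. \<exists>B>0. \<forall>t\<in>disc_sector d \<alpha>' r'. nrm (wseq \<rho>) (F t) < A * exp (B * cmod t powr k)"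
        using AB by (intro exI[of _ "A + 1"] exI[of _ B] conjI) auto
    qed
  qed (use Gcar \<alpha> r M \<epsilon> k Fcar in auto)
  then have "summable_in (wseq \<rho>) k d (\<lambda>n j. ?G n * x n j)" by (auto simp: summable_in_def)
  then show thesis by (intro that[OF \<rho>]) (simp add: x_def \<beta>_def)
qed

text \<open>
  The coefficients differ from those of the preceding series by the factors \<open>\<Gamma>\<^bsub>s2\<^esub> / (\<Gamma>\<^bsub>s1\<^esub> \<Gamma>\<^bsub>s2 - s1\<^esub>)\<close> and
  \<open>1 / m1\<close> in \<open>n\<close>, both of which preserve summability in the sequence space.
\<close>

lemma summable_solution_wseq:
  fixes z \<zeta> :: complex
  assumes m1: "preserves_summability m1" and m2: "preserves_summability m2" and s: "0 \<le> s1" "s1 < s2"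
    and z: "z * cis d \<notin> \<real>\<^sub>\<ge>\<^sub>0 \<or> z = 0"
  obtains \<rho> where "\<rho> > 0" "summable_in (wseq \<rho>) (1 / (s2 - s1)) d (\<lambda>n j. z ^ n * \<zeta> ^ j * complex_of_real
     (Gamma_seq s2 (n + j) * m2 (n + j) / (Gamma_seq s1 n * m1 n * (Gamma_seq s2 j * m2 j))))"
proof -
  let ?s = "s2 - s1" and ?k = "1 / (s2 - s1)"
  have k: "?k > 0" using s by simp
  let ?b = "\<lambda>n. Gamma_seq s2 n / (Gamma_seq s1 n * Gamma_seq ?s n)"
  have b: "preserves_summability ?b" using preserves_summability_binomial[of s1 ?s] s by simp
  have s2: "s2 > 0" using s by simp
  have e: "1 / ?k = ?s" by simp
  obtain \<rho> where \<rho>: "\<rho> > 0" and X': "summable_in (wseq \<rho>) ?k d (\<lambda>n j. complex_of_real (Gamma_seq (1 / ?k) n) *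
     (z ^ n * \<zeta> ^ j * complex_of_real (Gamma_seq s2 (n + j) / (Gamma_seq s2 n * Gamma_seq s2 j) * (m2 (n + j) / m2 j))))"
    by (rule summable_binomial_series[OF m2 k s2 z, where \<zeta> = \<zeta>])
  note X = X'[unfolded e]
  let ?X = "\<lambda>n j. complex_of_real (Gamma_seq ?s n) *
     (z ^ n * \<zeta> ^ j * complex_of_real (Gamma_seq s2 (n + j) / (Gamma_seq s2 n * Gamma_seq s2 j) * (m2 (n + j) / m2 j)))"
  interpret W: banach_mod "wseq \<rho>" by (rule banach_wseq[OF \<rho>])
  have cb: "complex_banach (wseq \<rho>)" by (simp add: complex_banach_iff W.banach_mod_axioms)
  have Xc: "?X n \<in> carrier (wseq \<rho>)" for n
    using X by (auto simp: summable_in_def borel_continuation_def)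
  let ?Y = "\<lambda>n j. complex_of_real (?b n) * ?X n j"
  have Yc: "?Y n \<in> carrier (wseq \<rho>)" for n using W.smult_closed'[OF Xc[of n], of "complex_of_real (?b n)"] by simp
  have Gp: "Gamma_seq s1 n > 0" "Gamma_seq s2 n > 0" "Gamma_seq ?s n > 0" for n using s by (auto intro!: Gamma_seq_pos)
  have "borel_transform (wseq \<rho>) ?b ?Y = ?X"
    using Gp[THEN less_imp_neq] by (auto simp: borel_transform_def fun_eq_iff mult.assoc)
  then have "summable_in (wseq \<rho>) ?k d ?Y"
    using preserves_summabilityD[OF b k cb, of ?Y d] Yc X by simp
  then have Z: "summable_in (wseq \<rho>) ?k d (borel_transform (wseq \<rho>) m1 ?Y)"
    using preserves_summabilityD[OF m1 k cb, of ?Y d] Yc by simp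
  have "borel_transform (wseq \<rho>) m1 ?Y = (\<lambda>n j. z ^ n * \<zeta> ^ j * complex_of_real
     (Gamma_seq s2 (n + j) * m2 (n + j) / (Gamma_seq s1 n * m1 n * (Gamma_seq s2 j * m2 j))))"
  proof (intro ext)
    fix n j
    show "borel_transform (wseq \<rho>) m1 ?Y n j = z ^ n * \<zeta> ^ j * complex_of_real
     (Gamma_seq s2 (n + j) * m2 (n + j) / (Gamma_seq s1 n * m1 n * (Gamma_seq s2 j * m2 j)))"
      using Gp(1)[of n] Gp(2)[of n] Gp(3)[of n] by (simp add: borel_transform_def mult_ac)
  qed
  with Z show thesis by (intro that[OF \<rho>]) simp
qed

section \<open>From sequences to holomorphic functions\<close>

text \<open>
  The image of the continuation is differentiable with the image of the derivative, and its growth changes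
  by the constant \<open>C\<close> only.
\<close>

lemma (in normed_mod) summable_in_linear_image:
  fixes T :: "'v \<Rightarrow> 'b" and E' :: "'b nmodule"
  assumes E': "normed_mod E'" and T: "\<And>x. x \<in> carrier E \<Longrightarrow> T x \<in> carrier E'"
    and add: "\<And>x y. x \<in> carrier E \<Longrightarrow> y \<in> carrier E \<Longrightarrow> T (x \<oplus> y) = T x \<oplus>\<^bsub>E'\<^esub> T y"
    and smult: "\<And>c x. x \<in> carrier E \<Longrightarrow> T (c \<odot> x) = c \<odot>\<^bsub>E'\<^esub> T x"
    and bd: "\<And>x. x \<in> carrier E \<Longrightarrow> nrm E' (T x) \<le> C * nrm E x" and C: "C > 0"
    and u: "summable_in E k d u"
  shows "summable_in E' k d (\<lambda>n. T (u n))"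
proof -
  interpret E': normed_mod E' by (rule E')
  have minus: "T (x \<ominus> y) = T x \<ominus>\<^bsub>E'\<^esub> T y" if "x \<in> carrier E" "y \<in> carrier E" for x y
    using that T by (simp add: a_minus_def minus_smult E'.minus_smult add smult)
  have zero: "T \<zero> = \<zero>\<^bsub>E'\<^esub>" using smult[of \<zero> 0] T[of \<zero>] by simp
  have sum: "T (\<Oplus>n\<in>{..<N::nat}. x n) = (\<Oplus>\<^bsub>E'\<^esub>n\<in>{..<N}. T (x n))" if x: "\<And>n. x n \<in> carrier E" for x N
  proof (induction N)
    case (Suc N)
    have "(\<Oplus>n\<in>{..<N}. x n) \<in> carrier E" using x by (intro finsum_closed) auto
    then show ?case
      using x T Suc by (simp only: finsum_lessThan_Suc E'.finsum_lessThan_Suc add)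
  qed (simp add: zero)
  obtain f where "borel_continuation E k d u f" using u by (auto simp: summable_in_def)
  then obtain \<alpha> r \<epsilon> where uc: "\<And>n. u n \<in> carrier E" and *: "0 < \<alpha>" "\<alpha> \<le> 2 * pi" "0 < r" "0 < \<epsilon>"
    and f: "f \<in> exp_growth E k d \<alpha> r"
    and lim: "\<And>t. t \<in> ball 0 \<epsilon> \<Longrightarrow>
        (\<lambda>N. nrm E ((\<Oplus>n\<in>{..<N}. t ^ n \<odot> borel_transform E (Gamma_seq (1 / k)) u n) \<ominus> f t)) \<longlonglongrightarrow> 0"
    unfolding borel_continuation_def by auto
  have hol: "holomorphic_into E f (disc_sector d \<alpha> r)" and gr: "growth_bound E k d \<alpha> r f"
    using f by (auto simp: exp_growth_iff)
  have fc: "f t \<in> carrier E" if "t \<in> disc_sector d \<alpha> r" for t using hol that by (auto simp: holomorphic_into_def)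
  have "holomorphic_into E' (\<lambda>t. T (f t)) (disc_sector d \<alpha> r)"
    unfolding holomorphic_into_def
  proof (intro conjI ballI)
    fix z assume z: "z \<in> disc_sector d \<alpha> r"
    show "T (f z) \<in> carrier E'" using T fc z by blast
    obtain D where D: "D \<in> carrier E"
      "((\<lambda>w. nrm E (inverse (w - z) \<odot> (f w \<ominus> f z) \<ominus> D)) \<longlongrightarrow> 0) (at z within disc_sector d \<alpha> r)"
      using hol z unfolding holomorphic_into_def by blast
    have "((\<lambda>w. nrm E' (inverse (w - z) \<odot>\<^bsub>E'\<^esub> (T (f w) \<ominus>\<^bsub>E'\<^esub> T (f z)) \<ominus>\<^bsub>E'\<^esub> T D)) \<longlongrightarrow> 0) (at z within disc_sector d \<alpha> r)"
    proof (rule Lim_null_comparison[OF _ tendsto_mult_right_zero[OF D(2), of C]])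
      have "\<forall>\<^sub>F w in at z within disc_sector d \<alpha> r. w \<in> disc_sector d \<alpha> r" by (simp add: eventually_at_filter)
      then show "\<forall>\<^sub>F w in at z within disc_sector d \<alpha> r.
          norm (nrm E' (inverse (w - z) \<odot>\<^bsub>E'\<^esub> (T (f w) \<ominus>\<^bsub>E'\<^esub> T (f z)) \<ominus>\<^bsub>E'\<^esub> T D))
          \<le> C * nrm E (inverse (w - z) \<odot> (f w \<ominus> f z) \<ominus> D)"
      proof eventually_elim
        case (elim w)
        let ?q = "inverse (w - z) \<odot> (f w \<ominus> f z) \<ominus> D"
        have q: "?q \<in> carrier E" using fc[OF elim] fc[OF z] D by auto
        have "T ?q = inverse (w - z) \<odot>\<^bsub>E'\<^esub> (T (f w) \<ominus>\<^bsub>E'\<^esub> T (f z)) \<ominus>\<^bsub>E'\<^esub> T D"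
          using fc[OF elim] fc[OF z] D by (simp add: minus smult)
        then show ?case using bd[OF q] E'.nrm_nonneg[OF T[OF q]] by simp
      qed
    qed
    then show "\<exists>D\<in>carrier E'. ((\<lambda>w. nrm E' (inverse (w - z) \<odot>\<^bsub>E'\<^esub> (T (f w) \<ominus>\<^bsub>E'\<^esub> T (f z)) \<ominus>\<^bsub>E'\<^esub> D)) \<longlongrightarrow> 0)
        (at z within disc_sector d \<alpha> r)" using T D by blast
  qed
  moreover have "growth_bound E' k d \<alpha> r (\<lambda>t. T (f t))"
    unfolding growth_bound_def
  proof (intro ballI)
    fix \<alpha>' r' assume a: "\<alpha>' \<in> {0<..<\<alpha>}" "r' \<in> {0<..<r}"
    then obtain A B where AB: "A > 0" "B > 0" "\<And>t. t \<in> disc_sector d \<alpha>' r' \<Longrightarrow> nrm E (f t) < A * exp (B * cmod t powr k)"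
      using gr unfolding growth_bound_def by meson
    have "nrm E' (T (f t)) < (C * A) * exp (B * cmod t powr k)" if t: "t \<in> disc_sector d \<alpha>' r'" for t
    proof -
      have "t \<in> disc_sector d \<alpha> r" using disc_sector_mono[of \<alpha>' \<alpha> r' r d] t a by auto
      from bd[OF fc[OF this]] have "nrm E' (T (f t)) \<le> C * nrm E (f t)" .
      also have "\<dots> < C * (A * exp (B * cmod t powr k))" using AB(3)[OF t] C by (intro mult_strict_left_mono)
      finally show ?thesis by (simp add: mult.assoc)
    qed
    then show "\<exists>A>0. \<exists>B>0. \<forall>t\<in>disc_sector d \<alpha>' r'. nrm E' (T (f t)) < A * exp (B * cmod t powr k)"
      using AB C by (intro exI[of _ "C * A"] exI[of _ B] conjI) auto
  qed
  ultimately have "(\<lambda>t. T (f t)) \<in> exp_growth E' k d \<alpha> r" by (simp add: exp_growth_iff)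
  moreover have "(\<lambda>N. nrm E' ((\<Oplus>\<^bsub>E'\<^esub>n\<in>{..<N}. t ^ n \<odot>\<^bsub>E'\<^esub> borel_transform E' (Gamma_seq (1 / k)) (\<lambda>n. T (u n)) n) \<ominus>\<^bsub>E'\<^esub> T (f t))) \<longlonglongrightarrow> 0"
    if t: "t \<in> ball 0 (min \<epsilon> r)" for t
  proof (rule Lim_null_comparison[OF _ tendsto_mult_right_zero[OF lim, of t C]])
    show "t \<in> ball 0 \<epsilon>" using t by auto
    have ft: "f t \<in> carrier E" using t by (intro fc) (auto simp: disc_sector_def)
    have b: "t ^ n \<odot> borel_transform E (Gamma_seq (1 / k)) u n \<in> carrier E" for n using uc by (simp add: borel_transform_def)
    have "norm (nrm E' ((\<Oplus>\<^bsub>E'\<^esub>n\<in>{..<N}. t ^ n \<odot>\<^bsub>E'\<^esub> borel_transform E' (Gamma_seq (1 / k)) (\<lambda>n. T (u n)) n) \<ominus>\<^bsub>E'\<^esub> T (f t)))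
        \<le> C * nrm E ((\<Oplus>n\<in>{..<N}. t ^ n \<odot> borel_transform E (Gamma_seq (1 / k)) u n) \<ominus> f t)" for N
    proof -
      let ?q = "(\<Oplus>n\<in>{..<N}. t ^ n \<odot> borel_transform E (Gamma_seq (1 / k)) u n)"
      have q: "?q \<in> carrier E" using b by (intro finsum_closed) auto
      have "T ?q = (\<Oplus>\<^bsub>E'\<^esub>n\<in>{..<N}. t ^ n \<odot>\<^bsub>E'\<^esub> borel_transform E' (Gamma_seq (1 / k)) (\<lambda>n. T (u n)) n)"
        using uc b by (simp add: sum smult borel_transform_def)
      then show ?thesis using bd[of "?q \<ominus> f t"] minus[OF q ft] q ft E'.nrm_nonneg[OF T[of "?q \<ominus> f t"]] by simp
    qed
    then show "\<forall>\<^sub>F N in sequentially. norm (nrm E' ((\<Oplus>\<^bsub>E'\<^esub>n\<in>{..<N}. t ^ n \<odot>\<^bsub>E'\<^esub> borel_transform E' (Gamma_seq (1 / k)) (\<lambda>n. T (u n)) n) \<ominus>\<^bsub>E'\<^esub> T (f t)))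
        \<le> C * nrm E ((\<Oplus>n\<in>{..<N}. t ^ n \<odot> borel_transform E (Gamma_seq (1 / k)) u n) \<ominus> f t)"
      by (intro always_eventually allI)
  qed
  ultimately have "borel_continuation E' k d (\<lambda>n. T (u n)) (\<lambda>t. T (f t))"
    unfolding borel_continuation_def using * uc T
    by (intro conjI allI exI[of _ \<alpha>] exI[of _ r] exI[of _ "min \<epsilon> r"]) auto
  then show ?thesis by (auto simp: summable_in_def)
qed

lemma hol_simps [simp]:
  "\<zero>\<^bsub>hol_space r\<^esub> = (\<lambda>z. 0)" "f \<oplus>\<^bsub>hol_space r\<^esub> g = (\<lambda>z. f z + g z)" "c \<odot>\<^bsub>hol_space r\<^esub> f = (\<lambda>z. c * f z)"
  "nrm (hol_space r) f = (SUP z\<in>cball 0 r. cmod (f z))"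
  by (simp_all add: hol_space_def)

lemma hol_carrier:
  "f \<in> carrier (hol_space r) \<longleftrightarrow>
     continuous_on (cball 0 r) f \<and> f holomorphic_on ball 0 r \<and> (\<forall>z. z \<notin> cball 0 r \<longrightarrow> f z = 0)"
  by (simp add: hol_space_def)

lemma hol_nrm_upper: "f \<in> carrier (hol_space r) \<Longrightarrow> z \<in> cball 0 r \<Longrightarrow> cmod (f z) \<le> nrm (hol_space r) f"
proof -
  assume f: "f \<in> carrier (hol_space r)" and z: "z \<in> cball 0 r"
  have "compact ((\<lambda>z. cmod (f z)) ` cball 0 r)"
    using f by (intro compact_continuous_image continuous_intros) (auto simp: hol_carrier)
  then have "bdd_above ((\<lambda>z. cmod (f z)) ` cball 0 r)" by (intro bounded_imp_bdd_above compact_imp_bounded)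
  from cSUP_upper[OF z this] show ?thesis by simp
qed

lemma hol_nrm_least: "r > 0 \<Longrightarrow> (\<And>z. z \<in> cball 0 r \<Longrightarrow> cmod (f z) \<le> B) \<Longrightarrow> nrm (hol_space r) f \<le> B"
  unfolding hol_simps by (rule cSUP_least) auto

lemma module_hol: "module complex_ring (hol_space r)"
proof (rule moduleI[OF cring_complex_ring])
  show smult: "c \<odot>\<^bsub>hol_space r\<^esub> f \<in> carrier (hol_space r)" if "f \<in> carrier (hol_space r)" for c f
    using that by (auto simp: hol_carrier intro!: continuous_intros holomorphic_intros)
  show "abelian_group (hol_space r)"
  proof (rule abelian_groupI)
    show "\<exists>y\<in>carrier (hol_space r). y \<oplus>\<^bsub>hol_space r\<^esub> f = \<zero>\<^bsub>hol_space r\<^esub>" if "f \<in> carrier (hol_space r)" for f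
      using smult[OF that, of "-1"] by (intro bexI[of _ "\<lambda>z. - f z"]) auto
    show "f \<oplus>\<^bsub>hol_space r\<^esub> g \<in> carrier (hol_space r)" if "f \<in> carrier (hol_space r)" "g \<in> carrier (hol_space r)" for f g
      using that by (auto simp: hol_carrier intro!: continuous_intros holomorphic_intros)
    show "\<zero>\<^bsub>hol_space r\<^esub> \<in> carrier (hol_space r)"
      by (auto simp: hol_carrier intro!: continuous_intros holomorphic_intros)
  qed (auto simp: algebra_simps)
qed (auto simp: algebra_simps)

lemma normed_hol:
  assumes r: "r > 0" shows "normed_mod (hol_space r)"
proof (rule normed_mod.intro)
  show "module complex_ring (hol_space r)" by (rule module_hol)
  interpret m: module complex_ring "hol_space r" by (rule module_hol)
  fix f assume f: "f \<in> carrier (hol_space r)"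
  have z0: "0 \<in> cball (0::complex) r" using r by simp
  show nn: "0 \<le> nrm (hol_space r) f"
    by (rule order_trans[OF _ hol_nrm_upper[OF f z0]]) simp
  show "nrm (hol_space r) f = 0 \<longleftrightarrow> f = \<zero>\<^bsub>hol_space r\<^esub>"
  proof
    assume 0: "nrm (hol_space r) f = 0"
    have "f z = 0" for z
    proof (cases "z \<in> cball 0 r")
      case True then show ?thesis using hol_nrm_upper[OF f True] 0 by simp
    next
      case False then show ?thesis using f unfolding hol_carrier by blast
    qed
    then show "f = \<zero>\<^bsub>hol_space r\<^esub>" by auto
  qed (use z0 in auto)
  show "nrm (hol_space r) (f \<oplus>\<^bsub>hol_space r\<^esub> g) \<le> nrm (hol_space r) f + nrm (hol_space r) g" if g: "g \<in> carrier (hol_space r)" for g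
  proof (rule hol_nrm_least[OF r])
    fix z :: complex assume z: "z \<in> cball 0 r"
    show "cmod ((f \<oplus>\<^bsub>hol_space r\<^esub> g) z) \<le> nrm (hol_space r) f + nrm (hol_space r) g"
      using norm_triangle_mono[OF hol_nrm_upper[OF f z] hol_nrm_upper[OF g z]] by simp
  qed
  have le: "nrm (hol_space r) (c \<odot>\<^bsub>hol_space r\<^esub> f) \<le> cmod c * nrm (hol_space r) f" if f: "f \<in> carrier (hol_space r)" for c f
  proof (rule hol_nrm_least[OF r])
    fix z :: complex assume z: "z \<in> cball 0 r"
    show "cmod ((c \<odot>\<^bsub>hol_space r\<^esub> f) z) \<le> cmod c * nrm (hol_space r) f"
      using mult_left_mono[OF hol_nrm_upper[OF f z], of "cmod c"] by (simp add: norm_mult)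
  qed
  show "nrm (hol_space r) (c \<odot>\<^bsub>hol_space r\<^esub> f) = cmod c * nrm (hol_space r) f" for c
  proof (rule antisym[OF le[OF f]])
    show "cmod c * nrm (hol_space r) f \<le> nrm (hol_space r) (c \<odot>\<^bsub>hol_space r\<^esub> f)"
    proof (cases "c = 0")
      case False
      have "inverse c \<odot>\<^bsub>hol_space r\<^esub> (c \<odot>\<^bsub>hol_space r\<^esub> f) = f" using False by (simp add: mult.assoc[symmetric])
      then have "nrm (hol_space r) f \<le> cmod (inverse c) * nrm (hol_space r) (c \<odot>\<^bsub>hol_space r\<^esub> f)"
        using le[of "c \<odot>\<^bsub>hol_space r\<^esub> f" "inverse c"] m.smult_closed[of c f] f by simp
      moreover have "x \<le> inverse b * y \<Longrightarrow> b > 0 \<Longrightarrow> b * x \<le> y" for b x y :: real by (simp add: field_simps)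
      ultimately show ?thesis using False unfolding norm_inverse by (meson zero_less_norm_iff)
    next
      case True
      then show ?thesis using hol_nrm_upper[of "c \<odot>\<^bsub>hol_space r\<^esub> f" r 0] m.smult_closed[of c f] f r by simp
    qed
  qed
qed

lemma functional_eval: "z \<in> cball 0 r \<Longrightarrow> functional (hol_space r) (\<lambda>f. f z)"
  unfolding functional_def using hol_nrm_upper[of _ r z] by (auto simp del: hol_simps(4))

lemma fps_expansion_of_sums:
  assumes \<delta>: "\<delta> > 0" and s: "\<And>z. cmod z < \<delta> \<Longrightarrow> (\<lambda>n. c n * z ^ n) sums f z"
  shows "fps_expansion f 0 = Abs_fps c"
proof (rule fps_expansion_eqI)
  have "conv_radius c \<ge> norm (complex_of_real (\<delta> / 2))"
    by (rule conv_radius_geI) (use s[of "complex_of_real (\<delta> / 2)"] \<delta> in \<open>auto simp: sums_iff\<close>)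
  then have "fps_conv_radius (Abs_fps c) > 0"
    using \<delta> by (simp add: fps_conv_radius_def) (metis less_le_trans ereal_less(2) half_gt_zero)
  moreover have "\<forall>\<^sub>F z in nhds 0. eval_fps (Abs_fps c) z = f z"
  proof -
    have "\<forall>\<^sub>F z in nhds (0::complex). z \<in> ball 0 \<delta>" using \<delta> by (intro eventually_nhds_in_open) auto
    then show ?thesis by eventually_elim (use s in \<open>auto simp: eval_fps_def sums_iff\<close>)
  qed
  ultimately show "f has_fps_expansion Abs_fps c" by (simp add: has_fps_expansion_def)
qed

definition to_hol :: "real \<Rightarrow> (nat \<Rightarrow> complex) \<Rightarrow> complex \<Rightarrow> complex" where
  "to_hol r c z = (if z \<in> cball 0 r then \<Sum>j. c j * z ^ j else 0)"

lemma wseq_sums: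
  assumes \<rho>: "\<rho> > 0" and c: "c \<in> carrier (wseq \<rho>)" and z: "cmod z < \<rho>"
  shows "summable (\<lambda>j. c j * z ^ j)"
proof (rule summable_comparison_test'[of "\<lambda>j. nrm (wseq \<rho>) c * (cmod z / \<rho>) ^ j" 0])
  show "summable (\<lambda>j. nrm (wseq \<rho>) c * (cmod z / \<rho>) ^ j)"
    using z \<rho> by (intro summable_mult summable_geometric) simp
  show "norm (c j * z ^ j) \<le> nrm (wseq \<rho>) c * (cmod z / \<rho>) ^ j" for j
  proof -
    have "norm (c j * z ^ j) = (cmod (c j) * \<rho> ^ j) * (cmod z / \<rho>) ^ j"
      using \<rho> by (simp add: norm_mult norm_power power_divide)
    also have "\<dots> \<le> nrm (wseq \<rho>) c * (cmod z / \<rho>) ^ j"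
      using \<rho> by (intro mult_right_mono wseq_nrm_upper c) auto
    finally show ?thesis .
  qed
qed

lemma wseq_suminf_bound:
  assumes \<rho>: "\<rho> > 0" and c: "c \<in> carrier (wseq \<rho>)" and z: "cmod z \<le> \<rho> / 2"
  shows "cmod (\<Sum>j. c j * z ^ j) \<le> 2 * nrm (wseq \<rho>) c"
proof -
  have n: "nrm (wseq \<rho>) c \<ge> 0" by (rule order_trans[OF _ wseq_nrm_upper[OF c, of 0]]) simp
  have "norm (c j * z ^ j) \<le> nrm (wseq \<rho>) c * (1 / 2) ^ j" for j
  proof -
    have "norm (c j * z ^ j) = (cmod (c j) * \<rho> ^ j) * (cmod z / \<rho>) ^ j"
      using \<rho> by (simp add: norm_mult norm_power power_divide)
    also have "\<dots> \<le> nrm (wseq \<rho>) c * (1 / 2) ^ j"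
      using \<rho> z n by (intro mult_mono wseq_nrm_upper c power_mono) (auto simp: field_simps)
    finally show ?thesis .
  qed
  then have "cmod (\<Sum>j. c j * z ^ j) \<le> (\<Sum>j. nrm (wseq \<rho>) c * (1 / 2) ^ j)"
    by (intro norm_suminf_le) (auto intro!: summable_mult summable_geometric)
  also have "\<dots> = 2 * nrm (wseq \<rho>) c" using suminf_mult[of "\<lambda>j. (1 / 2 :: real) ^ j" "nrm (wseq \<rho>) c"]
    by (simp add: suminf_geometric del: wseq_simps)
  finally show ?thesis .
qed

lemma to_hol_carrier:
  assumes \<rho>: "\<rho> > 0" and c: "c \<in> carrier (wseq \<rho>)"
  shows "to_hol (\<rho> / 2) c \<in> carrier (hol_space (\<rho> / 2))"
proof -
  have "(\<lambda>z. \<Sum>j. c j * z ^ j) holomorphic_on ball 0 \<rho>"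
    by (rule power_series_holomorphic[of _ _ c]) (use wseq_sums[OF \<rho> c] in \<open>auto simp: summable_sums\<close>)
  moreover have "cball (0::complex) (\<rho> / 2) \<subseteq> ball 0 \<rho>" using \<rho> by auto
  ultimately have h: "(\<lambda>z. \<Sum>j. c j * z ^ j) holomorphic_on cball 0 (\<rho> / 2)" by (rule holomorphic_on_subset)
  have "to_hol (\<rho> / 2) c holomorphic_on cball 0 (\<rho> / 2)"
    by (rule holomorphic_transform[OF h]) (simp add: to_hol_def)
  then have "continuous_on (cball 0 (\<rho> / 2)) (to_hol (\<rho> / 2) c)" "to_hol (\<rho> / 2) c holomorphic_on ball 0 (\<rho> / 2)"
    using holomorphic_on_imp_continuous_on holomorphic_on_subset[OF _ ball_subset_cball] by blast+
  then show ?thesis unfolding hol_carrier by (simp add: to_hol_def)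
qed

lemma hol_summable_in_wseq:
  assumes \<rho>: "\<rho> > 0" and s: "summable_in (wseq \<rho>) k d c"
  shows "hol_summable_in k d (\<lambda>n. Abs_fps (c n))"
proof -
  interpret W: normed_mod "wseq \<rho>" by (rule normed_wseq[OF \<rho>])
  have r: "\<rho> / 2 > 0" using \<rho> by simp
  have small: "cmod z < \<rho>" if "z \<in> cball 0 (\<rho> / 2)" for z using that \<rho> by simp
  have "summable_in (hol_space (\<rho> / 2)) k d (\<lambda>n. to_hol (\<rho> / 2) (c n))"
  proof (rule W.summable_in_linear_image[OF normed_hol[OF r] _ _ _ _ _ s, where C = 2])
    show "to_hol (\<rho> / 2) x \<in> carrier (hol_space (\<rho> / 2))" if "x \<in> carrier (wseq \<rho>)" for x
      using to_hol_carrier[OF \<rho> that] .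
    show "to_hol (\<rho> / 2) (x \<oplus>\<^bsub>wseq \<rho>\<^esub> y) = to_hol (\<rho> / 2) x \<oplus>\<^bsub>hol_space (\<rho> / 2)\<^esub> to_hol (\<rho> / 2) y"
      if "x \<in> carrier (wseq \<rho>)" "y \<in> carrier (wseq \<rho>)" for x y
      using suminf_add[OF wseq_sums[OF \<rho> that(1) small] wseq_sums[OF \<rho> that(2) small]]
      by (auto simp: to_hol_def fun_eq_iff distrib_right)
    show "to_hol (\<rho> / 2) (a \<odot>\<^bsub>wseq \<rho>\<^esub> x) = a \<odot>\<^bsub>hol_space (\<rho> / 2)\<^esub> to_hol (\<rho> / 2) x"
      if "x \<in> carrier (wseq \<rho>)" for a x
      using suminf_mult[OF wseq_sums[OF \<rho> that small], of _ a]
      by (auto simp: to_hol_def fun_eq_iff mult.assoc)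
    show "nrm (hol_space (\<rho> / 2)) (to_hol (\<rho> / 2) x) \<le> 2 * nrm (wseq \<rho>) x" if "x \<in> carrier (wseq \<rho>)" for x
    proof (rule hol_nrm_least[OF r])
      fix z :: complex assume "z \<in> cball 0 (\<rho> / 2)"
      then show "cmod (to_hol (\<rho> / 2) x z) \<le> 2 * nrm (wseq \<rho>) x"
        using wseq_suminf_bound[OF \<rho> that, of z] by (simp add: to_hol_def)
    qed
  qed simp
  moreover have "represents (\<rho> / 2) (\<lambda>n. to_hol (\<rho> / 2) (c n)) (\<lambda>n. Abs_fps (c n))"
    unfolding represents_def
  proof (intro allI conjI)
    fix n
    have cn: "c n \<in> carrier (wseq \<rho>)" using s by (auto simp: summable_in_def borel_continuation_def)
    show "to_hol (\<rho> / 2) (c n) \<in> carrier (hol_space (\<rho> / 2))" by (rule to_hol_carrier[OF \<rho> cn])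
    show "fps_expansion (to_hol (\<rho> / 2) (c n)) 0 = Abs_fps (c n)"
      by (rule fps_expansion_of_sums[OF r]) (use wseq_sums[OF \<rho> cn] \<rho> in \<open>auto simp: to_hol_def summable_sums\<close>)
  qed
  ultimately show ?thesis unfolding hol_summable_in_def using r by blast
qed

lemma hol_summable_in_hol_series: "hol_summable_in k d u \<Longrightarrow> u \<in> hol_series"
  by (auto simp: hol_summable_in_def hol_series_def)

lemma hol_summable_inE:
  assumes "hol_summable_in k d u"
  obtains r v F where "r > 0" "represents r v u" "borel_continuation (hol_space r) k d v F"
    "continues k d (\<lambda>n. fps_nth (u n) 0 / complex_of_real (Gamma_seq (1 / k) n)) (\<lambda>t. F t 0)"
proof -
  obtain r v F where *: "r > 0" "represents r v u" "borel_continuation (hol_space r) k d v F"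
    using assms unfolding hol_summable_in_def summable_in_def by blast
  interpret normed_mod "hol_space r" by (rule normed_hol[OF *(1)])
  have "continues k d (\<lambda>n. v n 0 / complex_of_real (Gamma_seq (1 / k) n)) (\<lambda>t. F t 0)"
    by (rule continues_functional[OF *(3) functional_eval]) (use * in auto)
  moreover have "v n 0 = fps_nth (u n) 0" for n
  proof -
    have "fps_expansion (v n) 0 = u n" using *(2) by (auto simp: represents_def)
    moreover have "fps_nth (fps_expansion (v n) 0) 0 = v n 0" by (simp add: fps_expansion_def)
    ultimately show ?thesis by simp
  qed
  ultimately show thesis using that * by simp
qed

section \<open>The formal solution and its singular directions\<close>

lemma disc_sector_connected: "0 < r \<Longrightarrow> connected (disc_sector d \<alpha> r)"
proof (intro starlike_imp_connected)
  assume r: "0 < r"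
  show "starlike (disc_sector d \<alpha> r)"
    unfolding starlike_def
  proof (intro bexI[of _ 0] ballI subsetI)
    fix z w assume z: "z \<in> disc_sector d \<alpha> r" and w: "w \<in> closed_segment 0 z"
    then obtain x where "w = complex_of_real x * z" "0 \<le> x" "x \<le> 1" by (auto simp: in_segment scaleR_conv_of_real)
    then show "w \<in> disc_sector d \<alpha> r" using disc_sector_scale[OF z r] by simp
  qed (use r in \<open>auto simp: disc_sector_def\<close>)
qed

text \<open>
  The product of a continuation with \<open>1 - z * t\<close> is constant on the disc-sector, which contains the zero
  \<open>1 / z\<close> of the second factor.
\<close>

lemma not_continues_geometric:
  assumes c: "c \<noteq> 0" and z: "z \<noteq> 0" "z * cis d \<in> \<real>\<^sub>\<ge>\<^sub>0"
  shows "\<not> continues k d (\<lambda>n. c * z ^ n) f"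
proof
  assume "continues k d (\<lambda>n. c * z ^ n) f"
  then obtain \<alpha> r \<epsilon> where *: "0 < \<alpha>" "\<alpha> \<le> 2 * pi" "0 < r" "0 < \<epsilon>" "f holomorphic_on disc_sector d \<alpha> r"
    "\<And>t. cmod t < \<epsilon> \<Longrightarrow> (\<lambda>n. c * z ^ n * t ^ n) sums f t"
    unfolding continues_def by blast
  define \<delta> where "\<delta> = min (min \<epsilon> r) (1 / cmod z)"
  have \<delta>: "0 < \<delta>" "\<delta> \<le> \<epsilon>" "\<delta> \<le> r" "\<delta> \<le> 1 / cmod z" using * z by (auto simp: \<delta>_def)
  have p: "z * cis d = complex_of_real (cmod z)"
  proof -
    obtain x where x: "z * cis d = complex_of_real x" "x \<ge> 0" using z(2) by (auto elim: nonneg_Reals_cases)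
    have "cmod z = cmod (z * cis d)" by (simp add: norm_mult)
    also have "\<dots> = x" using x by simp
    finally show ?thesis using x by simp
  qed
  have "f (1 / z) * (1 - z * (1 / z)) = c"
  proof (rule analytic_continuation_open[of "ball 0 \<delta>" "disc_sector d \<alpha> r" "\<lambda>t. f t * (1 - z * t)" "\<lambda>t. c"])
    show "open (disc_sector d \<alpha> r)" using * by (intro open_disc_sector)
    show "connected (disc_sector d \<alpha> r)" using * by (intro disc_sector_connected)
    show "ball 0 \<delta> \<subseteq> disc_sector d \<alpha> r" using \<delta> by (auto simp: disc_sector_def)
    show "(\<lambda>t. f t * (1 - z * t)) holomorphic_on disc_sector d \<alpha> r" by (intro holomorphic_intros *)
    show "f t * (1 - z * t) = c" if "t \<in> ball 0 \<delta>" for t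
    proof -
      have t: "cmod t < \<epsilon>" "cmod t < 1 / cmod z" using that \<delta> by auto
      then have zt: "cmod (z * t) < 1" using z by (simp add: norm_mult field_simps)
      have "(\<lambda>n. c * z ^ n * t ^ n) sums (c * (1 / (1 - z * t)))"
        using sums_mult[OF geometric_sums[OF zt], of c] by (simp add: power_mult_distrib mult.assoc)
      then have "f t = c * (1 / (1 - z * t))" using *(6)[OF t(1)] sums_unique2 by blast
      moreover have "1 - z * t \<noteq> 0" using zt by auto
      ultimately show ?thesis by simp
    qed
    have "1 / z = rcis (1 / cmod z) d"
    proof -
      have "z * rcis (1 / cmod z) d = (z * cis d) * complex_of_real (1 / cmod z)" by (simp add: rcis_def)
      also have "\<dots> = 1" unfolding p using z by simp
      finally show ?thesis using z by (simp add: field_simps)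
    qed
    also have "\<dots> \<in> disc_sector d \<alpha> r" using z * by (auto simp: disc_sector_def intro!: disjI1 rcis_in_sector)
    finally show "1 / z \<in> disc_sector d \<alpha> r" .
  qed (use \<delta> in auto)
  then show False using c z by simp
qed

lemma rcis_nonneg_iff: "r > 0 \<Longrightarrow> rcis r \<theta> \<in> \<real>\<^sub>\<ge>\<^sub>0 \<longleftrightarrow> (\<exists>n::int. \<theta> = 2 * pi * of_int n)"
proof
  assume r: "r > 0" and "rcis r \<theta> \<in> \<real>\<^sub>\<ge>\<^sub>0"
  then have "sin \<theta> = 0" "0 \<le> cos \<theta>" by (auto simp: complex_nonneg_Reals_iff rcis_def zero_le_mult_iff)
  then have "cos \<theta> = 1" using sin_cos_squared_add[of \<theta>] by (auto simp: power2_eq_1_iff)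
  then show "\<exists>n::int. \<theta> = 2 * pi * of_int n" by (auto simp: cos_one_2pi_int mult_ac)
next
  assume "r > 0" "\<exists>n::int. \<theta> = 2 * pi * of_int n"
  then show "rcis r \<theta> \<in> \<real>\<^sub>\<ge>\<^sub>0" by (auto simp: complex_nonneg_Reals_iff rcis_def sin_int_2pin cos_int_2pin)
qed

locale moment_cauchy_problem =
  fixes m1 m2 :: "nat \<Rightarrow> real" and s1 s2 :: real and a lam z0 :: complex
  assumes m1: "preserves_summability m1" and m2: "preserves_summability m2"
    and s: "0 \<le> s1" "s1 < s2" and z0: "z0 \<noteq> 0"
begin

definition "mt1 = (\<lambda>n. Gamma_seq s1 n * m1 n)"
definition "mt2 = (\<lambda>n. Gamma_seq s2 n * m2 n)"
definition "k = 1 / (s2 - s1)"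
definition "c = lam / z0"
definition "m = (\<lambda>n. Gamma_seq s2 n / (Gamma_seq s1 n * Gamma_seq (s2 - s1) n) * (m2 n / m1 n))"

text \<open>
  The only possible coefficient of \<open>t ^ n * z ^ j\<close>: each step in \<open>t\<close> multiplies by \<open>lam\<close> and shifts the powers of \<open>z\<close>, so
  it depends on \<open>mt2\<close> through the telescoping product \<open>mt2 (n + j) / mt2 j\<close>.
\<close>

definition coeffs :: "nat \<Rightarrow> nat \<Rightarrow> complex" where
  "coeffs n j = - (a / z0) * (c ^ n * (1 / z0) ^ j * complex_of_real (mt2 (n + j) / (mt1 n * mt2 j)))"

definition U :: "nat \<Rightarrow> complex fps" where "U n = Abs_fps (coeffs n)"

lemma k: "k > 0" and k_inverse: "1 / k = s2 - s1"
  using s by (auto simp: k_def)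

lemma mt_pos: "mt1 n > 0" "mt2 n > 0"
  using m1 m2 s by (auto simp: mt1_def mt2_def preserves_summability_def intro!: mult_pos_pos Gamma_seq_pos)

lemma mt_0: "mt1 0 = 1" "mt2 0 = 1"
  using m1 m2 by (auto simp: mt1_def mt2_def preserves_summability_def)

lemma preserves_m: "preserves_summability m"
  unfolding m_def
  using preserves_summability_mult_divide[OF preserves_summability_binomial[of s1 "s2 - s1"] m1 m2] s by simp

lemma summable_U:
  assumes d: "a = 0 \<or> c = 0 \<or> c * cis d \<notin> \<real>\<^sub>\<ge>\<^sub>0"
  shows "hol_summable_in k d U"
proof -
  \<comment> \<open>The solution with \<open>a = 0\<close> vanishes; the base 0 gives summability in all directions in this case.\<close>
  define z where "z = (if a = 0 then 0 else c)"
  have z: "z * cis d \<notin> \<real>\<^sub>\<ge>\<^sub>0 \<or> z = 0" using d by (auto simp: z_def)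
  obtain \<rho> where \<rho>: "\<rho> > 0" and su: "summable_in (wseq \<rho>) (1 / (s2 - s1)) d (\<lambda>n j. z ^ n * (1 / z0) ^ j * complex_of_real
     (Gamma_seq s2 (n + j) * m2 (n + j) / (Gamma_seq s1 n * m1 n * (Gamma_seq s2 j * m2 j))))"
    by (rule summable_solution_wseq[OF m1 m2 s z])
  interpret W: normed_mod "wseq \<rho>" by (rule normed_wseq[OF \<rho>])
  let ?T = "\<lambda>x. - (a / z0) \<odot>\<^bsub>wseq \<rho>\<^esub> x"
  have "summable_in (wseq \<rho>) k d (\<lambda>n. ?T (\<lambda>j. z ^ n * (1 / z0) ^ j * complex_of_real
     (Gamma_seq s2 (n + j) * m2 (n + j) / (Gamma_seq s1 n * m1 n * (Gamma_seq s2 j * m2 j)))))"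
  proof (rule W.summable_in_linear_image[OF W.normed_mod_axioms _ _ _ _ _ su[folded k_def], where C = "cmod (- (a / z0)) + 1"])
    show "nrm (wseq \<rho>) (?T x) \<le> (cmod (- (a / z0)) + 1) * nrm (wseq \<rho>) x" if x: "x \<in> carrier (wseq \<rho>)" for x
      unfolding W.nrm_smult[OF x] using W.nrm_nonneg[OF x] by (intro mult_right_mono) auto
    show "?T (b \<odot>\<^bsub>wseq \<rho>\<^esub> x) = b \<odot>\<^bsub>wseq \<rho>\<^esub> ?T x" if "x \<in> carrier (wseq \<rho>)" for b x
      by (simp add: mult_ac)
    show "?T x \<in> carrier (wseq \<rho>)" if "x \<in> carrier (wseq \<rho>)" for x
      by (rule W.smult_closed'[OF that])
    show "0 < cmod (- (a / z0)) + 1" by (rule add_nonneg_pos) simp_all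
  qed (auto simp: algebra_simps)
  then have "hol_summable_in k d (\<lambda>n. Abs_fps (?T (\<lambda>j. z ^ n * (1 / z0) ^ j * complex_of_real
     (Gamma_seq s2 (n + j) * m2 (n + j) / (Gamma_seq s1 n * m1 n * (Gamma_seq s2 j * m2 j))))))"
    by (rule hol_summable_in_wseq[OF \<rho>])
  also have "(\<lambda>n. Abs_fps (?T (\<lambda>j. z ^ n * (1 / z0) ^ j * complex_of_real
     (Gamma_seq s2 (n + j) * m2 (n + j) / (Gamma_seq s1 n * m1 n * (Gamma_seq s2 j * m2 j)))))) = U"
    by (auto simp: U_def coeffs_def[abs_def] mt1_def mt2_def z_def fun_eq_iff)
  finally show ?thesis .
qed

lemma U_formal_solution: "formal_solution mt1 mt2 lam (\<lambda>z. a / (z - z0)) U"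
  unfolding formal_solution_def
proof (intro conjI allI)
  have "c * cis (pi - Arg c) \<notin> \<real>\<^sub>\<ge>\<^sub>0 \<or> c = 0"
  proof (cases "c = 0")
    case False
    have "c * cis (pi - Arg c) = rcis (cmod c) (Arg c) * cis (pi - Arg c)" by (simp add: rcis_cmod_Arg)
    also have "\<dots> = rcis (cmod c) pi" by (simp only: cis_rcis_eq rcis_mult) simp
    also have "\<dots> = - complex_of_real (cmod c)" by (simp add: rcis_def)
    finally show ?thesis using False by (simp add: complex_nonneg_Reals_iff)
  qed simp
  then show "U \<in> hol_series" using summable_U hol_summable_in_hol_series by blast
  show "moment_deriv_t mt1 U n - fps_const lam * moment_deriv_z mt2 (U n) = 0" for n
  proof -
    have "fps_nth (moment_deriv_t mt1 U n) j = fps_nth (fps_const lam * moment_deriv_z mt2 (U n)) j" for j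
    proof -
      have "fps_nth (moment_deriv_t mt1 U n) j = - (a / z0) * (c ^ Suc n * (1 / z0) ^ j * complex_of_real (mt2 (Suc (n + j)) / (mt1 n * mt2 j)))"
        using mt_pos[of "Suc n"] by (simp add: moment_deriv_t_def U_def coeffs_def mult_ac)
      moreover have "fps_nth (fps_const lam * moment_deriv_z mt2 (U n)) j = lam * (- (a / z0) * (c ^ n * (1 / z0) ^ Suc j * complex_of_real (mt2 (Suc (n + j)) / (mt1 n * mt2 j))))"
        using mt_pos[of "Suc j"] by (simp add: moment_deriv_z_def U_def coeffs_def mult_ac)
      moreover have e: "c ^ Suc n * (1 / z0) ^ j = lam * (c ^ n * (1 / z0) ^ Suc j)" by (simp add: c_def)
      have "- (a / z0) * (c ^ Suc n * (1 / z0) ^ j * X) = lam * (- (a / z0) * (c ^ n * (1 / z0) ^ Suc j * X))" for X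
        unfolding e by (simp only: mult_ac)
      ultimately show ?thesis by (simp only:)
    qed
    then show ?thesis by (simp add: fps_eq_iff)
  qed
  have "fps_expansion (\<lambda>z. a / (z - z0)) 0 = Abs_fps (coeffs 0)"
  proof (rule fps_expansion_of_sums)
    show "cmod z0 > 0" using z0 by simp
    fix z assume z: "cmod z < cmod z0"
    then have q: "cmod (z / z0) < 1" using z0 by (simp add: norm_divide)
    have "z \<noteq> z0" using z by auto
    then have "- (a / z0) * (1 / (1 - z / z0)) = a / (z - z0)" using z0 by (simp add: divide_simps) (simp add: algebra_simps)
    then have "(\<lambda>j. - (a / z0) * (z / z0) ^ j) sums (a / (z - z0))"
      using sums_mult[OF geometric_sums[OF q], of "- (a / z0)"] by simp
    moreover have "- (a / z0) * (z / z0) ^ j = coeffs 0 j * z ^ j" for j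
      using mt_pos[of j] mt_0 by (simp add: coeffs_def power_divide)
    ultimately show "(\<lambda>j. coeffs 0 j * z ^ j) sums (a / (z - z0))" by simp
  qed
  then show "U 0 = fps_expansion (\<lambda>z. a / (z - z0)) 0" by (simp add: U_def)
qed

lemma formal_solution_unique:
  assumes u: "formal_solution mt1 mt2 lam (\<lambda>z. a / (z - z0)) u"
  shows "u = U"
proof
  fix n show "u n = U n"
  proof (induction n)
    case 0 then show ?case using u U_formal_solution by (simp add: formal_solution_def)
  next
    case (Suc n)
    have "fps_const (complex_of_real (mt1 (Suc n) / mt1 n)) * u (Suc n) = fps_const (complex_of_real (mt1 (Suc n) / mt1 n)) * U (Suc n)"
    proof -
      have e: "moment_deriv_t mt1 v n = fps_const lam * moment_deriv_z mt2 (v n)"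
        if "formal_solution mt1 mt2 lam (\<lambda>z. a / (z - z0)) v" for v
        using that by (simp add: formal_solution_def)
      from e[OF u] e[OF U_formal_solution] Suc show ?thesis by (simp add: moment_deriv_t_def)
    qed
    moreover have "fps_const (complex_of_real (mt1 (Suc n) / mt1 n)) \<noteq> 0" using mt_pos[of n] mt_pos[of "Suc n"] by simp
    ultimately show ?case by simp
  qed
qed

text \<open>
  The Borel transform divides by the Gamma sequence of order \<open>s2 - s1\<close>; this is how \<open>m\<close> arises.
\<close>

lemma borel_coeffs_at_0:
  "fps_nth (U n) 0 / complex_of_real (Gamma_seq (1 / k) n) = - (a / z0) * (complex_of_real (m n) * c ^ n)"
  using mt_0 by (simp add: U_def coeffs_def k_inverse m_def mt1_def mt2_def mult_ac)

text \<open>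
  Evaluate at \<open>z = 0\<close> and divide by \<open>m\<close>: a geometric series would have a continuation to its pole.
\<close>

lemma not_summable_U:
  assumes "a \<noteq> 0" "c \<noteq> 0" "c * cis d \<in> \<real>\<^sub>\<ge>\<^sub>0"
  shows "\<not> hol_summable_in k d U"
proof
  assume "hol_summable_in k d U"
  then obtain F where "continues k d (\<lambda>n. fps_nth (U n) 0 / complex_of_real (Gamma_seq (1 / k) n)) F"
    by (rule hol_summable_inE) blast
  then have "\<exists>f. continues k d (\<lambda>n. - (a / z0) * (complex_of_real (m n) * c ^ n)) f"
    unfolding borel_coeffs_at_0 by (rule exI[of _ F])
  then have "\<exists>f. continues k d (\<lambda>n. (- (a / z0) * (complex_of_real (m n) * c ^ n)) / complex_of_real (m n)) f"
    by (rule preserves_summability_continues[OF preserves_m k, THEN iffD1])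
  moreover have "m n \<noteq> 0" for n using preserves_m by (auto simp: preserves_summability_def less_le)
  then have "(\<lambda>n. (- (a / z0) * (complex_of_real (m n) * c ^ n)) / complex_of_real (m n)) = (\<lambda>n. - (a / z0) * c ^ n)"
    by (intro ext) simp
  ultimately have "\<exists>f. continues k d (\<lambda>n. - (a / z0) * c ^ n) f" by simp
  then show False using not_continues_geometric[of "- (a / z0)" c d k] assms z0 by auto
qed

lemma singular_directions_U:
  "singular_directions k U = {d. a \<noteq> 0 \<and> c \<noteq> 0 \<and> c * cis d \<in> \<real>\<^sub>\<ge>\<^sub>0}"
  using summable_U not_summable_U unfolding singular_directions_def by blast

lemma c_cis_nonneg_iff:
  assumes "lam \<noteq> 0"
  shows "c * cis d \<in> \<real>\<^sub>\<ge>\<^sub>0 \<longleftrightarrow> (\<exists>n::int. d = Arg z0 - Arg lam + 2 * pi * of_int n)"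
proof -
  have "c * cis d = rcis (cmod lam / cmod z0) (Arg lam - Arg z0 + d)"
  proof -
    have "c = rcis (cmod lam) (Arg lam) / rcis (cmod z0) (Arg z0)" by (simp add: c_def rcis_cmod_Arg)
    then show ?thesis by (simp add: rcis_divide cis_rcis_eq rcis_mult)
  qed
  then have "c * cis d \<in> \<real>\<^sub>\<ge>\<^sub>0 \<longleftrightarrow> (\<exists>n::int. Arg lam - Arg z0 + d = 2 * pi * of_int n)"
    using assms z0 by (simp add: rcis_nonneg_iff)
  also have "\<dots> \<longleftrightarrow> (\<exists>n::int. d = Arg z0 - Arg lam + 2 * pi * of_int n)"
    by (intro ex_cong1) auto
  finally show ?thesis .
qed

end

section \<open>The kernel function\<close>

text \<open>
  Such sets are connected and closed under intersections, so continuations of one power series agree on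
  the whole intersection of their domains.
\<close>

definition open_star :: "complex set \<Rightarrow> bool" where
  "open_star S \<longleftrightarrow> open S \<and> (\<forall>z\<in>S. \<forall>x. 0 \<le> x \<and> x \<le> 1 \<longrightarrow> complex_of_real x * z \<in> S)"

lemma open_star_Int: "open_star S \<Longrightarrow> open_star T \<Longrightarrow> open_star (S \<inter> T)"
  by (auto simp: open_star_def)

lemma open_star_ball: "open_star (ball 0 r)"
  unfolding open_star_def
proof (intro conjI ballI allI impI)
  fix z x assume "z \<in> ball (0::complex) r" "0 \<le> x \<and> x \<le> (1::real)"
  then have "x * cmod z \<le> cmod z" "cmod z < r" by (auto intro: mult_left_le_one_le)
  then have "x * cmod z < r" by linarith
  then show "complex_of_real x * z \<in> ball 0 r" using \<open>0 \<le> x \<and> x \<le> 1\<close> by (simp add: norm_mult)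
qed simp

lemma open_star_disc_sector: "0 < \<alpha> \<Longrightarrow> \<alpha> \<le> 2 * pi \<Longrightarrow> 0 < r \<Longrightarrow> open_star (disc_sector d \<alpha> r)"
  using disc_sector_scale by (auto simp: open_star_def open_disc_sector)

lemma nonneg_Reals_scale_iff: "x > 0 \<Longrightarrow> complex_of_real x * z \<in> \<real>\<^sub>\<ge>\<^sub>0 \<longleftrightarrow> z \<in> \<real>\<^sub>\<ge>\<^sub>0"
  by (auto simp: complex_nonneg_Reals_iff zero_le_mult_iff)

lemma open_star_slit: "\<epsilon> > 0 \<Longrightarrow> open_star (ball 0 \<epsilon> \<union> - \<real>\<^sub>\<ge>\<^sub>0)"
  unfolding open_star_def
proof (intro conjI ballI allI impI)
  show "open (ball 0 \<epsilon> \<union> - (\<real>\<^sub>\<ge>\<^sub>0 :: complex set))"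
    by (intro open_Un open_ball) (simp add: open_Compl closed_nonneg_Reals_complex)
  fix z x assume e: "\<epsilon> > 0" and z: "z \<in> ball (0::complex) \<epsilon> \<union> - \<real>\<^sub>\<ge>\<^sub>0" and x: "0 \<le> x \<and> x \<le> (1::real)"
  show "complex_of_real x * z \<in> ball 0 \<epsilon> \<union> - \<real>\<^sub>\<ge>\<^sub>0"
  proof (cases "x = 0 \<or> z \<in> ball 0 \<epsilon>")
    case True
    then have "complex_of_real x * z \<in> ball 0 \<epsilon>"
      using open_star_ball[of \<epsilon>] x e unfolding open_star_def by auto
    then show ?thesis by blast
  next
    case False
    then show ?thesis using z x nonneg_Reals_scale_iff[of x z] by auto
  qed
qed

lemma open_star_identity:
  assumes S: "open_star S" and f: "f holomorphic_on S" and g: "g holomorphic_on S"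
    and \<epsilon>: "\<epsilon> > 0" "\<And>t. cmod t < \<epsilon> \<Longrightarrow> (\<lambda>n. c n * t ^ n) sums f t"
    and \<delta>: "\<delta> > 0" "\<And>t. cmod t < \<delta> \<Longrightarrow> (\<lambda>n. c n * t ^ n) sums g t"
    and w: "w \<in> S"
  shows "f w = g w"
proof -
  have 0: "0 \<in> S" and op: "open S" using S w unfolding open_star_def by force+
  have "starlike S"
    unfolding starlike_def
  proof (intro bexI[OF _ 0] ballI subsetI)
    fix z v assume z: "z \<in> S" and "v \<in> closed_segment 0 z"
    then obtain x where "v = complex_of_real x * z" "0 \<le> x" "x \<le> 1" by (auto simp: in_segment scaleR_conv_of_real)
    then show "v \<in> S" using S z by (auto simp: open_star_def)
  qed
  then have conn: "connected S" by (rule starlike_imp_connected)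
  obtain e where e: "e > 0" "ball 0 e \<subseteq> S" using op 0 open_contains_ball by blast
  show ?thesis
  proof (rule analytic_continuation_open[of "ball 0 (min e (min \<epsilon> \<delta>))" S f g])
    show "f z = g z" if "z \<in> ball 0 (min e (min \<epsilon> \<delta>))" for z
      using \<epsilon>(2)[of z] \<delta>(2)[of z] that sums_unique2 by auto
  qed (use op conn f g w e \<epsilon> \<delta> in auto)
qed

text \<open>
  The continuations in the various directions live on domains that are star-shaped with respect to
  the origin, so any two of them agree where both are defined, and they can be glued together.
\<close>

lemma kernel_exists:
  assumes m: "preserves_summability m"
  shows "\<exists>e. \<exists>\<epsilon>>0. e holomorphic_on (ball 0 \<epsilon> \<union> - \<real>\<^sub>\<ge>\<^sub>0) \<and>
     (\<forall>z\<in>ball 0 \<epsilon>. (\<lambda>n. complex_of_real (m n) * z ^ n) sums e z)"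
proof -
  let ?c = "\<lambda>n. complex_of_real (m n)"
  define P where "P = (\<lambda>S f. open_star S \<and> f holomorphic_on S \<and> (\<exists>\<delta>>0. \<forall>t. cmod t < \<delta> \<longrightarrow> (\<lambda>n. ?c n * t ^ n) sums f t))"
  have uniq: "f w = g w" if "P S f" "P T g" "w \<in> S" "w \<in> T" for S T f g w
  proof -
    obtain \<epsilon> where \<epsilon>: "\<epsilon> > 0" "\<And>t. cmod t < \<epsilon> \<Longrightarrow> (\<lambda>n. ?c n * t ^ n) sums f t" using \<open>P S f\<close> unfolding P_def by blast
    obtain \<delta> where \<delta>: "\<delta> > 0" "\<And>t. cmod t < \<delta> \<Longrightarrow> (\<lambda>n. ?c n * t ^ n) sums g t" using \<open>P T g\<close> unfolding P_def by blast
    show ?thesis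
      by (rule open_star_identity[where S = "S \<inter> T", OF _ _ _ \<epsilon> \<delta>])
         (use that in \<open>auto simp: P_def intro: open_star_Int holomorphic_on_subset\<close>)
  qed
  have dir: "\<exists>S f. P S f \<and> w \<in> S" if w: "w \<notin> \<real>\<^sub>\<ge>\<^sub>0" for w
  proof -
    have w0: "w \<noteq> 0" using w by auto
    have "w = complex_of_real (cmod w) * cis (Arg w)" using rcis_cmod_Arg[of w] by (simp add: rcis_def)
    then have "1 * cis (Arg w) \<notin> \<real>\<^sub>\<ge>\<^sub>0 \<or> (1::complex) = 0"
      using w w0 nonneg_Reals_scale_iff[of "cmod w" "cis (Arg w)"] by simp
    then obtain f where "continues 1 (Arg w) (\<lambda>n. ?c n * 1 ^ n) f" using continues_moment[OF m, of 1 1 "Arg w"] by auto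
    then obtain \<alpha> r \<epsilon> where *: "0 < \<alpha>" "\<alpha> \<le> 2 * pi" "0 < r" "0 < \<epsilon>" "f holomorphic_on disc_sector (Arg w) \<alpha> r"
      "\<And>t. cmod t < \<epsilon> \<Longrightarrow> (\<lambda>n. ?c n * t ^ n) sums f t" unfolding continues_def by auto
    have "P (disc_sector (Arg w) \<alpha> r) f" using * by (auto simp: P_def open_star_disc_sector)
    moreover have "w \<in> disc_sector (Arg w) \<alpha> r"
      using rcis_in_sector[of "cmod w" "Arg w" "Arg w" \<alpha>] w0 * by (simp add: rcis_cmod_Arg disc_sector_def)
    ultimately show ?thesis by blast
  qed
  have "1 * cis pi \<notin> \<real>\<^sub>\<ge>\<^sub>0 \<or> (1::complex) = 0" by (simp add: complex_nonneg_Reals_iff)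
  then obtain f0 where "continues 1 pi (\<lambda>n. ?c n * 1 ^ n) f0" using continues_moment[OF m, of 1 1 pi] by auto
  then obtain \<epsilon> where \<epsilon>: "0 < \<epsilon>" "\<And>t. cmod t < \<epsilon> \<Longrightarrow> (\<lambda>n. ?c n * t ^ n) sums f0 t" unfolding continues_def by auto
  have "f0 holomorphic_on ball 0 \<epsilon>" by (rule power_series_holomorphic[of _ _ ?c]) (use \<epsilon> in auto)
  then have P0: "P (ball 0 \<epsilon>) f0" using \<epsilon> by (auto simp: P_def open_star_ball)
  define e where "e = (\<lambda>w. SOME v. \<exists>S f. P S f \<and> w \<in> S \<and> v = f w)"
  have ev: "e w = f w" if "P S f" "w \<in> S" for S f w
  proof -
    have "\<exists>v S f. P S f \<and> w \<in> S \<and> v = f w" using that by blast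
    then have "\<exists>S f. P S f \<and> w \<in> S \<and> e w = f w" unfolding e_def by (rule someI_ex)
    then show ?thesis using uniq that by metis
  qed
  have op: "open (ball 0 \<epsilon> \<union> - (\<real>\<^sub>\<ge>\<^sub>0 :: complex set))" using open_star_slit[OF \<epsilon>(1)] by (simp add: open_star_def)
  have "e holomorphic_on (ball 0 \<epsilon> \<union> - \<real>\<^sub>\<ge>\<^sub>0)"
    unfolding holomorphic_on_open[OF op]
  proof
    fix w assume "w \<in> ball 0 \<epsilon> \<union> - (\<real>\<^sub>\<ge>\<^sub>0 :: complex set)"
    then obtain S f where Sf: "P S f" "w \<in> S" using dir P0 by blast
    then have S: "open S" "f holomorphic_on S" by (auto simp: P_def open_star_def)
    then have "(f has_field_derivative deriv f w) (at w)" using Sf holomorphic_derivI by blast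
    then have "(e has_field_derivative deriv f w) (at w)"
      by (rule has_field_derivative_transform_within_open[OF _ S(1) Sf(2)]) (simp add: ev[OF Sf(1)])
    then show "\<exists>f'. (e has_field_derivative f') (at w)" by blast
  qed
  moreover have "\<forall>z\<in>ball 0 \<epsilon>. (\<lambda>n. ?c n * z ^ n) sums e z" using ev[OF P0] \<epsilon>(2) by simp
  ultimately show ?thesis using \<epsilon>(1) by blast
qed

lemma kernel_fun_spec:
  assumes "preserves_summability m"
  obtains \<epsilon> where "\<epsilon> > 0" "kernel_fun m holomorphic_on (ball 0 \<epsilon> \<union> - \<real>\<^sub>\<ge>\<^sub>0)"
    "\<And>z. cmod z < \<epsilon> \<Longrightarrow> (\<lambda>n. complex_of_real (m n) * z ^ n) sums kernel_fun m z"
proof -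
  from someI_ex[OF kernel_exists[OF assms]] show thesis
    unfolding kernel_fun_def[symmetric] using that by auto
qed

lemma rcis_nonneg_cis: "x > 0 \<Longrightarrow> rcis x \<phi> \<in> \<real>\<^sub>\<ge>\<^sub>0 \<longleftrightarrow> cis \<phi> \<in> \<real>\<^sub>\<ge>\<^sub>0"
  unfolding rcis_def by (rule nonneg_Reals_scale_iff)

text \<open>
  Each direction has a sector with its own constants, and finitely many of these sectors cover a closed interval of
  directions.
\<close>

lemma kernel_fun_growth:
  assumes m: "preserves_summability m" and k: "k > 0" and le: "\<theta>1 \<le> \<theta>2"
    and away: "\<And>\<theta>. \<theta>1 \<le> \<theta> \<Longrightarrow> \<theta> \<le> \<theta>2 \<Longrightarrow> cis \<theta> \<notin> \<real>\<^sub>\<ge>\<^sub>0"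
  obtains A B where "A > 0" "B > 0"
    "\<And>x \<phi>. x > 0 \<Longrightarrow> \<theta>1 \<le> \<phi> \<Longrightarrow> \<phi> \<le> \<theta>2 \<Longrightarrow> cmod (kernel_fun m (rcis x \<phi>)) \<le> A * exp (B * x powr k)"
proof -
  obtain \<epsilon> where \<epsilon>: "\<epsilon> > 0" "kernel_fun m holomorphic_on (ball 0 \<epsilon> \<union> - \<real>\<^sub>\<ge>\<^sub>0)"
    "\<And>z. cmod z < \<epsilon> \<Longrightarrow> (\<lambda>n. complex_of_real (m n) * z ^ n) sums kernel_fun m z"
    by (rule kernel_fun_spec[OF m]) blast
  define P where "P = (\<lambda>p q. \<theta>1 \<le> p \<longrightarrow> q \<le> \<theta>2 \<longrightarrow> (\<exists>A>0. \<exists>B>0. \<forall>x>0. \<forall>\<phi>. p \<le> \<phi> \<and> \<phi> \<le> q \<longrightarrow>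
     cmod (kernel_fun m (rcis x \<phi>)) \<le> A * exp (B * x powr k)))"
  have "P \<theta>1 \<theta>2"
  proof (rule Bolzano[OF le])
    fix p q s assume "P p q" "P q s" and pq: "p \<le> q" "q \<le> s"
    show "P p s" unfolding P_def
    proof (intro impI)
      assume *: "\<theta>1 \<le> p" "s \<le> \<theta>2"
      obtain A1 B1 where 1: "A1 > 0" "B1 > 0" "\<And>x \<phi>. x > 0 \<Longrightarrow> p \<le> \<phi> \<Longrightarrow> \<phi> \<le> q \<Longrightarrow> cmod (kernel_fun m (rcis x \<phi>)) \<le> A1 * exp (B1 * x powr k)"
        using \<open>P p q\<close> * pq unfolding P_def by (metis order_trans)
      obtain A2 B2 where 2: "A2 > 0" "B2 > 0" "\<And>x \<phi>. x > 0 \<Longrightarrow> q \<le> \<phi> \<Longrightarrow> \<phi> \<le> s \<Longrightarrow> cmod (kernel_fun m (rcis x \<phi>)) \<le> A2 * exp (B2 * x powr k)"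
        using \<open>P q s\<close> * pq unfolding P_def by (metis order_trans)
      have mx: "A * exp (B * x powr k) \<le> max A1 A2 * exp (max B1 B2 * x powr k)"
        if "A \<le> max A1 A2" "B \<le> max B1 B2" "A > 0" for A B x
        using that by (intro mult_mono iffD2[OF exp_le_cancel_iff] mult_right_mono) auto
      have "cmod (kernel_fun m (rcis x \<phi>)) \<le> max A1 A2 * exp (max B1 B2 * x powr k)" if "x > 0" "p \<le> \<phi>" "\<phi> \<le> s" for x \<phi>
      proof (cases "\<phi> \<le> q")
        case True
        then show ?thesis using 1(3)[of x \<phi>] mx[of A1 B1 x] that 1 by (meson max.cobounded1 order_trans)
      next
        case False
        then show ?thesis using 2(3)[of x \<phi>] mx[of A2 B2 x] that 2 by (meson max.cobounded2 order_trans nle_le)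
      qed
      then show "\<exists>A>0. \<exists>B>0. \<forall>x>0. \<forall>\<phi>. p \<le> \<phi> \<and> \<phi> \<le> s \<longrightarrow> cmod (kernel_fun m (rcis x \<phi>)) \<le> A * exp (B * x powr k)"
        using 1(1,2) by (rule_tac exI[of _ "max A1 A2"], intro conjI, simp, rule_tac exI[of _ "max B1 B2"]) simp
    qed
  next
    fix \<theta> assume \<theta>: "\<theta>1 \<le> \<theta>" "\<theta> \<le> \<theta>2"
    have "1 * cis \<theta> \<notin> \<real>\<^sub>\<ge>\<^sub>0 \<or> (1::complex) = 0" using away[OF \<theta>] by simp
    then obtain f where "continues k \<theta> (\<lambda>n. complex_of_real (m n) * 1 ^ n) f" using continues_moment[OF m k] by blast
    then obtain \<alpha> r \<delta> where f: "0 < \<alpha>" "\<alpha> \<le> 2 * pi" "0 < r" "0 < \<delta>" "f holomorphic_on disc_sector \<theta> \<alpha> r"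
      "growth_bound complex_space k \<theta> \<alpha> r f" "\<And>t. cmod t < \<delta> \<Longrightarrow> (\<lambda>n. complex_of_real (m n) * t ^ n) sums f t"
      unfolding continues_def by auto
    obtain A B where AB: "A > 0" "B > 0" "\<And>t. t \<in> disc_sector \<theta> (\<alpha> / 2) (r / 2) \<Longrightarrow> cmod (f t) < A * exp (B * cmod t powr k)"
    proof -
      have "\<alpha> / 2 \<in> {0<..<\<alpha>}" "r / 2 \<in> {0<..<r}" using f by auto
      then show thesis using f(6) that unfolding growth_bound_def complex_space_nrm by meson
    qed
    have "P p q" if pq: "p \<le> \<theta> \<and> \<theta> \<le> q \<and> q - p < \<alpha> / 4" for p q
      unfolding P_def
    proof (intro impI)
      assume *: "\<theta>1 \<le> p" "q \<le> \<theta>2"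
      have "cmod (kernel_fun m (rcis x \<phi>)) \<le> A * exp (B * x powr k)" if x: "x > 0" and \<phi>: "p \<le> \<phi>" "\<phi> \<le> q" for x \<phi>
      proof -
        have "rcis x \<phi> \<in> sector \<theta> (\<alpha> / 2)" using pq \<phi> x by (intro rcis_in_sector) (auto simp: abs_if)
        then have ds: "rcis x \<phi> \<in> disc_sector \<theta> (\<alpha> / 2) (r / 2)" by (simp add: disc_sector_def)
        have ds': "rcis x \<phi> \<in> disc_sector \<theta> \<alpha> r" using ds disc_sector_mono[of "\<alpha> / 2" \<alpha> "r / 2" r \<theta>] f by auto
        have nn: "rcis x \<phi> \<notin> \<real>\<^sub>\<ge>\<^sub>0" using away[of \<phi>] * \<phi> rcis_nonneg_cis[OF x] by simp
        have "kernel_fun m (rcis x \<phi>) = f (rcis x \<phi>)"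
        proof (rule open_star_identity[where S = "disc_sector \<theta> \<alpha> r \<inter> (ball 0 \<epsilon> \<union> - \<real>\<^sub>\<ge>\<^sub>0)", OF _ _ _ \<epsilon>(1,3) f(4,7)])
          show "open_star (disc_sector \<theta> \<alpha> r \<inter> (ball 0 \<epsilon> \<union> - \<real>\<^sub>\<ge>\<^sub>0))"
            using f \<epsilon> by (intro open_star_Int open_star_disc_sector open_star_slit)
        qed (use ds' nn \<epsilon>(2) f(5) in \<open>auto intro: holomorphic_on_subset\<close>)
        then show ?thesis using AB(3)[OF ds] x by simp
      qed
      then show "\<exists>A>0. \<exists>B>0. \<forall>x>0. \<forall>\<phi>. p \<le> \<phi> \<and> \<phi> \<le> q \<longrightarrow> cmod (kernel_fun m (rcis x \<phi>)) \<le> A * exp (B * x powr k)"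
        using AB by blast
    qed
    then show "\<exists>\<delta>>0. \<forall>p q. p \<le> \<theta> \<and> \<theta> \<le> q \<and> q - p < \<delta> \<longrightarrow> P p q"
      using f by (intro exI[of _ "\<alpha> / 4"]) auto
  qed
  then show thesis using that le unfolding P_def by auto
qed

lemma normed_complex_space: "normed_mod complex_space"
proof (rule normed_mod.intro)
  have s: "\<zero>\<^bsub>complex_space\<^esub> = 0" "x \<oplus>\<^bsub>complex_space\<^esub> y = x + y" "c \<odot>\<^bsub>complex_space\<^esub> x = c * x" "carrier complex_space = UNIV" for x y c
    by (simp_all add: complex_space_def)
  show "module complex_ring complex_space"
  proof (rule moduleI[OF cring_complex_ring])
    show "abelian_group complex_space"
    proof (rule abelian_groupI)
      fix x show "\<exists>y\<in>carrier complex_space. y \<oplus>\<^bsub>complex_space\<^esub> x = \<zero>\<^bsub>complex_space\<^esub>"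
        by (rule bexI[of _ "- x"]) (auto simp: s)
    qed (auto simp: s)
  qed (auto simp: s algebra_simps)
  show "nrm complex_space x = 0 \<longleftrightarrow> x = \<zero>\<^bsub>complex_space\<^esub>" for x by (simp add: s)
  show "nrm complex_space (x \<oplus>\<^bsub>complex_space\<^esub> y) \<le> nrm complex_space x + nrm complex_space y" for x y
    by (simp add: s norm_triangle_ineq)
  show "nrm complex_space (c \<odot>\<^bsub>complex_space\<^esub> x) = cmod c * nrm complex_space x" for c x by (simp add: s norm_mult)
qed simp

lemma holomorphic_into_complex_space:
  assumes S: "open S" and f: "f holomorphic_on S"
  shows "holomorphic_into complex_space f S"
proof -
  interpret C: normed_mod complex_space by (rule normed_complex_space)
  have s: "x \<oplus>\<^bsub>complex_space\<^esub> y = x + y" "c \<odot>\<^bsub>complex_space\<^esub> x = c * x" "carrier complex_space = UNIV" for x y c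
    by (simp_all add: complex_space_def)
  have minus: "x \<ominus>\<^bsub>complex_space\<^esub> y = x - y" for x y
    using C.minus_smult[of y] by (simp add: s a_minus_def)
  show ?thesis
    unfolding holomorphic_into_def minus s complex_space_nrm
  proof (intro conjI ballI)
    fix z assume z: "z \<in> S"
    have "(f has_field_derivative deriv f z) (at z within S)"
      using f S z holomorphic_derivI has_field_derivative_at_within by blast
    then have "((\<lambda>w. (f w - f z) / (w - z)) \<longlongrightarrow> deriv f z) (at z within S)" by (simp add: has_field_derivative_iff)
    then have "((\<lambda>w. cmod ((f w - f z) / (w - z) - deriv f z)) \<longlongrightarrow> 0) (at z within S)"
      by (intro tendsto_norm_zero) (simp add: LIM_zero_iff)
    then show "\<exists>D\<in>UNIV. ((\<lambda>w. cmod (inverse (w - z) * (f w - f z) - D)) \<longlongrightarrow> 0) (at z within S)"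
      by (intro bexI[of _ "deriv f z"]) (simp_all add: divide_inverse mult.commute)
  qed simp
qed

context moment_cauchy_problem
begin

text \<open>
  The Borel transform of the solution at \<open>z = 0\<close>, continued to the plane cut along the singular ray.
\<close>

definition g :: "complex \<Rightarrow> complex" where "g s = - (a / z0) * kernel_fun m (lam * s / z0)"

lemma g_eq: "g s = - (a / z0) * kernel_fun m (c * s)"
  by (simp add: g_def c_def)

text \<open>
  The half-plane on one side of the singular ray, selected by the sign \<open>sg\<close>: outside the disc, \<open>c * s\<close> avoids the
  positive half-line there, uniformly on smaller sectors.
\<close>

lemma g_half:
  assumes cd: "c * cis d = complex_of_real (cmod c)" and sg: "\<bar>sg\<bar> = (1::real)" and \<epsilon>: "\<epsilon> > 0"
    and hol: "kernel_fun m holomorphic_on (ball 0 \<epsilon> \<union> - \<real>\<^sub>\<ge>\<^sub>0)" and r: "r > 0" "cmod c * r \<le> \<epsilon>"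
  shows "g \<in> exp_growth complex_space k (d + sg * pi / 2) pi r"
proof (cases "c = 0")
  case True
  have "g = (\<lambda>s. g 0)" by (simp add: g_eq True fun_eq_iff)
  then show ?thesis
    unfolding exp_growth_iff
    using holomorphic_into_complex_space[OF open_disc_sector, of pi "\<lambda>s. g 0" "d + sg * pi / 2" r]
      growth_bound_bounded[of "d + sg * pi / 2" pi r g "cmod (g 0)" k] pi_gt_zero by (metis holomorphic_on_const less_imp_le mult_2 add_increasing order_refl)
next
  case False
  let ?d = "d + sg * pi / 2"
  have crcis: "c * rcis x \<phi> = rcis (cmod c * x) (\<phi> - d)" for x \<phi>
  proof -
    have "c * rcis x \<phi> = (c * cis d) * rcis x (\<phi> - d)" by (simp add: cis_rcis_eq rcis_mult mult.assoc)
    also have "\<dots> = rcis (cmod c * x) (\<phi> - d)" unfolding cd by (simp add: rcis_def)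
    finally show ?thesis .
  qed
  have away: "cis \<theta> \<notin> \<real>\<^sub>\<ge>\<^sub>0" if "\<bar>\<theta> - sg * pi / 2\<bar> < pi / 2" for \<theta>
  proof -
    have "sg = 1 \<or> sg = -1" using sg by linarith
    then have "sin \<theta> \<noteq> 0"
    proof
      assume "sg = 1"
      then have "0 < \<theta>" "\<theta> < pi" using that by (auto simp: abs_if split: if_splits)
      then show ?thesis using sin_gt_zero[of \<theta>] by simp
    next
      assume "sg = -1"
      then have "0 < - \<theta>" "- \<theta> < pi" using that by (auto simp: abs_if split: if_splits)
      then show ?thesis using sin_gt_zero[of "- \<theta>"] by simp
    qed
    then show ?thesis by (simp add: complex_nonneg_Reals_iff)
  qed
  have dom: "c * s \<in> ball 0 \<epsilon> \<union> - \<real>\<^sub>\<ge>\<^sub>0" if s: "s \<in> disc_sector ?d pi r" for s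
  proof (cases "s \<in> ball 0 r")
    case True
    then have "cmod c * cmod s < cmod c * r" using False by simp
    then show ?thesis using r by (simp add: norm_mult)
  next
    case nb: False
    then obtain x \<phi> where "s = rcis x \<phi>" "x > 0" "\<bar>\<phi> - ?d\<bar> < pi / 2" using s by (auto simp: disc_sector_def sector_def)
    have "cis (\<phi> - d) \<notin> \<real>\<^sub>\<ge>\<^sub>0" using \<open>\<bar>\<phi> - ?d\<bar> < pi / 2\<close> by (intro away) (simp add: algebra_simps)
    then have "rcis (cmod c * x) (\<phi> - d) \<notin> \<real>\<^sub>\<ge>\<^sub>0"
      using rcis_nonneg_cis[of "cmod c * x" "\<phi> - d"] False \<open>x > 0\<close> by simp
    then show ?thesis unfolding \<open>s = rcis x \<phi>\<close> crcis by blast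
  qed
  have "(\<lambda>s. kernel_fun m (c * s)) holomorphic_on disc_sector ?d pi r"
    by (rule holomorphic_on_compose_gen[of "\<lambda>s. c * s" _ "kernel_fun m", OF _ hol, unfolded o_def])
       (use dom in \<open>blast intro: holomorphic_intros\<close>)+
  then have ghol: "g holomorphic_on disc_sector ?d pi r" unfolding g_eq[abs_def] by (intro holomorphic_intros)
  have "growth_bound complex_space k ?d pi r g"
    unfolding growth_bound_def complex_space_nrm
  proof (intro ballI)
    fix \<alpha>' r' assume a': "\<alpha>' \<in> {0<..<pi}" and r': "r' \<in> {0<..<r}"
    obtain A B where AB: "A > 0" "B > 0"
      "\<And>x \<phi>. x > 0 \<Longrightarrow> sg * pi / 2 - \<alpha>' / 2 \<le> \<phi> \<Longrightarrow> \<phi> \<le> sg * pi / 2 + \<alpha>' / 2 \<Longrightarrow> cmod (kernel_fun m (rcis x \<phi>)) \<le> A * exp (B * x powr k)"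
    proof (rule kernel_fun_growth[OF preserves_m k, of "sg * pi / 2 - \<alpha>' / 2" "sg * pi / 2 + \<alpha>' / 2"])
      show "cis \<theta> \<notin> \<real>\<^sub>\<ge>\<^sub>0" if "sg * pi / 2 - \<alpha>' / 2 \<le> \<theta>" "\<theta> \<le> sg * pi / 2 + \<alpha>' / 2" for \<theta>
      proof (rule away)
        have "\<alpha>' < pi" using a' by simp
        then show "\<bar>\<theta> - sg * pi / 2\<bar> < pi / 2" using that unfolding abs_less_iff by linarith
      qed
    qed (use a' in auto)
    have "continuous_on (cball 0 r') g"
      using r' by (intro holomorphic_on_imp_continuous_on holomorphic_on_subset[OF ghol]) (auto simp: disc_sector_def)
    then have "bounded (g ` cball 0 r')" by (intro compact_imp_bounded compact_continuous_image) auto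
    then obtain C where C: "\<And>s. s \<in> cball 0 r' \<Longrightarrow> cmod (g s) \<le> C" unfolding bounded_iff by (metis imageI)
    define A' where "A' = \<bar>C\<bar> + cmod (a / z0) * A + 1"
    define B' where "B' = B * cmod c powr k"
    have A': "A' > 0" "\<bar>C\<bar> < A'" "cmod (a / z0) * A < A'" unfolding A'_def using AB
      mult_nonneg_nonneg[of "cmod (a / z0)" A] by (auto intro: add_nonneg_pos)
    have B': "B' > 0" using AB False by (simp add: B'_def)
    have "cmod (g t) < A' * exp (B' * cmod t powr k)" if t: "t \<in> disc_sector ?d \<alpha>' r'" for t
    proof (cases "t \<in> ball 0 r'")
      case True
      then have "cmod (g t) < A' * 1" using C[of t] A' by auto
      also have "\<dots> \<le> A' * exp (B' * cmod t powr k)" using A' B' by (intro mult_left_mono) auto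
      finally show ?thesis .
    next
      case nb: False
      then obtain x \<phi> where p: "t = rcis x \<phi>" "x > 0" "\<bar>\<phi> - ?d\<bar> < \<alpha>' / 2" using t by (auto simp: disc_sector_def sector_def)
      have "cmod (kernel_fun m (c * t)) \<le> A * exp (B * (cmod c * x) powr k)"
        unfolding p(1) crcis
      proof (rule AB(3))
        show "0 < cmod c * x" using p False by simp
        show "sg * pi / 2 - \<alpha>' / 2 \<le> \<phi> - d" "\<phi> - d \<le> sg * pi / 2 + \<alpha>' / 2"
          using p(3) unfolding abs_less_iff by linarith+
      qed
      also have "B * (cmod c * x) powr k = B' * cmod t powr k" using p by (simp add: B'_def powr_mult)
      finally have "cmod (g t) \<le> cmod (a / z0) * (A * exp (B' * cmod t powr k))"
        unfolding g_eq norm_mult norm_minus_cancel by (intro mult_left_mono) auto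
      also have "\<dots> < A' * exp (B' * cmod t powr k)"
        unfolding mult.assoc[symmetric] using A' by (intro mult_strict_right_mono) auto
      finally show ?thesis .
    qed
    then show "\<exists>A>0. \<exists>B>0. \<forall>t\<in>disc_sector ?d \<alpha>' r'. cmod (g t) < A * exp (B * cmod t powr k)"
      using A' B' by blast
  qed
  moreover have "open (disc_sector ?d pi r)" using pi_gt_zero by (intro open_disc_sector) auto
  ultimately show ?thesis
    unfolding exp_growth_iff using holomorphic_into_complex_space[OF _ ghol] by blast
qed

lemma g_cut_exp_growth:
  assumes "c * cis d = complex_of_real (cmod c)"
  obtains r where "r > 0" "g \<in> cut_exp_growth k d (2 * pi) r"
proof -
  obtain \<epsilon> where \<epsilon>: "\<epsilon> > 0" "kernel_fun m holomorphic_on (ball 0 \<epsilon> \<union> - \<real>\<^sub>\<ge>\<^sub>0)"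
    by (rule kernel_fun_spec[OF preserves_m]) blast
  define r where "r = \<epsilon> / (cmod c + 1)"
  have p: "cmod c + 1 > 0" by (rule add_nonneg_pos) auto
  have "cmod c * \<epsilon> \<le> \<epsilon> * (cmod c + 1)" using \<epsilon> by (simp add: algebra_simps)
  then have r: "r > 0" "cmod c * r \<le> \<epsilon>" using \<epsilon> p by (auto simp: r_def pos_divide_le_eq)
  have "g \<in> cut_exp_growth k d (2 * pi) r"
    unfolding cut_exp_growth_def
    using g_half[OF assms _ \<epsilon> r, of 1] g_half[OF assms _ \<epsilon> r, of "-1"] by simp
  then show thesis using that r by blast
qed

end

section \<open>Rotating the path of the Laplace integral\<close>

text \<open>
  In the logarithmic coordinate a ray becomes a horizontal line of the strip, on which the integrand
  has a primitive. Moving the line changes the integral only by the integrals over two short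
  vertical segments, which the majorant forces to vanish as they recede to both ends.
\<close>

lemma strip_ray_integral:
  fixes \<Phi> :: "complex \<Rightarrow> complex"
  assumes k: "k > 0" and l: "l > 0" and C: "C > 0" and hol: "\<Phi> holomorphic_on {z. \<bar>Im z - d\<bar> < \<delta>}"
    and bd: "\<And>z. \<bar>Im z - d\<bar> < \<delta> \<Longrightarrow> cmod (\<Phi> z) \<le> C * exp (k * Re z) * exp (- (l * exp (k * Re z)))"
  obtains w where "\<And>\<theta>. \<bar>\<theta> - d\<bar> < \<delta> \<Longrightarrow> ((\<lambda>\<sigma>. \<Phi> (Complex (ln \<sigma>) \<theta>) / complex_of_real \<sigma>) has_integral w) {0<..}"
proof (cases "\<delta> > 0")
  case False
  then show thesis using that by force
next
  case \<delta>: True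
  define S where "S = {z::complex. \<bar>Im z - d\<bar> < \<delta>}"
  have S_eq: "S = {z. Im z > d - \<delta>} \<inter> {z. Im z < d + \<delta>}" by (auto simp: S_def abs_less_iff)
  have S: "convex S" "open S" unfolding S_eq
    by (auto intro!: convex_Int open_Int convex_halfspace_Im_gt convex_halfspace_Im_lt open_halfspace_Im_gt open_halfspace_Im_lt)
  obtain P where P: "\<And>z. z \<in> S \<Longrightarrow> (P has_field_derivative \<Phi> z) (at z within S)"
    by (rule holomorphic_convex_primitive'[OF S]) (use hol in \<open>auto simp: S_def\<close>)
  have P': "(P has_field_derivative \<Phi> z) (at z)" if "z \<in> S" for z
    using P[OF that] at_within_open[OF that S(2)] by simp
  define q where "q = (\<lambda>\<theta> \<sigma>. \<Phi> (Complex (ln \<sigma>) \<theta>) / complex_of_real \<sigma>)"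
  define M where "M = (\<lambda>x. C * exp (k * x) * exp (- (l * exp (k * x))))"
  define h where "h = (\<lambda>\<sigma>. M (ln \<sigma>) / \<sigma>)"
  have hpos: "0 \<le> h \<sigma>" if "\<sigma> > 0" for \<sigma> using that C by (simp add: h_def M_def)
  have hint: "set_integrable lborel {0<..} h"
  proof -
    define H where "H = (\<lambda>\<sigma>. - (C / (l * k)) * exp (- (l * exp (k * ln \<sigma>))))"
    have "set_integrable lborel (einterval (ereal 0) \<infinity>) h"
    proof (rule interval_integral_FTC_nonneg(1)[where F = H])
      show "(H has_real_derivative h x) (at x)" if "ereal 0 < ereal x" for x
        using that k l unfolding H_def h_def M_def by (auto intro!: derivative_eq_intros simp: field_simps)
      show "isCont h x" if "ereal 0 < ereal x" for x
        using that unfolding h_def M_def by (auto intro!: continuous_intros)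
      show "AE x in lborel. ereal 0 < ereal x \<longrightarrow> ereal x < \<infinity> \<longrightarrow> 0 \<le> h x" using hpos by auto
      have "((\<lambda>\<sigma>. - (C / (l * k)) * exp (- (l * exp (k * ln \<sigma>)))) \<longlongrightarrow> - (C / (l * k)) * exp 0) (at_right 0)"
        using k l by real_asymp
      then show "((H \<circ> real_of_ereal) \<longlongrightarrow> - (C / (l * k)) * exp 0) (at_right (ereal 0))"
        unfolding ereal_tendsto_simps H_def .
      have "((\<lambda>\<sigma>. - (C / (l * k)) * exp (- (l * exp (k * ln \<sigma>)))) \<longlongrightarrow> 0) at_top"
        using k l by real_asymp
      then show "((H \<circ> real_of_ereal) \<longlongrightarrow> 0) (at_left \<infinity>)"
        unfolding ereal_tendsto_simps H_def .
    qed simp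
    then show ?thesis by (simp add: einterval_def greaterThan_def)
  qed
  have cont: "continuous_on {0<..} (q \<theta>)" if "\<bar>\<theta> - d\<bar> < \<delta>" for \<theta>
  proof -
    have "continuous_on S \<Phi>" using hol by (simp add: S_def holomorphic_on_imp_continuous_on)
    then have "continuous_on {0<..} (\<lambda>\<sigma>. \<Phi> (Complex (ln \<sigma>) \<theta>))"
      by (rule continuous_on_compose2) (use that in \<open>auto intro!: continuous_intros simp: S_def\<close>)
    then show ?thesis unfolding q_def by (auto intro!: continuous_intros)
  qed
  have qint: "set_integrable lborel {0<..} (q \<theta>)" if "\<bar>\<theta> - d\<bar> < \<delta>" for \<theta>
  proof (rule set_integrable_bound[OF hint])
    show "set_borel_measurable lborel {0<..} (q \<theta>)"
      using borel_measurable_continuous_on_indicator[OF _ cont[OF that]] by (simp add: set_borel_measurable_def)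
    show "AE \<sigma> in lborel. \<sigma> \<in> {0<..} \<longrightarrow> norm (q \<theta> \<sigma>) \<le> norm (h \<sigma>)"
    proof (intro AE_I2 impI)
      fix \<sigma> :: real assume "\<sigma> \<in> {0<..}"
      then have \<sigma>: "\<sigma> > 0" by simp
      have "cmod (\<Phi> (Complex (ln \<sigma>) \<theta>)) \<le> M (ln \<sigma>)" using bd[of "Complex (ln \<sigma>) \<theta>"] that by (simp add: M_def)
      then have "norm (q \<theta> \<sigma>) \<le> h \<sigma>" unfolding q_def h_def norm_divide using \<sigma> by (simp add: divide_right_mono)
      then show "norm (q \<theta> \<sigma>) \<le> norm (h \<sigma>)" by simp
    qed
  qed
  define A where "A = (\<lambda>n. {inverse (real (Suc n)) .. real (Suc n)})"
  have UA: "(\<Union>n. A n) = {0<..}"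
  proof
    show "(\<Union>n. A n) \<subseteq> {0<..}"
    proof
      fix x assume "x \<in> (\<Union>n. A n)"
      then obtain n where "inverse (real (Suc n)) \<le> x" by (auto simp: A_def)
      moreover have "inverse (real (Suc n)) > 0" by simp
      ultimately show "x \<in> {0<..}" unfolding greaterThan_iff by linarith
    qed
    show "{0<..} \<subseteq> (\<Union>n. A n)"
    proof
      fix x :: real assume "x \<in> {0<..}"
      then have x: "x > 0" by simp
      obtain i where i: "x \<le> real i" using real_arch_simple by blast
      obtain j where j: "inverse (real (Suc j)) < x" using reals_Archimedean[OF x] by blast
      have "inverse (real (Suc (i + j))) \<le> inverse (real (Suc j))" by (rule le_imp_inverse_le) simp_all
      then have "inverse (real (Suc (i + j))) \<le> x" using j by linarith
      moreover have "x \<le> real (Suc (i + j))" using i by simp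
      ultimately have "x \<in> A (i + j)" by (simp add: A_def)
      then show "x \<in> (\<Union>n. A n)" by blast
    qed
  qed
  have incA: "incseq A"
  proof (rule incseq_SucI)
    fix n
    have "inverse (real (Suc (Suc n))) \<le> inverse (real (Suc n))" by (rule le_imp_inverse_le) simp_all
    then show "A n \<subseteq> A (Suc n)" by (auto simp: A_def)
  qed
  define p where "p = (\<lambda>\<theta> n. P (Complex (ln (real (Suc n))) \<theta>) - P (Complex (ln (inverse (real (Suc n)))) \<theta>))"
  have lim: "p \<theta> \<longlonglongrightarrow> integral {0<..} (q \<theta>)" if \<theta>: "\<bar>\<theta> - d\<bar> < \<delta>" for \<theta>
  proof -
    have "(\<lambda>n. LINT \<sigma>:A n|lborel. q \<theta> \<sigma>) \<longlonglongrightarrow> (LINT \<sigma>:(\<Union>n. A n)|lborel. q \<theta> \<sigma>)"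
    proof (rule set_integral_cont_up[OF _ incA])
      show "A i \<in> sets lborel" for i by (simp add: A_def)
      show "set_integrable lborel (\<Union>n. A n) (q \<theta>)" unfolding UA by (rule qint[OF \<theta>])
    qed
    moreover have "(LINT \<sigma>:A n|lborel. q \<theta> \<sigma>) = p \<theta> n" for n
    proof -
      have sub: "A n \<subseteq> {0<..}" using UA by blast
      have "set_integrable lborel (A n) (q \<theta>)"
        by (rule set_integrable_subset[OF qint[OF \<theta>] _ sub]) (simp add: A_def)
      then have "(LINT \<sigma>:A n|lborel. q \<theta> \<sigma>) = integral (A n) (q \<theta>)" by (rule set_borel_integral_eq_integral(2))
      also have "(q \<theta> has_integral p \<theta> n) (A n)"
        unfolding A_def p_def
      proof (rule fundamental_theorem_of_calculus[where f = "\<lambda>\<sigma>. P (Complex (ln \<sigma>) \<theta>)"])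
        have "inverse (real (Suc n)) \<le> inverse 1" by (rule le_imp_inverse_le) simp_all
        then show "inverse (real (Suc n)) \<le> real (Suc n)" by simp
        fix \<sigma> assume "\<sigma> \<in> {inverse (real (Suc n))..real (Suc n)}"
        then have \<sigma>: "\<sigma> > 0" using sub by (auto simp: A_def)
        have "((\<lambda>\<sigma>. complex_of_real (ln \<sigma>) + \<i> * complex_of_real \<theta>) has_vector_derivative complex_of_real (1 / \<sigma>)) (at \<sigma>)"
          using \<sigma> by (auto intro!: derivative_eq_intros simp: field_simps)
        then have "((\<lambda>\<sigma>. Complex (ln \<sigma>) \<theta>) has_vector_derivative complex_of_real (1 / \<sigma>)) (at \<sigma>)"
          by (simp add: Complex_eq)
        moreover have "Complex (ln \<sigma>) \<theta> \<in> S" using \<theta> by (simp add: S_def)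
        ultimately have "(P \<circ> (\<lambda>\<sigma>. Complex (ln \<sigma>) \<theta>) has_vector_derivative complex_of_real (1 / \<sigma>) * \<Phi> (Complex (ln \<sigma>) \<theta>)) (at \<sigma>)"
          by (intro field_vector_diff_chain_at P')
        moreover have "complex_of_real (1 / \<sigma>) * \<Phi> (Complex (ln \<sigma>) \<theta>) = q \<theta> \<sigma>" by (simp add: q_def)
        ultimately have "((\<lambda>\<sigma>. P (Complex (ln \<sigma>) \<theta>)) has_vector_derivative q \<theta> \<sigma>) (at \<sigma>)" by (simp only: o_def)
        then show "((\<lambda>\<sigma>. P (Complex (ln \<sigma>) \<theta>)) has_vector_derivative q \<theta> \<sigma>) (at \<sigma> within {inverse (real (Suc n))..real (Suc n)})"
          by (rule has_vector_derivative_at_within)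
      qed
      then have "integral (A n) (q \<theta>) = p \<theta> n" by (rule integral_unique)
      finally show ?thesis .
    qed
    moreover have "(LINT \<sigma>:{0<..}|lborel. q \<theta> \<sigma>) = integral {0<..} (q \<theta>)"
      by (rule set_borel_integral_eq_integral(2)[OF qint[OF \<theta>]])
    ultimately show ?thesis by (simp add: UA)
  qed
  have M0: "(\<lambda>n. M (ln (real (Suc n)))) \<longlonglongrightarrow> 0" "(\<lambda>n. M (ln (inverse (real (Suc n))))) \<longlonglongrightarrow> 0"
    unfolding M_def using k l C by real_asymp+
  have step: "cmod (P (Complex x \<theta>) - P (Complex x \<theta>')) \<le> M x * (2 * \<delta>)" if "\<bar>\<theta> - d\<bar> < \<delta>" "\<bar>\<theta>' - d\<bar> < \<delta>" for x \<theta> \<theta>'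
  proof -
    let ?I = "closed_segment (Complex x \<theta>) (Complex x \<theta>')"
    have I: "?I \<subseteq> S" using that S(1) by (intro closed_segment_subset) (auto simp: S_def)
    have "cmod (P (Complex x \<theta>) - P (Complex x \<theta>')) \<le> M x * cmod (Complex x \<theta> - Complex x \<theta>')"
    proof (rule field_differentiable_bound[where S = ?I and f' = \<Phi>])
      fix z assume z: "z \<in> ?I"
      then obtain u where "z = (1 - u) *\<^sub>R Complex x \<theta> + u *\<^sub>R Complex x \<theta>'" by (auto simp: in_segment)
      then have "Re z = (1 - u) * x + u * x" by simp
      then have "Re z = x" by (simp add: algebra_simps)
      then show "cmod (\<Phi> z) \<le> M x" using bd[of z] z I by (auto simp: M_def S_def)
      show "(P has_field_derivative \<Phi> z) (at z within ?I)" using P' z I has_field_derivative_at_within by blast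
    qed auto
    also have "cmod (Complex x \<theta> - Complex x \<theta>') = \<bar>\<theta> - \<theta>'\<bar>" by (simp add: cmod_def)
    also have "M x * \<bar>\<theta> - \<theta>'\<bar> \<le> M x * (2 * \<delta>)"
      using that C by (intro mult_left_mono) (auto simp: M_def abs_less_iff abs_le_iff)
    finally show ?thesis .
  qed
  have same: "integral {0<..} (q \<theta>) = integral {0<..} (q \<theta>')" if t: "\<bar>\<theta> - d\<bar> < \<delta>" "\<bar>\<theta>' - d\<bar> < \<delta>" for \<theta> \<theta>'
  proof -
    have b: "cmod (p \<theta> n - p \<theta>' n) \<le> M (ln (real (Suc n))) * (2 * \<delta>) + M (ln (inverse (real (Suc n)))) * (2 * \<delta>)" for n
    proof -
      have "p \<theta> n - p \<theta>' n = (P (Complex (ln (real (Suc n))) \<theta>) - P (Complex (ln (real (Suc n))) \<theta>'))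
         - (P (Complex (ln (inverse (real (Suc n)))) \<theta>) - P (Complex (ln (inverse (real (Suc n)))) \<theta>'))"
        by (simp add: p_def)
      also have "cmod \<dots> \<le> cmod (P (Complex (ln (real (Suc n))) \<theta>) - P (Complex (ln (real (Suc n))) \<theta>'))
         + cmod (P (Complex (ln (inverse (real (Suc n)))) \<theta>) - P (Complex (ln (inverse (real (Suc n)))) \<theta>'))"
        by (rule norm_triangle_ineq4)
      also have "\<dots> \<le> M (ln (real (Suc n))) * (2 * \<delta>) + M (ln (inverse (real (Suc n)))) * (2 * \<delta>)"
        by (intro add_mono step t)
      finally show ?thesis .
    qed
    have "(\<lambda>n. M (ln (real (Suc n))) * (2 * \<delta>) + M (ln (inverse (real (Suc n)))) * (2 * \<delta>)) \<longlonglongrightarrow> 0 * (2 * \<delta>) + 0 * (2 * \<delta>)"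
      by (intro tendsto_intros M0)
    then have "(\<lambda>n. p \<theta> n - p \<theta>' n) \<longlonglongrightarrow> 0"
      by (intro Lim_null_comparison[OF always_eventually[OF allI[OF b]]]) simp
    moreover have "(\<lambda>n. p \<theta> n - p \<theta>' n) \<longlonglongrightarrow> integral {0<..} (q \<theta>) - integral {0<..} (q \<theta>')"
      by (intro tendsto_diff lim t)
    ultimately show ?thesis using LIMSEQ_unique by fastforce
  qed
  show thesis
  proof
    fix \<theta> assume \<theta>: "\<bar>\<theta> - d\<bar> < \<delta>"
    have "q \<theta> integrable_on {0<..}" by (rule set_borel_integral_eq_integral(1)[OF qint[OF \<theta>]])
    then have "(q \<theta> has_integral integral {0<..} (q \<theta>)) {0<..}" by (rule integrable_integral)
    also have "integral {0<..} (q \<theta>) = integral {0<..} (q d)" using same[OF \<theta>, of d] \<delta> by simp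
    finally show "((\<lambda>\<sigma>. \<Phi> (Complex (ln \<sigma>) \<theta>) / complex_of_real \<sigma>) has_integral integral {0<..} (q d)) {0<..}"
      by (simp add: q_def)
  qed
qed

lemma exp_Complex: "exp (Complex x y) = rcis (exp x) y"
  by (simp add: exp_eq_polar rcis_def)

text \<open>
  On directions within \<open>\<beta> + \<delta> < \<pi> / (2 * k)\<close> of \<open>\<tau>\<close> the exponential in the kernel decays at the rate \<open>c0 / \<rho> ^ k\<close> in
  \<open>\<bar>s\<bar> ^ k\<close>. For small \<open>\<rho>\<close> this is more than twice the growth rate \<open>B\<close> of \<open>f\<close>, so the integrand has the
  majorant required for a rotation of the ray.
\<close>

lemma laplace_ray_integral:
  assumes k: "k > 0" and \<alpha>: "0 < \<alpha>" "\<alpha> \<le> 2 * pi" and r: "r > 0"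
    and f: "f holomorphic_on disc_sector d \<alpha> r" and gr: "growth_bound complex_space k d \<alpha> r f"
    and \<beta>: "0 < \<beta>" "\<beta> < pi / (2 * k)"
  obtains \<rho>0 \<delta> where "\<rho>0 > 0" "\<delta> > 0"
    "\<And>\<rho> \<tau>. 0 < \<rho> \<Longrightarrow> \<rho> < \<rho>0 \<Longrightarrow> \<bar>\<tau> - d\<bar> < \<beta> \<Longrightarrow>
       \<exists>w. \<forall>\<theta>. \<bar>\<theta> - d\<bar> < \<delta> \<longrightarrow> has_ray_integral (\<lambda>s. f (cov_proj s) * laplace_kernel k (\<rho>, \<tau>) s) w \<theta>"
proof -
  define \<delta> where "\<delta> = min (\<alpha> / 4) ((pi / (2 * k) - \<beta>) / 2)"
  define c0 where "c0 = cos (k * (\<beta> + \<delta>))"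
  have "\<delta> > 0" using \<alpha> \<beta> by (simp add: \<delta>_def)
  moreover have "\<delta> \<le> \<alpha> / 4" "\<delta> \<le> (pi / (2 * k) - \<beta>) / 2" unfolding \<delta>_def by (rule min.cobounded1, rule min.cobounded2)
  ultimately have \<delta>: "\<delta> > 0" "\<delta> \<le> \<alpha> / 4" "\<delta> \<le> (pi / (2 * k) - \<beta>) / 2" by blast+
  have "\<beta> + \<delta> < x" if "\<delta> \<le> (x - \<beta>) / 2" "\<beta> < x" for x using that by (simp add: field_simps)
  then have "\<beta> + \<delta> < pi / (2 * k)" using \<delta> \<beta> by blast
  then have "k * (\<beta> + \<delta>) < k * (pi / (2 * k))" using k by (intro mult_strict_left_mono)
  then have ang: "k * (\<beta> + \<delta>) < pi / 2" using k by simp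
  have ang0: "k * (\<beta> + \<delta>) > 0" using k \<beta> \<delta> by simp
  have c0: "c0 > 0" unfolding c0_def using ang ang0 by (intro cos_gt_zero_pi) auto
  obtain A B where AB: "A > 0" "B > 0" "\<And>t. t \<in> disc_sector d (\<alpha> / 2) (r / 2) \<Longrightarrow> cmod (f t) < A * exp (B * cmod t powr k)"
  proof -
    have "\<alpha> / 2 \<in> {0<..<\<alpha>}" "r / 2 \<in> {0<..<r}" using \<alpha> r by auto
    then show thesis using gr that unfolding growth_bound_def complex_space_nrm by meson
  qed
  define \<rho>0 where "\<rho>0 = (c0 / (2 * B)) powr (1 / k)"
  show thesis
  proof (rule that[OF _ \<delta>(1)])
    show "\<rho>0 > 0" using c0 AB by (simp add: \<rho>0_def)
    fix \<rho> \<tau> assume \<rho>: "0 < \<rho>" "\<rho> < \<rho>0" and \<tau>: "\<bar>\<tau> - d\<bar> < \<beta>"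
    define R where "R = exp (- (k * ln \<rho>))"
    have R: "R > 0" by (simp add: R_def)
    have "k * ln \<rho> < k * ln \<rho>0" using \<rho> k by (simp add: ln_less_cancel_iff)
    also have "k * ln \<rho>0 = ln (c0 / (2 * B))" using c0 AB k by (simp add: \<rho>0_def ln_powr)
    finally have "exp (k * ln \<rho>) < exp (ln (c0 / (2 * B)))" by simp
    then have "exp (k * ln \<rho>) < c0 / (2 * B)" using c0 AB by simp
    then have Rc: "2 * B < R * c0" using AB by (simp add: R_def exp_minus field_simps)
    define E where "E = (\<lambda>z. exp (of_real k * (z - Complex (ln \<rho>) \<tau>)))"
    define \<Phi> where "\<Phi> = (\<lambda>z. f (exp z) * (of_real k * E z * exp (- E z)))"
    have Ecis: "E z = rcis (exp (k * Re z) * R) (k * (Im z - \<tau>))" for z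
    proof -
      have "of_real k * (z - Complex (ln \<rho>) \<tau>) = Complex (k * Re z - k * ln \<rho>) (k * (Im z - \<tau>))"
        by (simp add: complex_eq_iff algebra_simps)
      then show ?thesis by (simp add: E_def exp_Complex R_def exp_diff exp_minus divide_inverse)
    qed
    have dom: "exp z \<in> disc_sector d (\<alpha> / 2) (r / 2)" if "\<bar>Im z - d\<bar> < \<delta>" for z
    proof -
      have "exp z = rcis (exp (Re z)) (Im z)" using exp_Complex[of "Re z" "Im z"] by simp
      moreover have "rcis (exp (Re z)) (Im z) \<in> sector d (\<alpha> / 2)" using that \<delta> by (intro rcis_in_sector) auto
      ultimately show ?thesis by (simp add: disc_sector_def)
    qed
    have sub: "disc_sector d (\<alpha> / 2) (r / 2) \<subseteq> disc_sector d \<alpha> r" using disc_sector_mono[of "\<alpha> / 2" \<alpha> "r / 2" r d] \<alpha> r by auto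
    obtain w where w: "\<And>\<theta>. \<bar>\<theta> - d\<bar> < \<delta> \<Longrightarrow> ((\<lambda>\<sigma>. \<Phi> (Complex (ln \<sigma>) \<theta>) / complex_of_real \<sigma>) has_integral w) {0<..}"
    proof (rule strip_ray_integral[OF k AB(2), of "A * k * R" \<Phi> d \<delta>])
      show "0 < A * k * R" using AB k R by simp
      have "(\<lambda>z. f (exp z)) holomorphic_on {z. \<bar>Im z - d\<bar> < \<delta>}"
        by (rule holomorphic_on_compose_gen[OF holomorphic_on_exp f, unfolded o_def]) (use dom sub in blast)
      then show "\<Phi> holomorphic_on {z. \<bar>Im z - d\<bar> < \<delta>}" unfolding \<Phi>_def E_def by (intro holomorphic_intros)
      fix z assume z: "\<bar>Im z - d\<bar> < \<delta>"
      let ?e = "exp (k * Re z)"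
      have "\<bar>Im z - \<tau>\<bar> \<le> \<beta> + \<delta>" using z \<tau> by linarith
      then have "\<bar>k * (Im z - \<tau>)\<bar> \<le> k * (\<beta> + \<delta>)" using k by (simp add: abs_mult)
      then have "cos (k * (\<beta> + \<delta>)) \<le> cos \<bar>k * (Im z - \<tau>)\<bar>" using ang pi_gt_zero by (intro cos_monotone_0_pi_le) auto
      then have cs: "c0 \<le> cos (k * (Im z - \<tau>))" by (simp add: c0_def)
      have "?e * (2 * B) \<le> ?e * (R * c0)" using Rc by (intro mult_left_mono) auto
      also have "\<dots> \<le> ?e * (R * cos (k * (Im z - \<tau>)))" using cs R by (intro mult_left_mono) auto
      also have "\<dots> = Re (E z)" by (simp add: Ecis)
      finally have Re: "?e * (2 * B) \<le> Re (E z)" .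
      have "cmod (f (exp z)) \<le> A * exp (B * cmod (exp z) powr k)" using AB(3)[OF dom[OF z]] by simp
      also have "cmod (exp z) powr k = ?e" by (simp add: powr_def)
      finally have fb: "cmod (f (exp z)) \<le> A * exp (B * ?e)" .
      have "cmod (\<Phi> z) = cmod (f (exp z)) * (k * (?e * R) * exp (- Re (E z)))"
        using k R by (simp add: \<Phi>_def norm_mult Ecis)
      also have "\<dots> \<le> (A * exp (B * ?e)) * (k * (?e * R) * exp (- (?e * (2 * B))))"
        using fb Re k R AB by (intro mult_mono) auto
      also have "\<dots> = A * k * R * ?e * (exp (B * ?e) * exp (- (?e * (2 * B))))" by (simp only: mult_ac)
      also have "exp (B * ?e) * exp (- (?e * (2 * B))) = exp (- (B * ?e))" by (simp add: exp_add[symmetric])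
      finally show "cmod (\<Phi> z) \<le> A * k * R * ?e * exp (- (B * ?e))" .
    qed blast
    have "has_ray_integral (\<lambda>s. f (cov_proj s) * laplace_kernel k (\<rho>, \<tau>) s) w \<theta>" if "\<bar>\<theta> - d\<bar> < \<delta>" for \<theta>
      unfolding has_ray_integral_def
    proof (rule has_integral_eq[OF _ w[OF that]])
      fix \<sigma> :: real assume "\<sigma> \<in> {0<..}"
      then have \<sigma>: "\<sigma> > 0" by simp
      have "(\<sigma> / \<rho>) powr k = \<sigma> powr k / \<rho> powr k" by (simp only: powr_divide)
      also have "\<dots> = exp (k * ln \<sigma>) * R" using \<sigma> \<rho> by (simp add: powr_def R_def exp_minus divide_inverse)
      finally have "(\<sigma> / \<rho>) powr k = exp (k * ln \<sigma>) * R" .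
      then have q: "cov_quot_powr (\<sigma>, \<theta>) (\<rho>, \<tau>) k = E (Complex (ln \<sigma>) \<theta>)" by (simp add: cov_quot_powr_def Ecis)
      have e: "exp (Complex (ln \<sigma>) \<theta>) = complex_of_real \<sigma> * cis \<theta>" using \<sigma> by (simp add: exp_Complex rcis_def)
      have p: "cov_proj (\<sigma>, \<theta>) = complex_of_real \<sigma> * cis \<theta>" by (simp add: cov_proj_def rcis_def)
      show "\<Phi> (Complex (ln \<sigma>) \<theta>) / complex_of_real \<sigma> = f (cov_proj (\<sigma>, \<theta>)) * laplace_kernel k (\<rho>, \<tau>) (\<sigma>, \<theta>) * cis \<theta>"
        using \<sigma> unfolding \<Phi>_def laplace_kernel_def q e p by simp
    qed
    then show "\<exists>w. \<forall>\<theta>. \<bar>\<theta> - d\<bar> < \<delta> \<longrightarrow> has_ray_integral (\<lambda>s. f (cov_proj s) * laplace_kernel k (\<rho>, \<tau>) s) w \<theta>" by blast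
  qed
qed

section \<open>The jump across the singular direction\<close>

context moment_cauchy_problem
begin

text \<open>
  Two continuations of one power series to sets that are star-shaped about 0.
\<close>

lemma g_continues:
  assumes w: "c * w \<notin> \<real>\<^sub>\<ge>\<^sub>0 \<or> c = 0" and f: "continues k d (\<lambda>n. - (a / z0) * (complex_of_real (m n) * c ^ n)) f"
    and wd: "\<And>\<alpha> r. 0 < \<alpha> \<Longrightarrow> 0 < r \<Longrightarrow> w \<in> disc_sector d \<alpha> r"
  shows "f w = g w"
proof -
  obtain \<epsilon> where \<epsilon>: "\<epsilon> > 0" "kernel_fun m holomorphic_on (ball 0 \<epsilon> \<union> - \<real>\<^sub>\<ge>\<^sub>0)"
    "\<And>z. cmod z < \<epsilon> \<Longrightarrow> (\<lambda>n. complex_of_real (m n) * z ^ n) sums kernel_fun m z"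
    by (rule kernel_fun_spec[OF preserves_m]) blast
  obtain \<alpha> r \<delta> where *: "0 < \<alpha>" "\<alpha> \<le> 2 * pi" "0 < r" "0 < \<delta>" "f holomorphic_on disc_sector d \<alpha> r"
    "growth_bound complex_space k d \<alpha> r f" "\<And>t. cmod t < \<delta> \<Longrightarrow> (\<lambda>n. - (a / z0) * (complex_of_real (m n) * c ^ n) * t ^ n) sums f t"
    using f by (rule continuesE) blast
  define T where "T = {s. c * s \<in> ball 0 \<epsilon> \<union> - \<real>\<^sub>\<ge>\<^sub>0}"
  have st: "open_star (ball 0 \<epsilon> \<union> - \<real>\<^sub>\<ge>\<^sub>0)" by (rule open_star_slit[OF \<epsilon>(1)])
  have T: "open_star T"
    unfolding open_star_def
  proof (intro conjI ballI allI impI)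
    have "open ((\<lambda>s. c * s) -` (ball 0 \<epsilon> \<union> - \<real>\<^sub>\<ge>\<^sub>0))"
      using st by (intro open_vimage) (auto simp: open_star_def intro!: continuous_intros)
    then show "open T" by (simp add: T_def vimage_def)
    fix z x assume "z \<in> T" "0 \<le> x \<and> x \<le> (1::real)"
    then have "complex_of_real x * (c * z) \<in> ball 0 \<epsilon> \<union> - \<real>\<^sub>\<ge>\<^sub>0" using st unfolding open_star_def T_def by blast
    then show "complex_of_real x * z \<in> T" by (simp add: T_def mult.left_commute)
  qed
  have "(\<lambda>s. kernel_fun m (c * s)) holomorphic_on T"
    by (rule holomorphic_on_compose_gen[of "\<lambda>s. c * s" _ "kernel_fun m", OF _ \<epsilon>(2), unfolded o_def])
       (auto simp: T_def intro!: holomorphic_intros)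
  then have g: "g holomorphic_on T" unfolding g_eq[abs_def] by (intro holomorphic_intros)
  have c1: "cmod c + 1 > 0" by (rule add_nonneg_pos) auto
  show ?thesis
  proof (rule open_star_identity[where S = "disc_sector d \<alpha> r \<inter> T", OF _ _ _ *(4,7)])
    show "open_star (disc_sector d \<alpha> r \<inter> T)" using * T by (intro open_star_Int open_star_disc_sector)
    show "w \<in> disc_sector d \<alpha> r \<inter> T" using w wd[OF *(1,3)] \<epsilon>(1) by (auto simp: T_def)
    show "0 < \<epsilon> / (cmod c + 1)" using \<epsilon> c1 by simp
    fix t assume "cmod t < \<epsilon> / (cmod c + 1)"
    then have t: "cmod t * (cmod c + 1) < \<epsilon>" using c1 by (simp add: pos_less_divide_eq)
    have "cmod (c * t) \<le> cmod t * (cmod c + 1)" by (simp add: norm_mult algebra_simps)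
    then have "(\<lambda>n. - (a / z0) * (complex_of_real (m n) * (c * t) ^ n)) sums g t"
      unfolding g_eq using t by (intro sums_mult \<epsilon>(3)) linarith
    then show "(\<lambda>n. - (a / z0) * (complex_of_real (m n) * c ^ n) * t ^ n) sums g t"
      by (simp add: power_mult_distrib mult.assoc)
  qed (use *(5) g in \<open>auto intro: holomorphic_on_subset\<close>)
qed

text \<open>
  The continuation supplied by summability agrees with \<open>g\<close> on the ray itself, and the sum may be computed there.
\<close>

lemma sum_of_U:
  assumes nn: "c * cis \<phi> \<notin> \<real>\<^sub>\<ge>\<^sub>0 \<or> c = 0" and \<beta>: "0 < \<beta>" "\<beta> < pi / (2 * k)"
  obtains \<rho>0 where "\<rho>0 > 0" "\<And>\<rho> \<tau>. 0 < \<rho> \<Longrightarrow> \<rho> < \<rho>0 \<Longrightarrow> \<bar>\<tau> - \<phi>\<bar> < \<beta> \<Longrightarrow>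
     \<exists>w. has_sum_at k \<phi> U (\<rho>, \<tau>) 0 w \<and> has_ray_integral (\<lambda>s. g (cov_proj s) * laplace_kernel k (\<rho>, \<tau>) s) w \<phi>"
proof -
  have "hol_summable_in k \<phi> U" using nn summable_U by blast
  then obtain r v F where F: "r > 0" "represents r v U" "borel_continuation (hol_space r) k \<phi> v F"
    "continues k \<phi> (\<lambda>n. fps_nth (U n) 0 / complex_of_real (Gamma_seq (1 / k) n)) (\<lambda>t. F t 0)"
    by (rule hol_summable_inE) blast
  note cont = F(4)[unfolded borel_coeffs_at_0]
  obtain \<alpha> r' \<delta>' where *: "0 < \<alpha>" "\<alpha> \<le> 2 * pi" "0 < r'" "(\<lambda>t. F t 0) holomorphic_on disc_sector \<phi> \<alpha> r'"
    "growth_bound complex_space k \<phi> \<alpha> r' (\<lambda>t. F t 0)"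
    using cont by (rule continuesE) blast
  obtain \<rho>0 \<delta> where L: "\<rho>0 > 0" "\<delta> > 0" "\<And>\<rho> \<tau>. 0 < \<rho> \<Longrightarrow> \<rho> < \<rho>0 \<Longrightarrow> \<bar>\<tau> - \<phi>\<bar> < \<beta> \<Longrightarrow>
       \<exists>w. \<forall>\<theta>. \<bar>\<theta> - \<phi>\<bar> < \<delta> \<longrightarrow> has_ray_integral (\<lambda>s. F (cov_proj s) 0 * laplace_kernel k (\<rho>, \<tau>) s) w \<theta>"
    by (rule laplace_ray_integral[OF k * \<beta>]) blast
  show thesis
  proof (rule that[OF L(1)])
    fix \<rho> \<tau> assume "0 < \<rho>" "\<rho> < \<rho>0" "\<bar>\<tau> - \<phi>\<bar> < \<beta>"
    then obtain w where w: "\<And>\<theta>. \<bar>\<theta> - \<phi>\<bar> < \<delta> \<Longrightarrow> has_ray_integral (\<lambda>s. F (cov_proj s) 0 * laplace_kernel k (\<rho>, \<tau>) s) w \<theta>"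
      using L(3) by blast
    have "\<forall>\<^sub>F \<theta> in nhds \<phi>. \<bar>\<theta> - \<phi>\<bar> < \<delta>"
      using L(2) unfolding eventually_nhds_metric dist_real_def by blast
    then have "\<forall>\<^sub>F \<theta> in nhds \<phi>. has_ray_integral (\<lambda>s. F (cov_proj s) 0 * laplace_kernel k (\<rho>, \<tau>) s) w \<theta>"
      by (rule eventually_mono) (rule w)
    then have "has_sum_at k \<phi> U (\<rho>, \<tau>) 0 w"
      unfolding has_sum_at_def using F by (intro exI[of _ r] conjI, simp, rule_tac exI[of _ v], rule_tac exI[of _ F]) simp
    moreover have "has_ray_integral (\<lambda>s. g (cov_proj s) * laplace_kernel k (\<rho>, \<tau>) s) w \<phi>"
      unfolding has_ray_integral_def
    proof (rule has_integral_eq)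
      show "((\<lambda>\<sigma>. F (cov_proj (\<sigma>, \<phi>)) 0 * laplace_kernel k (\<rho>, \<tau>) (\<sigma>, \<phi>) * cis \<phi>) has_integral w) {0<..}"
        using w[of \<phi>] L(2) by (simp add: has_ray_integral_def)
      fix \<sigma> :: real assume "\<sigma> \<in> {0<..}"
      then have \<sigma>: "\<sigma> > 0" by simp
      have "F (rcis \<sigma> \<phi>) 0 = g (rcis \<sigma> \<phi>)"
      proof (rule g_continues[OF _ cont])
        have "c * rcis \<sigma> \<phi> = complex_of_real \<sigma> * (c * cis \<phi>)" by (simp add: rcis_def)
        then show "c * rcis \<sigma> \<phi> \<notin> \<real>\<^sub>\<ge>\<^sub>0 \<or> c = 0" using nn nonneg_Reals_scale_iff[OF \<sigma>] by metis
        show "rcis \<sigma> \<phi> \<in> disc_sector \<phi> \<alpha> r" if "0 < \<alpha>" for \<alpha> r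
          using rcis_in_sector[OF \<sigma>, of \<phi> \<phi> \<alpha>] that by (simp add: disc_sector_def)
      qed
      then show "F (cov_proj (\<sigma>, \<phi>)) 0 * laplace_kernel k (\<rho>, \<tau>) (\<sigma>, \<phi>) * cis \<phi>
          = g (cov_proj (\<sigma>, \<phi>)) * laplace_kernel k (\<rho>, \<tau>) (\<sigma>, \<phi>) * cis \<phi>"
        by (simp add: cov_proj_def)
    qed
    ultimately show "\<exists>w. has_sum_at k \<phi> U (\<rho>, \<tau>) 0 w \<and> has_ray_integral (\<lambda>s. g (cov_proj s) * laplace_kernel k (\<rho>, \<tau>) s) w \<phi>" by blast
  qed
qed

lemma g_in_hyperfunction:
  assumes "g \<in> cut_exp_growth k d (2 * pi) r"
  shows "g \<in> hyperfunction k d (2 * pi) r g"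
proof -
  have "(\<lambda>s. 0) \<in> exp_growth complex_space k d (2 * pi) r"
    unfolding exp_growth_iff
    using holomorphic_into_complex_space[OF open_disc_sector[of "2 * pi" d r] holomorphic_on_const[of 0]]
      growth_bound_bounded[of d "2 * pi" r "\<lambda>s. 0" 0 k] pi_gt_zero by simp
  then show ?thesis unfolding hyperfunction_def using assms by (auto intro!: bexI[of _ "\<lambda>s. 0"])
qed

text \<open>
  Since \<open>c * cis d\<close> is a nonnegative real, a ray whose direction differs from \<open>d\<close> by less than \<open>\<pi>\<close>
  is regular unless it is \<open>d\<close> itself; so the hyperfunction lives on the full opening \<open>2 * \<pi>\<close>.
\<close>

lemma jump_U:
  assumes d: "d = Arg z0 - Arg lam + 2 * pi * of_int N"
  shows "\<exists>\<alpha> r. 0 < \<alpha> \<and> \<alpha> \<le> 2 * pi \<and> 0 < r \<and>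
         (\<forall>dp dm. d < dp \<and> dp < d + \<alpha> / 2 \<and> d - \<alpha> / 2 < dm \<and> dm < d \<longrightarrow>
           (\<forall>\<beta>. 0 < \<beta> \<and> \<beta> < pi / (2 * k) \<longrightarrow>
             (\<exists>\<rho>0>0. \<forall>\<rho> \<tau>. 0 < \<rho> \<and> \<rho> < \<rho>0 \<and> \<bar>\<tau> - dp\<bar> < \<beta> \<and> \<bar>\<tau> - dm\<bar> < \<beta> \<longrightarrow>
               (\<exists>w. has_jump k dm dp U (\<rho>, \<tau>) 0 w \<and>
                    hyperfunction_acts dm dp (hyperfunction k d \<alpha> r g) (laplace_kernel k (\<rho>, \<tau>)) w))))"
proof -
  have cd: "c * cis d = complex_of_real (cmod c)"
  proof (cases "lam = 0")
    case False
    then have "c * cis d \<in> \<real>\<^sub>\<ge>\<^sub>0" using c_cis_nonneg_iff d by blast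
    then obtain x where x: "c * cis d = complex_of_real x" "x \<ge> 0" by (rule nonneg_Reals_cases)
    have "cmod (c * cis d) = x" unfolding x(1) using x(2) by simp
    moreover have "cmod (c * cis d) = cmod c" by (simp add: norm_mult)
    ultimately show ?thesis using x(1) by metis
  next
    case True
    then have "lam / z0 = 0" by simp
    then have "c = 0" by (simp only: c_def)
    then show ?thesis by simp
  qed
  have off: "c * cis \<phi> \<notin> \<real>\<^sub>\<ge>\<^sub>0 \<or> c = 0" if "sin (\<phi> - d) \<noteq> 0" for \<phi>
  proof -
    have "c * cis \<phi> = (c * cis d) * cis (\<phi> - d)" by (simp add: cis_mult mult.assoc)
    then have "Im (c * cis \<phi>) = cmod c * sin (\<phi> - d)" by (simp add: cd)
    then show ?thesis using that by (auto simp: complex_nonneg_Reals_iff)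
  qed
  obtain r where r: "r > 0" "g \<in> cut_exp_growth k d (2 * pi) r" by (rule g_cut_exp_growth[OF cd])
  have J: "\<exists>\<rho>0>0. \<forall>\<rho> \<tau>. 0 < \<rho> \<and> \<rho> < \<rho>0 \<and> \<bar>\<tau> - dp\<bar> < \<beta> \<and> \<bar>\<tau> - dm\<bar> < \<beta> \<longrightarrow>
      (\<exists>w. has_jump k dm dp U (\<rho>, \<tau>) 0 w \<and>
           hyperfunction_acts dm dp (hyperfunction k d (2 * pi) r g) (laplace_kernel k (\<rho>, \<tau>)) w)"
    if dp: "d < dp" "dp < d + pi" and dm: "d - pi < dm" "dm < d" and \<beta>: "0 < \<beta>" "\<beta> < pi / (2 * k)" for dp dm \<beta>
  proof -
    have "sin (dp - d) > 0" using dp by (intro sin_gt_zero) auto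
    then have p: "c * cis dp \<notin> \<real>\<^sub>\<ge>\<^sub>0 \<or> c = 0" by (intro off) simp
    have "sin (d - dm) > 0" using dm by (intro sin_gt_zero) auto
    moreover have "sin (dm - d) = - sin (d - dm)" using sin_minus[of "d - dm"] by simp
    ultimately have n: "c * cis dm \<notin> \<real>\<^sub>\<ge>\<^sub>0 \<or> c = 0" by (intro off) simp
    obtain \<rho>p where P: "\<rho>p > 0" "\<And>\<rho> \<tau>. 0 < \<rho> \<Longrightarrow> \<rho> < \<rho>p \<Longrightarrow> \<bar>\<tau> - dp\<bar> < \<beta> \<Longrightarrow>
      \<exists>w. has_sum_at k dp U (\<rho>, \<tau>) 0 w \<and> has_ray_integral (\<lambda>s. g (cov_proj s) * laplace_kernel k (\<rho>, \<tau>) s) w dp"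
      by (rule sum_of_U[OF p \<beta>]) blast
    obtain \<rho>m where M: "\<rho>m > 0" "\<And>\<rho> \<tau>. 0 < \<rho> \<Longrightarrow> \<rho> < \<rho>m \<Longrightarrow> \<bar>\<tau> - dm\<bar> < \<beta> \<Longrightarrow>
      \<exists>w. has_sum_at k dm U (\<rho>, \<tau>) 0 w \<and> has_ray_integral (\<lambda>s. g (cov_proj s) * laplace_kernel k (\<rho>, \<tau>) s) w dm"
      by (rule sum_of_U[OF n \<beta>]) blast
    show ?thesis
    proof (intro exI[of _ "min \<rho>p \<rho>m"] conjI allI impI)
      show "0 < min \<rho>p \<rho>m" using P(1) M(1) by simp
      fix \<rho> \<tau> assume *: "0 < \<rho> \<and> \<rho> < min \<rho>p \<rho>m \<and> \<bar>\<tau> - dp\<bar> < \<beta> \<and> \<bar>\<tau> - dm\<bar> < \<beta>"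
      then obtain wp where wp: "has_sum_at k dp U (\<rho>, \<tau>) 0 wp"
        "has_ray_integral (\<lambda>s. g (cov_proj s) * laplace_kernel k (\<rho>, \<tau>) s) wp dp" using P(2)[of \<rho> \<tau>] by auto
      obtain wm where wm: "has_sum_at k dm U (\<rho>, \<tau>) 0 wm"
        "has_ray_integral (\<lambda>s. g (cov_proj s) * laplace_kernel k (\<rho>, \<tau>) s) wm dm" using M(2)[of \<rho> \<tau>] * by auto
      have "has_jump k dm dp U (\<rho>, \<tau>) 0 (wp - wm)" unfolding has_jump_def using wp(1) wm(1) by blast
      moreover have "hyperfunction_acts dm dp (hyperfunction k d (2 * pi) r g) (laplace_kernel k (\<rho>, \<tau>)) (wp - wm)"
        unfolding hyperfunction_acts_def using g_in_hyperfunction[OF r(2)] wp(2) wm(2) by blast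
      ultimately show "\<exists>w. has_jump k dm dp U (\<rho>, \<tau>) 0 w \<and>
           hyperfunction_acts dm dp (hyperfunction k d (2 * pi) r g) (laplace_kernel k (\<rho>, \<tau>)) w" by blast
    qed
  qed
  show ?thesis
    by (rule exI[of _ "2 * pi"], rule exI[of _ r]) (use J r(1) in simp)
qed

lemma singular_directions_U_eq:
  assumes d: "d = Arg z0 - Arg lam + 2 * pi * of_int N"
  shows "singular_directions k U = (if a = 0 \<or> lam = 0 then {} else {d + 2 * pi * of_int j | j :: int. True})"
proof (cases "a = 0 \<or> lam = 0")
  case True
  then show ?thesis by (auto simp: singular_directions_U c_def)
next
  case False
  then have "c \<noteq> 0" using z0 by (simp add: c_def)
  then have "singular_directions k U = {e. \<exists>n::int. e = Arg z0 - Arg lam + 2 * pi * of_int n}"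
    using False c_cis_nonneg_iff by (simp add: singular_directions_U)
  also have "\<dots> = {d + 2 * pi * of_int j | j :: int. True}"
  proof (rule Set.set_eqI)
    fix e
    have "e = Arg z0 - Arg lam + 2 * pi * of_int n \<longleftrightarrow> e = d + 2 * pi * of_int (n - N)" for n
      by (simp add: d algebra_simps)
    moreover have "e = d + 2 * pi * of_int j \<longleftrightarrow> e = Arg z0 - Arg lam + 2 * pi * of_int (j + N)" for j
      by (simp add: d algebra_simps)
    ultimately show "e \<in> {e. \<exists>n::int. e = Arg z0 - Arg lam + 2 * pi * of_int n} \<longleftrightarrow> e \<in> {d + 2 * pi * of_int j | j :: int. True}"
      by blast
  qed
  finally show ?thesis using False by simp
qed

lemma hol_summable_U: "hol_summable k U"
proof -
  let ?d = "Arg z0 - Arg lam + 2 * pi * of_int 0"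
  have "cis (?d + 2 * pi * of_int j) = cis ?d" for j :: int
    by (simp add: cis_mult[symmetric] cis_multiple_2pi)
  then have "cis ` singular_directions k U \<subseteq> {cis ?d}"
    unfolding singular_directions_U_eq[OF refl, of 0] by auto
  then show ?thesis unfolding hol_summable_def by (rule finite_subset) simp
qed

lemma summability_and_jump:
  fixes N :: int
  assumes d: "d = Arg z0 - Arg lam + 2 * pi * of_int N"
  shows "preserves_summability m \<and>
    (\<exists>!u. formal_solution mt1 mt2 lam (\<lambda>z. a / (z - z0)) u) \<and>
    (\<forall>u. formal_solution mt1 mt2 lam (\<lambda>z. a / (z - z0)) u \<longrightarrow>
       hol_summable k u \<and>
       singular_directions k u =
         (if a = 0 \<or> lam = 0 then {} else {d + 2 * pi * of_int j | j :: int. True}) \<and>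
       (\<exists>\<alpha> r. 0 < \<alpha> \<and> \<alpha> \<le> 2 * pi \<and> 0 < r \<and>
         (\<forall>dp dm. d < dp \<and> dp < d + \<alpha> / 2 \<and> d - \<alpha> / 2 < dm \<and> dm < d \<longrightarrow>
           (\<forall>\<beta>. 0 < \<beta> \<and> \<beta> < pi / (2 * k) \<longrightarrow>
             (\<exists>\<rho>0>0. \<forall>\<rho> \<tau>. 0 < \<rho> \<and> \<rho> < \<rho>0 \<and> \<bar>\<tau> - dp\<bar> < \<beta> \<and> \<bar>\<tau> - dm\<bar> < \<beta> \<longrightarrow>
               (\<exists>w. has_jump k dm dp u (\<rho>, \<tau>) 0 w \<and>
                    hyperfunction_acts dm dp
                      (hyperfunction k d \<alpha> r (\<lambda>s. - (a / z0) * kernel_fun m (lam * s / z0)))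
                      (laplace_kernel k (\<rho>, \<tau>)) w))))))"
proof (intro conjI allI impI)
  show "preserves_summability m" by (rule preserves_m)
  show "\<exists>!u. formal_solution mt1 mt2 lam (\<lambda>z. a / (z - z0)) u"
    using U_formal_solution formal_solution_unique by blast
  fix u assume "formal_solution mt1 mt2 lam (\<lambda>z. a / (z - z0)) u"
  then have u: "u = U" by (rule formal_solution_unique)
  show "hol_summable k u" unfolding u by (rule hol_summable_U)
  show "singular_directions k u = (if a = 0 \<or> lam = 0 then {} else {d + 2 * pi * of_int j | j :: int. True})"
    unfolding u by (rule singular_directions_U_eq[OF d])
  show "(\<exists>\<alpha> r. 0 < \<alpha> \<and> \<alpha> \<le> 2 * pi \<and> 0 < r \<and>
         (\<forall>dp dm. d < dp \<and> dp < d + \<alpha> / 2 \<and> d - \<alpha> / 2 < dm \<and> dm < d \<longrightarrow>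
           (\<forall>\<beta>. 0 < \<beta> \<and> \<beta> < pi / (2 * k) \<longrightarrow>
             (\<exists>\<rho>0>0. \<forall>\<rho> \<tau>. 0 < \<rho> \<and> \<rho> < \<rho>0 \<and> \<bar>\<tau> - dp\<bar> < \<beta> \<and> \<bar>\<tau> - dm\<bar> < \<beta> \<longrightarrow>
               (\<exists>w. has_jump k dm dp u (\<rho>, \<tau>) 0 w \<and>
                    hyperfunction_acts dm dp
                      (hyperfunction k d \<alpha> r (\<lambda>s. - (a / z0) * kernel_fun m (lam * s / z0)))
                      (laplace_kernel k (\<rho>, \<tau>)) w)))))"
    unfolding u by (rule jump_U[OF d, unfolded g_def[abs_def]])
qed

end

theorem theorem6:
  fixes m1 m2 mt1 mt2 m :: "nat \<Rightarrow> real"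
    and s1 s2 k d :: real
    and a lam z0 :: complex
    and N :: int
  assumes "preserves_summability m1" and "preserves_summability m2"
    and "0 \<le> s1" and "s1 < s2"
    and mt1: "mt1 = (\<lambda>n. Gamma_seq s1 n * m1 n)"
    and mt2: "mt2 = (\<lambda>n. Gamma_seq s2 n * m2 n)"
    and m: "m = (\<lambda>n. Gamma_seq s2 n / (Gamma_seq s1 n * Gamma_seq (s2 - s1) n) * (m2 n / m1 n))"
    and k: "k = 1 / (s2 - s1)"
    and "z0 \<noteq> 0"
    and d: "d = Arg z0 - Arg lam + 2 * pi * of_int N"
  shows "preserves_summability m \<and>
    (\<exists>!u. formal_solution mt1 mt2 lam (\<lambda>z. a / (z - z0)) u) \<and>
    (\<forall>u. formal_solution mt1 mt2 lam (\<lambda>z. a / (z - z0)) u \<longrightarrow>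
       hol_summable k u \<and>
       singular_directions k u =
         (if a = 0 \<or> lam = 0 then {} else {d + 2 * pi * of_int j | j :: int. True}) \<and>
       (\<exists>\<alpha> r. 0 < \<alpha> \<and> \<alpha> \<le> 2 * pi \<and> 0 < r \<and>
         (\<forall>dp dm. d < dp \<and> dp < d + \<alpha> / 2 \<and> d - \<alpha> / 2 < dm \<and> dm < d \<longrightarrow>
           (\<forall>\<beta>. 0 < \<beta> \<and> \<beta> < pi / (2 * k) \<longrightarrow>
             (\<exists>\<rho>0>0. \<forall>\<rho> \<tau>. 0 < \<rho> \<and> \<rho> < \<rho>0 \<and> \<bar>\<tau> - dp\<bar> < \<beta> \<and> \<bar>\<tau> - dm\<bar> < \<beta> \<longrightarrow>
               (\<exists>w. has_jump k dm dp u (\<rho>, \<tau>) 0 w \<and>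
                    hyperfunction_acts dm dp
                      (hyperfunction k d \<alpha> r (\<lambda>s. - (a / z0) * kernel_fun m (lam * s / z0)))
                      (laplace_kernel k (\<rho>, \<tau>)) w))))))"
proof -
  have P: "moment_cauchy_problem m1 m2 s1 s2 z0" by (rule moment_cauchy_problem.intro) fact+
  have mt1': "mt1 = moment_cauchy_problem.mt1 m1 s1" unfolding mt1 moment_cauchy_problem.mt1_def[OF P] ..
  have mt2': "mt2 = moment_cauchy_problem.mt2 m2 s2" unfolding mt2 moment_cauchy_problem.mt2_def[OF P] ..
  have m': "m = moment_cauchy_problem.m m1 m2 s1 s2" unfolding m moment_cauchy_problem.m_def[OF P] ..
  have k': "k = moment_cauchy_problem.k s1 s2" unfolding k moment_cauchy_problem.k_def[OF P] ..
  show ?thesis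
    unfolding mt1' mt2' m' k' by (rule moment_cauchy_problem.summability_and_jump[OF P d])
qed

end
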